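(* Suppose $\Omega\subset\mathbb{R}^n$ is a bounded domain with Lipschitz boundary and $\alpha>0$. Let $\varphi\in C([0,\infty))$ be such that $\varphi^\infty:=\lim_{t\to\infty}\varphi(t)/t$ exists and such that for some $c,C'>0$ and $b\ge0$, $ct-b\le\varphi(t)\le C'(1+t)$ for all $t\ge0$. Let $J:\mathrm{BV}(\Omega)\to\mathbb{R}$ be convex, proper and weakly* lower semicontinuous, and suppose that for some $C>0$ $$J(u)\ge C(\|u\|_{L^1(\Omega)}-1)\qquad(u\in\mathrm{BV}(\Omega)).$$ Then the functional $$G(u):=J(u)+\alpha\,\mathrm{TV}^\varphi_{\mathrm{as}}(u)+\eta(DU),\qquad(u\in\mathrm{BV}(\Omega)),$$ admits a minimiser $u\in\mathrm{BV}(\Omega)$.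
   Context: For $u\in \mathrm{BV}(\Omega)$, $Du=\nabla u\,\mathcal{L}^n+D^su$ with $D^su$ the singular part, and $$\mathrm{TV}^\varphi_{\mathrm{as}}(u):=\int_\Omega\varphi(|\nabla u(x)|)\,dx+\varphi^\infty|D^su|(\Omega).$$ $DU$ denotes the $\mathbb{R}^{1+n}$-valued measure $(\mathcal{L}^n\llcorner\Omega,\,Du)$ on $\Omega$ (the "lifting" of $Du$), so that $|DU|(\Omega)=\int_\Omega\sqrt{1+|\nabla u|^2}\,dx+|D^su|(\Omega)$. Fix $\eta_0>0$ and a family of mollifiers $\{\rho_\epsilon\}_{\epsilon>0}$ on $\mathbb{R}^n$ (nonnegative smooth functions with integral $1$, concentrating at $0$ as $\epsilon\searrow0$) satisfying the semigroup property $\rho_{\epsilon+\delta}=\rho_\epsilon*\rho_\delta$. For a finite vector-valued Radon measure $\mu$ on $\Omega$, extended by zero to $\mathbb{R}^n$, $$\eta(\mu):=\eta_0\sum_{\ell=1}^\infty\eta_\ell(\mu),\qquad \eta_\ell(\mu):=\int_{\mathbb{R}^n}(|\mu|*\rho_{2^{-\ell}})(x)-|\mu*\rho_{2^{-\ell}}|(x)\,dx,$$ where $|\mu|$ is the total variation measure. Weak* convergence in $\mathrm{BV}(\Omega)$: $u^i\to u$ strongly in $L^1(\Omega)$ and $Du^i\rightharpoonup^*Du$ weakly* in $\mathcal{M}(\Omega;\mathbb{R}^n)$; weak* lower semicontinuity is understood sequentially. *)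

theory Defs
  imports "HOL-Analysis.Analysis"
begin

text \<open>
  A finite vector-valued Radon measure on \<open>\<Omega>\<close>, extended by zero to the whole space, is a countably
  additive set function on the Borel sets that does not charge the complement of \<open>\<Omega>\<close>.  Values on
  non-Borel sets are irrelevant.  Finiteness and regularity are automatic, since the values lie
  in a finite-dimensional space.
\<close>

definition vector_measure_on ::
    "'a::euclidean_space set \<Rightarrow> ('a set \<Rightarrow> 'b::euclidean_space) \<Rightarrow> bool" where
  "vector_measure_on \<Omega> \<mu> \<longleftrightarrow>
     (\<forall>A :: nat \<Rightarrow> 'a set. range A \<subseteq> sets borel \<longrightarrow> disjoint_family A \<longrightarrow>
        (\<lambda>i. \<mu> (A i)) sums \<mu> (\<Union>i. A i)) \<and>
     (\<forall>A\<in>sets borel. \<mu> A = \<mu> (A \<inter> \<Omega>))"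

definition variation ::
    "('a::euclidean_space set \<Rightarrow> 'b::euclidean_space) \<Rightarrow> 'a measure" where
  "variation \<mu> = measure_of UNIV (sets borel)
     (\<lambda>A. SUP E \<in> {E :: nat \<Rightarrow> 'a set. range E \<subseteq> sets borel \<and> disjoint_family E \<and> (\<Union>i. E i) = A}.
        (\<Sum>i. ennreal (norm (\<mu> (E i)))))"

text \<open>Integration against a vector measure is componentwise; each component \<open>\<nu>\<close> is split by the
  Jordan decomposition into \<open>(|\<nu>| + \<nu>) / 2\<close> and \<open>(|\<nu>| - \<nu>) / 2\<close>.\<close>

definition pos_part :: "('a::euclidean_space set \<Rightarrow> real) \<Rightarrow> 'a measure" where
  "pos_part \<nu> = measure_of UNIV (sets borel) (\<lambda>A. ennreal ((measure (variation \<nu>) A + \<nu> A) / 2))"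

definition neg_part :: "('a::euclidean_space set \<Rightarrow> real) \<Rightarrow> 'a measure" where
  "neg_part \<nu> = measure_of UNIV (sets borel) (\<lambda>A. ennreal ((measure (variation \<nu>) A - \<nu> A) / 2))"

definition vm_integral ::
    "('a::euclidean_space set \<Rightarrow> 'b::euclidean_space) \<Rightarrow> ('a \<Rightarrow> real) \<Rightarrow> 'b" where
  "vm_integral \<mu> f = (\<Sum>b\<in>Basis.
     ((LINT x|pos_part (\<lambda>A. \<mu> A \<bullet> b). f x) - (LINT x|neg_part (\<lambda>A. \<mu> A \<bullet> b). f x)) *\<^sub>R b)"

fun Ck :: "nat \<Rightarrow> ('a::euclidean_space \<Rightarrow> real) \<Rightarrow> bool" where
  "Ck 0 f \<longleftrightarrow> continuous_on UNIV f"
| "Ck (Suc k) f \<longleftrightarrow> (\<forall>x. f differentiable at x) \<and>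
     (\<forall>b\<in>Basis. Ck k (\<lambda>x. frechet_derivative f (at x) b))"

definition smooth :: "('a::euclidean_space \<Rightarrow> real) \<Rightarrow> bool" where
  "smooth f \<longleftrightarrow> (\<forall>k. Ck k f)"

definition gradient :: "('a::euclidean_space \<Rightarrow> real) \<Rightarrow> 'a \<Rightarrow> 'a" where
  "gradient f x = (\<Sum>b\<in>Basis. frechet_derivative f (at x) b *\<^sub>R b)"

definition test_functions :: "'a::euclidean_space set \<Rightarrow> ('a \<Rightarrow> real) set" where
  "test_functions \<Omega> =
     {\<psi>. smooth \<psi> \<and> compact (closure {x. \<psi> x \<noteq> 0}) \<and> closure {x. \<psi> x \<noteq> 0} \<subseteq> \<Omega>}"

text \<open>\<open>C\<^sub>0(\<Omega>)\<close>, the continuous functions vanishing at the boundary and at infinity,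
  extended by zero.\<close>

definition C0 :: "'a::euclidean_space set \<Rightarrow> ('a \<Rightarrow> real) set" where
  "C0 \<Omega> = {\<psi>. continuous_on UNIV \<psi> \<and> (\<forall>x. x \<notin> \<Omega> \<longrightarrow> \<psi> x = 0) \<and>
     (\<forall>e>0. compact {x. e \<le> \<bar>\<psi> x\<bar>})}"

text \<open>Elements of \<open>BV(\<Omega>)\<close> are handled through representatives defined on the whole space; only
  their values on \<open>\<Omega>\<close>, up to Lebesgue null sets, matter.\<close>

definition has_deriv_measure ::
    "'a::euclidean_space set \<Rightarrow> ('a \<Rightarrow> real) \<Rightarrow> ('a set \<Rightarrow> 'a) \<Rightarrow> bool" where
  "has_deriv_measure \<Omega> u \<mu> \<longleftrightarrow> vector_measure_on \<Omega> \<mu> \<and>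
     (\<forall>\<psi>\<in>test_functions \<Omega>.
        (LINT x|lebesgue_on \<Omega>. u x *\<^sub>R gradient \<psi> x) = - vm_integral \<mu> \<psi>)"

definition BV :: "'a::euclidean_space set \<Rightarrow> ('a \<Rightarrow> real) set" where
  "BV \<Omega> = {u. integrable (lebesgue_on \<Omega>) u \<and> (\<exists>\<mu>. has_deriv_measure \<Omega> u \<mu>)}"

text \<open>The choices below are unique on Borel sets and almost everywhere in \<open>\<Omega>\<close>, respectively.\<close>

definition Deriv :: "'a::euclidean_space set \<Rightarrow> ('a \<Rightarrow> real) \<Rightarrow> 'a set \<Rightarrow> 'a" where
  "Deriv \<Omega> u = (SOME \<mu>. has_deriv_measure \<Omega> u \<mu>)"

definition lebesgue_singular :: "('a::euclidean_space set \<Rightarrow> 'b::euclidean_space) \<Rightarrow> bool" where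
  "lebesgue_singular \<mu> \<longleftrightarrow> (\<exists>N\<in>null_sets lborel. \<forall>A\<in>sets borel. \<mu> A = \<mu> (A \<inter> N))"

definition ac_grad :: "'a::euclidean_space set \<Rightarrow> ('a \<Rightarrow> real) \<Rightarrow> 'a \<Rightarrow> 'a" where
  "ac_grad \<Omega> u = (SOME g. integrable (lebesgue_on \<Omega>) g \<and>
     lebesgue_singular (\<lambda>A. Deriv \<Omega> u A - (LINT x:A|lebesgue_on \<Omega>. g x)))"

definition sing_deriv :: "'a::euclidean_space set \<Rightarrow> ('a \<Rightarrow> real) \<Rightarrow> 'a set \<Rightarrow> 'a" where
  "sing_deriv \<Omega> u A = Deriv \<Omega> u A - (LINT x:A|lebesgue_on \<Omega>. ac_grad \<Omega> u x)"

definition weak_star_BV ::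
    "'a::euclidean_space set \<Rightarrow> (nat \<Rightarrow> 'a \<Rightarrow> real) \<Rightarrow> ('a \<Rightarrow> real) \<Rightarrow> bool" where
  "weak_star_BV \<Omega> U u \<longleftrightarrow>
     (\<lambda>i. LINT x|lebesgue_on \<Omega>. \<bar>U i x - u x\<bar>) \<longlonglongrightarrow> 0 \<and>
     (\<forall>\<psi>\<in>C0 \<Omega>. (\<lambda>i. vm_integral (Deriv \<Omega> (U i)) \<psi>) \<longlonglongrightarrow> vm_integral (Deriv \<Omega> u) \<psi>)"

definition TV_as ::
    "(real \<Rightarrow> real) \<Rightarrow> real \<Rightarrow> 'a::euclidean_space set \<Rightarrow> ('a \<Rightarrow> real) \<Rightarrow> real" where
  "TV_as \<phi> \<phi>inf \<Omega> u = (LINT x|lebesgue_on \<Omega>. \<phi> (norm (ac_grad \<Omega> u x))) +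
     \<phi>inf * measure (variation (sing_deriv \<Omega> u)) \<Omega>"

text \<open>The product type carries the Euclidean norm, so \<open>real \<times> 'a\<close> plays the role of
  \<open>\<real>\<^sup>1\<^sup>+\<^sup>n\<close>.\<close>

definition lifting ::
    "'a::euclidean_space set \<Rightarrow> ('a \<Rightarrow> real) \<Rightarrow> 'a set \<Rightarrow> real \<times> 'a" where
  "lifting \<Omega> u A = (measure lborel (A \<inter> \<Omega>), Deriv \<Omega> u A)"

text \<open>Semigroup mollifiers are not compactly supported (think of the Gaussian kernel), so
  concentration is expressed by vanishing mass outside every ball around the origin.\<close>

definition mollifier_semigroup :: "(real \<Rightarrow> 'a::euclidean_space \<Rightarrow> real) \<Rightarrow> bool" where
  "mollifier_semigroup \<rho> \<longleftrightarrow>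
     (\<forall>e>0. smooth (\<rho> e) \<and> (\<forall>x. 0 \<le> \<rho> e x) \<and> has_bochner_integral lborel (\<rho> e) 1) \<and>
     (\<forall>r>0. ((\<lambda>e. LINT x:- ball 0 r|lborel. \<rho> e x) \<longlongrightarrow> 0) (at_right 0)) \<and>
     (\<forall>e>0. \<forall>d>0. \<forall>x. has_bochner_integral lborel (\<lambda>y. \<rho> e (x - y) * \<rho> d y) (\<rho> (e + d) x))"

definition eta_level ::
    "(real \<Rightarrow> 'a::euclidean_space \<Rightarrow> real) \<Rightarrow> nat \<Rightarrow> ('a set \<Rightarrow> 'b::euclidean_space) \<Rightarrow> real" where
  "eta_level \<rho> l \<mu> = (LINT x|lborel.
     (LINT y|variation \<mu>. \<rho> ((1/2) ^ l) (x - y)) -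
     norm (vm_integral \<mu> (\<lambda>y. \<rho> ((1/2) ^ l) (x - y))))"

text \<open>The terms are nonnegative; the sum may be infinite.\<close>

definition eta ::
    "(real \<Rightarrow> 'a::euclidean_space \<Rightarrow> real) \<Rightarrow> real \<Rightarrow> ('a set \<Rightarrow> 'b::euclidean_space) \<Rightarrow> ereal" where
  "eta \<rho> \<eta>\<^sub>0 \<mu> = ereal \<eta>\<^sub>0 * (\<Sum>l. ereal (eta_level \<rho> (Suc l) \<mu>))"

text \<open>Near every boundary point, \<open>\<Omega>\<close> is the strict epigraph, in some direction \<open>\<nu>\<close>, of a Lipschitz
  function on the hyperplane orthogonal to \<open>\<nu>\<close>.\<close>

definition lipschitz_boundary :: "'a::euclidean_space set \<Rightarrow> bool" where
  "lipschitz_boundary \<Omega> \<longleftrightarrow> (\<forall>x\<in>frontier \<Omega>. \<exists>r>0. \<exists>\<nu> g L.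
     norm \<nu> = 1 \<and> L-lipschitz_on {z. z \<bullet> \<nu> = 0} g \<and>
     \<Omega> \<inter> ball x r = {y \<in> ball x r. g (y - (y \<bullet> \<nu>) *\<^sub>R \<nu>) < y \<bullet> \<nu>})"

definition bounded_lipschitz_domain :: "'a::euclidean_space set \<Rightarrow> bool" where
  "bounded_lipschitz_domain \<Omega> \<longleftrightarrow>
     open \<Omega> \<and> connected \<Omega> \<and> \<Omega> \<noteq> {} \<and> bounded \<Omega> \<and> lipschitz_boundary \<Omega>"

text \<open>Functionals on \<open>BV(\<Omega>)\<close> act on representatives, so well-definedness on almost-everywhere
  classes is recorded separately; extended-real values give properness its usual content.\<close>

definition respects_ae :: "'a::euclidean_space set \<Rightarrow> (('a \<Rightarrow> real) \<Rightarrow> ereal) \<Rightarrow> bool" where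
  "respects_ae \<Omega> J \<longleftrightarrow> (\<forall>u\<in>BV \<Omega>. \<forall>v\<in>BV \<Omega>. (AE x in lebesgue_on \<Omega>. u x = v x) \<longrightarrow> J u = J v)"

definition convex_on_BV :: "'a::euclidean_space set \<Rightarrow> (('a \<Rightarrow> real) \<Rightarrow> ereal) \<Rightarrow> bool" where
  "convex_on_BV \<Omega> J \<longleftrightarrow> (\<forall>u\<in>BV \<Omega>. \<forall>v\<in>BV \<Omega>. \<forall>t. 0 < t \<longrightarrow> t < 1 \<longrightarrow>
     J (\<lambda>x. (1 - t) * u x + t * v x) \<le> ereal (1 - t) * J u + ereal t * J v)"

definition proper_on_BV :: "'a::euclidean_space set \<Rightarrow> (('a \<Rightarrow> real) \<Rightarrow> ereal) \<Rightarrow> bool" where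
  "proper_on_BV \<Omega> J \<longleftrightarrow> (\<forall>u\<in>BV \<Omega>. J u \<noteq> - \<infinity>) \<and> (\<exists>u\<in>BV \<Omega>. J u \<noteq> \<infinity>)"

definition weak_star_lsc :: "'a::euclidean_space set \<Rightarrow> (('a \<Rightarrow> real) \<Rightarrow> ereal) \<Rightarrow> bool" where
  "weak_star_lsc \<Omega> J \<longleftrightarrow> (\<forall>U u. (\<forall>i. U i \<in> BV \<Omega>) \<longrightarrow> u \<in> BV \<Omega> \<longrightarrow> weak_star_BV \<Omega> U u \<longrightarrow>
     J u \<le> liminf (\<lambda>i. J (U i)))"

end

theory Submission
  imports Defs "HOL-Probability.Probability"
begin

text \<open>
  The direct method.  Along a minimising sequence the growth of \<open>J\<close> and of \<open>\<phi>\<close> bounds the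
  \<open>BV\<close> norms, so a subsequence converges weakly* in \<open>BV(\<Omega>)\<close>, and the liftings
  \<open>DU\<^sub>i\<close>, as measures on the closure of \<open>\<Omega>\<close>, converge narrowly to some \<open>\<nu>\<close> whose
  restriction to \<open>\<Omega>\<close> is the lifting of the limit.  The weak* limit alone does not suffice, since
  \<open>\<phi>\<close> need not be convex; here \<open>\<eta>\<close> helps.  By the semigroup property \<open>\<eta>\<^sub>\<ell>(\<mu>)\<close>
  decreases in \<open>\<ell>\<close>, so a bound on \<open>\<eta>(DU\<^sub>i)\<close> makes \<open>\<eta>\<^sub>\<ell>(DU\<^sub>i)\<close> of order
  \<open>1/\<ell>\<close> uniformly in \<open>i\<close>.  Mollification at a fixed scale turns narrow convergence into
  \<open>L\<^sup>1\<close> convergence; hence \<open>|DU\<^sub>i|(\<real>\<^sup>n)\<close> converges to \<open>|\<nu>|(\<real>\<^sup>n)\<close>, and so do the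
  integrals of every continuous positively homogeneous function of the measures.  The functional
  \<open>TV\<^sub>a\<^sub>s\<close> is such an integral, its integrand being the perspective of \<open>\<phi>\<close>.  Mass of
  \<open>\<nu>\<close> on the boundary of \<open>\<Omega>\<close> can only increase the limits of \<open>TV\<^sub>a\<^sub>s\<close> and of
  \<open>\<eta>\<close>.
\<close>

section \<open>Hahn decomposition of real set functions\<close>

text \<open>The measures are bare set functions, so each is first written as a density
  \<open>f\<close> against a finite positive measure \<open>l\<close> (\<open>represents\<close>).
  Variation, Jordan parts, mollifications and \<eta> then become integrals of \<open>f\<close>, and
  restriction to a set or a linear image merely changes \<open>f\<close>.

  The first component of the lifting is what makes the integrand homogeneous: where the measure is
  absolutely continuous, \<open>f\<close> is proportional to (1, grad u); on the singular part its
  first entry is 0.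

  Narrow convergence alone does not pass to such functionals, since oscillation and cancellation
  lose mass. The mass that a mollification loses is exactly a level of \<eta>, and up to an
  arbitrarily small multiple of the total mass it bounds the mollification error of every continuous
  homogeneous integrand. So one scale can be fixed for the whole sequence before the index tends to
  infinity.

  The closure of \<Omega> is used because convergence against functions vanishing at the boundary
  would let mass disappear there. The Lipschitz boundary yields strong L1 compactness: thin boundary
  layers carry uniformly little of u, so that the extensions by zero share a modulus of
  translation.\<close>

definition additive_borel :: "('a::topological_space set \<Rightarrow> 'b::real_normed_vector) \<Rightarrow> bool" where
  "additive_borel \<nu> \<longleftrightarrow> (\<forall>A :: nat \<Rightarrow> 'a set. range A \<subseteq> sets borel \<longrightarrow> disjoint_family A \<longrightarrow>
        (\<lambda>i. \<nu> (A i)) sums \<nu> (\<Union>i. A i))"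

lemma additive_borelD:
  "additive_borel \<nu> \<Longrightarrow> (\<And>i::nat. A i \<in> sets borel) \<Longrightarrow> disjoint_family A \<Longrightarrow>
    (\<lambda>i. \<nu> (A i)) sums \<nu> (\<Union>i. A i)"
  unfolding additive_borel_def by blast

lemma additive_borel_empty:
  assumes "additive_borel \<nu>"
  shows "\<nu> {} = 0"
proof -
  have "(\<lambda>i::nat. \<nu> {}) sums \<nu> (\<Union>i::nat. {})"
    by (rule additive_borelD[OF assms]) (auto simp: disjoint_family_on_def)
  then have "summable (\<lambda>i::nat. \<nu> {})" by (rule sums_summable)
  then show ?thesis by (simp add: summable_const_iff)
qed

lemma additive_borel_Un:
  assumes \<nu>: "additive_borel \<nu>" and "A \<in> sets borel" "B \<in> sets borel" "A \<inter> B = {}"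
  shows "\<nu> (A \<union> B) = \<nu> A + \<nu> B"
proof -
  have "(\<lambda>i. \<nu> (binaryset A B i)) sums \<nu> (\<Union>i. binaryset A B i)"
    using assms by (intro additive_borelD[OF \<nu>])
      (auto simp: binaryset_def disjoint_family_on_def)
  moreover have "(\<lambda>i. \<nu> (binaryset A B i)) sums (\<nu> A + \<nu> B)"
    by (rule binaryset_sums) (rule additive_borel_empty[OF \<nu>])
  ultimately show ?thesis
    by (simp add: UN_binaryset_eq sums_unique2)
qed

lemma additive_borel_Diff:
  assumes \<nu>: "additive_borel \<nu>" and "A \<in> sets borel" "B \<in> sets borel" "B \<subseteq> A"
  shows "\<nu> (A - B) = \<nu> A - \<nu> B"
  using additive_borel_Un[OF \<nu>, of B "A - B"] assms by (simp add: Un_absorb1)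

lemma additive_borel_linear:
  assumes \<nu>: "additive_borel \<nu>" and h: "bounded_linear h"
  shows "additive_borel (\<lambda>A. h (\<nu> A))"
  using \<nu> bounded_linear.sums[OF h] unfolding additive_borel_def by blast

lemma additive_borel_Int:
  assumes \<nu>: "additive_borel \<nu>" and S: "S \<in> sets borel"
  shows "additive_borel (\<lambda>A. \<nu> (A \<inter> S))"
  unfolding additive_borel_def
proof (intro allI impI)
  fix A :: "nat \<Rightarrow> 'a set" assume A: "range A \<subseteq> sets borel" "disjoint_family A"
  have "(\<lambda>i. \<nu> (A i \<inter> S)) sums \<nu> (\<Union>i. A i \<inter> S)"
    using A S by (intro additive_borelD[OF \<nu>]) (auto simp: disjoint_family_on_def)
  then show "(\<lambda>i. \<nu> (A i \<inter> S)) sums \<nu> ((\<Union>i. A i) \<inter> S)"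
    by simp
qed

lemma additive_borel_add:
  "additive_borel \<nu> \<Longrightarrow> additive_borel \<mu> \<Longrightarrow> additive_borel (\<lambda>A. \<nu> A + \<mu> A)"
  unfolding additive_borel_def by (auto intro!: sums_add)

lemma additive_borel_sum:
  "(\<And>i. i \<in> I \<Longrightarrow> additive_borel (\<nu> i)) \<Longrightarrow> additive_borel (\<lambda>A. \<Sum>i\<in>I. \<nu> i A)"
  unfolding additive_borel_def by (auto intro!: sums_sum)

text \<open>Exhaustion: repeatedly remove a subset that is almost as negative as possible
  (capped at \<open>1\<close>, since no lower bound is known yet).\<close>

lemma additive_borel_pos_subset:
  fixes \<nu> :: "'a::topological_space set \<Rightarrow> real"
  assumes \<nu>: "additive_borel \<nu>" and A: "A \<in> sets borel"
  obtains B where "B \<in> sets borel" "B \<subseteq> A" "\<nu> A \<le> \<nu> B"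
    "\<forall>E\<in>sets borel. E \<subseteq> B \<longrightarrow> 0 \<le> \<nu> E"
proof -
  \<comment> \<open>Half of the capped supremum is required because a supremum need not be attained;
    when it is 0, the empty set is good.\<close>
  define good where "good B D \<longleftrightarrow> D \<in> sets borel \<and> D \<subseteq> B \<and> \<nu> D \<le> 0 \<and>
    (\<forall>E\<in>sets borel. E \<subseteq> B \<longrightarrow> min 1 (- \<nu> E) \<le> - 2 * \<nu> D)" for B D
  have ex: "\<exists>D. good B D" if B: "B \<in> sets borel" for B
  proof -
    define S where "S = (\<lambda>E. min 1 (- \<nu> E)) ` {E\<in>sets borel. E \<subseteq> B}"
    have bdd: "bdd_above S" unfolding S_def by (rule bdd_aboveI[of _ 1]) auto
    have z: "0 \<in> S" unfolding S_def using additive_borel_empty[OF \<nu>] by (auto intro!: image_eqI[of _ _ "{}"])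
    have le: "min 1 (- \<nu> E) \<le> Sup S" if "E \<in> sets borel" "E \<subseteq> B" for E
      using that by (intro cSup_upper[OF _ bdd]) (auto simp: S_def)
    show ?thesis
    proof (cases "Sup S > 0")
      case False
      then have "good B {}" unfolding good_def using le additive_borel_empty[OF \<nu>] by force
      then show ?thesis ..
    next
      case True
      then obtain y where "y \<in> S" "Sup S / 2 < y"
        using less_cSupD[of S "Sup S / 2"] z by auto
      then obtain E where E: "E \<in> sets borel" "E \<subseteq> B" "Sup S / 2 < min 1 (- \<nu> E)"
        unfolding S_def by blast
      have "min 1 (- \<nu> F) \<le> - 2 * \<nu> E" if "F \<in> sets borel" "F \<subseteq> B" for F
        using le[OF that] E(3) by linarith
      moreover have "\<nu> E \<le> 0" using E(3) True by linarith
      ultimately have "good B E" unfolding good_def using E by blast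
      then show ?thesis ..
    qed
  qed
  define D where "D B = (SOME D. good B D)" for B
  have D: "good B (D B)" if "B \<in> sets borel" for B
    unfolding D_def using ex[OF that] by (rule someI_ex)
  define F where "F = rec_nat A (\<lambda>_ B. B - D B)"
  have F0: "F 0 = A" and FS: "\<And>n. F (Suc n) = F n - D (F n)" unfolding F_def by auto
  have Fb: "F n \<in> sets borel" for n
    by (induction n) (use A D in \<open>auto simp: F0 FS good_def\<close>)
  have gd: "good (F n) (D (F n))" for n by (rule D[OF Fb])
  have dec: "decseq F" by (rule decseq_SucI) (auto simp: FS)
  have disj: "disjoint_family (\<lambda>n. D (F n))"
    unfolding disjoint_family_on_def
  proof (intro ballI impI)
    have *: "D (F m) \<inter> D (F n) = {}" if "m < n" for m n
    proof -
      have "F n \<subseteq> F (Suc m)" using dec that by (auto simp: decseq_def Suc_le_eq)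
      then show ?thesis using gd[of n] by (auto simp: FS good_def)
    qed
    fix m n :: nat assume "m \<noteq> n" then show "D (F m) \<inter> D (F n) = {}"
      using *[of m n] *[of n m] by (metis Int_commute linorder_neqE_nat)
  qed
  have s: "(\<lambda>n. \<nu> (D (F n))) sums \<nu> (\<Union>n. D (F n))"
    using gd by (intro additive_borelD[OF \<nu>] disj) (auto simp: good_def)
  define B where "B = A - (\<Union>n. D (F n))"
  have Db: "(\<Union>n. D (F n)) \<in> sets borel" using gd by (auto simp: good_def)
  have DA: "D (F n) \<subseteq> A" for n
    using gd[of n] dec F0 unfolding good_def decseq_def by (metis order_trans zero_le)
  have FB: "B \<subseteq> F n" for n
    by (induction n) (auto simp: B_def F0 FS)
  have "\<nu> (\<Union>n. D (F n)) \<le> 0"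
    using s gd by (intro sums_le[OF _ s sums_zero]) (auto simp: good_def)
  then have le: "\<nu> A \<le> \<nu> B"
    unfolding B_def using additive_borel_Diff[OF \<nu> A Db] DA by (simp add: UN_least)
  \<comment> \<open>The removed masses are the terms of a convergent series and tend to 0. In the
    limit the cap is harmless, because \<open>min 1 x \<le> 0\<close> forces
    \<open>x \<le> 0\<close>.\<close>
  have tend: "(\<lambda>n. - 2 * \<nu> (D (F n))) \<longlonglongrightarrow> - 2 * 0"
    by (intro tendsto_mult tendsto_const summable_LIMSEQ_zero sums_summable[OF s])
  have pos: "0 \<le> \<nu> E" if "E \<in> sets borel" "E \<subseteq> B" for E
  proof -
    have "min 1 (- \<nu> E) \<le> - 2 * \<nu> (D (F n))" for n
      using gd[of n] that FB[of n] by (auto simp: good_def)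
    then have "min 1 (- \<nu> E) \<le> - 2 * 0" by (intro LIMSEQ_le_const[OF tend]) auto
    then show ?thesis by auto
  qed
  have "B \<in> sets borel" "B \<subseteq> A" unfolding B_def using A Db by auto
  then show ?thesis by (rule that[OF _ _ le]) (use pos in blast)
qed

text \<open>A countable union \<open>P\<close> of positive sets whose values approach the supremum
  attains it. A set of positive value outside \<open>P\<close> would contain a positive set that
  could be added to \<open>P\<close>, contradicting maximality. The supremum is formed in the
  extended reals because its finiteness is known only once it is attained.\<close>

lemma Hahn_decomposition_borel:
  fixes \<nu> :: "'a::topological_space set \<Rightarrow> real"
  assumes \<nu>: "additive_borel \<nu>"
  obtains P where "P \<in> sets borel"
    "\<And>E. E \<in> sets borel \<Longrightarrow> E \<subseteq> P \<Longrightarrow> 0 \<le> \<nu> E"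
    "\<And>E. E \<in> sets borel \<Longrightarrow> E \<inter> P = {} \<Longrightarrow> \<nu> E \<le> 0"
proof -
  define pos where "pos = {P\<in>sets borel. \<forall>E\<in>sets borel. E \<subseteq> P \<longrightarrow> 0 \<le> \<nu> E}"
  have ne: "(\<lambda>P. ereal (\<nu> P)) ` pos \<noteq> {}"
    unfolding pos_def using additive_borel_empty[OF \<nu>] by (auto intro!: exI[of _ "{}"])
  obtain Q where Q: "range Q \<subseteq> (\<lambda>P. ereal (\<nu> P)) ` pos" "Sup ((\<lambda>P. ereal (\<nu> P)) ` pos) = (SUP i::nat. Q i)"
    using Sup_countable_SUP[OF ne] by metis
  have "\<forall>i. \<exists>P. P \<in> pos \<and> Q i = ereal (\<nu> P)" using Q(1) by blast
  then obtain R where R: "\<And>i. R i \<in> pos" "\<And>i. Q i = ereal (\<nu> (R i))" by metis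
  define P where "P = (\<Union>i. R i)"
  have Pb: "P \<in> sets borel" using R(1) by (auto simp: P_def pos_def)
  have pos: "0 \<le> \<nu> E" if E: "E \<in> sets borel" "E \<subseteq> P" for E
  proof -
    have db: "disjointed R i \<inter> E \<in> sets borel" for i
      using R(1) E sets.range_disjointed_sets[of R borel] by (auto simp: pos_def)
    have "disjoint_family (\<lambda>i. disjointed R i \<inter> E)"
      using disjoint_family_disjointed[of R] by (auto simp: disjoint_family_on_def)
    then have sm: "(\<lambda>i. \<nu> (disjointed R i \<inter> E)) sums \<nu> (\<Union>i. disjointed R i \<inter> E)"
      by (intro additive_borelD[OF \<nu>] db)
    have nn: "0 \<le> \<nu> (disjointed R i \<inter> E)" for i
      using R(1)[of i] disjointed_subset[of R i] db[of i] unfolding pos_def by blast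
    have "0 \<le> \<nu> (\<Union>i. disjointed R i \<inter> E)" by (rule sums_le[OF nn sums_zero sm])
    also have "(\<Union>i. disjointed R i \<inter> E) = (\<Union>i. disjointed R i) \<inter> E" by blast
    also have "\<dots> = E" using E unfolding UN_disjointed_eq P_def by blast
    finally show ?thesis .
  qed
  have max: "\<nu> Z \<le> \<nu> P" if Z: "Z \<in> pos" for Z
  proof -
    have "Q i \<le> ereal (\<nu> P)" for i
    proof -
      have "\<nu> (P - R i) = \<nu> P - \<nu> (R i)" "0 \<le> \<nu> (P - R i)"
        using R(1)[of i] Pb by (auto simp: pos_def P_def intro!: additive_borel_Diff[OF \<nu>] pos)
      then show ?thesis using R(2) by simp
    qed
    then have "Sup ((\<lambda>P. ereal (\<nu> P)) ` pos) \<le> ereal (\<nu> P)" unfolding Q(2) by (rule SUP_least)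
    then show ?thesis using Z by (simp add: SUP_le_iff)
  qed
  have "\<nu> E \<le> 0" if E: "E \<in> sets borel" "E \<inter> P = {}" for E
  proof (rule ccontr)
    assume "\<not> \<nu> E \<le> 0"
    obtain B where B: "B \<in> sets borel" "B \<subseteq> E" "\<nu> E \<le> \<nu> B"
      "\<forall>E\<in>sets borel. E \<subseteq> B \<longrightarrow> 0 \<le> \<nu> E"
      using additive_borel_pos_subset[OF \<nu> E(1)] by metis
    have "0 \<le> \<nu> F" if F: "F \<in> sets borel" "F \<subseteq> P \<union> B" for F
    proof -
      have "\<nu> (F \<inter> P \<union> (F - P)) = \<nu> (F \<inter> P) + \<nu> (F - P)"
        by (rule additive_borel_Un[OF \<nu>]) (use F Pb in auto)
      then have "\<nu> F = \<nu> (F \<inter> P) + \<nu> (F - P)" by (simp add: Int_Diff_Un)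
      moreover have "0 \<le> \<nu> (F - P)" using F Pb by (intro B(4)[rule_format]) auto
      ultimately show ?thesis using pos[of "F \<inter> P"] F Pb by auto
    qed
    then have "P \<union> B \<in> pos" using Pb B by (auto simp: pos_def)
    moreover have "P \<inter> B = {}" using B(2) E(2) by blast
    ultimately have "\<nu> P + \<nu> B \<le> \<nu> P"
      using max[of "P \<union> B"] additive_borel_Un[OF \<nu> Pb B(1)] by simp
    then show False using B(3) \<open>\<not> \<nu> E \<le> 0\<close> by simp
  qed
  from that[OF Pb pos this] show ?thesis .
qed

section \<open>Vector measures as densities\<close>

text \<open>A polar decomposition without normalisation: \<open>f\<close> need not have norm 1 and
  \<open>l\<close> need not be the variation. This freedom lets several measures share the same
  \<open>l\<close>, for instance the two components of a lifting or a measure and its restriction to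
  \<Omega>.\<close>

definition represents ::
    "'a::topological_space measure \<Rightarrow> ('a \<Rightarrow> 'b::euclidean_space) \<Rightarrow> ('a set \<Rightarrow> 'b) \<Rightarrow> bool" where
  "represents l f \<mu> \<longleftrightarrow> finite_measure l \<and> sets l = sets borel \<and> integrable l f \<and>
     (\<forall>A\<in>sets borel. \<mu> A = (LINT x:A|l. f x))"

lemma additive_borel_measure:
  fixes \<nu> :: "'a::topological_space set \<Rightarrow> real"
  assumes \<nu>: "additive_borel \<nu>" and nn: "\<forall>A\<in>sets borel. 0 \<le> \<nu> A"
  defines "N \<equiv> measure_of UNIV (sets borel) (\<lambda>A. ennreal (\<nu> A))"
  shows "sets N = sets borel" "A \<in> sets borel \<Longrightarrow> emeasure N A = ennreal (\<nu> A)"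
    "finite_measure N"
proof -
  show s: "sets N = sets borel"
    unfolding N_def using sets.sigma_sets_eq[of borel] by (simp add: sets_measure_of)
  have e: "emeasure N A = ennreal (\<nu> A)" if "A \<in> sets borel" for A
    unfolding N_def
  proof (rule emeasure_measure_of_sigma[OF _ _ _ that])
    show "sigma_algebra UNIV (sets borel)" using sets.sigma_algebra_axioms[of borel] by simp
    show "positive (sets borel) (\<lambda>A. ennreal (\<nu> A))"
      by (simp add: positive_def additive_borel_empty[OF \<nu>])
    show "countably_additive (sets borel) (\<lambda>A. ennreal (\<nu> A))"
      unfolding countably_additive_def
    proof (intro allI impI)
      fix A :: "nat \<Rightarrow> 'a set"
      assume A: "range A \<subseteq> sets borel" "disjoint_family A" "\<Union> (range A) \<in> sets borel"
      then have "(\<lambda>i. \<nu> (A i)) sums \<nu> (\<Union>i. A i)"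
        by (intro additive_borelD[OF \<nu>]) auto
      then show "(\<Sum>i. ennreal (\<nu> (A i))) = ennreal (\<nu> (\<Union> (range A)))"
        using A nn by (intro suminf_ennreal_eq) auto
    qed
  qed
  show "A \<in> sets borel \<Longrightarrow> emeasure N A = ennreal (\<nu> A)" by (rule e)
  have "space N = UNIV" using s by (metis sets_eq_imp_space_eq space_borel)
  then show "finite_measure N" by (intro finite_measureI) (simp add: e)
qed

text \<open>The Radon-Nikodym derivative has extended values; its real version \<open>D\<close> is
  integrable because its integral over the whole space is the finite number
  \<open>\<nu> UNIV\<close>.\<close>

lemma Radon_Nikodym_set_function:
  fixes \<nu> :: "'a::topological_space set \<Rightarrow> real"
  assumes l: "finite_measure l" "sets l = sets borel"
    and \<nu>: "additive_borel \<nu>" and nn: "\<forall>A\<in>sets borel. 0 \<le> \<nu> A"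
    and ac: "\<forall>A\<in>sets borel. emeasure l A = 0 \<longrightarrow> \<nu> A = 0"
  obtains D where "integrable l D" "\<And>A. A \<in> sets borel \<Longrightarrow> \<nu> A = (LINT x:A|l. D x)"
proof -
  interpret l: finite_measure l by fact
  define N where "N = measure_of UNIV (sets borel) (\<lambda>A. ennreal (\<nu> A))"
  note N = additive_borel_measure[OF \<nu> nn, folded N_def]
  have acN: "absolutely_continuous l N"
    unfolding absolutely_continuous_def using l N ac by (auto simp: null_sets_def)
  have sN: "sets N = sets l" using N l by simp
  obtain D where D: "D \<in> borel_measurable l" "AE x in l. RN_deriv l N x = ennreal (D x)"
    "\<And>x. 0 \<le> D x" using l.real_RN_deriv[OF N(3) acN sN] by metis
  have eq: "(\<integral>\<^sup>+x. ennreal (indicator A x * D x) \<partial>l) = ennreal (\<nu> A)" if A: "A \<in> sets borel" for A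
  proof -
    have "ennreal (\<nu> A) = emeasure (density l (RN_deriv l N)) A"
      using N(2)[OF A] l.density_RN_deriv[OF acN sN] by simp
    also have "\<dots> = (\<integral>\<^sup>+x. RN_deriv l N x * indicator A x \<partial>l)"
      using A l by (intro emeasure_density) auto
    also have "\<dots> = (\<integral>\<^sup>+x. ennreal (indicator A x * D x) \<partial>l)"
      using D(2) by (intro nn_integral_cong_AE) (auto split: split_indicator elim!: AE_mp)
    finally show ?thesis by simp
  qed
  have "integrable l D"
    using D eq[of UNIV] by (intro integrableI_nonneg) auto
  moreover have "\<nu> A = (LINT x:A|l. D x)" if A: "A \<in> sets borel" for A
  proof -
    have "(LINT x:A|l. D x) = enn2real (\<integral>\<^sup>+x. ennreal (indicator A x * D x) \<partial>l)"
      unfolding set_lebesgue_integral_def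
      using A l D by (simp add: integral_eq_nn_integral)
    then show ?thesis using eq[OF A] nn A by simp
  qed
  ultimately show ?thesis by (rule that)
qed

lemma vector_measure_on_additive: "vector_measure_on \<Omega> \<mu> \<Longrightarrow> additive_borel \<mu>"
  unfolding vector_measure_on_def additive_borel_def by blast

text \<open>Hahn sets of the coordinates split each of them into a positive part \<open>p b\<close>
  and a negative part \<open>n b\<close>. The sum \<open>l\<close> of all these parts dominates
  every one of them, so Radon-Nikodym supplies the coordinates of \<open>f\<close>.\<close>

lemma additive_borel_represents:
  fixes \<mu> :: "'a::topological_space set \<Rightarrow> 'b::euclidean_space"
  assumes \<mu>: "additive_borel \<mu>"
  obtains l f where "represents l f \<mu>"
proof -
  have comp: "additive_borel (\<lambda>A. \<mu> A \<bullet> b)" for b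
    by (rule additive_borel_linear[OF \<mu> bounded_linear_inner_left])
  have "\<forall>b. \<exists>P. P \<in> sets borel \<and> (\<forall>E. E \<in> sets borel \<longrightarrow> E \<subseteq> P \<longrightarrow> 0 \<le> \<mu> E \<bullet> b) \<and>
    (\<forall>E. E \<in> sets borel \<longrightarrow> E \<inter> P = {} \<longrightarrow> \<mu> E \<bullet> b \<le> 0)"
    using Hahn_decomposition_borel[OF comp] by metis
  then obtain P where P: "\<And>b. P b \<in> sets borel"
    "\<And>b E. E \<in> sets borel \<Longrightarrow> E \<subseteq> P b \<Longrightarrow> 0 \<le> \<mu> E \<bullet> b"
    "\<And>b E. E \<in> sets borel \<Longrightarrow> E \<inter> P b = {} \<Longrightarrow> \<mu> E \<bullet> b \<le> 0" by metis
  define p where "p b A = \<mu> (A \<inter> P b) \<bullet> b" for b A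
  define n where "n b A = - (\<mu> (A \<inter> - P b) \<bullet> b)" for b A
  have p: "additive_borel (p b)" "\<forall>A\<in>sets borel. 0 \<le> p b A" for b
    using additive_borel_Int[OF comp P(1)] P(1,2) by (auto simp: p_def[abs_def])
  have n: "additive_borel (n b)" "\<forall>A\<in>sets borel. 0 \<le> n b A" for b
    using additive_borel_linear[OF additive_borel_Int[OF comp borel_comp[OF P(1)]]
        bounded_linear_minus[OF bounded_linear_ident]] P(1,3)
    by (auto simp: n_def[abs_def] borel_comp Int_assoc intro!: sets.Int)
  define t where "t A = (\<Sum>b\<in>Basis. p b A + n b A)" for A
  have t: "additive_borel t" "\<forall>A\<in>sets borel. 0 \<le> t A"
    unfolding t_def[abs_def] using p n
    by (auto intro!: additive_borel_sum additive_borel_add sum_nonneg add_nonneg_nonneg)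
  define l where "l = measure_of UNIV (sets borel) (\<lambda>A. ennreal (t A))"
  note l = additive_borel_measure[OF t, folded l_def]
  \<comment> \<open>The summands of \<open>t\<close> are nonnegative, so an \<open>l\<close>-null
    set is null for each of them; this is the absolute continuity used below.\<close>
  have null: "p b A = 0" "n b A = 0" if "A \<in> sets borel" "emeasure l A = 0" "b \<in> Basis" for b A
  proof -
    have "t A = 0" using that l(2) t(2) by (auto simp: ennreal_eq_0_iff intro: antisym)
    then have "\<forall>b\<in>Basis. p b A + n b A = 0"
      unfolding t_def using p(2) n(2) that(1)
      by (subst (asm) sum_nonneg_eq_0_iff) (auto intro: add_nonneg_nonneg)
    then show "p b A = 0" "n b A = 0" using that p(2)[of b] n(2)[of b] by (auto simp: add_nonneg_eq_0_iff)
  qed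
  have "\<exists>D. b \<in> Basis \<longrightarrow> integrable l D \<and> (\<forall>A\<in>sets borel. p b A = (LINT x:A|l. D x))" for b
    using Radon_Nikodym_set_function[OF l(3) l(1) p(1) p(2), of b] null(1) by metis
  then obtain D where D: "\<And>b. b \<in> Basis \<Longrightarrow> integrable l (D b)"
    "\<And>b A. b \<in> Basis \<Longrightarrow> A \<in> sets borel \<Longrightarrow> p b A = (LINT x:A|l. D b x)" by metis
  have "\<exists>E. b \<in> Basis \<longrightarrow> integrable l E \<and> (\<forall>A\<in>sets borel. n b A = (LINT x:A|l. E x))" for b
    using Radon_Nikodym_set_function[OF l(3) l(1) n(1) n(2), of b] null(2) by metis
  then obtain E where E: "\<And>b. b \<in> Basis \<Longrightarrow> integrable l (E b)"
    "\<And>b A. b \<in> Basis \<Longrightarrow> A \<in> sets borel \<Longrightarrow> n b A = (LINT x:A|l. E b x)" by metis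
  define f where "f x = (\<Sum>b\<in>Basis. (D b x - E b x) *\<^sub>R b)" for x
  have "represents l f \<mu>" unfolding represents_def
  proof (intro conjI ballI)
    show "integrable l f" unfolding f_def using D E by (auto intro!: Bochner_Integration.integrable_sum)
    fix A :: "'a set" assume A: "A \<in> sets borel"
    have A': "A \<in> sets l" using A l by simp
    have i: "integrable l (\<lambda>x. indicat_real A x *\<^sub>R D b x)" "integrable l (\<lambda>x. indicat_real A x *\<^sub>R E b x)"
      if "b \<in> Basis" for b
      using integrable_mult_indicator[OF A' D(1)[OF that]] integrable_mult_indicator[OF A' E(1)[OF that]] .
    have "(LINT x:A|l. f x) = (LINT x|l. (\<Sum>b\<in>Basis. (indicator A x *\<^sub>R D b x - indicator A x *\<^sub>R E b x) *\<^sub>R b))"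
      unfolding set_lebesgue_integral_def f_def
      by (intro Bochner_Integration.integral_cong) (auto simp: scaleR_sum_right algebra_simps)
    also have "\<dots> = (\<Sum>b\<in>Basis. (LINT x|l. (indicator A x *\<^sub>R D b x - indicator A x *\<^sub>R E b x) *\<^sub>R b))"
      using i by (intro Bochner_Integration.integral_sum) auto
    also have "\<dots> = (\<Sum>b\<in>Basis. (p b A - n b A) *\<^sub>R b)"
      using i D(2)[OF _ A] E(2)[OF _ A]
      by (intro sum.cong refl) (simp add: set_lebesgue_integral_def integral_diff del: real_scaleR_def)
    also have "\<dots> = (\<Sum>b\<in>Basis. (\<mu> A \<bullet> b) *\<^sub>R b)"
    proof (intro sum.cong refl)
      fix b :: 'b assume "b \<in> Basis"
      have "\<mu> (A \<inter> P b \<union> A \<inter> - P b) = \<mu> (A \<inter> P b) + \<mu> (A \<inter> - P b)"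
        by (rule additive_borel_Un[OF \<mu>]) (use A P(1) borel_comp in auto)
      moreover have "A \<inter> P b \<union> A \<inter> - P b = A" by blast
      ultimately show "(p b A - n b A) *\<^sub>R b = (\<mu> A \<bullet> b) *\<^sub>R b"
        by (simp add: p_def n_def inner_add_left)
    qed
    also have "\<dots> = \<mu> A" by (rule euclidean_representation)
    finally show "\<mu> A = (LINT x:A|l. f x)" by simp
  qed (use l in auto)
  then show ?thesis by (rule that)
qed

lemma represents_restrict:
  assumes r: "represents l f \<mu>" and S: "S \<in> sets borel"
  shows "represents l (\<lambda>x. indicator S x *\<^sub>R f x) (\<lambda>A. \<mu> (A \<inter> S))"
proof -
  have s: "sets l = sets borel" and f: "integrable l f" using r by (auto simp: represents_def)
  show ?thesis
    using r S s unfolding represents_def set_lebesgue_integral_def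
    by (auto simp: scaleR_scaleR indicator_inter_arith intro!: integrable_mult_indicator
      arg_cong[where f="integral\<^sup>L l"])
qed

lemma represents_cong:
  "represents l f \<mu> \<Longrightarrow> (\<And>A. A \<in> sets borel \<Longrightarrow> \<mu> A = \<nu> A) \<Longrightarrow> represents l f \<nu>"
  unfolding represents_def by auto

text \<open>The density is multiplied by the indicator of \<Omega>, so that it vanishes off \<Omega>
  at every point and not just almost everywhere. Later support hypotheses are pointwise.\<close>

lemma vector_measure_on_represents:
  assumes "vector_measure_on \<Omega> \<mu>" and \<Omega>: "\<Omega> \<in> sets borel"
  obtains l f where "represents l f \<mu>" "\<And>x. x \<notin> \<Omega> \<Longrightarrow> f x = 0"
proof -
  obtain l f where r: "represents l f \<mu>"
    using additive_borel_represents[OF vector_measure_on_additive[OF assms(1)]] by blast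
  have "represents l (\<lambda>x. indicator \<Omega> x *\<^sub>R f x) \<mu>"
    by (rule represents_cong[OF represents_restrict[OF r \<Omega>]])
      (use assms(1) in \<open>unfold vector_measure_on_def, metis\<close>)
  then show ?thesis by (rule that) auto
qed

lemma represents_bounded_linear:
  assumes r: "represents l f \<mu>" and h: "bounded_linear h"
  shows "represents l (\<lambda>x. h (f x)) (\<lambda>A. h (\<mu> A))"
proof -
  interpret h: bounded_linear h by fact
  have f: "integrable l f" and s: "sets l = sets borel" using r by (auto simp: represents_def)
  have "h (\<mu> A) = (LINT x:A|l. h (f x))" if A: "A \<in> sets borel" for A
  proof -
    have "integrable l (\<lambda>x. indicat_real A x *\<^sub>R f x)"
      using A s f by (intro integrable_mult_indicator) auto
    from integral_bounded_linear[OF h this] show ?thesis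
      using r A by (simp add: represents_def set_lebesgue_integral_def h.scaleR)
  qed
  then show ?thesis
    using r integrable_bounded_linear[OF h f] unfolding represents_def by blast
qed

section \<open>Variation, Jordan parts and integrals of a measure given by a density\<close>

lemma nn_integral_le_plus_small:
  fixes a S :: ennreal
  assumes "\<And>e::real. 0 < e \<Longrightarrow> a \<le> S + ennreal (2 * e) * L" and L: "L < \<infinity>"
  shows "a \<le> S"
proof (cases "S = \<infinity>")
  case False
  show ?thesis
  proof (rule ennreal_le_epsilon)
    fix e :: real assume e: "0 < e"
    obtain r where r: "0 \<le> r" "L = ennreal r" using L by (cases L) auto
    define d where "d = e / (2 * (r + 1))"
    have d: "0 < d" using e r by (simp add: d_def)
    have "2 * d * r \<le> e" using e r by (simp add: d_def field_simps)
    then have "ennreal (2 * d) * L \<le> ennreal e"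
      using d r by (simp add: r ennreal_mult[symmetric] ennreal_leI)
    then show "a \<le> S + ennreal e" using assms(1)[OF d] by (meson add_left_mono order_trans)
  qed
qed simp

lemma represents_norm_le:
  assumes r: "represents l f \<mu>" and A: "A \<in> sets borel"
  shows "ennreal (norm (\<mu> A)) \<le> emeasure (density l (\<lambda>x. ennreal (norm (f x)))) A"
proof -
  have s: "sets l = sets borel" and f: "integrable l f" using r by (auto simp: represents_def)
  have "integrable l (\<lambda>x. indicat_real A x *\<^sub>R f x)"
    using A s f by (intro integrable_mult_indicator) auto
  then have "ennreal (norm (\<mu> A)) \<le> (\<integral>\<^sup>+x. norm (indicat_real A x *\<^sub>R f x) \<partial>l)"
    using r A by (simp only: represents_def set_lebesgue_integral_def integral_norm_bound_ennreal)
  also have "\<dots> = (\<integral>\<^sup>+x. ennreal (norm (f x)) * indicator A x \<partial>l)"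
    by (intro nn_integral_cong) (auto split: split_indicator)
  also have "\<dots> = emeasure (density l (\<lambda>x. ennreal (norm (f x)))) A"
    using A s f by (intro emeasure_density[symmetric]) auto
  finally show ?thesis .
qed

text \<open>No partition can exceed the integral of \<open>norm f\<close>, by the triangle
  inequality on each piece. Conversely, on a piece where \<open>f\<close> is within \<open>e\<close>
  of a constant, passing to that constant and back costs at most \<open>2 * e\<close> times the
  \<open>l\<close>-mass of the piece, and \<open>l\<close> is finite.\<close>

lemma represents_variation_SUP:
  fixes \<mu> :: "'a::euclidean_space set \<Rightarrow> 'b::euclidean_space"
  assumes r: "represents l f \<mu>" and A: "A \<in> sets borel"
  shows "(SUP E \<in> {E :: nat \<Rightarrow> 'a set. range E \<subseteq> sets borel \<and> disjoint_family E \<and> (\<Union>i. E i) = A}.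
        (\<Sum>i. ennreal (norm (\<mu> (E i))))) = emeasure (density l (\<lambda>x. ennreal (norm (f x)))) A"
    (is "Sup (?g ` ?P) = ?v A")
proof (rule antisym)
  have s: "sets l = sets borel" and f: "integrable l f" using r by (auto simp: represents_def)
  interpret l: finite_measure l using r by (simp add: represents_def)
  show "Sup (?g ` ?P) \<le> ?v A"
  proof (rule SUP_least)
    fix E :: "nat \<Rightarrow> 'a set" assume E: "E \<in> ?P"
    have "(\<Sum>i. ennreal (norm (\<mu> (E i)))) \<le> (\<Sum>i. ?v (E i))"
      using E by (intro suminf_le represents_norm_le[OF r]) auto
    also have "\<dots> = ?v (\<Union>i. E i)"
      using E s by (intro suminf_emeasure) auto
    finally show "(\<Sum>i. ennreal (norm (\<mu> (E i)))) \<le> ?v A" using E by simp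
  qed
  show "?v A \<le> Sup (?g ` ?P)"
  proof (rule nn_integral_le_plus_small)
    show "emeasure l (space l) < \<infinity>" using l.finite_emeasure_space by (metis infinity_ennreal_def less_top)
    fix e :: real assume e: "0 < e"
    obtain D :: "'b set" where D: "countable D" "\<And>X. open X \<Longrightarrow> X \<noteq> {} \<Longrightarrow> \<exists>d\<in>D. d \<in> X"
      by (rule countable_dense_setE) blast
    have "D \<noteq> {}" using D(2)[of UNIV] by auto
    define d where "d = from_nat_into D"
    \<comment> \<open>Disjointed balls around a dense sequence partition the target space, so their
      preimages partition \<open>A\<close> into countably many sets on which \<open>f\<close> stays
      within \<open>e\<close> of \<open>d k\<close>.\<close>
    define Q where "Q = disjointed (\<lambda>k::nat. ball (d k) e)"
    define E where "E k = A \<inter> f -` Q k" for k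
    have Qb: "Q k \<in> sets borel" for k
    proof -
      have "range (\<lambda>k. ball (d k) e) \<subseteq> sets borel" by (auto simp: borel_open)
      from sets.range_disjointed_sets[OF this] show ?thesis unfolding Q_def by blast
    qed
    have fm: "f \<in> borel_measurable borel" using borel_measurable_integrable[OF f] unfolding measurable_cong_sets[OF s refl] .
    have Eb: "E k \<in> sets borel" for k
      unfolding E_def using sets.Int[OF A measurable_sets[OF fm Qb[of k]]] by simp
    have Ed: "disjoint_family E"
      using disjoint_family_disjointed[of "\<lambda>k::nat. ball (d k) e", folded Q_def]
      unfolding disjoint_family_on_def E_def by blast
    have cov: "(\<Union>k. ball (d k) e) = UNIV"
    proof -
      have "\<exists>k. x \<in> ball (d k) e" for x
      proof -
        obtain y where "y \<in> D" "y \<in> ball x e" using D(2)[of "ball x e"] e by auto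
        then show ?thesis using from_nat_into_surj[OF D(1)] by (metis d_def dist_commute mem_ball)
      qed
      then show ?thesis by auto
    qed
    have EU: "(\<Union>i. E i) = A"
    proof -
      have "(\<Union>k. Q k) = UNIV" unfolding Q_def UN_disjointed_eq by (rule cov)
      then show ?thesis unfolding E_def by blast
    qed
    have EP: "E \<in> ?P" using Eb Ed EU by blast
    have close: "norm (f x - d k) < e" if "x \<in> E k" for x k
    proof -
      have "f x \<in> ball (d k) e" using that disjointed_subset[of "\<lambda>k::nat. ball (d k) e" k]
        unfolding E_def Q_def by blast
      then show ?thesis by (simp add: dist_norm norm_minus_commute)
    qed
    have piece: "?v (E k) \<le> ennreal (norm (\<mu> (E k))) + ennreal (2 * e) * emeasure l (E k)" for k
    proof -
      have El: "E k \<in> sets l" using Eb s by simp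
      have if1: "integrable l (\<lambda>x. indicat_real (E k) x *\<^sub>R f x)"
        using El f by (intro integrable_mult_indicator) auto
      have if3: "integrable l (\<lambda>x. indicat_real (E k) x *\<^sub>R d k)" "integrable l (indicat_real (E k))"
        using El by (auto intro!: integrable_real_indicator simp: l.emeasure_finite less_top[symmetric])
      have "(LINT x|l. indicator (E k) x * norm (f x)) \<le>
          (LINT x|l. indicator (E k) x * (norm (d k) + e))"
      proof (rule integral_mono)
        show "integrable l (\<lambda>x. indicator (E k) x * norm (f x))"
          using integrable_norm[OF if1] by simp
        show "integrable l (\<lambda>x. indicator (E k) x * (norm (d k) + e))"
          using if3(2) by simp
        show "indicator (E k) x * norm (f x) \<le> indicator (E k) x * (norm (d k) + e)" for x
          using close[of x k] norm_triangle_sub[of "f x" "d k"] by (cases "x \<in> E k") auto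
      qed
      also have "\<dots> = measure l (E k) * (norm (d k) + e)" using El by simp
      finally have 1: "(LINT x|l. indicator (E k) x * norm (f x)) \<le> measure l (E k) * norm (d k) + e * measure l (E k)"
        by (simp add: algebra_simps)
      have "measure l (E k) * norm (d k) - norm (\<mu> (E k)) \<le> norm (\<mu> (E k) - measure l (E k) *\<^sub>R d k)"
        using norm_triangle_ineq2[of "measure l (E k) *\<^sub>R d k" "\<mu> (E k)"]
        by (simp add: norm_minus_commute)
      also have "\<mu> (E k) - measure l (E k) *\<^sub>R d k = (LINT x|l. indicat_real (E k) x *\<^sub>R (f x - d k))"
        using r Eb[of k] if1 if3 El
        by (simp add: represents_def set_lebesgue_integral_def scaleR_diff_right)
      also have "norm \<dots> \<le> (LINT x|l. indicat_real (E k) x * e)"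
      proof (rule Bochner_Integration.integral_norm_bound_integral)
        show "integrable l (\<lambda>x. indicat_real (E k) x *\<^sub>R (f x - d k))"
          using Bochner_Integration.integrable_diff[OF if1 if3(1)] by (simp add: scaleR_diff_right)
        show "integrable l (\<lambda>x. indicat_real (E k) x * e)" using if3(2) by simp
        show "norm (indicat_real (E k) x *\<^sub>R (f x - d k)) \<le> indicat_real (E k) x * e" for x
          using close[of x k] by (cases "x \<in> E k") auto
      qed
      also have "\<dots> = e * measure l (E k)" using El by simp
      finally have 2: "(LINT x|l. indicator (E k) x * norm (f x)) \<le> norm (\<mu> (E k)) + 2 * e * measure l (E k)"
        using 1 by simp
      have "?v (E k) = (\<integral>\<^sup>+x. ennreal (norm (f x)) * indicator (E k) x \<partial>l)"
        using El f by (intro emeasure_density) auto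
      also have "\<dots> = (\<integral>\<^sup>+x. ennreal (indicator (E k) x * norm (f x)) \<partial>l)"
        by (intro nn_integral_cong) (auto split: split_indicator)
      also have "\<dots> = ennreal (LINT x|l. indicator (E k) x * norm (f x))"
        using integrable_norm[OF if1] by (intro nn_integral_eq_integral) auto
      also have "\<dots> \<le> ennreal (norm (\<mu> (E k)) + 2 * e * measure l (E k))"
        using 2 by (rule ennreal_leI)
      also have "\<dots> = ennreal (norm (\<mu> (E k))) + ennreal (2 * e) * emeasure l (E k)"
        using e by (simp add: l.emeasure_eq_measure ennreal_mult)
      finally show ?thesis .
    qed
    have "?v A = (\<Sum>k. ?v (E k))"
      using Eb Ed EU s by (subst suminf_emeasure) auto
    also have "\<dots> \<le> (\<Sum>k. ennreal (norm (\<mu> (E k))) + ennreal (2 * e) * emeasure l (E k))"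
      by (intro suminf_le piece) auto
    also have "\<dots> = (\<Sum>k. ennreal (norm (\<mu> (E k)))) + ennreal (2 * e) * (\<Sum>k. emeasure l (E k))"
      by (simp add: suminf_add[symmetric])
    also have "\<dots> = (\<Sum>k. ennreal (norm (\<mu> (E k)))) + ennreal (2 * e) * emeasure l A"
      using Eb Ed EU s by (subst suminf_emeasure) auto
    also have "\<dots> \<le> Sup (?g ` ?P) + ennreal (2 * e) * emeasure l (space l)"
    proof (rule add_mono)
      show "(\<Sum>k. ennreal (norm (\<mu> (E k)))) \<le> Sup (?g ` ?P)"
        by (rule SUP_upper[OF EP])
      show "ennreal (2 * e) * emeasure l A \<le> ennreal (2 * e) * emeasure l (space l)"
        by (intro mult_left_mono emeasure_space) simp
    qed
    finally show "?v A \<le> Sup (?g ` ?P) + ennreal (2 * e) * emeasure l (space l)" .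
  qed
qed

lemma measure_of_borel_eq:
  assumes "sets N = sets borel" "\<And>A. A \<in> sets borel \<Longrightarrow> F A = emeasure N A"
  shows "measure_of UNIV (sets borel) F = N"
proof -
  have sp: "space N = UNIV" using assms(1) by (metis sets_eq_imp_space_eq space_borel)
  have "measure_of UNIV (sets borel) F = measure_of UNIV (sets borel) (emeasure N)"
    using assms sets.sigma_sets_eq[of borel] by (intro measure_of_eq) auto
  then show ?thesis using measure_of_of_measure[of N] assms(1) sp by simp
qed

theorem represents_variation:
  fixes \<mu> :: "'a::euclidean_space set \<Rightarrow> 'b::euclidean_space"
  assumes r: "represents l f \<mu>"
  shows "variation \<mu> = density l (\<lambda>x. ennreal (norm (f x)))"
  unfolding variation_def
proof (rule measure_of_borel_eq)
  show "sets (density l (\<lambda>x. ennreal (norm (f x)))) = sets borel"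
    using r by (simp add: represents_def)
qed (rule represents_variation_SUP[OF r])

lemma represents_measure_variation:
  fixes \<mu> :: "'a::euclidean_space set \<Rightarrow> 'b::euclidean_space"
  assumes r: "represents l f \<mu>" and A: "A \<in> sets borel"
  shows "measure (variation \<mu>) A = (LINT x|l. indicator A x * norm (f x))"
    "integrable l (\<lambda>x. indicator A x * norm (f x))"
proof -
  have s: "sets l = sets borel" and f: "integrable l f" using r by (auto simp: represents_def)
  have "integrable l (\<lambda>x. indicat_real A x *\<^sub>R f x)"
    using A s f by (intro integrable_mult_indicator) auto
  from integrable_norm[OF this] show i: "integrable l (\<lambda>x. indicator A x * norm (f x))" by simp
  have "emeasure (variation \<mu>) A = (\<integral>\<^sup>+x. ennreal (norm (f x)) * indicator A x \<partial>l)"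
    unfolding represents_variation[OF r] using A s f by (intro emeasure_density) auto
  also have "\<dots> = (\<integral>\<^sup>+x. ennreal (indicator A x * norm (f x)) \<partial>l)"
    by (intro nn_integral_cong) (auto split: split_indicator)
  also have "\<dots> = ennreal (LINT x|l. indicator A x * norm (f x))"
    using i by (intro nn_integral_eq_integral) auto
  finally show "measure (variation \<mu>) A = (LINT x|l. indicator A x * norm (f x))"
    by (simp add: measure_def)
qed

lemma represents_pos_neg_part:
  fixes \<nu> :: "'a::euclidean_space set \<Rightarrow> real"
  assumes r: "represents l f \<nu>"
  shows "pos_part \<nu> = density l (\<lambda>x. ennreal (max 0 (f x)))"
    "neg_part \<nu> = density l (\<lambda>x. ennreal (max 0 (- f x)))"
proof -
  have s: "sets l = sets borel" and f: "integrable l f" using r by (auto simp: represents_def)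
  \<comment> \<open>The sign \<open>c\<close> treats both Jordan parts at once; pointwise
    \<open>(\<bar>f\<bar> + c * f) / 2 = max 0 (c * f)\<close> for \<open>c = 1\<close> and
    \<open>c = - 1\<close>.\<close>
  have *: "ennreal ((measure (variation \<nu>) A + c * \<nu> A) / 2) =
      emeasure (density l (\<lambda>x. ennreal (max 0 (c * f x)))) A"
    if A: "A \<in> sets borel" and c: "c = 1 \<or> c = - 1" for A c
  proof -
    have i1: "integrable l (\<lambda>x. indicat_real A x * f x)"
      using A s integrable_mult_indicator[OF _ f, of A] by simp
    note m = represents_measure_variation[OF r A]
    have i2: "integrable l (\<lambda>x. indicator A x * max 0 (c * f x))"
      by (rule Bochner_Integration.integrable_bound[OF m(2)])
         (use f A s c in \<open>auto split: split_indicator\<close>)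
    have "\<nu> A = (LINT x|l. indicator A x * f x)"
      using r A by (simp add: represents_def set_lebesgue_integral_def)
    then have "(measure (variation \<nu>) A + c * \<nu> A) / 2 =
        (LINT x|l. (indicator A x * norm (f x) + c * (indicator A x * f x)) / 2)"
      using i1 m by simp
    also have "\<dots> = (LINT x|l. indicator A x * max 0 (c * f x))"
      using c by (intro Bochner_Integration.integral_cong refl) (auto split: split_indicator)
    finally have "ennreal ((measure (variation \<nu>) A + c * \<nu> A) / 2) =
        (\<integral>\<^sup>+x. ennreal (indicator A x * max 0 (c * f x)) \<partial>l)"
      using i2 by (simp add: nn_integral_eq_integral)
    also have "\<dots> = (\<integral>\<^sup>+x. ennreal (max 0 (c * f x)) * indicator A x \<partial>l)"
      by (intro nn_integral_cong) (auto split: split_indicator)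
    also have "\<dots> = emeasure (density l (\<lambda>x. ennreal (max 0 (c * f x)))) A"
      using A s f by (intro emeasure_density[symmetric]) auto
    finally show ?thesis .
  qed
  show "pos_part \<nu> = density l (\<lambda>x. ennreal (max 0 (f x)))"
    unfolding pos_part_def using *[of _ 1] s by (intro measure_of_borel_eq) auto
  show "neg_part \<nu> = density l (\<lambda>x. ennreal (max 0 (- f x)))"
    unfolding neg_part_def using *[of _ "-1"] s by (intro measure_of_borel_eq) auto
qed

text \<open>Integrability of the product is assumed instead of boundedness of \<psi>, because
  mollifier kernels are continuous but may be unbounded.\<close>

theorem represents_vm_integral:
  fixes \<mu> :: "'a::euclidean_space set \<Rightarrow> 'b::euclidean_space"
  assumes r: "represents l f \<mu>" and \<psi>: "\<psi> \<in> borel_measurable borel"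
    and i: "integrable l (\<lambda>x. \<psi> x *\<^sub>R f x)"
  shows "vm_integral \<mu> \<psi> = (LINT x|l. \<psi> x *\<^sub>R f x)"
proof -
  have s: "sets l = sets borel" and f: "integrable l f" using r by (auto simp: represents_def)
  have \<psi>l: "\<psi> \<in> borel_measurable l" using \<psi> unfolding measurable_cong_sets[OF s refl] .
  have "(LINT x|pos_part (\<lambda>A. \<mu> A \<bullet> b). \<psi> x) - (LINT x|neg_part (\<lambda>A. \<mu> A \<bullet> b). \<psi> x) =
      (LINT x|l. \<psi> x *\<^sub>R f x) \<bullet> b" for b
  proof -
    have rb: "represents l (\<lambda>x. f x \<bullet> b) (\<lambda>A. \<mu> A \<bullet> b)"
      by (rule represents_bounded_linear[OF r bounded_linear_inner_left])
    have ib: "integrable l (\<lambda>x. \<psi> x * (f x \<bullet> b))"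
      using integrable_inner_left[of b l, OF i] by simp
    have ii: "integrable l (\<lambda>x. max 0 (f x \<bullet> b) * \<psi> x)" "integrable l (\<lambda>x. max 0 (- (f x \<bullet> b)) * \<psi> x)"
      by (rule Bochner_Integration.integrable_bound[OF ib];
          use f \<psi>l in \<open>auto simp: abs_mult mult.commute intro!: mult_left_mono\<close>)+
    have "(LINT x|pos_part (\<lambda>A. \<mu> A \<bullet> b). \<psi> x) - (LINT x|neg_part (\<lambda>A. \<mu> A \<bullet> b). \<psi> x) =
        (LINT x|l. max 0 (f x \<bullet> b) * \<psi> x) - (LINT x|l. max 0 (- (f x \<bullet> b)) * \<psi> x)"
      unfolding represents_pos_neg_part[OF rb] using f \<psi>l
      by (subst (1 2) integral_real_density) auto
    also have "\<dots> = (LINT x|l. max 0 (f x \<bullet> b) * \<psi> x - max 0 (- (f x \<bullet> b)) * \<psi> x)"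
      using ii by (rule Bochner_Integration.integral_diff[symmetric])
    also have "\<dots> = (LINT x|l. (\<psi> x *\<^sub>R f x) \<bullet> b)"
      by (intro Bochner_Integration.integral_cong refl) (auto simp: max_def)
    also have "\<dots> = (LINT x|l. \<psi> x *\<^sub>R f x) \<bullet> b"
      using i by (intro integral_inner_left) auto
    finally show ?thesis .
  qed
  then show ?thesis unfolding vm_integral_def by (simp add: euclidean_representation)
qed

section \<open>Smooth functions and test functions\<close>

lemma Ck_imp_continuous: "Ck k f \<Longrightarrow> continuous_on UNIV f"
  by (cases k) (auto intro!: differentiable_imp_continuous_on simp: differentiable_on_def
      intro: differentiable_at_withinI)

lemma Ck_SucI:
  assumes "\<And>x. (f has_derivative f' x) (at x)" "\<And>b. b \<in> Basis \<Longrightarrow> Ck k (\<lambda>x. f' x b)"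
  shows "Ck (Suc k) f"
proof -
  have "frechet_derivative f (at x) = f' x" for x
    using frechet_derivative_at[OF assms(1)] by simp
  then show ?thesis using assms by (auto simp: differentiable_def)
qed

lemma Ck_SucD:
  assumes "Ck (Suc k) f"
  shows "(f has_derivative frechet_derivative f (at x)) (at x)"
    "b \<in> Basis \<Longrightarrow> Ck k (\<lambda>x. frechet_derivative f (at x) b)"
  using assms by (auto simp: frechet_derivative_works)

lemma Ck_Suc_imp_Ck: "Ck (Suc k) f \<Longrightarrow> Ck k f"
proof (induction k arbitrary: f)
  case 0
  then show ?case by (metis Ck_imp_continuous Ck.simps(1))
next
  case (Suc k)
  show ?case
    by (rule Ck_SucI[OF Ck_SucD(1)[OF Suc.prems]]) (rule Suc.IH[OF Ck_SucD(2)[OF Suc.prems]])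
qed

lemma Ck_const: "Ck k (\<lambda>x. c)"
proof (induction k arbitrary: c)
  case (Suc k)
  show ?case by (rule Ck_SucI[where f'="\<lambda>_ _. 0"]) (auto intro: Suc)
qed simp

lemma Ck_add: "Ck k f \<Longrightarrow> Ck k g \<Longrightarrow> Ck k (\<lambda>x. f x + g x)"
proof (induction k arbitrary: f g)
  case (Suc k)
  show ?case
    by (rule Ck_SucI[OF has_derivative_add[OF Ck_SucD(1)[OF Suc.prems(1)] Ck_SucD(1)[OF Suc.prems(2)]]])
      (rule Suc.IH[OF Ck_SucD(2)[OF Suc.prems(1)] Ck_SucD(2)[OF Suc.prems(2)]])
qed (simp add: continuous_on_add)

lemma Ck_mult: "Ck k f \<Longrightarrow> Ck k g \<Longrightarrow> Ck k (\<lambda>x. f x * g x)"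
proof (induction k arbitrary: f g)
  case (Suc k)
  show ?case
    by (rule Ck_SucI[OF has_derivative_mult[OF Ck_SucD(1)[OF Suc.prems(1)] Ck_SucD(1)[OF Suc.prems(2)]]])
      (rule Ck_add[OF Suc.IH[OF Ck_Suc_imp_Ck[OF Suc.prems(1)] Ck_SucD(2)[OF Suc.prems(2)]]
            Suc.IH[OF Ck_SucD(2)[OF Suc.prems(1)] Ck_Suc_imp_Ck[OF Suc.prems(2)]]])
qed (simp add: continuous_on_mult)

lemma Ck_translate: "Ck k f \<Longrightarrow> Ck k (\<lambda>x. f (x + a))"
proof (induction k arbitrary: f)
  case 0
  then show ?case by (auto intro!: continuous_on_compose2[of UNIV f] continuous_intros)
next
  case (Suc k)
  have d: "((\<lambda>x. f (x + a)) has_derivative frechet_derivative f (at (x + a))) (at x)" for x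
  proof -
    have "((\<lambda>x. x + a) has_derivative (\<lambda>h. h)) (at x)" by (auto intro!: derivative_eq_intros)
    from has_derivative_compose[OF this Ck_SucD(1)[OF Suc.prems]] show ?thesis .
  qed
  show ?case by (rule Ck_SucI[OF d]) (rule Suc.IH[OF Ck_SucD(2)[OF Suc.prems]])
qed

lemma smooth_const: "smooth (\<lambda>x. c)" by (simp add: smooth_def Ck_const)

lemma smooth_add: "smooth f \<Longrightarrow> smooth g \<Longrightarrow> smooth (\<lambda>x. f x + g x)"
  by (simp add: smooth_def Ck_add)

lemma smooth_mult: "smooth f \<Longrightarrow> smooth g \<Longrightarrow> smooth (\<lambda>x. f x * g x)"
  by (simp add: smooth_def Ck_mult)

lemma smooth_diff: "smooth f \<Longrightarrow> smooth g \<Longrightarrow> smooth (\<lambda>x. f x - g x)"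
  using smooth_add[of f "\<lambda>x. - 1 * g x"] smooth_mult[OF smooth_const, of g "-1"] by simp

lemma smooth_translate: "smooth f \<Longrightarrow> smooth (\<lambda>x. f (x + a))"
  by (simp add: smooth_def Ck_translate)

lemma smooth_prod: "(\<And>i. i \<in> I \<Longrightarrow> smooth (f i)) \<Longrightarrow> smooth (\<lambda>x. \<Prod>i\<in>I. f i x)"
  by (induction I rule: infinite_finite_induct) (auto intro: smooth_const smooth_mult)

lemma smooth_power: "smooth f \<Longrightarrow> smooth (\<lambda>x. f x ^ n)"
  by (induction n) (auto intro: smooth_const smooth_mult)

lemma smooth_continuous: "smooth f \<Longrightarrow> continuous_on UNIV f"
  using Ck_imp_continuous smooth_def by blast

lemma smooth_has_derivative: "smooth f \<Longrightarrow> (f has_derivative frechet_derivative f (at x)) (at x)"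
  using Ck_SucD(1)[of 0 f] by (auto simp: smooth_def)

lemma smooth_has_derivative_gradient:
  assumes "smooth f"
  shows "(f has_derivative (\<lambda>h. gradient f x \<bullet> h)) (at x)"
proof -
  have d: "(f has_derivative frechet_derivative f (at x)) (at x)"
    by (rule smooth_has_derivative[OF assms])
  interpret bounded_linear "frechet_derivative f (at x)" by (rule has_derivative_bounded_linear[OF d])
  have "frechet_derivative f (at x) h = gradient f x \<bullet> h" for h
  proof -
    have "frechet_derivative f (at x) h = frechet_derivative f (at x) (\<Sum>b\<in>Basis. (h \<bullet> b) *\<^sub>R b)"
      by (simp add: euclidean_representation)
    also have "\<dots> = (\<Sum>b\<in>Basis. (h \<bullet> b) * frechet_derivative f (at x) b)"
      by (simp add: sum scaleR)
    also have "\<dots> = (\<Sum>b\<in>Basis. frechet_derivative f (at x) b * (b \<bullet> h))"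
      by (simp add: inner_commute mult.commute)
    finally show ?thesis by (simp add: gradient_def inner_sum_left)
  qed
  then have "frechet_derivative f (at x) = (\<lambda>h. gradient f x \<bullet> h)" by blast
  then show ?thesis using d by simp
qed

lemma smooth_gradient_continuous:
  assumes "smooth f"
  shows "continuous_on UNIV (gradient f)"
proof -
  have "continuous_on UNIV (\<lambda>x. frechet_derivative f (at x) b)" if "b \<in> Basis" for b
    using assms that Ck_SucD(2)[of 0 f b] by (auto simp: smooth_def)
  then show ?thesis unfolding gradient_def[abs_def] by (intro continuous_intros) auto
qed

lemma gradient_translate:
  assumes "smooth f"
  shows "gradient (\<lambda>x. f (x + a)) x = gradient f (x + a)"
proof -
  have "((\<lambda>x. f (x + a)) has_derivative (\<lambda>h. gradient f (x + a) \<bullet> h)) (at x)"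
  proof -
    have "((\<lambda>x. x + a) has_derivative (\<lambda>h. h)) (at x)" by (auto intro!: derivative_eq_intros)
    from has_derivative_compose[OF this smooth_has_derivative_gradient[OF assms]] show ?thesis .
  qed
  from has_derivative_unique[OF this smooth_has_derivative_gradient[OF smooth_translate[OF assms]]]
  have "gradient f (x + a) \<bullet> h = gradient (\<lambda>x. f (x + a)) x \<bullet> h" for h by (simp add: fun_eq_iff)
  from vector_eq_rdot[THEN iffD1, OF allI, OF this] show ?thesis by simp
qed

section \<open>Bump functions and smooth approximation of indicators of open sets\<close>

definition bump_exp :: "nat \<Rightarrow> real \<Rightarrow> real" where
  "bump_exp n t = (if t > 0 then inverse t ^ n * exp (- inverse t) else 0)"

lemma bump_exp_0_bounds: "0 \<le> bump_exp 0 t" "bump_exp 0 t < 1" "bump_exp 0 t > 0 \<longleftrightarrow> t > 0"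
  by (auto simp: bump_exp_def)

lemma bump_exp_tendsto_0: "((\<lambda>t. bump_exp n t) \<longlongrightarrow> 0) (at_right 0)"
proof -
  have "((\<lambda>s::real. s ^ n / exp s) \<longlongrightarrow> 0) at_top" by (rule tendsto_power_div_exp_0)
  then have "((\<lambda>t::real. inverse t ^ n / exp (inverse t)) \<longlongrightarrow> 0) (at_right 0)"
    by (rule filterlim_compose[OF _ filterlim_inverse_at_top_right])
  then show ?thesis
    by (rule Lim_transform_eventually)
       (auto simp: bump_exp_def eventually_at_filter exp_minus divide_inverse)
qed

text \<open>The powers of \<open>inverse t\<close> belong to the family in order to close it under
  differentiation, up to linear combinations. Smoothness then follows by induction on the order,
  with \<open>n\<close> arbitrary.\<close>

lemma bump_exp_has_derivative:
  "(bump_exp n has_real_derivative (bump_exp (n + 2) t - n * bump_exp (n + 1) t)) (at t)"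
proof -
  consider "t > 0" | "t < 0" | "t = 0" by linarith
  then show ?thesis
  proof cases
    case 1
    have "((\<lambda>t. inverse t ^ n * exp (- inverse t)) has_real_derivative
        (inverse t ^ n * (exp (- inverse t) * (inverse t * inverse t)) +
          real n * inverse t ^ (n - 1) * (- (inverse t * inverse t)) * exp (- inverse t))) (at t)"
      using 1 by (auto intro!: derivative_eq_intros)
    also have "inverse t ^ n * (exp (- inverse t) * (inverse t * inverse t)) +
          real n * inverse t ^ (n - 1) * (- (inverse t * inverse t)) * exp (- inverse t) =
        bump_exp (n + 2) t - n * bump_exp (n + 1) t"
      using 1 by (cases n) (simp_all add: bump_exp_def algebra_simps)
    finally have "((\<lambda>t. inverse t ^ n * exp (- inverse t)) has_real_derivative
        (bump_exp (n + 2) t - n * bump_exp (n + 1) t)) (at t)" .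
    then show ?thesis
      by (rule has_field_derivative_transform_within_open[where S="{0<..}"]) (use 1 in \<open>auto simp: bump_exp_def\<close>)
  next
    case 2
    have "((\<lambda>t. 0) has_real_derivative 0) (at t)" by simp
    then have "(bump_exp n has_real_derivative 0) (at t)"
      by (rule has_field_derivative_transform_within_open[where S="{..<0}"]) (use 2 in \<open>auto simp: bump_exp_def\<close>)
    then show ?thesis using 2 by (simp add: bump_exp_def)
  next
    case 3
    \<comment> \<open>For \<open>h > 0\<close> the difference quotient at 0 is
      \<open>bump_exp (Suc n) h\<close>, which tends to 0; from the left it is constantly 0.\<close>
    have "((\<lambda>h. (bump_exp n (0 + h) - bump_exp n 0) / h) \<longlongrightarrow> 0) (at_right 0)"
      by (rule Lim_transform_eventually[OF bump_exp_tendsto_0[of "Suc n"]])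
        (auto simp: bump_exp_def eventually_at_filter divide_inverse)
    moreover have "((\<lambda>h. (bump_exp n (0 + h) - bump_exp n 0) / h) \<longlongrightarrow> 0) (at_left 0)"
      by (rule Lim_transform_eventually[OF tendsto_const])
        (auto simp: bump_exp_def eventually_at_filter)
    ultimately have "((\<lambda>h. (bump_exp n (0 + h) - bump_exp n 0) / h) \<longlongrightarrow> 0) (at 0)"
      by (simp add: filterlim_split_at)
    then show ?thesis using 3 by (simp add: DERIV_def bump_exp_def)
  qed
qed

lemma Ck_bump_exp_inner: "Ck k (\<lambda>x. bump_exp n (x \<bullet> v + d))"
proof (induction k arbitrary: n)
  case 0
  have "continuous_on UNIV (bump_exp n)"
    using bump_exp_has_derivative DERIV_isCont by (blast intro: continuous_at_imp_continuous_on)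
  then show ?case
    by (auto intro!: continuous_on_compose2[of UNIV "bump_exp n"] continuous_intros)
next
  case (Suc k)
  have d: "((\<lambda>x. bump_exp n (x \<bullet> v + d)) has_derivative
     (\<lambda>h. (h \<bullet> v) * (bump_exp (n + 2) (x \<bullet> v + d) - n * bump_exp (n + 1) (x \<bullet> v + d)))) (at x)" for x
  proof -
    have "((\<lambda>x. x \<bullet> v + d) has_derivative (\<lambda>h. h \<bullet> v)) (at x)"
      by (auto intro!: derivative_eq_intros)
    from has_derivative_compose[OF this bump_exp_has_derivative[of n "x \<bullet> v + d", unfolded has_field_derivative_def]]
    show ?thesis by (simp only: mult.commute)
  qed
  have "Ck k (\<lambda>x. (b \<bullet> v) * (bump_exp (n + 2) (x \<bullet> v + d) + (- real n) * bump_exp (n + 1) (x \<bullet> v + d)))" for b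
    by (intro Ck_add Ck_mult Ck_const Suc)
  then show ?case by (intro Ck_SucI[OF d]) simp
qed

text \<open>A product over the coordinates of two one-sided bumps each. The bound below 1 keeps
  \<open>1 - \<beta>\<close> in the unit interval, so that its powers decrease to 0 wherever \<beta>
  is positive.\<close>

lemma box_bump:
  fixes a b :: "'a::euclidean_space"
  obtains \<beta> :: "'a \<Rightarrow> real" where "smooth \<beta>" "\<And>x. 0 \<le> \<beta> x" "\<And>x. \<beta> x < 1" "\<And>x. \<beta> x > 0 \<longleftrightarrow> x \<in> box a b"
proof -
  define g where "g i x = bump_exp 0 (x \<bullet> i + - (a \<bullet> i)) * bump_exp 0 (x \<bullet> (- i) + b \<bullet> i)" for i x :: 'a
  define \<beta> where "\<beta> x = (\<Prod>i\<in>Basis. g i x)" for x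
  have g: "0 \<le> g i x" "g i x < 1" "g i x > 0 \<longleftrightarrow> a \<bullet> i < x \<bullet> i \<and> x \<bullet> i < b \<bullet> i" for i x
  proof -
    show "0 \<le> g i x" unfolding g_def by (intro mult_nonneg_nonneg bump_exp_0_bounds)
    show "g i x < 1" unfolding g_def
      using mult_strict_mono[OF bump_exp_0_bounds(2) bump_exp_0_bounds(2), of _ _] bump_exp_0_bounds(1)
      by (metis less_numeral_extra(1) mult_1 mult_strict_mono)
    show "g i x > 0 \<longleftrightarrow> a \<bullet> i < x \<bullet> i \<and> x \<bullet> i < b \<bullet> i" unfolding g_def
      using bump_exp_0_bounds(1)[of "x \<bullet> i + - (a \<bullet> i)"] bump_exp_0_bounds(1)[of "x \<bullet> (- i) + b \<bullet> i"]
        bump_exp_0_bounds(3)[of "x \<bullet> i + - (a \<bullet> i)"] bump_exp_0_bounds(3)[of "x \<bullet> (- i) + b \<bullet> i"]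
      by (auto simp: zero_less_mult_iff)
  qed
  show ?thesis
  proof
    show "smooth \<beta>" unfolding \<beta>_def g_def
      by (intro smooth_prod smooth_mult) (simp_all only: smooth_def Ck_bump_exp_inner simp_thms)
    show "0 \<le> \<beta> x" for x unfolding \<beta>_def by (intro prod_nonneg g)
    show "\<beta> x < 1" for x
    proof -
      obtain i :: 'a where i: "i \<in> Basis" using nonempty_Basis by blast
      have "\<beta> x = g i x * (\<Prod>j\<in>Basis - {i}. g j x)" unfolding \<beta>_def using i by (simp add: prod.remove)
      also have "\<dots> \<le> g i x * 1" by (intro mult_left_mono prod_le_1 g conjI less_imp_le)
      finally show ?thesis using g(2)[of i x] by simp
    qed
    show "\<beta> x > 0 \<longleftrightarrow> x \<in> box a b" for x
    proof
      assume p: "\<beta> x > 0"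
      have "g i x \<noteq> 0" if "i \<in> Basis" for i
        using p that unfolding \<beta>_def by (metis finite_Basis less_numeral_extra(3) prod_zero)
      then show "x \<in> box a b" using g unfolding mem_box by (metis order_le_less)
    next
      assume "x \<in> box a b"
      then show "\<beta> x > 0" unfolding \<beta>_def mem_box by (intro prod_pos) (use g in blast)
    qed
  qed
qed

text \<open>The set is a union of countably many boxes with closures in \<open>W\<close>, each with
  its bump. In \<open>1 - (\<Prod>k<n. (1 - \<beta> k x) ^ n)\<close> the index \<open>n\<close>
  acts twice: the product ranges over finitely many boxes, which keeps the support compact, while
  the exponent drives a factor to 0 as soon as one bump is positive at \<open>x\<close>.\<close>

lemma open_indicator_limit:
  fixes W :: "'a::euclidean_space set"
  assumes W: "open W"
  obtains \<psi> :: "nat \<Rightarrow> 'a \<Rightarrow> real" where "\<And>n. \<psi> n \<in> test_functions W"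
    "\<And>n x. 0 \<le> \<psi> n x" "\<And>n x. \<psi> n x \<le> 1" "\<And>x. (\<lambda>n. \<psi> n x) \<longlonglongrightarrow> indicator W x"
proof (cases "W = {}")
  case True
  show ?thesis
    by (rule that[of "\<lambda>_ _. 0"]) (auto simp: True test_functions_def smooth_const)
next
  case False
  define F where "F = {box a b | a b. cbox a b \<subseteq> W}"
  have opF: "open S" if "S \<in> F" for S using that by (auto simp: F_def open_box)
  have UF: "\<Union>F = W"
  proof
    show "\<Union>F \<subseteq> W" unfolding F_def using box_subset_cbox by blast
    show "W \<subseteq> \<Union>F"
    proof
      fix x assume "x \<in> W"
      then obtain a b where "cbox a b \<subseteq> W" "x \<in> box a b"
        using open_contains_cbox[OF W] by metis
      then show "x \<in> \<Union>F" unfolding F_def by blast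
    qed
  qed
  obtain F' where F': "F' \<subseteq> F" "countable F'" "\<Union>F' = W"
    using Lindelof[of F] opF UF by metis
  have ne: "F' \<noteq> {}" using F'(3) False by auto
  have "\<exists>a b. from_nat_into F' k = box a b \<and> cbox a b \<subseteq> W" for k
    using from_nat_into[OF ne, of k] F'(1) by (auto simp: F_def)
  then obtain a b where ab: "\<And>k. from_nat_into F' k = box (a k) (b k)" "\<And>k. cbox (a k) (b k) \<subseteq> W" by metis
  have "\<forall>k. \<exists>\<beta>. smooth \<beta> \<and> (\<forall>x. 0 \<le> \<beta> x) \<and> (\<forall>x. \<beta> x < 1) \<and> (\<forall>x. \<beta> x > 0 \<longleftrightarrow> x \<in> box (a k) (b k))"
    using box_bump by metis
  then obtain \<beta> where \<beta>: "\<And>k. smooth (\<beta> k)" "\<And>k x. 0 \<le> \<beta> k x" "\<And>k x. \<beta> k x < 1"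
    "\<And>k x. \<beta> k x > 0 \<longleftrightarrow> x \<in> box (a k) (b k)" by metis
  define \<psi> where "\<psi> n x = 1 - (\<Prod>k<n. (1 - \<beta> k x) ^ n)" for n x
  have f: "0 \<le> (1 - \<beta> k x) ^ n" "(1 - \<beta> k x) ^ n \<le> 1" for k n x
    using \<beta>(2,3)[of k x] by (auto intro!: power_le_one simp: less_imp_le)
  show ?thesis
  proof
    fix n
    show "\<psi> n \<in> test_functions W" unfolding test_functions_def
    proof (intro CollectI conjI)
      show "smooth (\<psi> n)" unfolding \<psi>_def
        by (intro smooth_diff smooth_const smooth_prod smooth_power \<beta>)
      have "{x. \<psi> n x \<noteq> 0} \<subseteq> (\<Union>k<n. cbox (a k) (b k))"
      proof
        fix x assume "x \<in> {x. \<psi> n x \<noteq> 0}"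
        then have "(\<Prod>k<n. (1 - \<beta> k x) ^ n) \<noteq> 1" by (simp add: \<psi>_def)
        moreover have "(\<Prod>k<n. (1 - \<beta> k x) ^ n) = 1" if "\<forall>k<n. \<beta> k x = 0"
          using that by (intro prod.neutral) simp
        ultimately have "\<not> (\<forall>k<n. \<beta> k x = 0)" by blast
        then obtain k where "k < n" "\<beta> k x \<noteq> 0" by blast
        then show "x \<in> (\<Union>k<n. cbox (a k) (b k))"
          using \<beta>(2,4)[of k x] box_subset_cbox by (metis UN_I lessThan_iff order_le_less subsetD)
      qed
      moreover have c: "compact (\<Union>k<n. cbox (a k) (b k))" by (intro compact_UN) auto
      ultimately have s: "closure {x. \<psi> n x \<noteq> 0} \<subseteq> (\<Union>k<n. cbox (a k) (b k))"
        by (simp add: closure_minimal compact_imp_closed)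
      then show "compact (closure {x. \<psi> n x \<noteq> 0})"
        by (metis c closed_closure compact_Int_closed inf.absorb_iff2)
      show "closure {x. \<psi> n x \<noteq> 0} \<subseteq> W" using s ab(2) by blast
    qed
    fix x
    show "0 \<le> \<psi> n x" "\<psi> n x \<le> 1" unfolding \<psi>_def
      using prod_le_1[of "{..<n}" "\<lambda>k. (1 - \<beta> k x) ^ n"] prod_nonneg[of "{..<n}" "\<lambda>k. (1 - \<beta> k x) ^ n"] f
      by auto
  next
    fix x
    show "(\<lambda>n. \<psi> n x) \<longlonglongrightarrow> indicator W x"
    proof (cases "x \<in> W")
      case True
      then obtain S where "S \<in> F'" "x \<in> S" using F'(3) by auto
      then obtain k where k: "x \<in> box (a k) (b k)" using ab(1) from_nat_into_surj[OF F'(2)] by metis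
      have p1: "(\<lambda>n. (1 - \<beta> k x) ^ n) \<longlonglongrightarrow> 0"
        using \<beta>(2,3)[of k x] \<beta>(4)[of k x] k by (intro LIMSEQ_power_zero) auto
      have p2: "\<forall>\<^sub>F n in sequentially. (\<Prod>j<n. (1 - \<beta> j x) ^ n) \<le> (1 - \<beta> k x) ^ n"
      proof (intro eventually_sequentiallyI[of "Suc k"])
        fix n assume "Suc k \<le> n"
        then have "(\<Prod>j<n. (1 - \<beta> j x) ^ n) = (1 - \<beta> k x) ^ n * (\<Prod>j\<in>{..<n} - {k}. (1 - \<beta> j x) ^ n)"
          by (subst prod.remove[of _ k]) auto
        also have "\<dots> \<le> (1 - \<beta> k x) ^ n * 1" using f by (intro mult_left_mono prod_le_1) auto
        finally show "(\<Prod>j<n. (1 - \<beta> j x) ^ n) \<le> (1 - \<beta> k x) ^ n" by simp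
      qed
      have "(\<lambda>n. (\<Prod>j<n. (1 - \<beta> j x) ^ n)) \<longlonglongrightarrow> 0"
        by (rule tendsto_sandwich[OF _ p2 tendsto_const p1]) (intro always_eventually allI prod_nonneg f)
      from tendsto_diff[OF tendsto_const this, of 1] show ?thesis using True by (simp add: \<psi>_def)
    next
      case False
      have "\<beta> k x = 0" for k
        using \<beta>(2,4)[of k x] ab(2)[of k] False box_subset_cbox[of "a k" "b k"] by fastforce
      then show ?thesis using False by (simp add: \<psi>_def)
    qed
  qed
qed

section \<open>Bounds, differences and translates of test functions\<close>

lemma test_functionsD:
  assumes "\<psi> \<in> test_functions W"
  shows "smooth \<psi>" "continuous_on UNIV \<psi>" "\<psi> \<in> borel_measurable borel"
    "compact (closure {x. \<psi> x \<noteq> 0})" "closure {x. \<psi> x \<noteq> 0} \<subseteq> W"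
  using assms smooth_continuous[of \<psi>]
  by (auto simp: test_functions_def borel_measurable_continuous_onI)

lemma test_functions_zero: "\<psi> \<in> test_functions W \<Longrightarrow> x \<notin> W \<Longrightarrow> \<psi> x = 0"
  using test_functionsD(5)[of \<psi> W] closure_subset[of "{x. \<psi> x \<noteq> 0}"] by blast

lemma test_functions_mono: "W \<subseteq> V \<Longrightarrow> test_functions W \<subseteq> test_functions V"
  by (auto simp: test_functions_def)

lemma test_functions_diff:
  assumes "\<psi> \<in> test_functions W" "\<xi> \<in> test_functions W"
  shows "(\<lambda>x. \<psi> x - \<xi> x) \<in> test_functions W"
proof -
  let ?K = "closure {x. \<psi> x \<noteq> 0} \<union> closure {x. \<xi> x \<noteq> 0}"
  have "{x. \<psi> x - \<xi> x \<noteq> 0} \<subseteq> {x. \<psi> x \<noteq> 0} \<union> {x. \<xi> x \<noteq> 0}" by auto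
  from closure_mono[OF this] have s: "closure {x. \<psi> x - \<xi> x \<noteq> 0} \<subseteq> ?K" by (simp only: closure_Un)
  have c: "compact ?K" by (intro compact_Un test_functionsD(4)[OF assms(1)] test_functionsD(4)[OF assms(2)])
  have "compact (closure {x. \<psi> x - \<xi> x \<noteq> 0})"
    using compact_Int_closed[OF c closed_closure, of "{x. \<psi> x - \<xi> x \<noteq> 0}"] s by (simp only: Int_absorb1)
  moreover have "?K \<subseteq> W" by (intro Un_least test_functionsD(5)[OF assms(1)] test_functionsD(5)[OF assms(2)])
  ultimately show ?thesis
    using s smooth_diff[OF test_functionsD(1)[OF assms(1)] test_functionsD(1)[OF assms(2)]]
    unfolding test_functions_def by blast
qed

lemma continuous_compact_support_bounded:
  fixes f :: "'a::euclidean_space \<Rightarrow> 'b::real_normed_vector"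
  assumes "continuous_on UNIV f" "compact K" "\<And>x. x \<notin> K \<Longrightarrow> f x = 0"
  obtains B where "0 < B" "\<And>x. norm (f x) \<le> B"
proof -
  have "compact (f ` K)" using assms by (metis compact_continuous_image continuous_on_subset subset_UNIV)
  then obtain B where B: "0 < B" "\<And>y. y \<in> f ` K \<Longrightarrow> norm y \<le> B"
    using compact_imp_bounded bounded_pos by metis
  show ?thesis
    by (rule that[OF B(1)]) (metis B assms(3) imageI less_imp_le norm_zero)
qed

lemma test_functions_bounded:
  assumes "\<psi> \<in> test_functions W"
  obtains B where "0 < B" "\<And>x. \<bar>\<psi> x\<bar> \<le> B"
proof -
  have "\<psi> x = 0" if "x \<notin> closure {x. \<psi> x \<noteq> 0}" for x
    using that closure_subset[of "{x. \<psi> x \<noteq> 0}"] by blast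
  from continuous_compact_support_bounded[OF test_functionsD(2,4)[OF assms] this] that
  show ?thesis by (metis real_norm_def)
qed

lemma gradient_zero_outside:
  assumes "smooth \<psi>" "x \<notin> closure {x. \<psi> x \<noteq> 0}"
  shows "gradient \<psi> x = 0"
proof -
  have "((\<lambda>x. 0) has_derivative (\<lambda>h. 0)) (at x)" by simp
  moreover have "open (- closure {x. \<psi> x \<noteq> 0})" "x \<in> - closure {x. \<psi> x \<noteq> 0}" using assms by auto
  ultimately have "(\<psi> has_derivative (\<lambda>h. 0)) (at x)"
  proof (rule has_derivative_transform_within_open)
    fix y assume "y \<in> - closure {x. \<psi> x \<noteq> 0}"
    then show "0 = \<psi> y" using closure_subset[of "{x. \<psi> x \<noteq> 0}"] by auto
  qed
  from has_derivative_unique[OF this smooth_has_derivative_gradient[OF assms(1)]]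
  have "gradient \<psi> x \<bullet> gradient \<psi> x = 0" by (metis (mono_tags))
  then show ?thesis by simp
qed

lemma test_functions_gradient_bounded:
  assumes "\<psi> \<in> test_functions W"
  obtains B where "0 < B" "\<And>x. norm (gradient \<psi> x) \<le> B"
proof -
  note \<psi> = test_functionsD[OF assms]
  have "\<exists>B. 0 < B \<and> (\<forall>x. norm (gradient \<psi> x) \<le> B)"
    using continuous_compact_support_bounded[OF smooth_gradient_continuous[OF \<psi>(1)] \<psi>(4)
        gradient_zero_outside[OF \<psi>(1)]] by metis
  then show ?thesis using that by metis
qed

lemma test_functions_translate:
  assumes \<psi>: "\<psi> \<in> test_functions U" and sub: "\<And>y. y \<in> U \<Longrightarrow> y - a \<in> W"
  shows "(\<lambda>x. \<psi> (x + a)) \<in> test_functions W"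
proof -
  have e: "{x. \<psi> (x + a) \<noteq> 0} = (\<lambda>y. - a + y) ` {x. \<psi> x \<noteq> 0}"
    by (auto simp: image_iff) (metis add.commute add_diff_cancel uminus_add_conv_diff)
  have c: "closure {x. \<psi> (x + a) \<noteq> 0} = (\<lambda>y. - a + y) ` closure {x. \<psi> x \<noteq> 0}"
    unfolding e by (rule closure_translation)
  show ?thesis unfolding test_functions_def
  proof (intro CollectI conjI)
    show "smooth (\<lambda>x. \<psi> (x + a))" by (rule smooth_translate[OF test_functionsD(1)[OF \<psi>]])
    show "compact (closure {x. \<psi> (x + a) \<noteq> 0})"
      unfolding c by (rule compact_translation[OF test_functionsD(4)[OF \<psi>]])
    show "closure {x. \<psi> (x + a) \<noteq> 0} \<subseteq> W"
      unfolding c using test_functionsD(5)[OF \<psi>] sub by (auto simp: uminus_add_conv_diff)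
  qed
qed

lemma integrable_bounded_scaleR:
  fixes f :: "'a \<Rightarrow> 'b::{banach,second_countable_topology}" and \<psi> :: "'a \<Rightarrow> real"
  assumes "integrable M f" "\<psi> \<in> borel_measurable M" "\<And>x. \<bar>\<psi> x\<bar> \<le> B"
  shows "integrable M (\<lambda>x. \<psi> x *\<^sub>R f x)"
proof (rule Bochner_Integration.integrable_bound)
  show "integrable M (\<lambda>x. B * norm (f x))" using assms by simp
  show "AE x in M. norm (\<psi> x *\<^sub>R f x) \<le> norm (B * norm (f x))"
    using assms(3) by (intro AE_I2) (auto simp: abs_mult intro!: mult_right_mono order_trans[OF _ abs_ge_self])
qed (use assms in measurable)

lemma represents_borel_measurable:
  "represents l f \<mu> \<Longrightarrow> \<psi> \<in> borel_measurable borel \<Longrightarrow> \<psi> \<in> borel_measurable l"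
  using measurable_cong_sets[of l borel] by (auto simp: represents_def)

lemma represents_vm_integral_bounded:
  fixes \<mu> :: "'a::euclidean_space set \<Rightarrow> 'b::euclidean_space"
  assumes r: "represents l f \<mu>" and \<psi>: "\<psi> \<in> borel_measurable borel" "\<And>x. \<bar>\<psi> x\<bar> \<le> B"
  shows "vm_integral \<mu> \<psi> = (LINT x|l. \<psi> x *\<^sub>R f x)" "integrable l (\<lambda>x. \<psi> x *\<^sub>R f x)"
proof -
  have "integrable l f" using r by (simp add: represents_def)
  from integrable_bounded_scaleR[OF this represents_borel_measurable[OF r \<psi>(1)] \<psi>(2)]
  show "integrable l (\<lambda>x. \<psi> x *\<^sub>R f x)" .
  then show "vm_integral \<mu> \<psi> = (LINT x|l. \<psi> x *\<^sub>R f x)"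
    by (rule represents_vm_integral[OF r \<psi>(1)])
qed

section \<open>Measures and L1 norms are determined by test functions\<close>

lemma additive_borel_eqI_open:
  fixes \<mu> \<nu> :: "'a::topological_space set \<Rightarrow> 'b::real_normed_vector"
  assumes \<mu>: "additive_borel \<mu>" and \<nu>: "additive_borel \<nu>" and op: "\<And>U. open U \<Longrightarrow> \<mu> U = \<nu> U"
    and A: "A \<in> sets borel"
  shows "\<mu> A = \<nu> A"
proof -
  have "Int_stable {U::'a set. open U}" by (auto simp: Int_stable_def)
  moreover have "{U::'a set. open U} \<subseteq> Pow UNIV" by simp
  moreover have "A \<in> sigma_sets UNIV {U. open U}" using A by (simp add: sets_borel)
  ultimately show ?thesis
  proof (induction rule: sigma_sets_induct_disjoint)
    case (basic A) then show ?case using op by simp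
  next
    case empty then show ?case using additive_borel_empty \<mu> \<nu> by metis
  next
    case (compl A)
    then have "A \<in> sets borel" by (simp add: sets_borel)
    then show ?case using additive_borel_Diff[OF \<mu>, of UNIV A] additive_borel_Diff[OF \<nu>, of UNIV A]
        compl(2) op[of UNIV] by simp
  next
    case (union A)
    then have "\<And>i. A i \<in> sets borel" by (auto simp: sets_borel)
    from additive_borelD[OF \<mu> this union(1)] additive_borelD[OF \<nu> this union(1)] union(3)
    show ?case by (simp add: sums_unique2)
  qed
qed

lemma represents_additive:
  fixes \<mu> :: "'a::euclidean_space set \<Rightarrow> 'b::euclidean_space"
  assumes r: "represents l f \<mu>"
  shows "additive_borel \<mu>"
  unfolding additive_borel_def
proof (intro allI impI)
  fix A :: "nat \<Rightarrow> 'a set" assume A: "range A \<subseteq> sets borel" "disjoint_family A"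
  have s: "sets l = sets borel" and f: "integrable l f" using r by (auto simp: represents_def)
  have Ab: "A i \<in> sets borel" for i using A by auto
  have UA: "(\<Union>i. A i) \<in> sets borel" using A(1) by (rule sets.countable_UN)
  have "(\<lambda>i. LINT x:A i|l. f x) sums (LINT x:(\<Union>i. A i)|l. f x)"
    unfolding sums_def
  proof -
    have "(\<lambda>n. LINT x:(\<Union>i<n. A i)|l. f x) \<longlonglongrightarrow> (LINT x:(\<Union>i. A i)|l. f x)"
      unfolding set_lebesgue_integral_def
    proof (rule integral_dominated_convergence[where w="\<lambda>x. norm (f x)"])
      show "(\<lambda>x. indicat_real (\<Union>i. A i) x *\<^sub>R f x) \<in> borel_measurable l"
        using f UA s by (intro borel_measurable_scaleR borel_measurable_indicator) auto
      show "(\<lambda>x. indicat_real (\<Union>i<n. A i) x *\<^sub>R f x) \<in> borel_measurable l" for n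
        using f Ab s by (intro borel_measurable_scaleR borel_measurable_indicator) auto
      show "AE x in l. (\<lambda>n. indicat_real (\<Union>i<n. A i) x *\<^sub>R f x) \<longlonglongrightarrow> indicat_real (\<Union>i. A i) x *\<^sub>R f x"
      proof (intro AE_I2)
        fix x
        show "(\<lambda>n. indicat_real (\<Union>i<n. A i) x *\<^sub>R f x) \<longlonglongrightarrow> indicat_real (\<Union>i. A i) x *\<^sub>R f x"
          by (intro tendsto_scaleR tendsto_const LIMSEQ_indicator_UN)
      qed
    qed (use f in \<open>auto split: split_indicator\<close>)
    moreover have "(LINT x:(\<Union>i<n. A i)|l. f x) = (\<Sum>i<n. LINT x:A i|l. f x)" for n
    proof (rule set_integral_finite_Union)
      show "disjoint_family_on A {..<n}" using A(2) by (rule disjoint_family_on_mono[rotated]) simp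
      show "set_integrable l (A i) f" for i
        unfolding set_integrable_def using f Ab s by (intro integrable_mult_indicator) auto
    qed (use Ab s in auto)
    ultimately show "(\<lambda>n. \<Sum>i<n. LINT x:A i|l. f x) \<longlonglongrightarrow> (LINT x:(\<Union>i. A i)|l. f x)" by simp
  qed
  then show "(\<lambda>i. \<mu> (A i)) sums \<mu> (\<Union>i. A i)"
    using r Ab UA by (simp add: represents_def)
qed

lemma open_measure_limit:
  fixes \<mu> :: "'a::euclidean_space set \<Rightarrow> 'b::euclidean_space"
  assumes r: "represents l f \<mu>" and U: "open U"
    and \<psi>: "\<And>n. \<psi> n \<in> borel_measurable borel" "\<And>n x. \<bar>\<psi> n x\<bar> \<le> 1" "\<And>x. (\<lambda>n. \<psi> n x) \<longlonglongrightarrow> indicator U x"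
  shows "(\<lambda>n. LINT x|l. \<psi> n x *\<^sub>R f x) \<longlonglongrightarrow> \<mu> U"
proof -
  have s: "sets l = sets borel" and f: "integrable l f" using r by (auto simp: represents_def)
  have "(\<lambda>n. LINT x|l. \<psi> n x *\<^sub>R f x) \<longlonglongrightarrow> (LINT x|l. indicator U x *\<^sub>R f x)"
  proof (rule integral_dominated_convergence[where w="\<lambda>x. norm (f x)"])
    show "(\<lambda>x. indicat_real U x *\<^sub>R f x) \<in> borel_measurable l"
      using f U s by (intro borel_measurable_scaleR borel_measurable_indicator) auto
    show "(\<lambda>x. \<psi> n x *\<^sub>R f x) \<in> borel_measurable l" for n
      using f represents_borel_measurable[OF r \<psi>(1)] by (intro borel_measurable_scaleR) auto
    show "AE x in l. (\<lambda>n. \<psi> n x *\<^sub>R f x) \<longlonglongrightarrow> indicat_real U x *\<^sub>R f x"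
      by (intro AE_I2 tendsto_scaleR tendsto_const \<psi>(3))
    show "AE x in l. norm (\<psi> n x *\<^sub>R f x) \<le> norm (f x)" for n
      using \<psi>(2) by (intro AE_I2) (simp add: mult_left_le_one_le)
  qed (use f in simp)
  then show ?thesis using r U by (simp add: represents_def set_lebesgue_integral_def)
qed

text \<open>The value on an open subset of \<open>W\<close> is a limit of integrals of test
  functions of that subset. Equality on open sets extends to Borel sets, since open sets form an
  intersection-stable generator.\<close>

theorem test_functions_determine_measure:
  fixes \<mu> \<nu> :: "'a::euclidean_space set \<Rightarrow> 'b::euclidean_space"
  assumes r: "represents l f \<mu>" and r': "represents l' f' \<nu>" and W: "open W"
    and eq: "\<And>\<psi>. \<psi> \<in> test_functions W \<Longrightarrow> (LINT x|l. \<psi> x *\<^sub>R f x) = (LINT x|l'. \<psi> x *\<^sub>R f' x)"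
    and A: "A \<in> sets borel"
  shows "\<mu> (A \<inter> W) = \<nu> (A \<inter> W)"
proof -
  have op: "\<mu> (U \<inter> W) = \<nu> (U \<inter> W)" if "open U" for U
  proof -
    have o: "open (U \<inter> W)" using that W by blast
    obtain \<psi> where \<psi>: "\<And>n. \<psi> n \<in> test_functions (U \<inter> W)"
      "\<And>n x. 0 \<le> \<psi> n x" "\<And>n x. \<psi> n x \<le> 1" "\<And>x. (\<lambda>n::nat. \<psi> n x) \<longlonglongrightarrow> indicator (U \<inter> W) x"
      using open_indicator_limit[OF o] by metis
    have b: "\<bar>\<psi> n x\<bar> \<le> 1" for n x using \<psi>(2,3)[of n x] by simp
    have "\<psi> n \<in> test_functions W" for n by (rule subsetD[OF test_functions_mono \<psi>(1)]) auto
    then have "(LINT x|l. \<psi> n x *\<^sub>R f x) = (LINT x|l'. \<psi> n x *\<^sub>R f' x)" for n by (rule eq)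
    then show ?thesis
      using open_measure_limit[OF r o test_functionsD(3)[OF \<psi>(1)] b \<psi>(4)]
        open_measure_limit[OF r' o test_functionsD(3)[OF \<psi>(1)] b \<psi>(4)] LIMSEQ_unique by simp
  qed
  have ad: "additive_borel (\<lambda>A. \<mu> (A \<inter> W))" "additive_borel (\<lambda>A. \<nu> (A \<inter> W))"
    by (intro additive_borel_Int represents_additive[OF r] represents_additive[OF r'] borel_open W)+
  show ?thesis by (rule additive_borel_eqI_open[OF ad op A])
qed

lemma outer_approx:
  fixes M :: "'a::euclidean_space measure"
  assumes "finite_measure M" "sets M = sets borel" "B \<in> sets borel" "0 < e"
  obtains U where "open U" "B \<subseteq> U" "measure M (U - B) < e"
proof -
  interpret finite_measure M by fact
  have "emeasure M B < emeasure M B + ennreal e"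
    using assms(4) by (simp add: emeasure_eq_measure ennreal_plus[symmetric] ennreal_less_iff del: ennreal_plus)
  also have "emeasure M B = (INF U \<in> {U. B \<subseteq> U \<and> open U}. emeasure M U)"
    using assms by (intro outer_regular) (auto simp: emeasure_finite)
  finally have "(INF U \<in> {U. B \<subseteq> U \<and> open U}. emeasure M U) < emeasure M B + ennreal e"
    using outer_regular[OF assms(2) _ assms(3)] by (simp add: emeasure_finite)
  then obtain U where U: "B \<subseteq> U" "open U" "emeasure M U < emeasure M B + ennreal e"
    by (auto simp: INF_less_iff)
  have "measure M (U - B) = measure M U - measure M B"
    using U assms by (intro finite_measure_Diff) auto
  moreover have "measure M U < measure M B + e"
    using U(3) assms(4) by (simp add: emeasure_eq_measure ennreal_plus[symmetric] ennreal_less_iff del: ennreal_plus)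
  ultimately show ?thesis using that[of U] U by simp
qed

text \<open>The sign of \<open>v\<close> on \<open>W\<close> is imitated by test functions. Outer
  regularity of the finite measure \<open>\<bar>v\<bar> dx\<close> encloses the sets of positivity
  and negativity in open sets of nearly the same mass, and indicators of open sets are limits of
  test functions.\<close>

theorem L1_norm_dual_test_functions:
  fixes v :: "'a::euclidean_space \<Rightarrow> real"
  assumes v: "integrable lborel v" and W: "open W"
    and dual: "\<And>\<psi>. \<psi> \<in> test_functions W \<Longrightarrow> (\<And>x. \<bar>\<psi> x\<bar> \<le> 1) \<Longrightarrow> (LINT x|lborel. \<psi> x * v x) \<le> c"
  shows "(LINT x|lborel. indicator W x * \<bar>v x\<bar>) \<le> c"
proof (rule field_le_epsilon)
  fix e :: real assume e: "0 < e"
  have vm[measurable]: "v \<in> borel_measurable borel" using v by simp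
  have Wb[measurable]: "W \<in> sets borel" using W by simp
  define N where "N = density lborel (\<lambda>x. ennreal \<bar>v x\<bar>)"
  have av: "integrable lborel (\<lambda>x. \<bar>v x\<bar>)" using v by simp
  have em: "emeasure N A = ennreal (LINT x|lborel. indicator A x * \<bar>v x\<bar>)"
    and ii: "integrable lborel (\<lambda>x. indicator A x * \<bar>v x\<bar>)" if A: "A \<in> sets borel" for A
  proof -
    show i: "integrable lborel (\<lambda>x. indicator A x * \<bar>v x\<bar>)"
      using integrable_mult_indicator[OF _ av, of A] A by simp
    have "emeasure N A = (\<integral>\<^sup>+x. ennreal \<bar>v x\<bar> * indicator A x \<partial>lborel)"
      unfolding N_def using A by (intro emeasure_density) auto
    also have "\<dots> = (\<integral>\<^sup>+x. ennreal (indicator A x * \<bar>v x\<bar>) \<partial>lborel)"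
      by (intro nn_integral_cong) (auto split: split_indicator)
    also have "\<dots> = ennreal (LINT x|lborel. indicator A x * \<bar>v x\<bar>)"
      using i by (intro nn_integral_eq_integral) auto
    finally show "emeasure N A = ennreal (LINT x|lborel. indicator A x * \<bar>v x\<bar>)" .
  qed
  have sN: "sets N = sets borel" by (simp add: N_def)
  have fN: "finite_measure N"
    using em[of UNIV] by (intro finite_measureI) (simp add: N_def)
  define P where "P = {x\<in>W. v x > 0}"
  define Q where "Q = {x\<in>W. v x < 0}"
  have [measurable]: "P \<in> sets borel" "Q \<in> sets borel" unfolding P_def Q_def by measurable
  obtain U1 where U1: "open U1" "P \<subseteq> U1" "measure N (U1 - P) < e / 2"
    using outer_approx[OF fN sN, of P "e / 2"] e by auto
  obtain U2 where U2: "open U2" "Q \<subseteq> U2" "measure N (U2 - Q) < e / 2"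
    using outer_approx[OF fN sN, of Q "e / 2"] e by auto
  have [measurable]: "U1 \<in> sets borel" "U2 \<in> sets borel" using U1 U2 by auto
  have mN: "measure N A = (LINT x|lborel. indicator A x * \<bar>v x\<bar>)" if "A \<in> sets borel" for A
    using em[OF that] by (simp add: measure_def)
  obtain \<psi> where \<psi>: "\<And>n. \<psi> n \<in> test_functions (U1 \<inter> W)"
    "\<And>n x. 0 \<le> \<psi> n x" "\<And>n x. \<psi> n x \<le> 1" "\<And>x. (\<lambda>n::nat. \<psi> n x) \<longlonglongrightarrow> indicator (U1 \<inter> W) x"
    using open_indicator_limit[OF open_Int[OF U1(1) W]] by metis
  obtain \<xi> where \<xi>: "\<And>n. \<xi> n \<in> test_functions (U2 \<inter> W)"
    "\<And>n x. 0 \<le> \<xi> n x" "\<And>n x. \<xi> n x \<le> 1" "\<And>x. (\<lambda>n::nat. \<xi> n x) \<longlonglongrightarrow> indicator (U2 \<inter> W) x"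
    using open_indicator_limit[OF open_Int[OF U2(1) W]] by metis
  have b: "\<bar>\<psi> n x - \<xi> n x\<bar> \<le> 1" for n x using \<psi>(2,3)[of n x] \<xi>(2,3)[of n x] by linarith
  have m: "\<psi> n \<in> borel_measurable borel" "\<xi> n \<in> borel_measurable borel" for n
    by (rule test_functionsD(3)[OF \<psi>(1)], rule test_functionsD(3)[OF \<xi>(1)])
  have tf: "(\<lambda>x. \<psi> n x - \<xi> n x) \<in> test_functions W" for n
    by (intro test_functions_diff subsetD[OF test_functions_mono \<psi>(1)] subsetD[OF test_functions_mono \<xi>(1)]) auto
  \<comment> \<open>This agrees with the sign of \<open>v\<close> on \<open>W\<close> except where
    the two neighbourhoods reach beyond \<open>P\<close> and \<open>Q\<close>; there it errs by at
    most 1, and these excess sets have small mass.\<close>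
  let ?I = "\<lambda>x. indicator (U1 \<inter> W) x - indicator (U2 \<inter> W) x :: real"
  have lim: "(\<lambda>n. LINT x|lborel. (\<psi> n x - \<xi> n x) * v x) \<longlonglongrightarrow> (LINT x|lborel. ?I x * v x)"
  proof (rule integral_dominated_convergence[where w="\<lambda>x. \<bar>v x\<bar>"])
    show "(\<lambda>x. ?I x * v x) \<in> borel_measurable lborel" by measurable
    show "(\<lambda>x. (\<psi> n x - \<xi> n x) * v x) \<in> borel_measurable lborel" for n using m by measurable
    show "AE x in lborel. (\<lambda>n. (\<psi> n x - \<xi> n x) * v x) \<longlonglongrightarrow> ?I x * v x"
      by (intro AE_I2 tendsto_mult tendsto_diff tendsto_const \<psi>(4) \<xi>(4))
    show "AE x in lborel. norm ((\<psi> n x - \<xi> n x) * v x) \<le> \<bar>v x\<bar>" for n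
      using b[of n] by (intro AE_I2) (simp add: abs_mult mult_left_le_one_le)
  qed (use v in auto)
  have "(LINT x|lborel. ?I x * v x) \<le> c"
    by (rule LIMSEQ_le_const2[OF lim]) (intro exI allI impI dual[OF tf] b)
  moreover have "(LINT x|lborel. indicator W x * \<bar>v x\<bar>) \<le>
     (LINT x|lborel. ?I x * v x + indicator (U1 - P) x * \<bar>v x\<bar> + indicator (U2 - Q) x * \<bar>v x\<bar>)"
  proof (rule integral_mono)
    have iI: "integrable lborel (\<lambda>x. ?I x * v x)"
      by (rule Bochner_Integration.integrable_bound[OF av]) (auto split: split_indicator)
    show "integrable lborel (\<lambda>x. ?I x * v x + indicator (U1 - P) x * \<bar>v x\<bar> + indicator (U2 - Q) x * \<bar>v x\<bar>)"
      by (intro Bochner_Integration.integrable_add iI ii) auto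
    show "integrable lborel (\<lambda>x. indicator W x * \<bar>v x\<bar>)" by (rule ii[OF Wb])
    show "indicator W x * \<bar>v x\<bar> \<le> ?I x * v x + indicator (U1 - P) x * \<bar>v x\<bar> + indicator (U2 - Q) x * \<bar>v x\<bar>" for x
      using U1(2) U2(2) by (cases "v x" "0::real" rule: linorder_cases) (auto simp: P_def Q_def split: split_indicator)
  qed
  moreover have "\<dots> = (LINT x|lborel. ?I x * v x) + measure N (U1 - P) + measure N (U2 - Q)"
  proof -
    have iI: "integrable lborel (\<lambda>x. ?I x * v x)"
      by (rule Bochner_Integration.integrable_bound[OF av]) (auto split: split_indicator)
    show ?thesis using iI ii[of "U1 - P"] ii[of "U2 - Q"] by (simp add: mN)
  qed
  ultimately show "(LINT x|lborel. indicator W x * \<bar>v x\<bar>) \<le> c + e" using U1(3) U2(3) by linarith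
qed

section \<open>Translations of functions with measure derivatives\<close>

lemma integral_lborel_translate:
  fixes f :: "'a::euclidean_space \<Rightarrow> 'b::{banach,second_countable_topology}"
  assumes "f \<in> borel_measurable borel"
  shows "(LINT x|lborel. f (x + a)) = (LINT x|lborel. f x)"
proof -
  have "(LINT x|lborel. f x) = (LINT x|distr lborel borel (\<lambda>x. a + x). f x)"
    by (simp add: lborel_distr_plus)
  also have "\<dots> = (LINT x|lborel. f (a + x))" using assms by (intro integral_distr) auto
  finally show ?thesis by (simp add: add.commute)
qed

lemma integrable_lborel_translate:
  fixes f :: "'a::euclidean_space \<Rightarrow> 'b::{banach,second_countable_topology}"
  assumes "integrable lborel f"
  shows "integrable lborel (\<lambda>x. f (x + a))"
proof -
  have "integrable (distr lborel borel (\<lambda>x. a + x)) f" using assms by (simp add: lborel_distr_plus)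
  then have "integrable lborel (\<lambda>x. f (a + x))"
    using assms by (subst (asm) integrable_distr_eq) auto
  then show ?thesis by (simp add: add.commute)
qed

text \<open>The derivative in \<open>t\<close> of \<open>\<integral> u(x) \<psi>(x - t z) dx\<close> is controlled by the distributional gradient.\<close>

lemma translate_test_has_derivative:
  fixes u \<psi> :: "'a::euclidean_space \<Rightarrow> real"
  assumes u: "integrable lborel u" and \<psi>: "\<psi> \<in> test_functions U"
  shows "((\<lambda>t. LINT x|lborel. \<psi> (x - t *\<^sub>R z) * u x) has_real_derivative
     - (LINT x|lborel. (gradient \<psi> (x - t *\<^sub>R z) \<bullet> z) * u x)) (at t)"
proof -
  note \<psi>s = test_functionsD[OF \<psi>]
  have um[measurable]: "u \<in> borel_measurable borel" using u by simp
  have [measurable]: "\<psi> \<in> borel_measurable borel" by (rule \<psi>s)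
  have gm[measurable]: "gradient \<psi> \<in> borel_measurable borel"
    by (rule borel_measurable_continuous_onI[OF smooth_gradient_continuous[OF \<psi>s(1)]])
  obtain B0 where B0: "\<And>x. \<bar>\<psi> x\<bar> \<le> B0" using test_functions_bounded[OF \<psi>] by metis
  obtain B where B: "0 < B" "\<And>x. norm (gradient \<psi> x) \<le> B" using test_functions_gradient_bounded[OF \<psi>] by metis
  \<comment> \<open>The Lipschitz bound yields the integrable majorant
    \<open>(B * norm z) * \<bar>u x\<bar>\<close> of the difference quotients below.\<close>
  have lip: "\<bar>\<psi> x - \<psi> y\<bar> \<le> B * norm (x - y)" for x y
  proof -
    have "norm (\<psi> x - \<psi> y) \<le> B * norm (x - y)"
    proof (rule differentiable_bound[of UNIV \<psi> "\<lambda>x h. gradient \<psi> x \<bullet> h"])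
      show "(\<psi> has_derivative (\<bullet>) (gradient \<psi> x)) (at x within UNIV)" for x
        using smooth_has_derivative_gradient[OF \<psi>s(1)] by simp
      show "onorm ((\<bullet>) (gradient \<psi> x)) \<le> B" for x
      proof (rule onorm_le)
        fix h show "norm (gradient \<psi> x \<bullet> h) \<le> B * norm h"
          using Cauchy_Schwarz_ineq2[of "gradient \<psi> x" h] mult_right_mono[OF B(2)[of x], of "norm h"] by simp
      qed
    qed auto
    then show ?thesis by simp
  qed
  have i: "integrable lborel (\<lambda>x. \<psi> (x - t *\<^sub>R z) * u x)" for t
    using integrable_bounded_scaleR[OF u _ B0, of "\<lambda>x. x - t *\<^sub>R z" ] by simp
  have D: "((\<lambda>s. \<psi> (x - s *\<^sub>R z)) has_real_derivative - (gradient \<psi> (x - t *\<^sub>R z) \<bullet> z)) (at t)" for x t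
  proof -
    have "((\<lambda>s. x - s *\<^sub>R z) has_derivative (\<lambda>h. - h *\<^sub>R z)) (at t)"
      by (auto intro!: derivative_eq_intros)
    from has_derivative_compose[OF this smooth_has_derivative_gradient[OF \<psi>s(1)]]
    have "((\<lambda>s. \<psi> (x - s *\<^sub>R z)) has_derivative (\<lambda>h. gradient \<psi> (x - t *\<^sub>R z) \<bullet> (- h *\<^sub>R z))) (at t)" .
    also have "(\<lambda>h. gradient \<psi> (x - t *\<^sub>R z) \<bullet> (- h *\<^sub>R z)) = (*) (- (gradient \<psi> (x - t *\<^sub>R z) \<bullet> z))"
      by (auto simp: fun_eq_iff)
    finally show ?thesis by (simp only: has_field_derivative_def)
  qed
  show ?thesis
    unfolding DERIV_def tendsto_at_iff_sequentially comp_def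
  proof (intro allI impI)
    fix X :: "nat \<Rightarrow> real"
    assume X: "\<forall>i. X i \<in> UNIV - {0}" "X \<longlonglongrightarrow> 0"
    define s where "s i x = (\<psi> (x - (t + X i) *\<^sub>R z) - \<psi> (x - t *\<^sub>R z)) / X i * u x" for i x
    have eq: "((LINT x|lborel. \<psi> (x - (t + X i) *\<^sub>R z) * u x) - (LINT x|lborel. \<psi> (x - t *\<^sub>R z) * u x)) / X i
        = (LINT x|lborel. s i x)" for i
    proof -
      have "((LINT x|lborel. \<psi> (x - (t + X i) *\<^sub>R z) * u x) - (LINT x|lborel. \<psi> (x - t *\<^sub>R z) * u x)) / X i
        = (LINT x|lborel. (\<psi> (x - (t + X i) *\<^sub>R z) * u x - \<psi> (x - t *\<^sub>R z) * u x) / X i)"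
        using i[of "t + X i"] i[of t] by simp
      then show ?thesis unfolding s_def by (simp add: left_diff_distrib)
    qed
    have "(\<lambda>i. LINT x|lborel. s i x) \<longlonglongrightarrow> (LINT x|lborel. - (gradient \<psi> (x - t *\<^sub>R z) \<bullet> z) * u x)"
    proof (rule integral_dominated_convergence[where w="\<lambda>x. (B * norm z) * \<bar>u x\<bar>"])
      show "(\<lambda>x. - (gradient \<psi> (x - t *\<^sub>R z) \<bullet> z) * u x) \<in> borel_measurable lborel" by measurable
      show "s i \<in> borel_measurable lborel" for i unfolding s_def by measurable
      show "integrable lborel (\<lambda>x. (B * norm z) * \<bar>u x\<bar>)" using u by simp
      show "AE x in lborel. (\<lambda>i. s i x) \<longlonglongrightarrow> - (gradient \<psi> (x - t *\<^sub>R z) \<bullet> z) * u x"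
      proof (intro AE_I2)
        fix x
        from D[where x=x and t=t, unfolded DERIV_def tendsto_at_iff_sequentially comp_def] X
        have "(\<lambda>i. (\<psi> (x - (t + X i) *\<^sub>R z) - \<psi> (x - t *\<^sub>R z)) / X i) \<longlonglongrightarrow> - (gradient \<psi> (x - t *\<^sub>R z) \<bullet> z)"
          by blast
        then show "(\<lambda>i. s i x) \<longlonglongrightarrow> - (gradient \<psi> (x - t *\<^sub>R z) \<bullet> z) * u x"
          unfolding s_def by (intro tendsto_mult tendsto_const)
      qed
      show "AE x in lborel. norm (s i x) \<le> (B * norm z) * \<bar>u x\<bar>" for i
      proof (intro AE_I2)
        fix x
        have "\<bar>\<psi> (x - (t + X i) *\<^sub>R z) - \<psi> (x - t *\<^sub>R z)\<bar> \<le> B * norm z * \<bar>X i\<bar>"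
          using lip[of "x - (t + X i) *\<^sub>R z" "x - t *\<^sub>R z"] by (simp add: algebra_simps)
        then have "\<bar>(\<psi> (x - (t + X i) *\<^sub>R z) - \<psi> (x - t *\<^sub>R z)) / X i\<bar> \<le> B * norm z"
          using X(1) by (simp add: pos_divide_le_eq)
        then show "norm (s i x) \<le> (B * norm z) * \<bar>u x\<bar>"
          unfolding s_def real_norm_def abs_mult by (rule mult_right_mono) simp
      qed
    qed
    also have "(LINT x|lborel. - (gradient \<psi> (x - t *\<^sub>R z) \<bullet> z) * u x) =
        - (LINT x|lborel. (gradient \<psi> (x - t *\<^sub>R z) \<bullet> z) * u x)" by simp
    finally show "(\<lambda>i. ((LINT x|lborel. \<psi> (x - (t + X i) *\<^sub>R z) * u x) - (LINT x|lborel. \<psi> (x - t *\<^sub>R z) * u x)) / X i)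
       \<longlonglongrightarrow> - (LINT x|lborel. (gradient \<psi> (x - t *\<^sub>R z) \<bullet> z) * u x)" unfolding eq .
  qed
qed

text \<open>By duality the difference is tested against \<psi>, and the translation is moved onto
  \<psi>. The mean value theorem in the translation parameter leaves one derivative, which is an
  integral of a translated test function against the derivative measure. The segment condition keeps
  that translate supported in \<open>W\<close>.\<close>

theorem translation_estimate:
  fixes u :: "'a::euclidean_space \<Rightarrow> real"
  assumes u: "integrable lborel u" and f: "integrable l f"
    and m: "\<And>\<psi>. \<psi> \<in> test_functions W \<Longrightarrow> \<psi> \<in> borel_measurable l"
    and deriv: "\<And>\<psi>. \<psi> \<in> test_functions W \<Longrightarrow>
        (LINT x|lborel. u x *\<^sub>R gradient \<psi> x) = - (LINT x|l. \<psi> x *\<^sub>R f x)"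
    and U: "open U" and seg: "\<And>y t. y \<in> U \<Longrightarrow> 0 \<le> t \<Longrightarrow> t \<le> 1 \<Longrightarrow> y + t *\<^sub>R z \<in> W"
  shows "(LINT x|lborel. indicator U x * \<bar>u (x + z) - u x\<bar>) \<le> norm z * (LINT x|l. norm (f x))"
proof (rule L1_norm_dual_test_functions[OF _ U])
  have um[measurable]: "u \<in> borel_measurable borel" using u by simp
  have uz: "integrable lborel (\<lambda>x. u (x + z))" by (rule integrable_lborel_translate[OF u])
  show "integrable lborel (\<lambda>x. u (x + z) - u x)" using u uz by simp
  fix \<psi> assume \<psi>: "\<psi> \<in> test_functions U" and \<psi>1: "\<And>x. \<bar>\<psi> x\<bar> \<le> 1"
  have [measurable]: "\<psi> \<in> borel_measurable borel" by (rule test_functionsD[OF \<psi>])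
  have sm: "smooth \<psi>" by (rule test_functionsD[OF \<psi>])
  define h where "h t = (LINT x|lborel. \<psi> (x - t *\<^sub>R z) * u x)" for t
  define h' where "h' t = - (LINT x|lborel. (gradient \<psi> (x - t *\<^sub>R z) \<bullet> z) * u x)" for t
  obtain \<xi> where \<xi>: "0 < \<xi>" "\<xi> < 1" "h 1 - h 0 = (1 - 0) * h' \<xi>"
    using MVT2[of 0 1 h h'] translate_test_has_derivative[OF u \<psi>, of z] unfolding h_def h'_def by auto
  have "h' \<xi> \<le> norm z * (LINT x|l. norm (f x))"
  proof -
    \<comment> \<open>Translation by the fraction \<xi> of \<open>z\<close> moves the support along
      the segments into \<open>W\<close>, so \<open>deriv\<close> applies.\<close>
    define \<theta> where "\<theta> x = \<psi> (x + (- \<xi> *\<^sub>R z))" for x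
    have t: "\<theta> \<in> test_functions W" unfolding \<theta>_def
      by (rule test_functions_translate[OF \<psi>]) (use seg[of _ \<xi>] \<xi> in simp)
    have g: "gradient \<theta> x = gradient \<psi> (x - \<xi> *\<^sub>R z)" for x
      unfolding \<theta>_def using gradient_translate[OF sm, of "- \<xi> *\<^sub>R z" x] by simp
    obtain B where B: "\<And>x. norm (gradient \<theta> x) \<le> B" using test_functions_gradient_bounded[OF t] by metis
    have gm: "gradient \<theta> \<in> borel_measurable borel"
      by (rule borel_measurable_continuous_onI[OF smooth_gradient_continuous[OF test_functionsD(1)[OF t]]])
    have ig: "integrable lborel (\<lambda>x. u x *\<^sub>R gradient \<theta> x)"
    proof (rule Bochner_Integration.integrable_bound)
      show "integrable lborel (\<lambda>x. B * \<bar>u x\<bar>)" using u by simp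
      show "AE x in lborel. norm (u x *\<^sub>R gradient \<theta> x) \<le> norm (B * \<bar>u x\<bar>)"
        using B order_trans[OF norm_ge_zero B]
        by (intro AE_I2) (auto simp: abs_mult mult.commute[of B] intro!: mult_left_mono)
    qed (use gm in measurable)
    have "h' \<xi> = - (LINT x|lborel. (u x *\<^sub>R gradient \<theta> x) \<bullet> z)"
      unfolding h'_def g by (simp add: mult.commute)
    also have "\<dots> = - ((LINT x|lborel. u x *\<^sub>R gradient \<theta> x) \<bullet> z)"
      using ig by (subst integral_inner_left) auto
    also have "\<dots> = (LINT x|l. \<theta> x *\<^sub>R f x) \<bullet> z" using deriv[OF t] by simp
    also have "\<dots> \<le> norm (LINT x|l. \<theta> x *\<^sub>R f x) * norm z" by (rule norm_cauchy_schwarz)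
    also have "norm (LINT x|l. \<theta> x *\<^sub>R f x) \<le> (LINT x|l. norm (f x))"
    proof (rule order_trans[OF integral_norm_bound integral_mono])
      have \<theta>1: "\<bar>\<theta> x\<bar> \<le> 1" for x unfolding \<theta>_def by (rule \<psi>1)
      show "integrable l (\<lambda>x. norm (\<theta> x *\<^sub>R f x))"
        by (rule integrable_norm[OF integrable_bounded_scaleR[OF f m[OF t] \<theta>1]])
      show "integrable l (\<lambda>x. norm (f x))" using f by simp
      show "norm (\<theta> x *\<^sub>R f x) \<le> norm (f x)" for x
        using \<theta>1[of x] by (simp add: mult_left_le_one_le)
    qed
    finally show ?thesis by (simp add: mult.commute mult_right_mono)
  qed
  moreover have "(LINT x|lborel. \<psi> x * (u (x + z) - u x)) = h 1 - h 0"
  proof -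
    have "(LINT x|lborel. \<psi> (x - z) * u x) = (LINT x|lborel. \<psi> (x + z - z) * u (x + z))"
      by (rule integral_lborel_translate[symmetric, where f="\<lambda>x. \<psi> (x - z) * u x"]) measurable
    then have "h 1 = (LINT x|lborel. \<psi> x * u (x + z))" by (simp add: h_def)
    moreover have "integrable lborel (\<lambda>x. \<psi> x * u x)" "integrable lborel (\<lambda>x. \<psi> x * u (x + z))"
      using integrable_bounded_scaleR[OF u _ \<psi>1] integrable_bounded_scaleR[OF uz _ \<psi>1] by auto
    ultimately show ?thesis by (simp add: h_def right_diff_distrib)
  qed
  ultimately show "(LINT x|lborel. \<psi> x * (u (x + z) - u x)) \<le> norm z * (LINT x|l. norm (f x))"
    using \<xi> by simp
qed

section \<open>Weak compactness of vector measures\<close>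

text \<open>Base 3 with digits 0 and 1 is a Cantor-type expansion: the missing digit leaves gaps
  between the values, so that closeness of two values forces equality of digits. In base 2 the
  ambiguity of expansions would spoil this.\<close>

definition ternary :: "(nat \<Rightarrow> 'a set) \<Rightarrow> 'a \<Rightarrow> real" where
  "ternary b x = (\<Sum>k. indicator (b k) x * (1/3) ^ k)"

lemma ternary_summable: "summable (\<lambda>k. indicator (b k) x * (1/3::real) ^ k)"
  by (rule summable_comparison_test[of _ "\<lambda>k. (1/3) ^ k"])
     (auto intro!: exI[of _ 0] summable_geometric split: split_indicator)

lemma ternary_bounds: "0 \<le> ternary b x" "ternary b x \<le> 3/2"
proof -
  show "0 \<le> ternary b x" unfolding ternary_def by (intro suminf_nonneg ternary_summable) auto
  have "ternary b x \<le> (\<Sum>k. (1/3::real) ^ k)" unfolding ternary_def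
    by (intro suminf_le ternary_summable summable_geometric) (auto split: split_indicator)
  then show "ternary b x \<le> 3/2" by (simp add: suminf_geometric)
qed

lemma ternary_borel_measurable:
  assumes "\<And>k. b k \<in> sets borel"
  shows "ternary b \<in> borel_measurable borel"
  unfolding ternary_def[abs_def] using assms
  by (intro borel_measurable_suminf borel_measurable_times borel_measurable_indicator) auto

text \<open>If the first disagreement of the digits is at position \<open>k\<close>, the tails differ by at most
  \<open>3\<^sup>-\<^sup>k / 2\<close>.\<close>

lemma ternary_digits_eq:
  assumes "\<bar>ternary b x - ternary b y\<bar> < (1/3) ^ m / 2" "k \<le> m"
  shows "x \<in> b k \<longleftrightarrow> y \<in> b k"
proof (rule ccontr)
  assume ne: "\<not> (x \<in> b k \<longleftrightarrow> y \<in> b k)"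
  define k0 where "k0 = (LEAST k. \<not> (x \<in> b k \<longleftrightarrow> y \<in> b k))"
  have k0: "\<not> (x \<in> b k0 \<longleftrightarrow> y \<in> b k0)" "k0 \<le> k"
    unfolding k0_def using ne by (rule LeastI, rule Least_le)
  have less: "x \<in> b j \<longleftrightarrow> y \<in> b j" if "j < k0" for j
    using that not_less_Least unfolding k0_def by blast
  define e where "e j = (indicator (b j) x - indicator (b j) y :: real)" for j
  have sm: "summable (\<lambda>j. e j * (1/3) ^ j)"
    using summable_diff[OF ternary_summable[of b x] ternary_summable[of b y]]
    by (simp add: e_def left_diff_distrib)
  have "ternary b x - ternary b y = (\<Sum>j. e j * (1/3) ^ j)"
    unfolding ternary_def using suminf_diff[OF ternary_summable[of b x] ternary_summable[of b y]]
    by (simp add: e_def left_diff_distrib)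
  also have "\<dots> = (\<Sum>j. e (j + Suc k0) * (1/3) ^ (j + Suc k0)) + (\<Sum>j<Suc k0. e j * (1/3) ^ j)"
    by (rule suminf_split_initial_segment[OF sm])
  also have "(\<Sum>j<Suc k0. e j * (1/3) ^ j) = e k0 * (1/3) ^ k0"
    using less by (auto simp: e_def split: split_indicator intro!: sum.neutral)
  finally have eq: "ternary b x - ternary b y = (\<Sum>j. e (j + Suc k0) * (1/3) ^ (j + Suc k0)) + e k0 * (1/3) ^ k0" .
  have s2: "summable (\<lambda>j. (1/3::real) ^ (j + Suc k0))"
    using summable_geometric[of "1/3::real"] by (subst summable_iff_shift) simp
  have le: "\<bar>e (j + Suc k0) * (1/3) ^ (j + Suc k0)\<bar> \<le> (1/3) ^ (j + Suc k0)" for j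
    by (auto simp: e_def abs_mult split: split_indicator)
  have "\<bar>\<Sum>j. e (j + Suc k0) * (1/3) ^ (j + Suc k0)\<bar> \<le> (\<Sum>j. (1/3::real) ^ (j + Suc k0))"
    using norm_suminf_le[of "\<lambda>j. e (j + Suc k0) * (1/3) ^ (j + Suc k0)" "\<lambda>j. (1/3::real) ^ (j + Suc k0)"] le s2
    by simp
  also have "\<dots> = (1/3) ^ Suc k0 * (\<Sum>j. (1/3::real) ^ j)"
    by (subst suminf_mult[symmetric]) (auto simp: power_add mult.commute intro: summable_geometric)
  also have "\<dots> = (1/3) ^ k0 / 2" by (simp add: suminf_geometric)
  finally have t: "\<bar>\<Sum>j. e (j + Suc k0) * (1/3) ^ (j + Suc k0)\<bar> \<le> (1/3) ^ k0 / 2" .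
  have "\<bar>e k0 * (1/3) ^ k0\<bar> = (1/3::real) ^ k0"
    using k0(1) by (auto simp: e_def abs_mult)
  then have "(1/3) ^ k0 / 2 \<le> \<bar>ternary b x - ternary b y\<bar>" using eq t by linarith
  moreover have "(1/3::real) ^ m \<le> (1/3) ^ k0" using k0(2) assms(2) by (intro power_decreasing) auto
  ultimately show False using assms(1) by linarith
qed

text \<open>A compact set is coded into the line by the ternary digits recording membership in a
  countable base; the inverse of the coding is uniformly continuous, hence extends to the closure
  of the range.\<close>

lemma compact_coding:
  fixes K :: "'a::euclidean_space set"
  assumes K: "compact K"
  obtains c :: "'a \<Rightarrow> real" and T :: "real set" and g :: "real \<Rightarrow> 'a" where
    "c \<in> borel_measurable borel" "\<And>x. 0 \<le> c x" "\<And>x. c x \<le> 3/2"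
    "closed T" "\<And>x. x \<in> K \<Longrightarrow> c x \<in> T" "continuous_on T g" "\<And>t. t \<in> T \<Longrightarrow> g t \<in> K"
    "\<And>x. x \<in> K \<Longrightarrow> g (c x) = x"
proof -
  obtain B :: "'a set set" where B: "countable B" "topological_basis B" using ex_countable_basis by blast
  have ne: "B \<noteq> {}" using B(2) topological_basisE[OF B(2), of UNIV undefined] by auto
  define b where "b = from_nat_into B"
  have bB: "b k \<in> B" for k unfolding b_def using from_nat_into[OF ne] .
  have ob: "open (b k)" for k using topological_basis_open[OF B(2) bB] .
  define c where "c = ternary b"
  have fine: "\<exists>d>0. \<forall>x\<in>K. \<forall>y. \<bar>c x - c y\<bar> < d \<longrightarrow> dist x y < e" if e: "0 < e" for e
  proof -
    \<comment> \<open>Finitely many small basic sets cover \<open>K\<close>. If two codes agree in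
      the digits up to the largest index involved, both points lie in the same small set.\<close>
    define C where "C = {b k | k. \<exists>z. b k \<subseteq> ball z (e/2)}"
    have "K \<subseteq> \<Union>C"
    proof
      fix x assume "x \<in> K"
      obtain S where S: "S \<in> B" "x \<in> S" "S \<subseteq> ball x (e/2)"
        using topological_basisE[OF B(2), of "ball x (e/2)" x] e by auto
      obtain k where "S = b k" using from_nat_into_surj[OF B(1) S(1)] unfolding b_def by metis
      then show "x \<in> \<Union>C" using S unfolding C_def by blast
    qed
    moreover have "\<And>S. S \<in> C \<Longrightarrow> open S" using ob by (auto simp: C_def)
    ultimately obtain D where D: "D \<subseteq> C" "finite D" "K \<subseteq> \<Union>D"
      using compactE[OF K, of C] by metis
    have "\<forall>S\<in>D. \<exists>k. S = b k \<and> (\<exists>z. b k \<subseteq> ball z (e/2))" using D(1) by (auto simp: C_def)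
    then obtain q where q: "\<And>S. S \<in> D \<Longrightarrow> S = b (q S) \<and> (\<exists>z. b (q S) \<subseteq> ball z (e/2))" by metis
    define m where "m = Max (insert 0 (q ` D))"
    have m: "q S \<le> m" if "S \<in> D" for S unfolding m_def using that D(2) by (intro Max_ge) auto
    show ?thesis
    proof (intro exI[of _ "(1/3) ^ m / 2"] conjI ballI allI impI)
      fix x y assume x: "x \<in> K" and l: "\<bar>c x - c y\<bar> < (1/3) ^ m / 2"
      obtain S where S: "S \<in> D" "x \<in> S" using D(3) x by blast
      have "x \<in> b (q S)" using q[OF S(1)] S(2) by simp
      moreover have "y \<in> b (q S)"
        using ternary_digits_eq[OF l[unfolded c_def] m[OF S(1)]] calculation by blast
      moreover obtain z where "b (q S) \<subseteq> ball z (e/2)" using q[OF S(1)] by blast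
      ultimately have "dist z x < e/2" "dist z y < e/2" by auto
      then show "dist x y < e" by (rule dist_triangle_half_r)
    qed simp
  qed
  have inj: "x = y" if "x \<in> K" "c x = c y" for x y
  proof (rule ccontr)
    assume "x \<noteq> y"
    then have "0 < dist x y" by simp
    from fine[OF this] obtain d where "d > 0" "\<forall>x'\<in>K. \<forall>y'. \<bar>c x' - c y'\<bar> < d \<longrightarrow> dist x' y' < dist x y" by blast
    then have "dist x y < dist x y" using that by (metis abs_zero diff_self)
    then show False by simp
  qed
  define h where "h = inv_into K c"
  have h: "h (c x) = x" if "x \<in> K" for x
    unfolding h_def by (rule inv_into_f_f[OF inj_onI that]) (use inj in blast)
  have uc: "uniformly_continuous_on (c ` K) h"
    unfolding uniformly_continuous_on_def
  proof (intro allI impI)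
    fix e :: real assume "0 < e"
    from fine[OF this] obtain d where d: "d > 0" "\<And>x y. x \<in> K \<Longrightarrow> \<bar>c x - c y\<bar> < d \<Longrightarrow> dist x y < e" by blast
    show "\<exists>d>0. \<forall>x\<in>c ` K. \<forall>x'\<in>c ` K. dist x' x < d \<longrightarrow> dist (h x') (h x) < e"
      using d h by (intro exI[of _ d]) (auto simp: dist_real_def)
  qed
  obtain g where g: "uniformly_continuous_on (closure (c ` K)) g" "\<And>x. x \<in> c ` K \<Longrightarrow> h x = g x"
    using uniformly_continuous_on_extension_on_closure[OF uc] by metis
  have cg: "continuous_on (closure (c ` K)) g" by (rule uniformly_continuous_imp_continuous[OF g(1)])
  have gh: "g (c x) = x" if "x \<in> K" for x using g(2)[of "c x"] h[OF that] that by simp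
  have "g ` closure (c ` K) \<subseteq> K"
    by (rule image_closure_subset[OF cg compact_imp_closed[OF K]]) (use gh in auto)
  then have gK: "g t \<in> K" if "t \<in> closure (c ` K)" for t using that by blast
  show ?thesis
  proof (rule that[of c "closure (c ` K)" g])
    show "c \<in> borel_measurable borel" unfolding c_def
      by (rule ternary_borel_measurable) (use ob in auto)
    show "c x \<in> closure (c ` K)" if "x \<in> K" for x
      by (rule subsetD[OF closure_subset imageI[OF that]])
    show "0 \<le> c x" "c x \<le> 3/2" for x unfolding c_def by (rule ternary_bounds)+
    show "closed (closure (c ` K))" by simp
    show "continuous_on (closure (c ` K)) g" by (rule cg)
    show "g t \<in> K" if "t \<in> closure (c ` K)" for t by (rule gK[OF that])
    show "g (c x) = x" if "x \<in> K" for x by (rule gh[OF that])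
  qed
qed

section \<open>Narrow limits on the line and on compact sets\<close>

lemma weak_conv_m_closed_support:
  assumes \<mu>: "\<And>n. real_distribution (\<mu> n)" and M: "real_distribution M" and w: "weak_conv_m \<mu> M"
    and T: "closed T" "T \<noteq> {}" and supp: "\<And>n. AE t in \<mu> n. t \<in> T"
  shows "AE t in M. t \<in> T"
proof -
  interpret M: real_distribution M by fact
  \<comment> \<open>A bounded continuous function that vanishes exactly on \<open>T\<close>; its
    integral is 0 along the sequence, hence also in the limit.\<close>
  define F where "F t = min 1 (infdist t T)" for t :: real
  have cF: "continuous_on UNIV F" unfolding F_def by (intro continuous_intros)
  have bF: "norm (F t) \<le> 1" for t by (auto simp: F_def infdist_nonneg)
  have "(\<lambda>n. integral\<^sup>L (\<mu> n) F) \<longlonglongrightarrow> integral\<^sup>L M F"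
    by (rule weak_conv_imp_integral_bdd_continuous_conv[OF \<mu> M w _ bF])
      (use cF in \<open>simp add: continuous_on_eq_continuous_at\<close>)
  moreover have "integral\<^sup>L (\<mu> n) F = 0" for n
    by (rule integral_eq_zero_AE) (use supp[of n] in \<open>auto simp: F_def elim!: AE_mp\<close>)
  ultimately have "integral\<^sup>L M F = 0" by (simp add: LIMSEQ_const_iff)
  moreover have "integrable M F"
    using borel_measurable_continuous_onI[OF cF] bF by (intro M.integrable_const_bound[where B=1]) auto
  moreover have "AE t in M. 0 \<le> F t" by (auto simp: F_def infdist_nonneg)
  ultimately have "AE t in M. F t = 0" by (simp add: integral_nonneg_eq_0_iff_AE)
  then show ?thesis
  proof (rule AE_mp, intro AE_I2 impI)
    fix t assume "F t = 0"
    then have "infdist t T = 0" by (auto simp: F_def min_def split: if_splits)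
    then show "t \<in> T" using in_closed_iff_infdist_zero[OF T] by simp
  qed
qed

text \<open>The problem is transferred to the line, where tight sequences of probability measures
  have weakly convergent subsequences. The measures are normalised, pushed forward by the code, and
  the limit is pulled back by \<open>g\<close>. For continuous \<psi> the composition with
  \<open>g\<close> is continuous on the closed set \<open>T\<close>, so Tietze extends it to a
  bounded test function on the line.\<close>

theorem narrow_compactness:
  fixes m :: "nat \<Rightarrow> 'a::euclidean_space measure"
  assumes K: "compact K" and s: "\<And>i. sets (m i) = sets borel"
    and supp: "\<And>i. AE x in m i. x \<in> K" and bd: "\<And>i. emeasure (m i) UNIV \<le> ennreal B"
  obtains r M where "strict_mono (r :: nat \<Rightarrow> nat)" "sets M = sets borel" "finite_measure M" "AE x in M. x \<in> K"
    "\<And>\<psi>::'a \<Rightarrow> real. continuous_on UNIV \<psi> \<Longrightarrow> (\<lambda>i. LINT x|m (r i). \<psi> x) \<longlonglongrightarrow> (LINT x|M. \<psi> x)"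
proof -
  have sp: "space (m i) = UNIV" for i using s[of i] by (metis sets_eq_imp_space_eq space_borel)
  have fin: "finite_measure (m i)" for i
    using bd[of i] by (intro finite_measureI) (auto simp: sp top_unique)
  define c where "c i = measure (m i) UNIV" for i
  have em: "emeasure (m i) UNIV = ennreal (c i)" for i
    using finite_measure.emeasure_eq_measure[OF fin] by (simp add: c_def)
  have c0: "0 \<le> c i" for i by (simp add: c_def)
  have "bounded (range c)"
  proof (rule boundedI)
    fix y assume "y \<in> range c"
    then obtain i where "y = c i" by blast
    then show "norm y \<le> max 0 B" using bd[of i] em[of i] c0[of i]
      by (cases "B \<ge> 0") (auto simp: ennreal_le_iff2)
  qed
  then obtain L r0 where r0: "strict_mono (r0 :: nat \<Rightarrow> nat)" "(c \<circ> r0) \<longlonglongrightarrow> L"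
    using bounded_imp_convergent_subsequence by blast
  have L0: "0 \<le> L" using r0(2) c0 by (intro LIMSEQ_le_const[OF r0(2)]) auto
  have mb: "\<psi> \<in> borel_measurable (m i)" if "\<psi> \<in> borel_measurable borel" for \<psi> :: "'a \<Rightarrow> real" and i
    using that by (subst measurable_cong_sets[OF s refl])
  have bound: "\<bar>LINT x|m i. \<psi> x\<bar> \<le> S * c i"
    if \<psi>: "continuous_on UNIV \<psi>" "\<And>x. x \<in> K \<Longrightarrow> \<bar>\<psi> x\<bar> \<le> S" for \<psi> :: "'a \<Rightarrow> real" and S i
  proof -
    interpret finite_measure "m i" by (rule fin)
    have ae: "AE x in m i. \<bar>\<psi> x\<bar> \<le> S" using supp[of i] by (rule AE_mp) (use \<psi>(2) in auto)
    have i: "integrable (m i) \<psi>"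
      using ae mb[OF borel_measurable_continuous_onI[OF \<psi>(1)]] by (intro integrable_const_bound[where B=S]) auto
    have "norm (LINT x|m i. \<psi> x) \<le> (LINT x|m i. norm (\<psi> x))" by (rule integral_norm_bound)
    also have "\<dots> \<le> (LINT x|m i. S)" using ae i by (intro integral_mono_AE) auto
    also have "\<dots> = S * c i" by (simp add: sp c_def)
    finally show ?thesis by simp
  qed
  have Kbd: "\<exists>S. \<forall>x\<in>K. \<bar>\<psi> x\<bar> \<le> S" if "continuous_on UNIV \<psi>" for \<psi> :: "'a \<Rightarrow> real"
  proof -
    have "compact (\<psi> ` K)" by (rule compact_continuous_image[OF continuous_on_subset[OF that] K]) simp
    from compact_imp_bounded[OF this] show ?thesis by (auto simp: bounded_iff)
  qed
  show ?thesis
  proof (cases "L = 0")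
    case True
    \<comment> \<open>Masses tending to 0 cannot be normalised usefully; the limit is the zero
      measure, and no further subsequence is required.\<close>
    define M where "M = density (m 0) (\<lambda>_. 0)"
    have e0: "emeasure M A = 0" for A
    proof (cases "A \<in> sets borel")
      case True then show ?thesis unfolding M_def using s by (subst emeasure_density) auto
    next
      case False then show ?thesis unfolding M_def using s by (intro emeasure_notin_sets) simp
    qed
    have M0: "(LINT x|M. \<psi> x) = 0" if "continuous_on UNIV \<psi>" for \<psi> :: "'a \<Rightarrow> real"
      by (rule integral_eq_zero_AE, unfold M_def, subst AE_density) auto
    have lim: "(\<lambda>i. LINT x|m (r0 i). \<psi> x) \<longlonglongrightarrow> (LINT x|M. \<psi> x)"
      if \<psi>: "continuous_on UNIV \<psi>" for \<psi> :: "'a \<Rightarrow> real"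
    proof -
      obtain S where S: "\<And>x. x \<in> K \<Longrightarrow> \<bar>\<psi> x\<bar> \<le> S" using Kbd[OF \<psi>] by blast
      have "(\<lambda>i. S * (c \<circ> r0) i) \<longlonglongrightarrow> S * L" by (intro tendsto_mult tendsto_const r0(2))
      then have t0: "(\<lambda>i. S * c (r0 i)) \<longlonglongrightarrow> 0" using True by (simp add: comp_def)
      have "\<forall>\<^sub>F i in sequentially. norm (LINT x|m (r0 i). \<psi> x) \<le> S * c (r0 i)"
        by (intro always_eventually allI) (simp add: bound[OF \<psi> S])
      from Lim_null_comparison[OF this t0] have "(\<lambda>i. LINT x|m (r0 i). \<psi> x) \<longlonglongrightarrow> 0" .
      then show ?thesis using M0[OF \<psi>] by simp
    qed
    show ?thesis
    proof (rule that[OF r0(1) _ _ _ lim])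
      show "sets M = sets borel" by (simp add: M_def s)
      show "finite_measure M" by (intro finite_measureI) (simp add: e0)
      show "AE x in M. x \<in> K" unfolding M_def by (subst AE_density) auto
    qed
  next
    case False
    then have Lp: "0 < L" using L0 by simp
    have "eventually (\<lambda>i. 0 < (c \<circ> r0) i) sequentially" using order_tendstoD(1)[OF r0(2) Lp] .
    then obtain N where N: "\<And>i. N \<le> i \<Longrightarrow> 0 < c (r0 i)" by (auto simp: eventually_sequentially)
    \<comment> \<open>Initial members may have mass 0 and are dropped, so that division by the mass
      is legitimate.\<close>
    define r1 where "r1 i = r0 (i + N)" for i
    have cp: "0 < c (r1 i)" for i unfolding r1_def using N by simp
    have ne: "K \<noteq> {}"
    proof
      assume "K = {}"
      then have "AE x in m (r1 0). False" using supp[of "r1 0"] by simp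
      then have "emeasure (m (r1 0)) UNIV = 0"
        using AE_iff_measurable[of UNIV "m (r1 0)" "\<lambda>_. False"] by (simp add: s sp)
      then show False using em[of "r1 0"] cp[of 0] by (simp add: ennreal_eq_0_iff)
    qed
    then obtain x0 where x0: "x0 \<in> K" by blast
    obtain cc :: "'a \<Rightarrow> real" and T g where cc: "cc \<in> borel_measurable borel" "\<And>x. 0 \<le> cc x" "\<And>x. cc x \<le> 3/2"
      and T: "closed T" "\<And>x. x \<in> K \<Longrightarrow> cc x \<in> T" and g: "continuous_on T g" "\<And>t. t \<in> T \<Longrightarrow> g t \<in> K"
      "\<And>x. x \<in> K \<Longrightarrow> g (cc x) = x"
      using compact_coding[OF K] by metis
    have Tne: "T \<noteq> {}" using T(2)[OF x0] by auto
    have ccm: "cc \<in> borel_measurable (m i)" for i by (rule mb[OF cc(1)])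
    define q where "q i = density (m (r1 i)) (\<lambda>_. ennreal (1 / c (r1 i)))" for i
    define p where "p i = distr (q i) borel cc" for i
    have ccq: "cc \<in> measurable (q i) borel" for i unfolding q_def using ccm by simp
    have pq: "prob_space (q i)" for i
    proof (rule prob_spaceI)
      have "emeasure (q i) UNIV = ennreal (1 / c (r1 i)) * emeasure (m (r1 i)) UNIV"
        unfolding q_def by (subst emeasure_density) (auto simp: s sp nn_integral_cmult)
      also have "\<dots> = 1" using cp[of i] by (simp add: em ennreal_mult[symmetric])
      finally show "emeasure (q i) (space (q i)) = 1" by (simp add: q_def sp)
    qed
    have rd: "real_distribution (p i)" for i
      unfolding real_distribution_def real_distribution_axioms_def p_def
      using prob_space.prob_space_distr[OF pq ccq] by simp
    have int_p: "(LINT t|p i. F t) = (1 / c (r1 i)) * (LINT x|m (r1 i). F (cc x))"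
      if "F \<in> borel_measurable borel" for F :: "real \<Rightarrow> real" and i
    proof -
      have "(LINT t|p i. F t) = (LINT x|q i. F (cc x))"
        unfolding p_def using ccq that by (intro integral_distr) auto
      also have "\<dots> = (LINT x|m (r1 i). (1 / c (r1 i)) * F (cc x))"
        unfolding q_def using ccm that cp[of i] by (subst integral_real_density) auto
      finally show ?thesis by simp
    qed
    have aeT: "AE t in p i. t \<in> T" for i
    proof -
      have "AE x in m (r1 i). cc x \<in> T" using supp by (rule AE_mp) (use T in auto)
      then have "AE x in q i. cc x \<in> T" unfolding q_def by (subst AE_density) (auto elim: AE_mp)
      then show ?thesis unfolding p_def using T(1) by (subst AE_distr_iff[OF ccq]) auto
    qed
    have tight: "tight p" unfolding tight_def
    proof (intro conjI allI impI rd)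
      fix \<epsilon> :: real assume "0 < \<epsilon>"
      \<comment> \<open>The codes lie in \<open>{0..3/2}\<close>, so one fixed interval carries all
        the mass and tightness is immediate.\<close>
      have "measure (p n) {-1<..2} = 1" for n
      proof -
        interpret real_distribution "p n" by (rule rd)
        have "AE x in q n. cc x \<in> {-1<..2}"
        proof (rule AE_I2)
          fix x show "cc x \<in> {-1<..2}" using cc(2,3)[of x] by auto
        qed
        then have "AE t in p n. t \<in> {-1<..2}" unfolding p_def by (subst AE_distr_iff[OF ccq]) auto
        then show ?thesis by (subst prob_eq_1) auto
      qed
      then show "\<exists>a b. a < b \<and> (\<forall>n. 1 - \<epsilon> < measure (p n) {a<..b})"
        using \<open>0 < \<epsilon>\<close> by (intro exI[of _ "-1"] exI[of _ 2]) auto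
    qed
    obtain r2 P where r2: "strict_mono (r2 :: nat \<Rightarrow> nat)" and P: "real_distribution P"
      and w: "weak_conv_m (p \<circ> id \<circ> r2) P"
      using tight_imp_convergent_subsubsequence[OF tight strict_mono_id] by blast
    interpret P: real_distribution P by (rule P)
    have rd2: "real_distribution ((p \<circ> id \<circ> r2) i)" for i using rd by simp
    have PT: "AE t in P. t \<in> T"
    proof (rule weak_conv_m_closed_support[OF rd2 P w T(1) Tne])
      show "AE t in (p \<circ> id \<circ> r2) n. t \<in> T" for n
        using aeT[of "r2 n"] by (simp only: comp_apply id_apply)
    qed
    define r where "r i = r1 (r2 i)" for i
    have r: "strict_mono r"
      unfolding r_def r1_def strict_mono_def using r0(1) r2 by (simp add: strict_mono_def)
    have cr: "(\<lambda>i. c (r i)) \<longlonglongrightarrow> L"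
    proof -
      have "(\<lambda>i. (c \<circ> r0) (i + N)) \<longlonglongrightarrow> L" by (rule LIMSEQ_ignore_initial_segment[OF r0(2)])
      from LIMSEQ_subseq_LIMSEQ[OF this r2] show ?thesis by (simp add: comp_def r_def r1_def)
    qed
    \<comment> \<open>The value \<open>x0\<close> off \<open>T\<close> keeps the range of
      \<open>g'\<close> inside \<open>K\<close>; the limit measure gives no mass to the complement
      of \<open>T\<close>.\<close>
    define g' where "g' t = (if t \<in> T then g t else x0)" for t
    have g'm: "g' \<in> borel_measurable borel" unfolding g'_def
      by (rule borel_measurable_continuous_on_if[OF _ g(1)]) (use T in auto)
    \<comment> \<open>The factor \<open>L\<close>, the limit of the masses, undoes the
      normalisation.\<close>
    define PL where "PL = density P (\<lambda>_. ennreal L)"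
    define M where "M = distr PL borel g'"
    have g'P: "g' \<in> measurable PL borel"
      unfolding PL_def using g'm by simp
    have lim: "(\<lambda>i. LINT x|m (r i). \<psi> x) \<longlonglongrightarrow> (LINT x|M. \<psi> x)"
      if \<psi>: "continuous_on UNIV \<psi>" for \<psi> :: "'a \<Rightarrow> real"
    proof -
      obtain S where S: "\<And>x. x \<in> K \<Longrightarrow> \<bar>\<psi> x\<bar> \<le> S" using Kbd[OF \<psi>] by blast
      have S0: "0 \<le> S" using S[OF x0] by linarith
      have ct: "continuous_on T (\<lambda>t. \<psi> (g t))"
        by (rule continuous_on_compose2[OF \<psi> g(1)]) simp
      obtain \<Psi> where \<Psi>: "continuous_on UNIV \<Psi>" "\<And>t. t \<in> T \<Longrightarrow> \<Psi> t = \<psi> (g t)" "\<And>t. norm (\<Psi> t) \<le> S"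
      proof (rule Tietze[OF ct _ S0, of UNIV])
        show "closedin (top_of_set UNIV) T" using T(1) by simp
        show "norm (\<psi> (g t)) \<le> S" if "t \<in> T" for t using S[OF g(2)[OF that]] by simp
      qed (use that in auto)
      have \<Psi>m: "\<Psi> \<in> borel_measurable borel" by (rule borel_measurable_continuous_onI[OF \<Psi>(1)])
      have \<psi>m: "\<psi> \<in> borel_measurable borel" by (rule borel_measurable_continuous_onI[OF \<psi>])
      have "(\<lambda>i. LINT t|(p \<circ> id \<circ> r2) i. \<Psi> t) \<longlonglongrightarrow> (LINT t|P. \<Psi> t)"
        by (rule weak_conv_imp_integral_bdd_continuous_conv[OF rd2 P w _ \<Psi>(3)])
          (use \<Psi>(1) in \<open>simp add: continuous_on_eq_continuous_at\<close>)
      then have "(\<lambda>i. c (r i) * (LINT t|p (r2 i). \<Psi> t)) \<longlonglongrightarrow> L * (LINT t|P. \<Psi> t)"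
        by (intro tendsto_mult cr) (simp add: comp_def)
      moreover have "c (r i) * (LINT t|p (r2 i). \<Psi> t) = (LINT x|m (r i). \<psi> x)" for i
      proof -
        have "c (r i) * (LINT t|p (r2 i). \<Psi> t) = (LINT x|m (r i). \<Psi> (cc x))"
          unfolding int_p[OF \<Psi>m] r_def using cp[of "r2 i"] by simp
        also have "\<dots> = (LINT x|m (r i). \<psi> x)"
        proof (rule integral_cong_AE)
          show "(\<lambda>x. \<Psi> (cc x)) \<in> borel_measurable (m (r i))" using measurable_comp[OF ccm \<Psi>m] by (simp add: comp_def)
          show "\<psi> \<in> borel_measurable (m (r i))" by (rule mb[OF \<psi>m])
          show "AE x in m (r i). \<Psi> (cc x) = \<psi> x"
            using supp by (rule AE_mp) (use \<Psi>(2)[OF T(2)] g(3) in auto)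
        qed
        finally show ?thesis .
      qed
      moreover have "(LINT x|M. \<psi> x) = L * (LINT t|P. \<Psi> t)"
      proof -
        have g'P': "g' \<in> measurable P borel" using g'P unfolding PL_def by simp
        have "(LINT x|M. \<psi> x) = (LINT t|PL. \<psi> (g' t))"
          unfolding M_def using g'P \<psi>m by (intro integral_distr) auto
        also have "\<dots> = (LINT t|P. L * \<psi> (g' t))"
          unfolding PL_def using g'P' \<psi>m Lp by (subst integral_real_density) auto
        also have "\<dots> = L * (LINT t|P. \<psi> (g' t))" by simp
        also have "(LINT t|P. \<psi> (g' t)) = (LINT t|P. \<Psi> t)"
        proof (rule integral_cong_AE)
          show "(\<lambda>t. \<psi> (g' t)) \<in> borel_measurable P" using measurable_comp[OF g'P' \<psi>m] by (simp add: comp_def)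
          show "\<Psi> \<in> borel_measurable P" using \<Psi>m by simp
          show "AE t in P. \<psi> (g' t) = \<Psi> t"
            using PT by (rule AE_mp) (use \<Psi>(2) in \<open>auto simp: g'_def\<close>)
        qed
        finally show ?thesis .
      qed
      ultimately show ?thesis by simp
    qed
    show ?thesis
    proof (rule that[OF r _ _ _ lim])
      show "sets M = sets borel" by (simp add: M_def)
      have "emeasure PL (space PL) = ennreal L * emeasure P (space P)"
        unfolding PL_def by (subst emeasure_density) (auto simp: nn_integral_cmult)
      then have "finite_measure PL" using P.emeasure_space_1 by (intro finite_measureI) simp
      then show "finite_measure M" unfolding M_def using g'P by (rule finite_measure.finite_measure_distr)
      show "AE x in M. x \<in> K" unfolding M_def
        by (subst AE_distr_iff[OF g'P]) (use compact_imp_closed[OF K] g(2) x0 in \<open>auto simp: g'_def\<close>)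
    qed
  qed
qed

text \<open>Change of variables for the image under \<pi> of the vector measure with density
  \<open>F\<close>. It is known on indicators, passes to simple functions by linearity and to
  bounded functions by dominated convergence.\<close>

lemma integral_indicator_imp_integral_bounded:
  fixes f :: "'a::euclidean_space \<Rightarrow> 'b::euclidean_space" and \<psi> :: "'a \<Rightarrow> real"
  assumes s: "sets l = sets borel" and f: "integrable l f" and F: "integrable \<gamma> F" and \<pi>: "\<pi> \<in> measurable \<gamma> borel"
    and eq: "\<And>A. A \<in> sets borel \<Longrightarrow>
      (LINT x|l. indicat_real A x *\<^sub>R f x) = (LINT z|\<gamma>. indicat_real A (\<pi> z) *\<^sub>R F z)"
    and \<psi>: "\<psi> \<in> borel_measurable borel" "\<And>x. \<bar>\<psi> x\<bar> \<le> B"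
  shows "(LINT x|l. \<psi> x *\<^sub>R f x) = (LINT z|\<gamma>. \<psi> (\<pi> z) *\<^sub>R F z)"
proof -
  obtain h where h: "\<And>i::nat. simple_function borel (h i)" "\<And>x. (\<lambda>i. h i x) \<longlonglongrightarrow> \<psi> x"
    "\<And>i x. dist (h i x) 0 \<le> 2 * dist (\<psi> x) 0"
    using borel_measurable_implies_sequence_metric[OF \<psi>(1), of 0] by auto
  have hb: "\<bar>h i x\<bar> \<le> 2 * B" for i x using h(3)[of i x] \<psi>(2)[of x] by simp
  have hm: "h i \<in> borel_measurable borel" for i by (rule borel_measurable_simple_function[OF h(1)])
  have ml: "\<And>k::'a \<Rightarrow> real. k \<in> borel_measurable borel \<Longrightarrow> k \<in> borel_measurable l"
    by (subst measurable_cong_sets[OF s refl])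
  have m\<gamma>: "\<And>k::'a \<Rightarrow> real. k \<in> borel_measurable borel \<Longrightarrow> (\<lambda>z. k (\<pi> z)) \<in> borel_measurable \<gamma>"
    by (rule measurable_compose[OF \<pi>])
  have step: "(LINT x|l. h i x *\<^sub>R f x) = (LINT z|\<gamma>. h i (\<pi> z) *\<^sub>R F z)" for i
  proof -
    define R where "R = range (h i)"
    have R: "finite R" using simple_functionD(1)[OF h(1)[of i]] by (simp add: R_def)
    define A where "A y = h i -` {y}" for y
    have Ab: "A y \<in> sets borel" for y
      unfolding A_def using measurable_sets[OF hm[of i], of "{y}"] by simp
    have dec: "h i x = (\<Sum>y\<in>R. y * indicator (A y) x)" for x
    proof -
      have "(\<Sum>y\<in>R. y * indicator (A y) x) = (\<Sum>y\<in>R. if y = h i x then y else 0)"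
        by (intro sum.cong) (auto simp: A_def)
      then show ?thesis using R by (simp add: R_def)
    qed
    have i1: "integrable l (\<lambda>x. indicat_real (A y) x *\<^sub>R f x)" for y
      by (rule integrable_bounded_scaleR[OF f ml, where B=1]) (use Ab in \<open>auto split: split_indicator\<close>)
    have i2: "integrable \<gamma> (\<lambda>z. indicat_real (A y) (\<pi> z) *\<^sub>R F z)" for y
      by (rule integrable_bounded_scaleR[OF F m\<gamma>, where B=1]) (use Ab in \<open>auto split: split_indicator\<close>)
    have "(LINT x|l. h i x *\<^sub>R f x) = (LINT x|l. (\<Sum>y\<in>R. y *\<^sub>R (indicat_real (A y) x *\<^sub>R f x)))"
      by (subst dec) (simp add: scaleR_sum_left)
    also have "\<dots> = (\<Sum>y\<in>R. y *\<^sub>R (LINT x|l. indicat_real (A y) x *\<^sub>R f x))"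
      using i1 by (subst Bochner_Integration.integral_sum) (auto simp del: scaleR_scaleR)
    also have "\<dots> = (\<Sum>y\<in>R. y *\<^sub>R (LINT z|\<gamma>. indicat_real (A y) (\<pi> z) *\<^sub>R F z))"
      by (simp only: eq[OF Ab])
    also have "\<dots> = (LINT z|\<gamma>. (\<Sum>y\<in>R. y *\<^sub>R (indicat_real (A y) (\<pi> z) *\<^sub>R F z)))"
      using i2 by (subst Bochner_Integration.integral_sum) (auto simp del: scaleR_scaleR)
    also have "\<dots> = (LINT z|\<gamma>. h i (\<pi> z) *\<^sub>R F z)"
      by (subst dec) (simp add: scaleR_sum_left)
    finally show ?thesis .
  qed
  have l1: "(\<lambda>i. LINT x|l. h i x *\<^sub>R f x) \<longlonglongrightarrow> (LINT x|l. \<psi> x *\<^sub>R f x)"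
  proof (rule integral_dominated_convergence[where w="\<lambda>x. 2 * B * norm (f x)"])
    show "(\<lambda>x. \<psi> x *\<^sub>R f x) \<in> borel_measurable l" "\<And>i. (\<lambda>x. h i x *\<^sub>R f x) \<in> borel_measurable l"
      using f ml[OF \<psi>(1)] ml[OF hm] by (auto intro!: borel_measurable_scaleR)
    show "AE x in l. (\<lambda>i. h i x *\<^sub>R f x) \<longlonglongrightarrow> \<psi> x *\<^sub>R f x"
      by (intro AE_I2 tendsto_scaleR tendsto_const h(2))
    show "AE x in l. norm (h i x *\<^sub>R f x) \<le> 2 * B * norm (f x)" for i
      using hb by (intro AE_I2) (auto intro!: mult_right_mono)
  qed (use f in simp)
  have l2: "(\<lambda>i. LINT z|\<gamma>. h i (\<pi> z) *\<^sub>R F z) \<longlonglongrightarrow> (LINT z|\<gamma>. \<psi> (\<pi> z) *\<^sub>R F z)"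
  proof (rule integral_dominated_convergence[where w="\<lambda>z. 2 * B * norm (F z)"])
    show "(\<lambda>z. \<psi> (\<pi> z) *\<^sub>R F z) \<in> borel_measurable \<gamma>" "\<And>i. (\<lambda>z. h i (\<pi> z) *\<^sub>R F z) \<in> borel_measurable \<gamma>"
      using F m\<gamma>[OF \<psi>(1)] m\<gamma>[OF hm] by (auto intro!: borel_measurable_scaleR)
    show "AE z in \<gamma>. (\<lambda>i. h i (\<pi> z) *\<^sub>R F z) \<longlonglongrightarrow> \<psi> (\<pi> z) *\<^sub>R F z"
      by (intro AE_I2 tendsto_scaleR tendsto_const h(2))
    show "AE z in \<gamma>. norm (h i (\<pi> z) *\<^sub>R F z) \<le> 2 * B * norm (F z)" for i
      using hb by (intro AE_I2) (auto intro!: mult_right_mono)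
  qed (use F in simp)
  show ?thesis using LIMSEQ_unique[OF l1] l2 by (simp add: step)
qed

text \<open>The pairs \<open>(x, f(x)/|f(x)|)\<close> distributed according to \<open>|\<mu>|\<close> form positive measures on a compact
  set; integrating the second coordinate of a narrow limit yields the limiting vector measure.\<close>

theorem represents_compactness:
  fixes \<mu> :: "nat \<Rightarrow> 'a::euclidean_space set \<Rightarrow> 'b::euclidean_space"
  assumes K: "compact K" and rep: "\<And>i. represents (l i) (f i) (\<mu> i)"
    and supp: "\<And>i x. x \<notin> K \<Longrightarrow> f i x = 0" and bd: "\<And>i. (LINT x|l i. norm (f i x)) \<le> B"
  obtains r L g \<nu> where "strict_mono (r :: nat \<Rightarrow> nat)" "represents L g \<nu>" "\<And>x. x \<notin> K \<Longrightarrow> g x = 0"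
    "\<And>\<psi>::'a \<Rightarrow> real. continuous_on UNIV \<psi> \<Longrightarrow>
      (\<lambda>i. LINT x|l (r i). \<psi> x *\<^sub>R f (r i) x) \<longlonglongrightarrow> (LINT x|L. \<psi> x *\<^sub>R g x)"
proof -
  have s: "sets (l i) = sets borel" and fi: "integrable (l i) (f i)" for i
    using rep[of i] by (auto simp: represents_def)
  have fm: "f i \<in> borel_measurable (l i)" for i by (rule borel_measurable_integrable[OF fi])
  have lm: "\<And>k::'a \<Rightarrow> 'a. k \<in> borel_measurable borel \<Longrightarrow> k \<in> borel_measurable (l i)" for i
    by (subst measurable_cong_sets[OF s refl])
  have lmr: "\<And>k::'a \<Rightarrow> real. k \<in> borel_measurable borel \<Longrightarrow> k \<in> borel_measurable (l i)" for i
    by (subst measurable_cong_sets[OF s refl])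
  define G where "G i x = (x, sgn (f i x))" for i x
  have sgnm: "(\<lambda>x. sgn (f i x)) \<in> borel_measurable (l i)" for i
    unfolding sgn_div_norm using fm[of i] by (intro borel_measurable_scaleR) auto
  have Gm0: "G i \<in> measurable (l i) borel" for i
    unfolding G_def borel_prod[symmetric] using sgnm lm[of "\<lambda>x. x"] by (intro measurable_Pair) auto
  define D where "D i = density (l i) (\<lambda>x. ennreal (norm (f i x)))" for i
  have Gm: "G i \<in> measurable (D i) borel" for i unfolding D_def using Gm0 by simp
  define \<gamma> where "\<gamma> i = distr (D i) borel (G i)" for i
  define K' where "K' = K \<times> cball (0::'b) 1"
  have K': "compact K'" unfolding K'_def using K by (intro compact_Times) auto
  have ae: "AE z in \<gamma> i. z \<in> K'" for i
  proof -
    have "AE x in D i. G i x \<in> K'" unfolding D_def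
      using fm supp[of _ i] by (subst AE_density) (auto simp: G_def K'_def norm_sgn)
    then show ?thesis unfolding \<gamma>_def
      using compact_imp_closed[OF K'] by (subst AE_distr_iff[OF Gm]) auto
  qed
  have mass: "emeasure (\<gamma> i) UNIV \<le> ennreal B" for i
  proof -
    have "emeasure (\<gamma> i) UNIV = emeasure (D i) (space (D i))"
      unfolding \<gamma>_def using Gm by (subst emeasure_distr) auto
    also have "\<dots> = (\<integral>\<^sup>+x. ennreal (norm (f i x)) \<partial>l i)"
      unfolding D_def using fm by (subst emeasure_density) (auto intro!: nn_integral_cong)
    also have "\<dots> = ennreal (LINT x|l i. norm (f i x))"
      using fi by (intro nn_integral_eq_integral) auto
    also have "\<dots> \<le> ennreal B" using bd by (rule ennreal_leI)
    finally show ?thesis .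
  qed
  have \<gamma>s: "sets (\<gamma> i) = sets borel" for i by (simp add: \<gamma>_def)
  obtain r M where r: "strict_mono (r :: nat \<Rightarrow> nat)" and M: "sets M = sets borel" "finite_measure M" "AE z in M. z \<in> K'"
    and lim: "\<And>\<psi>::'a \<times> 'b \<Rightarrow> real. continuous_on UNIV \<psi> \<Longrightarrow> (\<lambda>i. LINT x|\<gamma> (r i). \<psi> x) \<longlonglongrightarrow> (LINT x|M. \<psi> x)"
    using narrow_compactness[of K' \<gamma> B, OF K' \<gamma>s ae mass] by metis
  interpret M: finite_measure M by (rule M)
  have Mm: "\<And>k::'a \<times> 'b \<Rightarrow> 'b. k \<in> borel_measurable borel \<Longrightarrow> k \<in> borel_measurable M"
    by (subst measurable_cong_sets[OF M(1) refl])
  have Mmr: "\<And>k::'a \<times> 'b \<Rightarrow> real. k \<in> borel_measurable borel \<Longrightarrow> k \<in> borel_measurable M"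
    by (subst measurable_cong_sets[OF M(1) refl])
  have Mfst: "fst \<in> measurable M borel"
    by (subst measurable_cong_sets[OF M(1) refl]) (simp add: borel_measurable_continuous_onI continuous_on_fst continuous_on_id)
  have snm: "(snd :: 'a \<times> 'b \<Rightarrow> 'b) \<in> borel_measurable borel"
    by (simp add: borel_measurable_continuous_onI continuous_on_snd continuous_on_id)
  have isnd: "integrable M (snd :: 'a \<times> 'b \<Rightarrow> 'b)"
    using M(3) Mm[OF snm] by (intro M.integrable_const_bound[where B=1]) (auto elim!: AE_mp simp: K'_def)
  define \<nu>' where "\<nu>' C = (LINT z:C|M. snd z)" for C :: "('a \<times> 'b) set"
  have rep': "represents M snd \<nu>'"
    using M isnd by (auto simp: represents_def \<nu>'_def)
  \<comment> \<open>The projection to the first coordinate is again countably additive, so a density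
    for it exists by \<open>additive_borel_represents\<close>; this replaces a disintegration of
    \<open>M\<close> along its fibres.\<close>
  define \<nu> where "\<nu> A = \<nu>' (A \<times> UNIV)" for A :: "'a set"
  have tb: "A \<times> (UNIV::'b set) \<in> sets borel" if "A \<in> sets borel" for A :: "'a set"
    using that by (metis borel_prod pair_measureI sets.top space_borel)
  have ad: "additive_borel \<nu>" unfolding additive_borel_def
  proof (intro allI impI)
    fix A :: "nat \<Rightarrow> 'a set" assume A: "range A \<subseteq> sets borel" "disjoint_family A"
    have "(\<lambda>i. \<nu>' (A i \<times> UNIV)) sums \<nu>' (\<Union>i. A i \<times> UNIV)"
    proof (rule additive_borelD[OF represents_additive[OF rep']])
      show "A i \<times> (UNIV::'b set) \<in> sets borel" for i using A(1) by (intro tb) auto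
      show "disjoint_family (\<lambda>i. A i \<times> (UNIV::'b set))" using A(2) by (auto simp: disjoint_family_on_def)
    qed
    moreover have "(\<Union>i. A i \<times> (UNIV::'b set)) = (\<Union>i. A i) \<times> UNIV" by auto
    ultimately show "(\<lambda>i. \<nu> (A i)) sums \<nu> (\<Union>i. A i)" by (simp add: \<nu>_def)
  qed
  obtain L g0 where Lg0: "represents L g0 \<nu>" using additive_borel_represents[OF ad] by blast
  have Kb: "K \<in> sets borel" using compact_imp_closed[OF K] by simp
  have \<nu>eq: "\<nu> A = (LINT z|M. indicat_real A (fst z) *\<^sub>R snd z)" for A
    unfolding \<nu>_def \<nu>'_def set_lebesgue_integral_def
    by (intro Bochner_Integration.integral_cong refl) (auto split: split_indicator)
  have \<nu>K: "\<nu> (A \<inter> K) = \<nu> A" if A: "A \<in> sets borel" for A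
    unfolding \<nu>eq
  proof (rule integral_cong_AE)
    show "(\<lambda>z. indicat_real (A \<inter> K) (fst z) *\<^sub>R snd z) \<in> borel_measurable M"
      "(\<lambda>z. indicat_real A (fst z) *\<^sub>R snd z) \<in> borel_measurable M"
      using A Kb measurable_compose[OF Mfst, of "indicat_real (A \<inter> K)" borel]
        measurable_compose[OF Mfst, of "indicat_real A" borel] Mm[OF snm]
      by (auto intro!: borel_measurable_scaleR)
    show "AE z in M. indicat_real (A \<inter> K) (fst z) *\<^sub>R snd z = indicat_real A (fst z) *\<^sub>R snd z"
      using M(3) by (rule AE_mp) (auto simp: K'_def split: split_indicator)
  qed
  define g where "g x = indicator K x *\<^sub>R g0 x" for x
  have Lg: "represents L g \<nu>"
    unfolding g_def by (rule represents_cong[OF represents_restrict[OF Lg0 Kb] \<nu>K])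
  have gK: "g x = 0" if "x \<notin> K" for x using that by (simp add: g_def)
  have ind: "(LINT x|L. indicat_real A x *\<^sub>R g x) = (LINT z|M. indicat_real A (fst z) *\<^sub>R snd z)"
    if "A \<in> sets borel" for A
    using Lg that by (simp add: represents_def set_lebesgue_integral_def \<nu>eq[symmetric])
  have Ls: "sets L = sets borel" and gi: "integrable L g" using Lg by (auto simp: represents_def)
  have main: "(\<lambda>i. LINT x|l (r i). \<psi> x *\<^sub>R f (r i) x) \<longlonglongrightarrow> (LINT x|L. \<psi> x *\<^sub>R g x)"
    if c: "continuous_on UNIV \<psi>" and b: "\<And>x. \<bar>\<psi> x\<bar> \<le> S" for \<psi> :: "'a \<Rightarrow> real" and S
  proof -
    have \<psi>m: "\<psi> \<in> borel_measurable borel" by (rule borel_measurable_continuous_onI[OF c])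
    have eL: "(LINT x|L. \<psi> x *\<^sub>R g x) = (LINT z|M. \<psi> (fst z) *\<^sub>R snd z)"
      by (rule integral_indicator_imp_integral_bounded[OF Ls gi isnd Mfst ind \<psi>m b])
    have iM: "integrable M (\<lambda>z. \<psi> (fst z) *\<^sub>R snd z)"
      by (rule integrable_bounded_scaleR[OF isnd measurable_compose[OF Mfst \<psi>m] b])
    have if': "integrable (l i) (\<lambda>x. \<psi> x *\<^sub>R f i x)" for i
      by (rule integrable_bounded_scaleR[OF fi lmr[OF \<psi>m] b])
    show ?thesis
    proof (rule tendsto_componentwise_iff[THEN iffD2], intro ballI)
      fix e :: 'b assume e: "e \<in> Basis"
      have cF: "continuous_on UNIV (\<lambda>z::'a \<times> 'b. \<psi> (fst z) * (snd z \<bullet> e))"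
        by (intro continuous_intros continuous_on_compose2[OF c]) auto
      have Fm: "(\<lambda>z::'a \<times> 'b. \<psi> (fst z) * (snd z \<bullet> e)) \<in> borel_measurable borel"
        by (rule borel_measurable_continuous_onI[OF cF])
      have "(LINT z|\<gamma> i. \<psi> (fst z) * (snd z \<bullet> e)) = (LINT x|l i. \<psi> x *\<^sub>R f i x) \<bullet> e" for i
      proof -
        have "(LINT z|\<gamma> i. \<psi> (fst z) * (snd z \<bullet> e)) = (LINT x|D i. \<psi> x * (sgn (f i x) \<bullet> e))"
          unfolding \<gamma>_def by (subst integral_distr[OF Gm Fm]) (simp add: G_def)
        also have "\<dots> = (LINT x|l i. norm (f i x) * (\<psi> x * (sgn (f i x) \<bullet> e)))"
          unfolding D_def using fm[of i] sgnm[of i] lmr[OF \<psi>m, of i] by (subst integral_real_density) auto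
        also have "\<dots> = (LINT x|l i. (\<psi> x *\<^sub>R f i x) \<bullet> e)"
        proof (intro Bochner_Integration.integral_cong refl)
          fix x
          have "norm (f i x) *\<^sub>R sgn (f i x) = f i x" by (cases "f i x = 0") (simp_all add: sgn_div_norm)
          then have "norm (f i x) * (sgn (f i x) \<bullet> e) = f i x \<bullet> e" by (metis inner_scaleR_left)
          then show "norm (f i x) * (\<psi> x * (sgn (f i x) \<bullet> e)) = (\<psi> x *\<^sub>R f i x) \<bullet> e"
            by (simp add: mult.left_commute)
        qed
        also have "\<dots> = (LINT x|l i. \<psi> x *\<^sub>R f i x) \<bullet> e" using if' by (intro integral_inner_left) auto
        finally show ?thesis .
      qed
      moreover have "(LINT z|M. \<psi> (fst z) * (snd z \<bullet> e)) = (LINT x|L. \<psi> x *\<^sub>R g x) \<bullet> e"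
      proof -
        have "(LINT z|M. \<psi> (fst z) * (snd z \<bullet> e)) = (LINT z|M. (\<psi> (fst z) *\<^sub>R snd z) \<bullet> e)" by simp
        also have "\<dots> = (LINT z|M. \<psi> (fst z) *\<^sub>R snd z) \<bullet> e" using iM by (intro integral_inner_left) auto
        finally show ?thesis by (simp add: eL)
      qed
      ultimately show "(\<lambda>i. (LINT x|l (r i). \<psi> x *\<^sub>R f (r i) x) \<bullet> e) \<longlonglongrightarrow> (LINT x|L. \<psi> x *\<^sub>R g x) \<bullet> e"
        using lim[OF cF] by simp
    qed
  qed
  have "(\<lambda>i. LINT x|l (r i). \<psi> x *\<^sub>R f (r i) x) \<longlonglongrightarrow> (LINT x|L. \<psi> x *\<^sub>R g x)"
    if c: "continuous_on UNIV \<psi>" for \<psi> :: "'a \<Rightarrow> real"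
  proof -
    have "compact (\<psi> ` K)" by (rule compact_continuous_image[OF continuous_on_subset[OF c] K]) simp
    from compact_imp_bounded[OF this] obtain S where S: "\<And>x. x \<in> K \<Longrightarrow> \<bar>\<psi> x\<bar> \<le> S" by (auto simp: bounded_iff)
    \<comment> \<open>All measures in play live on \<open>K\<close>, where \<psi> is bounded;
      truncation at that bound changes none of the integrals and reduces to
      \<open>main\<close>.\<close>
    define S' where "S' = max 0 S"
    have S': "0 \<le> S'" "\<And>x. x \<in> K \<Longrightarrow> \<bar>\<psi> x\<bar> \<le> S'" using S by (auto simp: S'_def le_max_iff_disj)
    define \<psi>' where "\<psi>' x = max (- S') (min S' (\<psi> x))" for x
    have c': "continuous_on UNIV \<psi>'" unfolding \<psi>'_def by (intro continuous_intros c)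
    have b': "\<bar>\<psi>' x\<bar> \<le> S'" for x using S'(1) by (auto simp: \<psi>'_def max_def min_def)
    have e: "\<psi>' x = \<psi> x" if "x \<in> K" for x using S'(2)[OF that] by (auto simp: \<psi>'_def max_def min_def)
    have e1: "\<psi>' x *\<^sub>R g x = \<psi> x *\<^sub>R g x" for x using e[of x] gK[of x] by (cases "x \<in> K") auto
    have e2: "\<psi>' x *\<^sub>R f i x = \<psi> x *\<^sub>R f i x" for i x using e[of x] supp[of x i] by (cases "x \<in> K") auto
    show ?thesis using main[OF c' b'] unfolding e1 e2 .
  qed
  from that[OF r Lg gK this] show ?thesis .
qed

section \<open>Mollification of vector measures\<close>

text \<open>Neither compact support nor boundedness is included, in accordance with mollifier
  semigroups. Continuity gives local bounds, and the finite integral gives small tails.\<close>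

definition kernel :: "('a::euclidean_space \<Rightarrow> real) \<Rightarrow> bool" where
  "kernel k \<longleftrightarrow> continuous_on UNIV k \<and> (\<forall>x. 0 \<le> k x) \<and> has_bochner_integral lborel k 1"

text \<open>This mollifies the vector measure with density \<open>f\<close> against
  \<open>l\<close>. With \<open>l = lborel\<close> it is the convolution of a function, so
  mollifications can be mollified again.\<close>

definition conv :: "('a::euclidean_space \<Rightarrow> real) \<Rightarrow> 'a measure \<Rightarrow> ('a \<Rightarrow> 'b::euclidean_space) \<Rightarrow> 'a \<Rightarrow> 'b" where
  "conv k l f x = (LINT y|l. k (x - y) *\<^sub>R f y)"

lemma kernelD:
  assumes "kernel k"
  shows "continuous_on UNIV k" "k \<in> borel_measurable borel" "0 \<le> k x" "integrable lborel k"
    "(LINT x|lborel. k x) = 1" "integrable lborel (\<lambda>x. k (x - y))" "(LINT x|lborel. k (x - y)) = 1"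
proof -
  show 1: "continuous_on UNIV k" "0 \<le> k x" "integrable lborel k" "(LINT x|lborel. k x) = 1"
    using assms by (auto simp: kernel_def has_bochner_integral_iff)
  show 2: "k \<in> borel_measurable borel" by (rule borel_measurable_continuous_onI[OF 1(1)])
  show "integrable lborel (\<lambda>x. k (x - y))" "(LINT x|lborel. k (x - y)) = 1"
    using integrable_lborel_translate[OF 1(3), of "- y"] integral_lborel_translate[OF 2, of "- y"] 1(4)
    by auto
qed

lemma sigma_finite_pair_lborel:
  fixes l :: "'a::euclidean_space measure"
  assumes "sigma_finite_measure l"
  shows "pair_sigma_finite l (lborel :: 'a measure)"
  using assms by (simp add: pair_sigma_finite_def sigma_finite_lborel)

lemma kernel_pair_measurable:
  fixes l :: "'a::euclidean_space measure"
  assumes "kernel k" and s: "sets l = sets borel"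
  shows "(\<lambda>(y, x). k (x - y)) \<in> borel_measurable (l \<Otimes>\<^sub>M lborel)"
proof -
  have "continuous_on UNIV (\<lambda>p::'a \<times> 'a. k (snd p - fst p))"
    by (rule continuous_on_compose2[OF kernelD(1)[OF assms(1)]]) (auto intro!: continuous_intros)
  then have "(\<lambda>p::'a \<times> 'a. k (snd p - fst p)) \<in> borel_measurable (borel \<Otimes>\<^sub>M borel)"
    unfolding borel_prod by (rule borel_measurable_continuous_onI)
  moreover have "sets (l \<Otimes>\<^sub>M lborel) = sets (borel \<Otimes>\<^sub>M (borel :: 'a measure))"
    using s by (intro sets_pair_measure_cong) auto
  ultimately show ?thesis
    by (subst measurable_cong_sets[OF _ refl]) (auto simp: split_beta)
qed

text \<open>\<open>g\<close> is a bounded weight in \<open>x\<close> that enters the tail and polar estimates.\<close>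

lemma kernel_pair_integrable:
  fixes l :: "'a::euclidean_space measure" and f :: "'a \<Rightarrow> 'b::euclidean_space"
  assumes k: "kernel k" and l: "sigma_finite_measure l" "sets l = sets borel" and f: "integrable l f"
    and g: "g \<in> borel_measurable borel" "\<And>x. \<bar>g x\<bar> \<le> B"
  shows "integrable (l \<Otimes>\<^sub>M lborel) (\<lambda>(y, x). (g x * k (x - y)) *\<^sub>R f y)"
proof -
  interpret pair_sigma_finite l "lborel :: 'a measure" by (rule sigma_finite_pair_lborel[OF l(1)])
  have fm: "f \<in> borel_measurable l" by (rule borel_measurable_integrable[OF f])
  have gm: "(\<lambda>x. g x) \<in> borel_measurable lborel" using g(1) by simp
  have B0: "0 \<le> B" using g(2)[of 0] by linarith
  have m: "(\<lambda>(y, x). (g x * k (x - y)) *\<^sub>R f y) \<in> borel_measurable (l \<Otimes>\<^sub>M lborel)"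
  proof -
    have "(\<lambda>p. g (snd p) * (case p of (y, x) \<Rightarrow> k (x - y))) \<in> borel_measurable (l \<Otimes>\<^sub>M lborel)"
      by (intro borel_measurable_times measurable_compose[OF measurable_snd gm] kernel_pair_measurable[OF k l(2)])
    moreover have "(\<lambda>p. f (fst p)) \<in> borel_measurable (l \<Otimes>\<^sub>M lborel)"
      by (rule measurable_compose[OF measurable_fst fm])
    ultimately have "(\<lambda>p. (g (snd p) * (case p of (y, x) \<Rightarrow> k (x - y))) *\<^sub>R f (fst p)) \<in> borel_measurable (l \<Otimes>\<^sub>M lborel)"
      by (rule borel_measurable_scaleR)
    then show ?thesis by (simp add: split_beta)
  qed
  have m1: "(\<lambda>(y, x). (1 * k (x - y)) *\<^sub>R f y) \<in> borel_measurable (l \<Otimes>\<^sub>M lborel)"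
  proof -
    have "(\<lambda>p. (case p of (y, x) \<Rightarrow> k (x - y)) *\<^sub>R f (fst p)) \<in> borel_measurable (l \<Otimes>\<^sub>M lborel)"
      by (intro borel_measurable_scaleR measurable_compose[OF measurable_fst fm] kernel_pair_measurable[OF k l(2)])
    then show ?thesis by (simp add: split_beta)
  qed
  \<comment> \<open>Without the weight the inner integral of the norm is \<open>norm (f y)\<close>
    by translation invariance; the bounded weight \<open>g\<close> is restored by
    domination.\<close>
  have i1: "integrable (l \<Otimes>\<^sub>M lborel) (\<lambda>(y, x). (1 * k (x - y)) *\<^sub>R f y)"
  proof (rule Fubini_integrable[OF m1])
    have eq: "(LINT x|lborel. norm ((1 * k (x - y)) *\<^sub>R f y)) = norm (f y)" for y
      using kernelD(6,7)[OF k, of y] kernelD(3)[OF k] by simp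
    show "integrable l (\<lambda>y. LINT x|lborel. norm (case (y, x) of (y, x) \<Rightarrow> (1 * k (x - y)) *\<^sub>R f y))"
      by (simp only: prod.case eq integrable_norm[OF f])
    show "AE y in l. integrable lborel (\<lambda>x. case (y, x) of (y, x) \<Rightarrow> (1 * k (x - y)) *\<^sub>R f y)"
      using kernelD(6)[OF k] by (intro AE_I2) simp
  qed
  show ?thesis
  proof (rule Bochner_Integration.integrable_bound[OF _ m])
    show "integrable (l \<Otimes>\<^sub>M lborel) (\<lambda>p. B * norm (case p of (y, x) \<Rightarrow> (1 * k (x - y)) *\<^sub>R f y))"
      using integrable_norm[OF i1] by simp
    show "AE p in l \<Otimes>\<^sub>M lborel. norm (case p of (y, x) \<Rightarrow> (g x * k (x - y)) *\<^sub>R f y)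
        \<le> norm (B * norm (case p of (y, x) \<Rightarrow> (1 * k (x - y)) *\<^sub>R f y))"
    proof (intro AE_I2)
      fix p :: "'a \<times> 'a"
      obtain y x where p: "p = (y, x)" by (cases p)
      have "\<bar>g x\<bar> * (\<bar>k (x - y)\<bar> * norm (f y)) \<le> \<bar>B\<bar> * (\<bar>k (x - y)\<bar> * norm (f y))"
        using g(2)[of x] by (intro mult_right_mono) auto
      then show "norm (case p of (y, x) \<Rightarrow> (g x * k (x - y)) *\<^sub>R f y)
        \<le> norm (B * norm (case p of (y, x) \<Rightarrow> (1 * k (x - y)) *\<^sub>R f y))"
        by (simp add: p abs_mult mult.assoc)
    qed
  qed
qed

lemma kernel_Fubini:
  fixes l :: "'a::euclidean_space measure" and f :: "'a \<Rightarrow> 'b::euclidean_space"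
  assumes k: "kernel k" and l: "sigma_finite_measure l" "sets l = sets borel" and f: "integrable l f"
    and g: "g \<in> borel_measurable borel" "\<And>x. \<bar>g x\<bar> \<le> B"
  shows "AE x in lborel. integrable l (\<lambda>y. (g x * k (x - y)) *\<^sub>R f y)"
    "integrable lborel (\<lambda>x. LINT y|l. (g x * k (x - y)) *\<^sub>R f y)"
    "(LINT x|lborel. LINT y|l. (g x * k (x - y)) *\<^sub>R f y) =
     (LINT y|l. LINT x|lborel. (g x * k (x - y)) *\<^sub>R f y)"
proof -
  interpret pair_sigma_finite l "lborel :: 'a measure" by (rule sigma_finite_pair_lborel[OF l(1)])
  note i = kernel_pair_integrable[OF assms]
  show "AE x in lborel. integrable l (\<lambda>y. (g x * k (x - y)) *\<^sub>R f y)" by (rule AE_integrable_snd[OF i])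
  show "integrable lborel (\<lambda>x. LINT y|l. (g x * k (x - y)) *\<^sub>R f y)" by (rule integrable_snd[OF i])
  show "(LINT x|lborel. LINT y|l. (g x * k (x - y)) *\<^sub>R f y) =
     (LINT y|l. LINT x|lborel. (g x * k (x - y)) *\<^sub>R f y)"
    by (rule Fubini_integral[OF i])
qed

lemma conv_integrable:
  fixes l :: "'a::euclidean_space measure" and f :: "'a \<Rightarrow> 'b::euclidean_space"
  assumes k: "kernel k" and l: "sigma_finite_measure l" "sets l = sets borel" and f: "integrable l f"
  shows "integrable lborel (conv k l f)" "AE x in lborel. integrable l (\<lambda>y. k (x - y) *\<^sub>R f y)"
    "(LINT x|lborel. conv k l f x) = (LINT y|l. f y)"
  using kernel_Fubini[OF assms, of "\<lambda>_. 1" 1] kernelD(6,7)[OF k]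
  by (auto simp: conv_def[abs_def])

lemma norm_conv_le:
  fixes l :: "'a::euclidean_space measure" and f :: "'a \<Rightarrow> 'b::euclidean_space"
  assumes k: "kernel k"
  shows "norm (conv k l f x) \<le> conv k l (\<lambda>y. norm (f y)) x"
  unfolding conv_def using integral_norm_bound[of l "\<lambda>y. k (x - y) *\<^sub>R f y"] kernelD(3)[OF k] by simp

lemma conv_norm_integral_le:
  fixes l :: "'a::euclidean_space measure" and f :: "'a \<Rightarrow> 'b::euclidean_space"
  assumes k: "kernel k" and l: "sigma_finite_measure l" "sets l = sets borel" and f: "integrable l f"
  shows "(LINT x|lborel. norm (conv k l f x)) \<le> (LINT y|l. norm (f y))"
proof -
  have fn: "integrable l (\<lambda>y. norm (f y))" using f by simp
  have "(LINT x|lborel. norm (conv k l f x)) \<le> (LINT x|lborel. conv k l (\<lambda>y. norm (f y)) x)"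
    by (intro integral_mono integrable_norm conv_integrable[OF k l] f fn norm_conv_le[OF k])
  then show ?thesis using conv_integrable(3)[OF k l fn] by simp
qed

lemma integrable_bounded_support:
  fixes l :: "'a::euclidean_space measure" and f :: "'a \<Rightarrow> 'b::euclidean_space"
  assumes s: "sets l = sets borel" and f: "integrable l f" and supp: "\<And>x. R < norm x \<Longrightarrow> f x = 0"
    and \<psi>: "continuous_on UNIV \<psi>"
  shows "integrable l (\<lambda>y. \<psi> y *\<^sub>R f y)"
proof -
  have "compact (\<psi> ` cball 0 R)"
    by (rule compact_continuous_image[OF continuous_on_subset[OF \<psi>] compact_cball]) simp
  from compact_imp_bounded[OF this] obtain S where "\<forall>x\<in>cball 0 R. \<bar>\<psi> x\<bar> \<le> S"
    by (auto simp: bounded_iff)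
  then have S: "\<bar>\<psi> x\<bar> \<le> S" if "norm x \<le> R" for x using that by simp
  have pm: "\<psi> \<in> borel_measurable l"
    by (subst measurable_cong_sets[OF s refl]) (rule borel_measurable_continuous_onI[OF \<psi>])
  show ?thesis
  proof (rule Bochner_Integration.integrable_bound)
    show "integrable l (\<lambda>y. S * norm (f y))" using f by simp
    show "(\<lambda>y. \<psi> y *\<^sub>R f y) \<in> borel_measurable l" using pm f by auto
    show "AE y in l. norm (\<psi> y *\<^sub>R f y) \<le> norm (S * norm (f y))"
    proof (intro AE_I2)
      fix y
      show "norm (\<psi> y *\<^sub>R f y) \<le> norm (S * norm (f y))"
      proof (cases "norm y \<le> R")
        case True
        have "\<bar>\<psi> y\<bar> * norm (f y) \<le> \<bar>S\<bar> * norm (f y)" using S[OF True] by (intro mult_right_mono) auto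
        then show ?thesis by (simp add: abs_mult)
      next
        case False then show ?thesis using supp[of y] by simp
      qed
    qed
  qed
qed

lemma continuous_kernel_shift:
  "kernel k \<Longrightarrow> continuous_on UNIV (\<lambda>y. k (x - y))"
  by (rule continuous_on_compose2[OF kernelD(1)]) (auto intro!: continuous_intros)

text \<open>Fubini, applied at a point \<open>x\<close> where \<open>ix\<close> holds. The kernels
  may be unbounded, so \<open>ix\<close> is a genuine condition on \<open>x\<close>; by
  \<open>conv_integrable\<close> almost every \<open>x\<close> satisfies it.\<close>

lemma conv_semigroup:
  fixes l :: "'a::euclidean_space measure" and f :: "'a \<Rightarrow> 'b::euclidean_space"
  assumes k: "kernel k1" "kernel k2" "kernel k3" and l: "sigma_finite_measure l" "sets l = sets borel"
    and f: "integrable l f"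
    and semi: "\<And>x. has_bochner_integral lborel (\<lambda>w. k1 (x - w) * k2 w) (k3 x)"
    and ix: "integrable l (\<lambda>y. k3 (x - y) *\<^sub>R f y)"
  shows "conv k3 l f x = conv k1 lborel (conv k2 l f) x"
proof -
  interpret pair_sigma_finite l "lborel :: 'a measure" by (rule sigma_finite_pair_lborel[OF l(1)])
  have fm: "f \<in> borel_measurable l" by (rule borel_measurable_integrable[OF f])
  have k1m: "(\<lambda>w. k1 (x - w)) \<in> borel_measurable lborel"
    using borel_measurable_continuous_onI[OF continuous_kernel_shift[OF k(1)]] by simp
  have semi': "integrable lborel (\<lambda>w. k1 (x - w) * k2 (w - y))"
    "(LINT w|lborel. k1 (x - w) * k2 (w - y)) = k3 (x - y)" for y
  proof -
    have h: "integrable lborel (\<lambda>w. k1 (x - y - w) * k2 w)" "(LINT w|lborel. k1 (x - y - w) * k2 w) = k3 (x - y)"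
      using semi[of "x - y"] by (auto simp: has_bochner_integral_iff)
    from integrable_lborel_translate[OF h(1), of "- y"] integral_lborel_translate[of "\<lambda>w. k1 (x - y - w) * k2 w" "- y"] h
    show "integrable lborel (\<lambda>w. k1 (x - w) * k2 (w - y))"
      "(LINT w|lborel. k1 (x - w) * k2 (w - y)) = k3 (x - y)" by (auto simp: borel_measurable_integrable)
  qed
  let ?F = "\<lambda>(y, w). (k1 (x - w) * k2 (w - y)) *\<^sub>R f y"
  have m: "?F \<in> borel_measurable (l \<Otimes>\<^sub>M lborel)"
  proof -
    have "(\<lambda>p. (k1 (x - snd p) * (case p of (y, w) \<Rightarrow> k2 (w - y))) *\<^sub>R f (fst p)) \<in> borel_measurable (l \<Otimes>\<^sub>M lborel)"
      by (intro borel_measurable_scaleR borel_measurable_times measurable_compose[OF measurable_snd k1m]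
          kernel_pair_measurable[OF k(2) l(2)] measurable_compose[OF measurable_fst fm])
    then show ?thesis by (simp add: split_beta)
  qed
  have i: "integrable (l \<Otimes>\<^sub>M lborel) ?F"
  proof (rule Fubini_integrable[OF m])
    have eq: "(LINT w|lborel. norm ((k1 (x - w) * k2 (w - y)) *\<^sub>R f y)) = norm (k3 (x - y) *\<^sub>R f y)" for y
      using semi'[of y] kernelD(3)[OF k(1)] kernelD(3)[OF k(2)] kernelD(3)[OF k(3)] by (simp add: abs_mult)
    show "integrable l (\<lambda>y. LINT w|lborel. norm (?F (y, w)))"
      by (simp only: prod.case eq integrable_norm[OF ix])
    show "AE y in l. integrable lborel (\<lambda>w. ?F (y, w))"
      using semi' by (intro AE_I2) simp
  qed
  have "conv k1 lborel (conv k2 l f) x = (LINT w|lborel. LINT y|l. (k1 (x - w) * k2 (w - y)) *\<^sub>R f y)"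
    unfolding conv_def
  proof (rule Bochner_Integration.integral_cong[OF refl])
    fix w
    show "k1 (x - w) *\<^sub>R (LINT y|l. k2 (w - y) *\<^sub>R f y) = (LINT y|l. (k1 (x - w) * k2 (w - y)) *\<^sub>R f y)"
      by (simp add: scaleR_scaleR[symmetric] del: scaleR_scaleR)
  qed
  also have "\<dots> = (LINT y|l. LINT w|lborel. (k1 (x - w) * k2 (w - y)) *\<^sub>R f y)"
    by (rule Fubini_integral[OF i])
  also have "\<dots> = (LINT y|l. k3 (x - y) *\<^sub>R f y)" using semi' by simp
  finally show ?thesis by (simp add: conv_def)
qed

text \<open>Mollifying by \<open>k3\<close> amounts to mollifying by \<open>k2\<close> and then by
  \<open>k1\<close>, and the second step contracts the L1 norm. This is the source of the
  monotonicity of the levels of \<eta>.\<close>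

lemma conv_norm_mono_semigroup:
  fixes l :: "'a::euclidean_space measure" and f :: "'a \<Rightarrow> 'b::euclidean_space"
  assumes k: "kernel k1" "kernel k2" "kernel k3" and l: "sigma_finite_measure l" "sets l = sets borel"
    and f: "integrable l f"
    and semi: "\<And>x. has_bochner_integral lborel (\<lambda>w. k1 (x - w) * k2 w) (k3 x)"
  shows "(LINT x|lborel. norm (conv k3 l f x)) \<le> (LINT x|lborel. norm (conv k2 l f x))"
proof -
  have i2: "integrable lborel (conv k2 l f)" by (rule conv_integrable[OF k(2) l f])
  have "(LINT x|lborel. norm (conv k3 l f x)) = (LINT x|lborel. norm (conv k1 lborel (conv k2 l f) x))"
  proof (rule integral_cong_AE)
    show "(\<lambda>x. norm (conv k3 l f x)) \<in> borel_measurable lborel"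
      using conv_integrable(1)[OF k(3) l f] by auto
    show "(\<lambda>x. norm (conv k1 lborel (conv k2 l f) x)) \<in> borel_measurable lborel"
      using conv_integrable(1)[OF k(1) sigma_finite_lborel _ i2] by auto
    show "AE x in lborel. norm (conv k3 l f x) = norm (conv k1 lborel (conv k2 l f) x)"
      using conv_integrable(2)[OF k(3) l f] by (rule AE_mp) (use conv_semigroup[OF k l f semi] in auto)
  qed
  also have "\<dots> \<le> (LINT x|lborel. norm (conv k2 l f x))"
    by (rule conv_norm_integral_le[OF k(1) sigma_finite_lborel _ i2]) simp
  finally show ?thesis .
qed

section \<open>Tails of mollifications and L1 convergence at a fixed scale\<close>

definition kernel_tail :: "('a::euclidean_space \<Rightarrow> real) \<Rightarrow> real \<Rightarrow> real" where
  "kernel_tail k r = (LINT z|lborel. indicator {z. r < norm z} z * k z)"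

lemma kernel_tail_bounds:
  assumes k: "kernel k"
  shows "0 \<le> kernel_tail k r" "integrable lborel (\<lambda>z. indicator {z. r < norm z} z * k z)"
proof -
  have [measurable]: "{z::'a. r < norm z} \<in> sets borel" by measurable
  show "integrable lborel (\<lambda>z. indicator {z. r < norm z} z * k z)"
    using integrable_mult_indicator[OF _ kernelD(4)[OF k], of "{z. r < norm z}"] by simp
  show "0 \<le> kernel_tail k r" unfolding kernel_tail_def using kernelD(3)[OF k] by (intro Bochner_Integration.integral_nonneg) auto
qed

lemma kernel_tail_tendsto:
  assumes k: "kernel (k :: 'a::euclidean_space \<Rightarrow> real)"
  shows "(\<lambda>n. kernel_tail k (real n)) \<longlonglongrightarrow> 0"
proof -
  have km[measurable]: "k \<in> borel_measurable borel" by (rule kernelD[OF k])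
  have "(\<lambda>n. LINT z|lborel. indicator {z. real n < norm z} z * k z) \<longlonglongrightarrow> (LINT z|(lborel::'a measure). 0)"
  proof (rule integral_dominated_convergence[where w=k])
    show "AE z in lborel. (\<lambda>n. indicator {z. real n < norm z} z * k z) \<longlonglongrightarrow> 0"
    proof (intro AE_I2)
      fix z :: 'a
      obtain N where N: "norm z \<le> real N" using real_arch_simple by blast
      have "\<forall>\<^sub>F n in sequentially. indicator {z. real n < norm z} z * k z = 0"
        using N by (intro eventually_sequentiallyI[of N]) (auto split: split_indicator)
      then show "(\<lambda>n. indicator {z. real n < norm z} z * k z) \<longlonglongrightarrow> 0" by (rule tendsto_eventually)
    qed
    show "AE z in lborel. norm (indicator {z. real n < norm z} z * k z) \<le> k z" for n
      using kernelD(3)[OF k] by (intro AE_I2) (auto split: split_indicator)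
  qed (use kernelD(4)[OF k] in auto)
  then show ?thesis by (simp add: kernel_tail_def)
qed

text \<open>If \<open>norm y \<le> R0\<close> and \<open>R0 + r < norm x\<close>, then
  \<open>r < norm (x - y)\<close>: mass leaves the ball of radius \<open>R0 + r\<close> only through
  the tail of the kernel. The bound depends on the measure through its total mass alone.\<close>

lemma conv_tail:
  fixes l :: "'a::euclidean_space measure" and f :: "'a \<Rightarrow> 'b::euclidean_space"
  assumes k: "kernel k" and l: "sigma_finite_measure l" "sets l = sets borel" and f: "integrable l f"
    and supp: "\<And>x. R0 < norm x \<Longrightarrow> f x = 0"
  shows "(LINT x|lborel. indicator {x. R0 + r < norm x} x * norm (conv k l f x)) \<le> kernel_tail k r * (LINT y|l. norm (f y))"
proof -
  let ?I = "indicator {x::'a. R0 + r < norm x} :: 'a \<Rightarrow> real"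
  have Im: "?I \<in> borel_measurable borel" by measurable
  have Ib: "\<bar>?I x\<bar> \<le> 1" for x by (auto split: split_indicator)
  have fn: "integrable l (\<lambda>y. norm (f y))" using f by simp
  note F = kernel_Fubini[OF k l fn Im Ib]
  have le: "?I x * norm (conv k l f x) \<le> (LINT y|l. (?I x * k (x - y)) *\<^sub>R norm (f y))" for x
    using mult_left_mono[OF norm_conv_le[OF k, of l f x], of "?I x"]
    by (simp add: conv_def mult.assoc)
  have "(LINT x|lborel. ?I x * norm (conv k l f x)) \<le> (LINT x|lborel. LINT y|l. (?I x * k (x - y)) *\<^sub>R norm (f y))"
  proof (rule integral_mono[OF _ F(2) le])
    show "integrable lborel (\<lambda>x. ?I x * norm (conv k l f x))"
      using integrable_bounded_scaleR[OF integrable_norm[OF conv_integrable(1)[OF k l f]], of ?I 1] Im Ib by simp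
  qed
  also have "\<dots> = (LINT y|l. LINT x|lborel. (?I x * k (x - y)) *\<^sub>R norm (f y))" by (rule F(3))
  also have "\<dots> \<le> (LINT y|l. kernel_tail k r * norm (f y))"
  proof (rule integral_mono')
    show "integrable l (\<lambda>y. kernel_tail k r * norm (f y))" using fn by simp
    show "0 \<le> kernel_tail k r * norm (f y)" for y using kernel_tail_bounds(1)[OF k] by simp
    fix y
    show "(LINT x|lborel. (?I x * k (x - y)) *\<^sub>R norm (f y)) \<le> kernel_tail k r * norm (f y)"
    proof (cases "norm y \<le> R0")
      case True
      have "(LINT x|lborel. ?I x * k (x - y)) \<le> (LINT x|lborel. indicator {z. r < norm z} (x - y) * k (x - y))"
      proof (rule integral_mono')
        show "integrable lborel (\<lambda>x. indicator {z. r < norm z} (x - y) * k (x - y))"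
          using integrable_lborel_translate[OF kernel_tail_bounds(2)[OF k], of r "- y"] by simp
        fix x
        have "R0 + r < norm x \<Longrightarrow> r < norm (x - y)" using norm_triangle_sub[of x y] True by linarith
        then show "?I x * k (x - y) \<le> indicator {z. r < norm z} (x - y) * k (x - y)"
          using kernelD(3)[OF k] by (auto split: split_indicator)
        show "0 \<le> indicator {z. r < norm z} (x - y) * k (x - y)" using kernelD(3)[OF k] by simp
      qed
      also have "\<dots> = kernel_tail k r"
      proof -
        have "(\<lambda>z. indicator {z. r < norm z} z * k z) \<in> borel_measurable borel"
          using borel_measurable_integrable[OF kernel_tail_bounds(2)[OF k, of r]] by simp
        from integral_lborel_translate[OF this, of "- y"] show ?thesis by (simp add: kernel_tail_def)
      qed
      finally show ?thesis by (simp add: mult_right_mono)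
    next
      case False then show ?thesis using supp[of y] by simp
    qed
  qed
  finally show ?thesis by simp
qed

text \<open>Inside a large ball the local bound allows dominated convergence; outside it the uniform
  tail bound is inherited by the limit through Fatou.\<close>

lemma tight_tendsto_L1:
  fixes g :: "nat \<Rightarrow> 'a::euclidean_space \<Rightarrow> 'b::euclidean_space"
  assumes gi: "\<And>n. integrable lborel (g n)" and hi: "integrable lborel h"
    and lim: "\<And>x. (\<lambda>n. g n x) \<longlonglongrightarrow> h x"
    and bd: "\<And>R. \<exists>C. \<forall>n x. norm x \<le> R \<longrightarrow> norm (g n x) \<le> C"
    and tail: "\<And>e. 0 < e \<Longrightarrow> \<exists>R. \<forall>n. (LINT x|lborel. indicator {x. R < norm x} x * norm (g n x)) \<le> e"
  shows "(\<lambda>n. LINT x|lborel. norm (g n x - h x)) \<longlonglongrightarrow> 0"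
proof (rule LIMSEQ_I)
  fix e :: real assume e: "0 < e"
  have gm: "g n \<in> borel_measurable borel" and hm: "h \<in> borel_measurable borel" for n
    using gi[of n] hi by auto
  have Im: "indicat_real {x::'a. R < norm x} \<in> borel_measurable borel" for R by measurable
  have ii: "integrable lborel (\<lambda>x. indicat_real {x. R < norm x} x * norm (k x))"
    if "integrable lborel k" for R and k :: "'a \<Rightarrow> 'b"
    using integrable_bounded_scaleR[OF integrable_norm[OF that], of "indicat_real {x. R < norm x}" 1] Im
    by (simp add: indicator_def)
  obtain R where R: "\<And>n. (LINT x|lborel. indicator {x. R < norm x} x * norm (g n x)) \<le> e / 4"
    using tail[of "e / 4"] e by auto
  have Rh: "(LINT x|lborel. indicator {x. R < norm x} x * norm (h x)) \<le> e / 4"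
  proof -
    have "(\<integral>\<^sup>+x. ennreal (indicator {x. R < norm x} x * norm (h x)) \<partial>lborel)
       \<le> liminf (\<lambda>n. \<integral>\<^sup>+x. ennreal (indicator {x. R < norm x} x * norm (g n x)) \<partial>lborel)"
    proof -
      have "ennreal (indicator {x. R < norm x} x * norm (h x)) =
          liminf (\<lambda>n. ennreal (indicator {x. R < norm x} x * norm (g n x)))" for x
        using lim[of x] by (intro lim_imp_Liminf[symmetric] tendsto_ennrealI tendsto_mult tendsto_const tendsto_norm) auto
      then show ?thesis using Im gm by (simp only:) (intro nn_integral_liminf, measurable)
    qed
    also have "\<dots> \<le> liminf (\<lambda>n::nat. ennreal (e / 4))"
      using R ii[OF gi] by (intro Liminf_mono always_eventually allI)
        (subst nn_integral_eq_integral, auto intro!: ennreal_leI)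
    finally have "ennreal (LINT x|lborel. indicator {x. R < norm x} x * norm (h x)) \<le> ennreal (e / 4)"
      using ii[OF hi] by (subst (asm) nn_integral_eq_integral) (auto simp: Liminf_const)
    then show ?thesis using e by (simp add: ennreal_le_iff)
  qed
  obtain C where C: "\<And>n x. norm x \<le> R \<Longrightarrow> norm (g n x) \<le> C" using bd[of R] by blast
  have Ch: "norm (h x) \<le> C" if "norm x \<le> R" for x
    using LIMSEQ_le_const2[OF tendsto_norm[OF lim[of x]], of C] C[OF that] by auto
  have cm: "indicat_real (cball (0::'a) R) \<in> borel_measurable borel"
    by (rule borel_measurable_indicator) (rule borel_closed[OF closed_cball])
  have il: "integrable lborel (\<lambda>x. indicat_real (cball 0 R) x * norm (g n x - h x))" for n
    using integrable_bounded_scaleR[OF integrable_norm[OF Bochner_Integration.integrable_diff[OF gi hi]],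
        of "indicat_real (cball 0 R)" 1 n] cm by (simp add: indicator_def)
  have "(\<lambda>n. LINT x|lborel. indicat_real (cball 0 R) x * norm (g n x - h x)) \<longlonglongrightarrow> (LINT x|(lborel::'a measure). 0)"
  proof (rule integral_dominated_convergence[where w="\<lambda>x. indicat_real (cball 0 R) x * (2 * C)"])
    show "integrable lborel (\<lambda>x::'a. indicat_real (cball 0 R) x * (2 * C))"
      by (intro integrable_mult_left integrable_real_indicator) (auto simp: emeasure_bounded_finite[unfolded infinity_ennreal_def])
    show "AE x in lborel. (\<lambda>n. indicat_real (cball 0 R) x * norm (g n x - h x)) \<longlonglongrightarrow> 0"
    proof (intro AE_I2)
      fix x
      have "(\<lambda>n. norm (g n x - h x)) \<longlonglongrightarrow> 0"
        using lim[of x] by (simp add: LIM_zero tendsto_norm_zero)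
      from tendsto_mult[OF tendsto_const this, of "indicat_real (cball 0 R) x"]
      show "(\<lambda>n. indicat_real (cball 0 R) x * norm (g n x - h x)) \<longlonglongrightarrow> 0" by simp
    qed
    show "AE x in lborel. norm (indicat_real (cball 0 R) x * norm (g n x - h x)) \<le> indicat_real (cball 0 R) x * (2 * C)" for n
    proof (intro AE_I2)
      fix x
      show "norm (indicat_real (cball 0 R) x * norm (g n x - h x)) \<le> indicat_real (cball 0 R) x * (2 * C)"
        using C[of x n] Ch[of x] norm_triangle_ineq4[of "g n x" "h x"] by (cases "norm x \<le> R") auto
    qed
    show "(\<lambda>x. indicat_real (cball 0 R) x * norm (g n x - h x)) \<in> borel_measurable lborel" for n
      by (rule borel_measurable_integrable[OF il])
  qed simp
  from LIMSEQ_D[OF this, of "e / 4"] e obtain N where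
    N: "\<And>n. N \<le> n \<Longrightarrow> \<bar>LINT x|lborel. indicat_real (cball 0 R) x * norm (g n x - h x)\<bar> < e / 4" by auto
  have "norm ((LINT x|lborel. norm (g n x - h x)) - 0) < e" if "N \<le> n" for n
  proof -
    have "(LINT x|lborel. norm (g n x - h x)) \<le> (LINT x|lborel. indicat_real (cball 0 R) x * norm (g n x - h x) +
       indicator {x. R < norm x} x * norm (g n x) + indicator {x. R < norm x} x * norm (h x))"
    proof (rule integral_mono)
      show "integrable lborel (\<lambda>x. norm (g n x - h x))" using gi hi by simp
      show "integrable lborel (\<lambda>x. indicat_real (cball 0 R) x * norm (g n x - h x) +
       indicator {x. R < norm x} x * norm (g n x) + indicator {x. R < norm x} x * norm (h x))"
        by (intro Bochner_Integration.integrable_add il ii gi hi)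
      show "norm (g n x - h x) \<le> indicat_real (cball 0 R) x * norm (g n x - h x) +
       indicator {x. R < norm x} x * norm (g n x) + indicator {x. R < norm x} x * norm (h x)" for x
        using norm_triangle_ineq4[of "g n x" "h x"] by (cases "norm x \<le> R") auto
    qed
    also have "\<dots> = (LINT x|lborel. indicat_real (cball 0 R) x * norm (g n x - h x)) +
       (LINT x|lborel. indicator {x. R < norm x} x * norm (g n x)) + (LINT x|lborel. indicator {x. R < norm x} x * norm (h x))"
      using il ii[OF gi] ii[OF hi] by simp
    also have "\<dots> < e" using N[OF that] R[of n] Rh e by linarith
    finally show ?thesis by simp
  qed
  then show "\<exists>no. \<forall>n\<ge>no. norm ((LINT x|lborel. norm (g n x - h x)) - 0) < e" by blast
qed

text \<open>For \<open>norm x \<le> R\<close> and \<open>norm y \<le> R0\<close> the kernel is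
  evaluated only in the ball of radius \<open>R + R0\<close>, where continuity bounds it. The
  constant is quantified before \<open>l\<close> and \<open>f\<close>, so it serves a whole sequence
  of measures.\<close>

lemma conv_local_bound:
  fixes f :: "'a::euclidean_space \<Rightarrow> 'b::euclidean_space"
  assumes k: "kernel k"
  shows "\<exists>S. \<forall>(l :: 'a measure) f :: 'a \<Rightarrow> 'b. sets l = sets borel \<longrightarrow> integrable l f \<longrightarrow> (\<forall>x. R0 < norm x \<longrightarrow> f x = 0) \<longrightarrow>
     (\<forall>x. norm x \<le> R \<longrightarrow> norm (conv k l f x) \<le> S * (LINT y|l. norm (f y)))"
proof -
  have "compact (k ` cball 0 (R + R0))"
    by (rule compact_continuous_image[OF continuous_on_subset[OF kernelD(1)[OF k]] compact_cball]) simp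
  from compact_imp_bounded[OF this] obtain S where "\<forall>x\<in>cball 0 (R + R0). \<bar>k x\<bar> \<le> S"
    by (auto simp: bounded_iff)
  then have S: "k x \<le> S" if "norm x \<le> R + R0" for x
    using that abs_le_D1[of "k x" S] by (simp add: mem_cball_0)
  show ?thesis
  proof (intro exI[of _ "max 0 S"] allI impI)
    fix l :: "'a measure" and f :: "'a \<Rightarrow> 'b" and x :: 'a
    assume s: "sets l = sets borel" and f: "integrable l f" and supp: "\<forall>x. R0 < norm x \<longrightarrow> f x = 0"
      and x: "norm x \<le> R"
    have i: "integrable l (\<lambda>y. k (x - y) *\<^sub>R f y)"
      using integrable_bounded_support[OF s f _ continuous_kernel_shift[OF k], of R0] supp by blast
    have "norm (conv k l f x) \<le> (LINT y|l. max 0 S * norm (f y))" unfolding conv_def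
    proof (rule Bochner_Integration.integral_norm_bound_integral[OF i])
      show "integrable l (\<lambda>y. max 0 S * norm (f y))" using f by simp
      fix y
      show "norm (k (x - y) *\<^sub>R f y) \<le> max 0 S * norm (f y)"
      proof (cases "norm y \<le> R0")
        case True
        have "norm (x - y) \<le> R + R0" using norm_triangle_ineq4[of x y] x True by linarith
        then have "\<bar>k (x - y)\<bar> \<le> max 0 S" using S[of "x - y"] kernelD(3)[OF k, of "x - y"] by simp
        then show ?thesis by (simp add: mult_right_mono)
      next
        case False then show ?thesis using supp by simp
      qed
    qed
    then show "norm (conv k l f x) \<le> max 0 S * (LINT y|l. norm (f y))" by simp
  qed
qed

text \<open>Weak convergence of measures supported in a fixed ball turns into \<open>L\<^sup>1\<close> convergence of
  their mollifications; \<open>h\<close> is any continuous function of linear growth.\<close>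

theorem conv_tendsto:
  fixes l :: "nat \<Rightarrow> 'a::euclidean_space measure" and f :: "nat \<Rightarrow> 'a \<Rightarrow> 'b::euclidean_space"
    and h :: "'b \<Rightarrow> 'c::euclidean_space"
  assumes k: "kernel k"
    and l: "\<And>i. sigma_finite_measure (l i)" "\<And>i. sets (l i) = sets borel" and f: "\<And>i. integrable (l i) (f i)"
    and supp: "\<And>i x. R0 < norm x \<Longrightarrow> f i x = 0" and bd: "\<And>i. (LINT y|l i. norm (f i y)) \<le> B"
    and L: "sigma_finite_measure L" "sets L = sets borel" and g: "integrable L g"
    and lim: "\<And>x. (\<lambda>i. conv k (l i) (f i) x) \<longlonglongrightarrow> conv k L g x"
    and h: "continuous_on UNIV h" "\<And>v. norm (h v) \<le> c * norm v"
  shows "(\<lambda>i. LINT x|lborel. norm (h (conv k (l i) (f i) x) - h (conv k L g x))) \<longlonglongrightarrow> 0"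
    "(\<lambda>i. LINT x|lborel. h (conv k (l i) (f i) x)) \<longlonglongrightarrow> (LINT x|lborel. h (conv k L g x))"
proof -
  have hm: "h \<in> borel_measurable borel" by (rule borel_measurable_continuous_onI[OF h(1)])
  have hint: "integrable lborel (\<lambda>x. h (u x))" if u: "integrable lborel u" for u :: "'a \<Rightarrow> 'b"
  proof (rule Bochner_Integration.integrable_bound)
    show "integrable lborel (\<lambda>x. c * norm (u x))" using u by simp
    show "(\<lambda>x. h (u x)) \<in> borel_measurable lborel"
      by (rule measurable_compose[OF borel_measurable_integrable[OF u] hm])
    show "AE x in lborel. norm (h (u x)) \<le> norm (c * norm (u x))"
      using h(2) by (intro AE_I2) (metis abs_ge_self order_trans real_norm_def)
  qed
  have ci: "integrable lborel (conv k (l i) (f i))" for i by (rule conv_integrable(1)[OF k l f])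
  have cL: "integrable lborel (conv k L g)" by (rule conv_integrable(1)[OF k L g])
  have B0: "0 \<le> B" using bd[of 0] by (rule order_trans[rotated]) simp
  have c0: "0 \<le> c"
  proof -
    obtain b :: 'b where "b \<in> Basis" using nonempty_Basis by blast
    then show ?thesis using h(2)[of b] norm_ge_zero[of "h b"] by (simp del: norm_ge_zero)
  qed
  show main: "(\<lambda>i. LINT x|lborel. norm (h (conv k (l i) (f i) x) - h (conv k L g x))) \<longlonglongrightarrow> 0"
  proof (rule tight_tendsto_L1)
    show "integrable lborel (\<lambda>x. h (conv k (l i) (f i) x))" for i by (rule hint[OF ci])
    show "integrable lborel (\<lambda>x. h (conv k L g x))" by (rule hint[OF cL])
    show "(\<lambda>i. h (conv k (l i) (f i) x)) \<longlonglongrightarrow> h (conv k L g x)" for x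
      using h(1) by (intro isCont_tendsto_compose[OF _ lim]) (simp add: continuous_on_eq_continuous_at)
  next
    fix R
    obtain S where S: "\<And>(l :: 'a measure) f :: 'a \<Rightarrow> 'b. sets l = sets borel \<Longrightarrow> integrable l f \<Longrightarrow> (\<forall>x. R0 < norm x \<longrightarrow> f x = 0) \<Longrightarrow>
     (\<forall>x. norm x \<le> R \<longrightarrow> norm (conv k l f x) \<le> S * (LINT y|l. norm (f y)))"
      using conv_local_bound[OF k, of R0 R] by metis
    show "\<exists>C. \<forall>n x. norm x \<le> R \<longrightarrow> norm (h (conv k (l n) (f n) x)) \<le> C"
    proof (intro exI[of _ "c * (\<bar>S\<bar> * B)"] allI impI)
      fix n and x :: 'a assume x: "norm x \<le> R"
      have "norm (conv k (l n) (f n) x) \<le> S * (LINT y|l n. norm (f n y))"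
        using S[OF l(2) f] supp x by blast
      also have "\<dots> \<le> \<bar>S\<bar> * B" using bd[of n] by (intro mult_mono) auto
      finally have "c * norm (conv k (l n) (f n) x) \<le> c * (\<bar>S\<bar> * B)" using c0 by (rule mult_left_mono)
      then show "norm (h (conv k (l n) (f n) x)) \<le> c * (\<bar>S\<bar> * B)" using h(2) order_trans by blast
    qed
  next
    fix e :: real assume e: "0 < e"
    \<comment> \<open>Chosen so that the tail contribution, at most \<open>c * (d * B)\<close>,
      stays below \<open>e\<close>; the added units exclude division by 0.\<close>
    define d where "d = e / ((c + 1) * (B + 1))"
    have d: "0 < d" using e c0 B0 by (simp add: d_def)
    obtain n where n: "kernel_tail k (real n) < d"
      using order_tendstoD(2)[OF kernel_tail_tendsto[OF k] d] by (metis eventually_happens sequentially_bot)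
    show "\<exists>R. \<forall>i. (LINT x|lborel. indicator {x. R < norm x} x * norm (h (conv k (l i) (f i) x))) \<le> e"
    proof (intro exI[of _ "R0 + real n"] allI)
      fix i
      let ?I = "indicat_real {x::'a. R0 + real n < norm x}"
      have Im: "?I \<in> borel_measurable borel" by measurable
      have Ib: "\<bar>?I x\<bar> \<le> 1" for x by (auto split: split_indicator)
      have "(LINT x|lborel. ?I x * norm (h (conv k (l i) (f i) x))) \<le> (LINT x|lborel. c * (?I x * norm (conv k (l i) (f i) x)))"
      proof (rule integral_mono)
        show "integrable lborel (\<lambda>x. ?I x * norm (h (conv k (l i) (f i) x)))"
          using integrable_bounded_scaleR[OF integrable_norm[OF hint[OF ci]], of ?I 1] Im Ib by simp
        show "integrable lborel (\<lambda>x. c * (?I x * norm (conv k (l i) (f i) x)))"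
          using integrable_bounded_scaleR[OF integrable_norm[OF ci], of ?I 1] Im Ib by simp
        show "?I x * norm (h (conv k (l i) (f i) x)) \<le> c * (?I x * norm (conv k (l i) (f i) x))" for x
          using h(2) by (auto split: split_indicator)
      qed
      also have "\<dots> = c * (LINT x|lborel. ?I x * norm (conv k (l i) (f i) x))" by simp
      also have "\<dots> \<le> c * (kernel_tail k (real n) * (LINT y|l i. norm (f i y)))"
        by (intro mult_left_mono c0 conv_tail[OF k l f supp])
      also have "\<dots> \<le> c * (d * B)"
        using n bd[of i] d by (intro mult_left_mono c0 mult_mono) auto
      also have "\<dots> \<le> (c + 1) * (d * (B + 1))" using c0 d B0 by (intro mult_mono) auto
      also have "\<dots> = e" using c0 B0 by (simp add: d_def)
      finally show "(LINT x|lborel. ?I x * norm (h (conv k (l i) (f i) x))) \<le> e" .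
    qed
  qed
  show "(\<lambda>i. LINT x|lborel. h (conv k (l i) (f i) x)) \<longlonglongrightarrow> (LINT x|lborel. h (conv k L g x))"
  proof (rule LIM_zero_cancel, rule Lim_null_comparison[OF _ main])
    have "norm ((LINT x|lborel. h (conv k (l i) (f i) x)) - (LINT x|lborel. h (conv k L g x)))
        \<le> (LINT x|lborel. norm (h (conv k (l i) (f i) x) - h (conv k L g x)))" for i
      using integral_norm_bound[of lborel "\<lambda>x. h (conv k (l i) (f i) x) - h (conv k L g x)"]
        hint[OF ci] hint[OF cL] by simp
    then show "\<forall>\<^sub>F i in sequentially. norm ((LINT x|lborel. h (conv k (l i) (f i) x)) - (LINT x|lborel. h (conv k L g x)))
        \<le> (LINT x|lborel. norm (h (conv k (l i) (f i) x) - h (conv k L g x)))" by simp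
  qed
qed

text \<open>A quantitative substitute for Reshetnyak's continuity theorem: the defect
  \<open>|\<mu>|(\<real>\<^sup>n) - \<integral>|\<mu> * k|\<close> controls the error of replacing \<open>\<mu>\<close> by its mollification in a
  homogeneous functional.\<close>

theorem mollified_functional_error:
  fixes l :: "'a::euclidean_space measure" and f :: "'a \<Rightarrow> 'b::euclidean_space" and \<Phi> :: "'b \<Rightarrow> real"
  assumes k: "kernel k" and l: "sigma_finite_measure l" "sets l = sets borel" and f: "integrable l f"
    and supp: "\<And>x. R0 < norm x \<Longrightarrow> f x = 0"
    and \<Phi>: "continuous_on UNIV \<Phi>" "\<And>v. \<bar>\<Phi> v\<bar> \<le> c * norm v" "\<And>t v. 0 \<le> t \<Longrightarrow> \<Phi> (t *\<^sub>R v) = t * \<Phi> v"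
    and key: "\<And>v m. norm m = 1 \<Longrightarrow> \<bar>\<Phi> v - \<Phi> m * (v \<bullet> m)\<bar> \<le> \<delta> * norm v + C * (norm v - v \<bullet> m)"
  shows "\<bar>(LINT y|l. \<Phi> (f y)) - (LINT x|lborel. \<Phi> (conv k l f x))\<bar> \<le>
     \<delta> * (LINT y|l. norm (f y)) + C * ((LINT y|l. norm (f y)) - (LINT x|lborel. norm (conv k l f x)))"
proof -
  obtain b0 :: 'b where b0: "b0 \<in> Basis" using nonempty_Basis by blast
  \<comment> \<open>The direction of the mollified measure. Where it vanishes, a basis vector stands
    in, so that \<open>key\<close> with its condition \<open>norm m = 1\<close> applies at every
    \<open>x\<close>.\<close>
  define m where "m x = (if conv k l f x = 0 then b0 else sgn (conv k l f x))" for x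
  have nm: "norm (m x) = 1" for x using b0 by (simp add: m_def norm_sgn)
  have mc: "conv k l f x = norm (conv k l f x) *\<^sub>R m x" for x by (auto simp: m_def sgn_div_norm)
  have inner_m: "conv k l f x \<bullet> m x = norm (conv k l f x)" for x
  proof -
    have "conv k l f x \<bullet> m x = norm (conv k l f x) * (m x \<bullet> m x)"
      by (subst mc) simp
    then show ?thesis using nm[of x] by (simp add: dot_square_norm)
  qed
  have \<Phi>m: "\<Phi> \<in> borel_measurable borel" by (rule borel_measurable_continuous_onI[OF \<Phi>(1)])
  have fm: "f \<in> borel_measurable l" by (rule borel_measurable_integrable[OF f])
  have i\<Phi>: "integrable l (\<lambda>y. \<Phi> (f y))"
  proof (rule Bochner_Integration.integrable_bound)
    show "integrable l (\<lambda>y. c * norm (f y))" using f by simp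
    show "(\<lambda>y. \<Phi> (f y)) \<in> borel_measurable l" by (rule measurable_compose[OF fm \<Phi>m])
    show "AE y in l. norm (\<Phi> (f y)) \<le> norm (c * norm (f y))"
      using \<Phi>(2) by (intro AE_I2) (metis abs_ge_self order_trans real_norm_def)
  qed
  have fn: "integrable l (\<lambda>y. norm (f y))" using f by simp
  have cf: "integrable lborel (conv k l f)" by (rule conv_integrable(1)[OF k l f])
  have c\<Phi>: "integrable lborel (conv k l (\<lambda>y. \<Phi> (f y)))" by (rule conv_integrable(1)[OF k l i\<Phi>])
  have cn: "integrable lborel (conv k l (\<lambda>y. norm (f y)))" by (rule conv_integrable(1)[OF k l fn])
  have \<Phi>c: "integrable lborel (\<lambda>x. \<Phi> (conv k l f x))"
  proof (rule Bochner_Integration.integrable_bound)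
    show "integrable lborel (\<lambda>x. c * norm (conv k l f x))" using cf by simp
    show "(\<lambda>x. \<Phi> (conv k l f x)) \<in> borel_measurable lborel"
      by (rule measurable_compose[OF borel_measurable_integrable[OF cf] \<Phi>m])
    show "AE x in lborel. norm (\<Phi> (conv k l f x)) \<le> norm (c * norm (conv k l f x))"
      using \<Phi>(2) by (intro AE_I2) (metis abs_ge_self order_trans real_norm_def)
  qed
  have kb: "integrable l (\<lambda>y. k (x - y) *\<^sub>R f y)" for x
    using integrable_bounded_support[OF l(2) f supp continuous_kernel_shift[OF k]] by blast
  have kn: "integrable l (\<lambda>y. k (x - y) *\<^sub>R norm (f y))" for x
    using integrable_norm[OF kb[of x]] kernelD(3)[OF k] by simp
  have k\<Phi>: "integrable l (\<lambda>y. k (x - y) *\<^sub>R \<Phi> (f y))" for x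
  proof (rule integrable_bounded_support[OF l(2) i\<Phi> _ continuous_kernel_shift[OF k]])
    fix y :: 'a assume "R0 < norm y"
    then show "\<Phi> (f y) = 0" using supp \<Phi>(3)[of 0 0] by simp
  qed
  \<comment> \<open>The estimate \<open>key\<close> is used with the direction \<open>m x\<close>
    held fixed while \<open>y\<close> varies. Integrated against the kernel, the linear term
    \<open>\<Phi> (m x) * (f y \<bullet> m x)\<close> becomes exactly
    \<open>\<Phi> (conv k l f x)\<close> by homogeneity, and the error term becomes the mass lost at
    \<open>x\<close>.\<close>
  have pt: "\<bar>conv k l (\<lambda>y. \<Phi> (f y)) x - \<Phi> (conv k l f x)\<bar> \<le>
      \<delta> * conv k l (\<lambda>y. norm (f y)) x + C * (conv k l (\<lambda>y. norm (f y)) x - norm (conv k l f x))" for x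
  proof -
    have ki: "integrable l (\<lambda>y. k (x - y) * (f y \<bullet> m x))"
      using integrable_inner_left[of "m x" l "\<lambda>y. k (x - y) *\<^sub>R f y"] kb[of x] by simp
    have ci: "(LINT y|l. k (x - y) * (f y \<bullet> m x)) = norm (conv k l f x)"
    proof -
      have "(LINT y|l. k (x - y) * (f y \<bullet> m x)) = (LINT y|l. (k (x - y) *\<^sub>R f y) \<bullet> m x)" by simp
      also have "\<dots> = conv k l f x \<bullet> m x" unfolding conv_def using kb by (intro integral_inner_left) auto
      finally show ?thesis using inner_m by simp
    qed
    have "\<Phi> (conv k l f x) = \<Phi> (m x) * norm (conv k l f x)"
      using \<Phi>(3)[of "norm (conv k l f x)" "m x"] mc[of x] by (simp add: mult.commute)
    also have "\<dots> = (LINT y|l. \<Phi> (m x) * (k (x - y) * (f y \<bullet> m x)))" using ci by simp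
    finally have "conv k l (\<lambda>y. \<Phi> (f y)) x - \<Phi> (conv k l f x) =
        (LINT y|l. k (x - y) * \<Phi> (f y) - \<Phi> (m x) * (k (x - y) * (f y \<bullet> m x)))"
      unfolding conv_def using k\<Phi>[of x] ki by simp
    also have "\<bar>\<dots>\<bar> \<le> (LINT y|l. (\<delta> + C) * (k (x - y) * norm (f y)) - C * (k (x - y) * (f y \<bullet> m x)))"
      unfolding real_norm_def[symmetric]
    proof (rule Bochner_Integration.integral_norm_bound_integral)
      show "integrable l (\<lambda>y. k (x - y) * \<Phi> (f y) - \<Phi> (m x) * (k (x - y) * (f y \<bullet> m x)))"
        using k\<Phi>[of x] ki by simp
      show "integrable l (\<lambda>y. (\<delta> + C) * (k (x - y) * norm (f y)) - C * (k (x - y) * (f y \<bullet> m x)))"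
        using kn[of x] ki by simp
      fix y
      have "k (x - y) * \<bar>\<Phi> (f y) - \<Phi> (m x) * (f y \<bullet> m x)\<bar> \<le>
          k (x - y) * (\<delta> * norm (f y) + C * (norm (f y) - f y \<bullet> m x))"
        by (intro mult_left_mono key nm kernelD(3)[OF k])
      also have "k (x - y) * \<bar>\<Phi> (f y) - \<Phi> (m x) * (f y \<bullet> m x)\<bar> =
          \<bar>k (x - y) * \<Phi> (f y) - \<Phi> (m x) * (k (x - y) * (f y \<bullet> m x))\<bar>"
      proof -
        have "k (x - y) * \<bar>\<Phi> (f y) - \<Phi> (m x) * (f y \<bullet> m x)\<bar> = \<bar>k (x - y) * (\<Phi> (f y) - \<Phi> (m x) * (f y \<bullet> m x))\<bar>"
          using kernelD(3)[OF k, of "x - y"] by (simp add: abs_mult)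
        then show ?thesis by (simp add: right_diff_distrib mult.left_commute)
      qed
      finally show "norm (k (x - y) * \<Phi> (f y) - \<Phi> (m x) * (k (x - y) * (f y \<bullet> m x))) \<le>
          (\<delta> + C) * (k (x - y) * norm (f y)) - C * (k (x - y) * (f y \<bullet> m x))"
        by (simp add: algebra_simps)
    qed
    also have "\<dots> = (\<delta> + C) * conv k l (\<lambda>y. norm (f y)) x - C * norm (conv k l f x)"
      using kn[of x] ki ci by (simp add: conv_def)
    finally show ?thesis by (simp add: algebra_simps)
  qed
  have "(LINT y|l. \<Phi> (f y)) - (LINT x|lborel. \<Phi> (conv k l f x)) =
      (LINT x|lborel. conv k l (\<lambda>y. \<Phi> (f y)) x - \<Phi> (conv k l f x))"
    using conv_integrable(3)[OF k l i\<Phi>] c\<Phi> \<Phi>c by simp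
  also have "\<bar>\<dots>\<bar> \<le> (LINT x|lborel. \<delta> * conv k l (\<lambda>y. norm (f y)) x + C * (conv k l (\<lambda>y. norm (f y)) x - norm (conv k l f x)))"
    unfolding real_norm_def[symmetric]
    by (rule Bochner_Integration.integral_norm_bound_integral) (use c\<Phi> \<Phi>c cn cf pt in auto)
  also have "\<dots> = \<delta> * (LINT y|l. norm (f y)) + C * ((LINT y|l. norm (f y)) - (LINT x|lborel. norm (conv k l f x)))"
    using cn cf conv_integrable(3)[OF k l fn] by simp
  finally show ?thesis .
qed

section \<open>Recovery of the total variation as the scale tends to 0\<close>

lemma continuous_dense_L1:
  fixes h :: "'a::euclidean_space \<Rightarrow> 'b::euclidean_space"
  assumes M: "finite_measure M" "sets M = sets borel" and h: "integrable M h"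
  shows "\<forall>e>0. \<exists>g. continuous_on UNIV g \<and> integrable M g \<and> (LINT x|M. norm (g x - h x)) < e"
  using h
proof (induction rule: integrable_induct)
  case (base A c)
  interpret finite_measure M by (rule M)
  show ?case
  proof (intro allI impI)
    fix e :: real assume e: "0 < e"
    \<comment> \<open>Two errors of size \<open>d\<close>, one from outer regularity and one from
      the smooth approximation of the open set, are multiplied by \<open>norm c\<close>.\<close>
    define d where "d = e / (2 * (norm c + 1))"
    have d: "0 < d" using e by (simp add: d_def add_nonneg_pos)
    have A: "A \<in> sets borel" using base M by simp
    obtain U where U: "open U" "A \<subseteq> U" "measure M (U - A) < d" using outer_approx[OF M A d] by blast
    obtain \<psi> where \<psi>: "\<And>n. \<psi> n \<in> test_functions U" "\<And>n x. 0 \<le> \<psi> n x" "\<And>n x. \<psi> n x \<le> 1"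
      "\<And>x. (\<lambda>n::nat. \<psi> n x) \<longlonglongrightarrow> indicator U x"
      using open_indicator_limit[OF U(1)] by metis
    have \<psi>m: "\<psi> n \<in> borel_measurable M" for n
      using test_functionsD(3)[OF \<psi>(1)] by (subst measurable_cong_sets[OF M(2) refl])
    have Ub: "U \<in> sets M" using U(1) M(2) by simp
    have Um: "indicat_real U \<in> borel_measurable M" using Ub by simp
    have "(\<lambda>n. LINT x|M. \<bar>\<psi> n x - indicator U x\<bar>) \<longlonglongrightarrow> (LINT x|M. 0)"
    proof (rule integral_dominated_convergence[where w="\<lambda>_. 1"])
      show "AE x in M. (\<lambda>n. \<bar>\<psi> n x - indicator U x\<bar>) \<longlonglongrightarrow> 0"
        using \<psi>(4) by (intro AE_I2 tendsto_rabs_zero) (simp add: LIM_zero)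
      show "AE x in M. norm \<bar>\<psi> n x - indicator U x\<bar> \<le> 1" for n
      proof (intro AE_I2)
        fix x
        show "norm \<bar>\<psi> n x - indicator U x\<bar> \<le> 1"
          using \<psi>(2)[of n x] \<psi>(3)[of n x] by (cases "x \<in> U") auto
      qed
      show "(\<lambda>x. \<bar>\<psi> n x - indicator U x\<bar>) \<in> borel_measurable M" for n using \<psi>m Um by auto
    qed auto
    from order_tendstoD(2)[OF this, of d] d obtain n where n: "(LINT x|M. \<bar>\<psi> n x - indicator U x\<bar>) < d"
      by (auto dest: eventually_happens)
    have ig: "integrable M (\<psi> n)"
      using \<psi>m \<psi>(2,3) by (intro integrable_const_bound[where B=1]) auto
    have i1: "integrable M (\<lambda>x. \<bar>\<psi> n x - indicator U x\<bar>)"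
      using ig Ub by (auto intro!: integrable_real_indicator simp: emeasure_finite less_top[symmetric])
    have iUA: "integrable M (indicat_real (U - A))"
      using Ub base by (auto intro!: integrable_real_indicator simp: emeasure_finite less_top[symmetric])
    have iA: "integrable M (\<lambda>x. indicat_real A x *\<^sub>R c)"
      using base by (auto intro!: integrable_real_indicator simp: emeasure_finite less_top[symmetric])
    show "\<exists>g. continuous_on UNIV g \<and> integrable M g \<and> (LINT x|M. norm (g x - indicat_real A x *\<^sub>R c)) < e"
    proof (intro exI[of _ "\<lambda>x. \<psi> n x *\<^sub>R c"] conjI)
      show "continuous_on UNIV (\<lambda>x. \<psi> n x *\<^sub>R c)" by (intro continuous_intros test_functionsD(2)[OF \<psi>(1)])
      show igc: "integrable M (\<lambda>x. \<psi> n x *\<^sub>R c)" using ig by simp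
      have "(LINT x|M. norm (\<psi> n x *\<^sub>R c - indicat_real A x *\<^sub>R c)) \<le>
          (LINT x|M. (\<bar>\<psi> n x - indicator U x\<bar> + indicat_real (U - A) x) * norm c)"
      proof (rule integral_mono)
        show "integrable M (\<lambda>x. norm (\<psi> n x *\<^sub>R c - indicat_real A x *\<^sub>R c))" using igc iA by simp
        show "integrable M (\<lambda>x. (\<bar>\<psi> n x - indicator U x\<bar> + indicat_real (U - A) x) * norm c)" using i1 iUA by simp
        fix x
        have "\<bar>\<psi> n x - indicat_real A x\<bar> \<le> \<bar>\<psi> n x - indicator U x\<bar> + indicat_real (U - A) x"
          using U(2) by (auto split: split_indicator)
        then show "norm (\<psi> n x *\<^sub>R c - indicat_real A x *\<^sub>R c) \<le> (\<bar>\<psi> n x - indicator U x\<bar> + indicat_real (U - A) x) * norm c"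
          by (simp add: scaleR_diff_left[symmetric] mult_right_mono)
      qed
      also have "\<dots> = ((LINT x|M. \<bar>\<psi> n x - indicator U x\<bar>) + measure M (U - A)) * norm c"
        using i1 iUA Ub base by simp
      also have "\<dots> \<le> (d + d) * norm c" using n U(3) by (intro mult_right_mono) auto
      also have "\<dots> < (d + d) * (norm c + 1)" using d by simp
      also have "\<dots> = e" by (simp add: d_def field_simps add_nonneg_eq_0_iff)
      finally show "(LINT x|M. norm (\<psi> n x *\<^sub>R c - indicat_real A x *\<^sub>R c)) < e" .
    qed
  qed
next
  case (add f g)
  show ?case
  proof (intro allI impI)
    fix e :: real assume "0 < e"
    then have e: "0 < e / 2" by simp
    obtain f' where f': "continuous_on UNIV f'" "integrable M f'" "(LINT x|M. norm (f' x - f x)) < e / 2"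
      using add.IH(1) e by blast
    obtain g' where g': "continuous_on UNIV g'" "integrable M g'" "(LINT x|M. norm (g' x - g x)) < e / 2"
      using add.IH(2) e by blast
    have "(LINT x|M. norm (f' x + g' x - (f x + g x))) \<le> (LINT x|M. norm (f' x - f x) + norm (g' x - g x))"
    proof (rule integral_mono)
      show "norm (f' x + g' x - (f x + g x)) \<le> norm (f' x - f x) + norm (g' x - g x)" for x
        using norm_triangle_ineq[of "f' x - f x" "g' x - g x"] by (simp add: algebra_simps)
    qed (use f' g' add.hyps in auto)
    also have "\<dots> < e" using f' g' add.hyps by simp
    finally show "\<exists>h. continuous_on UNIV h \<and> integrable M h \<and> (LINT x|M. norm (h x - (f x + g x))) < e"
      using f' g' by (intro exI[of _ "\<lambda>x. f' x + g' x"]) (auto intro: continuous_on_add)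
  qed
next
  case (lim f s)
  have "(\<lambda>i. LINT x|M. norm (s i x - f x)) \<longlonglongrightarrow> (LINT x|M. 0)"
  proof (rule integral_dominated_convergence[where w="\<lambda>x. 3 * norm (f x)"])
    show "AE x in M. (\<lambda>i. norm (s i x - f x)) \<longlonglongrightarrow> 0"
      by (intro AE_I2 tendsto_norm_zero LIM_zero lim.hyps(2))
    show "AE x in M. norm (norm (s i x - f x)) \<le> 3 * norm (f x)" for i
    proof (intro AE_I2)
      fix x assume "x \<in> space M"
      then show "norm (norm (s i x - f x)) \<le> 3 * norm (f x)"
        using lim.hyps(3)[of x i] norm_triangle_ineq4[of "s i x" "f x"] by simp
    qed
    show "(\<lambda>x. norm (s i x - f x)) \<in> borel_measurable M" for i using lim.hyps by auto
  qed (use lim.hyps in auto)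
  then have L: "(\<lambda>i. LINT x|M. norm (s i x - f x)) \<longlonglongrightarrow> 0" by simp
  show ?case
  proof (intro allI impI)
    fix e :: real assume "0 < e"
    then have e: "0 < e / 2" by simp
    from order_tendstoD(2)[OF L e] obtain i where i: "(LINT x|M. norm (s i x - f x)) < e / 2"
      by (auto dest: eventually_happens)
    obtain g where g: "continuous_on UNIV g" "integrable M g" "(LINT x|M. norm (g x - s i x)) < e / 2"
      using lim.IH[of i] e by blast
    have "(LINT x|M. norm (g x - f x)) \<le> (LINT x|M. norm (g x - s i x) + norm (s i x - f x))"
    proof (rule integral_mono)
      show "norm (g x - f x) \<le> norm (g x - s i x) + norm (s i x - f x)" for x
        using norm_triangle_ineq[of "g x - s i x" "s i x - f x"] by simp
    qed (use g lim.hyps in auto)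
    also have "\<dots> < e" using i g lim.hyps by simp
    finally show "\<exists>g. continuous_on UNIV g \<and> integrable M g \<and> (LINT x|M. norm (g x - f x)) < e"
      using g by blast
  qed
qed

text \<open>The optimal test field is the direction of \<open>f\<close>. It is approximated by a
  continuous field in L1 of the variation, and the approximant is then projected onto the unit ball;
  the projection is 1-Lipschitz and fixes the direction field, so the error does not grow.\<close>

lemma norm_integral_dual:
  fixes l :: "'a::euclidean_space measure" and f :: "'a \<Rightarrow> 'b::euclidean_space"
  assumes s: "sets l = sets borel" and f: "integrable l f" and e: "0 < e"
  obtains g where "continuous_on UNIV g" "\<And>x. norm (g x) \<le> 1"
    "(LINT y|l. norm (f y)) - e < (LINT y|l. f y \<bullet> g y)"
proof -
  have fm: "f \<in> borel_measurable l" by (rule borel_measurable_integrable[OF f])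
  define M where "M = density l (\<lambda>x. ennreal (norm (f x)))"
  have Ms: "sets M = sets borel" by (simp add: M_def s)
  have "emeasure M (space M) = (\<integral>\<^sup>+x. ennreal (norm (f x)) \<partial>l)"
    unfolding M_def using fm by (subst emeasure_density) (auto intro!: nn_integral_cong)
  also have "\<dots> < \<infinity>" using f by (simp add: integrable_iff_bounded)
  finally have Mf: "finite_measure M" by (intro finite_measureI) auto
  interpret finite_measure M by (rule Mf)
  have sm: "(\<lambda>x. sgn (f x)) \<in> borel_measurable l"
    unfolding sgn_div_norm using fm by (intro borel_measurable_scaleR) auto
  have sM: "(\<lambda>x. sgn (f x)) \<in> borel_measurable M" unfolding M_def using sm by simp
  have si: "integrable M (\<lambda>x. sgn (f x))"
    by (rule integrable_const_bound[where B=1, OF _ sM]) (auto simp: norm_sgn)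
  obtain g0 where g0: "continuous_on UNIV g0" "integrable M g0" "(LINT x|M. norm (g0 x - sgn (f x))) < e"
    using continuous_dense_L1[OF Mf Ms si] e by blast
  define g where "g x = closest_point (cball 0 1) (g0 x)" for x
  have c: "continuous_on UNIV (closest_point (cball (0::'b) 1))"
    by (rule continuous_on_closest_point) auto
  have cg: "continuous_on UNIV g" unfolding g_def by (rule continuous_on_compose2[OF c g0(1)]) simp
  have bg: "norm (g x) \<le> 1" for x
    using closest_point_in_set[of "cball (0::'b) 1" "g0 x"] by (simp add: g_def)
  have near: "norm (g x - sgn (f x)) \<le> norm (g0 x - sgn (f x))" for x
  proof -
    have "closest_point (cball 0 1) (sgn (f x)) = sgn (f x)"
      by (rule closest_point_self) (simp add: norm_sgn)
    then show ?thesis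
      using closest_point_lipschitz[of "cball (0::'b) 1" "g0 x" "sgn (f x)"] by (simp add: g_def dist_norm)
  qed
  have gM: "g \<in> borel_measurable M"
    by (subst measurable_cong_sets[OF Ms refl]) (rule borel_measurable_continuous_onI[OF cg])
  have gl: "g \<in> borel_measurable l"
    by (subst measurable_cong_sets[OF s refl]) (rule borel_measurable_continuous_onI[OF cg])
  have gi: "integrable M g" by (rule integrable_const_bound[where B=1, OF _ gM]) (simp add: bg)
  have "(LINT x|M. norm (g x - sgn (f x))) \<le> (LINT x|M. norm (g0 x - sgn (f x)))"
    by (rule integral_mono) (use gi si g0 near in auto)
  then have lt: "(LINT x|M. norm (g x - sgn (f x))) < e" using g0(3) by simp
  have eq: "(LINT x|M. norm (g x - sgn (f x))) = (LINT x|l. norm (f x) * norm (g x - sgn (f x)))"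
    unfolding M_def using fm gl sm by (subst integral_real_density) auto
  have ig: "integrable l (\<lambda>y. f y \<bullet> g y)"
  proof (rule Bochner_Integration.integrable_bound[OF integrable_norm[OF f]])
    show "(\<lambda>y. f y \<bullet> g y) \<in> borel_measurable l" using fm gl by (rule borel_measurable_inner)
    show "AE x in l. norm (f x \<bullet> g x) \<le> norm (norm (f x))"
    proof (intro AE_I2)
      fix x
      have "\<bar>f x \<bullet> g x\<bar> \<le> norm (f x) * norm (g x)" by (rule Cauchy_Schwarz_ineq2)
      also have "\<dots> \<le> norm (f x)" using bg[of x] by (simp add: mult_left_le)
      finally show "norm (f x \<bullet> g x) \<le> norm (norm (f x))" by simp
    qed
  qed
  have id: "integrable l (\<lambda>x. norm (f x) * norm (g x - sgn (f x)))"
  proof -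
    have "\<bar>norm (g x - sgn (f x))\<bar> \<le> 2" for x
      using norm_triangle_ineq4[of "g x" "sgn (f x)"] bg[of x] by (simp add: norm_sgn split: if_splits)
    from integrable_bounded_scaleR[OF integrable_norm[OF f] _ this] gl sm
    show ?thesis by (simp add: mult.commute)
  qed
  have "(LINT y|l. norm (f y)) - (LINT y|l. f y \<bullet> g y) = (LINT y|l. norm (f y) - f y \<bullet> g y)"
    using f ig by simp
  also have "\<dots> \<le> (LINT x|l. norm (f x) * norm (g x - sgn (f x)))"
  proof (rule integral_mono[OF _ id])
    show "integrable l (\<lambda>y. norm (f y) - f y \<bullet> g y)" using f ig by simp
    fix x
    have "f x \<bullet> sgn (f x) = norm (f x)"
      by (cases "f x = 0") (simp_all add: sgn_div_norm dot_square_norm power2_eq_square)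
    then have "norm (f x) - f x \<bullet> g x = f x \<bullet> (sgn (f x) - g x)" by (simp add: inner_diff_right)
    also have "\<dots> \<le> norm (f x) * norm (sgn (f x) - g x)" by (rule norm_cauchy_schwarz)
    finally show "norm (f x) - f x \<bullet> g x \<le> norm (f x) * norm (g x - sgn (f x))"
      by (simp add: norm_minus_commute)
  qed
  also have "\<dots> < e" using lt eq by simp
  finally show ?thesis using that[OF cg bg] by simp
qed

text \<open>This is the adjoint mollification, integrated in the first variable of
  \<open>k n (x - y)\<close>: it is what Fubini produces when a mollifier is moved from a measure to
  a test function. Kernels need not be even.\<close>

lemma mollify_pointwise:
  fixes g :: "'a::euclidean_space \<Rightarrow> real"
  assumes k: "\<And>n. kernel (k n)"
    and conc: "\<And>r. 0 < r \<Longrightarrow> (\<lambda>n. LINT x|lborel. indicator (- ball 0 r) x * k n x) \<longlonglongrightarrow> 0"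
    and g: "continuous_on UNIV g" "\<And>x. \<bar>g x\<bar> \<le> B"
  shows "(\<lambda>n::nat. LINT x|lborel. g x * k n (x - y)) \<longlonglongrightarrow> g y"
proof (rule LIMSEQ_I)
  fix e :: real assume e: "0 < e"
  have B0: "0 \<le> B" using g(2)[of 0] by linarith
  have gm: "g \<in> borel_measurable borel" by (rule borel_measurable_continuous_onI[OF g(1)])
  have "isCont g y" using g(1) by (simp add: continuous_on_eq_continuous_at)
  then obtain r where r: "0 < r" "\<And>x. dist x y < r \<Longrightarrow> \<bar>g x - g y\<bar> < e / 2"
    unfolding continuous_at_eps_delta using e by (metis dist_real_def half_gt_zero)
  define D where "D = 2 * B + 1"
  have D: "0 < D" using B0 by (simp add: D_def)
  define d where "d = e / (2 * D)"
  have d: "0 < d" using e D by (simp add: d_def)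
  from order_tendstoD(2)[OF conc[OF r(1)] d] obtain N where
    N: "\<And>n. N \<le> n \<Longrightarrow> (LINT x|lborel. indicator (- ball 0 r) x * k n x) < d" by (auto simp: eventually_sequentially)
  have "norm ((LINT x|lborel. g x * k n (x - y)) - g y) < e" if n: "N \<le> n" for n
  proof -
    have ki: "integrable lborel (\<lambda>x. k n (x - y))" "(LINT x|lborel. k n (x - y)) = 1"
      using kernelD(6,7)[OF k] by auto
    have gk: "integrable lborel (\<lambda>x. g x * k n (x - y))"
      using integrable_bounded_scaleR[OF ki(1) _ g(2)] gm by simp
    have bm: "indicat_real (- ball (0::'a) r) \<in> borel_measurable borel"
      by (rule borel_measurable_indicator) auto
    have im: "integrable lborel (\<lambda>x. indicat_real (- ball 0 r) x * k n x)"
      using integrable_bounded_scaleR[OF kernelD(4)[OF k], of "indicat_real (- ball 0 r)" 1] bm by (simp add: indicator_def)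
    have im': "integrable lborel (\<lambda>x. indicat_real (- ball 0 r) (x - y) * k n (x - y))"
      using integrable_lborel_translate[OF im, of "- y"] by simp
    have "(LINT x|lborel. g x * k n (x - y)) - g y = (LINT x|lborel. (g x - g y) * k n (x - y))"
      using gk ki by (simp add: left_diff_distrib)
    also have "norm \<dots> \<le> (LINT x|lborel. (e / 2) * k n (x - y) + (2 * B) * (indicat_real (- ball 0 r) (x - y) * k n (x - y)))"
    proof (rule Bochner_Integration.integral_norm_bound_integral)
      show "integrable lborel (\<lambda>x. (g x - g y) * k n (x - y))" using gk ki by (simp add: left_diff_distrib)
      show "integrable lborel (\<lambda>x. (e / 2) * k n (x - y) + (2 * B) * (indicat_real (- ball 0 r) (x - y) * k n (x - y)))"
        using ki im' by simp
      fix x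
      have "\<bar>g x - g y\<bar> \<le> e / 2 + 2 * B * indicat_real (- ball 0 r) (x - y)"
      proof (cases "dist x y < r")
        case True
        have "0 \<le> 2 * B * indicat_real (- ball 0 r) (x - y)" using B0 by simp
        then show ?thesis using r(2)[OF True] by linarith
      next
        case False
        then have "x - y \<in> - ball 0 r" by (simp add: dist_norm norm_minus_commute)
        then have "indicat_real (- ball 0 r) (x - y) = 1" by (rule indicator_simps(1))
        moreover have "\<bar>g x - g y\<bar> \<le> 2 * B" using g(2)[of x] g(2)[of y] by linarith
        ultimately show ?thesis using e by simp
      qed
      then have "\<bar>g x - g y\<bar> * k n (x - y) \<le> (e / 2 + 2 * B * indicat_real (- ball 0 r) (x - y)) * k n (x - y)"
        by (intro mult_right_mono kernelD(3)[OF k])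
      then show "norm ((g x - g y) * k n (x - y)) \<le> (e / 2) * k n (x - y) + (2 * B) * (indicat_real (- ball 0 r) (x - y) * k n (x - y))"
        using kernelD(3)[OF k, of n "x - y"] unfolding real_norm_def abs_mult
        by (simp add: distrib_right mult.assoc)
    qed
    also have "\<dots> = e / 2 + 2 * B * (LINT x|lborel. indicat_real (- ball 0 r) (x - y) * k n (x - y))"
      using ki im' by simp
    also have "(LINT x|lborel. indicat_real (- ball 0 r) (x - y) * k n (x - y)) = (LINT x|lborel. indicat_real (- ball 0 r) x * k n x)"
    proof -
      have "(\<lambda>x. indicat_real (- ball 0 r) x * k n x) \<in> borel_measurable borel"
        using borel_measurable_integrable[OF im] by simp
      from integral_lborel_translate[OF this, of "- y"] show ?thesis by simp
    qed
    also have "e / 2 + 2 * B * (LINT x|lborel. indicat_real (- ball 0 r) x * k n x) \<le> e / 2 + 2 * B * d"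
      using N[OF n] B0 by (intro add_left_mono mult_left_mono) auto
    also have "\<dots> < e / 2 + (2 * B + 1) * d" using d by simp
    also have "(2 * B + 1) * d = e / 2" using D by (simp add: d_def flip: D_def)
    also have "e / 2 + e / 2 = e" by simp
    finally show ?thesis .
  qed
  then show "\<exists>no. \<forall>n\<ge>no. norm ((LINT x|lborel. g x * k n (x - y)) - g y) < e" by blast
qed

text \<open>Mollification never increases the mass. For the lower bound a nearly optimal continuous
  field \<open>g\<close> is tested against the mollified measure, and the mollifier is moved onto
  the components of \<open>g\<close>, which converge back boundedly.\<close>

theorem conv_norm_tendsto:
  fixes l :: "'a::euclidean_space measure" and f :: "'a \<Rightarrow> 'b::euclidean_space"
  assumes k: "\<And>n. kernel (k n)"
    and conc: "\<And>r. 0 < r \<Longrightarrow> (\<lambda>n. LINT x|lborel. indicator (- ball 0 r) x * k n x) \<longlonglongrightarrow> 0"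
    and l: "sigma_finite_measure l" "sets l = sets borel" and f: "integrable l f"
  shows "(\<lambda>n::nat. LINT x|lborel. norm (conv (k n) l f x)) \<longlonglongrightarrow> (LINT y|l. norm (f y))"
proof (rule LIMSEQ_I)
  fix e :: real assume "0 < e"
  then have e: "0 < e / 2" by simp
  obtain g where g: "continuous_on UNIV g" "\<And>x. norm (g x) \<le> 1"
    "(LINT y|l. norm (f y)) - e / 2 < (LINT y|l. f y \<bullet> g y)"
    using norm_integral_dual[OF l(2) f e] by blast
  have gb: "continuous_on UNIV (\<lambda>x. g x \<bullet> b)" for b by (intro continuous_intros g)
  have gbm: "(\<lambda>x. g x \<bullet> b) \<in> borel_measurable borel" for b by (rule borel_measurable_continuous_onI[OF gb])
  have gb1: "\<bar>g x \<bullet> b\<bar> \<le> 1" if "b \<in> Basis" for x b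
    using Basis_le_norm[OF that, of "g x"] g(2)[of x] by linarith
  have fb: "integrable l (\<lambda>y. f y \<bullet> b)" for b using f by simp
  have ci: "integrable lborel (conv (k n) l f)" for n by (rule conv_integrable(1)[OF k l f])
  have gbl: "(\<lambda>x. g x \<bullet> b) \<in> borel_measurable l" for b
    by (subst measurable_cong_sets[OF l(2) refl]) (rule gbm)
  have lb: "(\<lambda>n. LINT y|l. (f y \<bullet> b) * (LINT x|lborel. (g x \<bullet> b) * k n (x - y))) \<longlonglongrightarrow> (LINT y|l. (f y \<bullet> b) * (g y \<bullet> b))"
    if b: "b \<in> Basis" for b
  proof (rule integral_dominated_convergence[where w="\<lambda>y. \<bar>f y \<bullet> b\<bar>"])
    show "(\<lambda>y. (f y \<bullet> b) * (g y \<bullet> b)) \<in> borel_measurable l"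
      by (rule borel_measurable_times[OF borel_measurable_integrable[OF fb] gbl])
    show "AE y in l. (\<lambda>n. (f y \<bullet> b) * (LINT x|lborel. (g x \<bullet> b) * k n (x - y))) \<longlonglongrightarrow> (f y \<bullet> b) * (g y \<bullet> b)"
      by (intro AE_I2 tendsto_mult tendsto_const mollify_pointwise[OF k conc gb gb1[OF b]])
    show "(\<lambda>y. (f y \<bullet> b) * (LINT x|lborel. (g x \<bullet> b) * k n (x - y))) \<in> borel_measurable l" for n
    proof -
      interpret pair_sigma_finite l "lborel :: 'a measure" by (rule sigma_finite_pair_lborel[OF l(1)])
      have "integrable (l \<Otimes>\<^sub>M lborel) (\<lambda>(y, x). ((g x \<bullet> b) * k n (x - y)) *\<^sub>R (f y \<bullet> b))"
        by (rule kernel_pair_integrable[OF k l fb gbm gb1[OF b]])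
      from integrable_fst[OF this] have "integrable l (\<lambda>y. LINT x|lborel. ((g x \<bullet> b) * k n (x - y)) *\<^sub>R (f y \<bullet> b))" .
      from borel_measurable_integrable[OF this] show ?thesis by (simp add: mult.commute)
    qed
    show "AE y in l. norm ((f y \<bullet> b) * (LINT x|lborel. (g x \<bullet> b) * k n (x - y))) \<le> \<bar>f y \<bullet> b\<bar>" for n
    proof (intro AE_I2)
      fix y
      have "norm (LINT x|lborel. (g x \<bullet> b) * k n (x - y)) \<le> (LINT x|lborel. k n (x - y))"
      proof (rule Bochner_Integration.integral_norm_bound_integral)
        show "integrable lborel (\<lambda>x. (g x \<bullet> b) * k n (x - y))"
          using integrable_bounded_scaleR[OF kernelD(6)[OF k] _ gb1[OF b]] gbm by simp
        show "norm ((g x \<bullet> b) * k n (x - y)) \<le> k n (x - y)" for x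
          using gb1[OF b, of x] kernelD(3)[OF k, of n "x - y"] by (simp add: abs_mult mult_left_le_one_le)
      qed (rule kernelD(6)[OF k])
      then have "\<bar>LINT x|lborel. (g x \<bullet> b) * k n (x - y)\<bar> \<le> 1" using kernelD(7)[OF k] by simp
      then show "norm ((f y \<bullet> b) * (LINT x|lborel. (g x \<bullet> b) * k n (x - y))) \<le> \<bar>f y \<bullet> b\<bar>"
        by (simp add: abs_mult mult_left_le)
    qed
  qed (use fb in simp)
  have sw: "(LINT y|l. (f y \<bullet> b) * (LINT x|lborel. (g x \<bullet> b) * k n (x - y))) = (LINT x|lborel. (conv (k n) l f x \<bullet> b) * (g x \<bullet> b))"
    if b: "b \<in> Basis" for b n
  proof -
    have "(LINT x|lborel. (conv (k n) l f x \<bullet> b) * (g x \<bullet> b)) = (LINT x|lborel. LINT y|l. ((g x \<bullet> b) * k n (x - y)) *\<^sub>R (f y \<bullet> b))"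
    proof (rule integral_cong_AE)
      show "(\<lambda>x. (conv (k n) l f x \<bullet> b) * (g x \<bullet> b)) \<in> borel_measurable lborel"
        using ci[of n] gbm by auto
      show "(\<lambda>x. LINT y|l. ((g x \<bullet> b) * k n (x - y)) *\<^sub>R (f y \<bullet> b)) \<in> borel_measurable lborel"
        by (rule borel_measurable_integrable[OF kernel_Fubini(2)[OF k l fb gbm gb1[OF b]]])
      show "AE x in lborel. (conv (k n) l f x \<bullet> b) * (g x \<bullet> b) = (LINT y|l. ((g x \<bullet> b) * k n (x - y)) *\<^sub>R (f y \<bullet> b))"
        using conv_integrable(2)[OF k[of n] l f]
      proof (rule AE_mp, intro AE_I2 impI)
        fix x assume i: "integrable l (\<lambda>y. k n (x - y) *\<^sub>R f y)"
        have "conv (k n) l f x \<bullet> b = (LINT y|l. (k n (x - y) *\<^sub>R f y) \<bullet> b)"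
          unfolding conv_def using i by (intro integral_inner_left[symmetric]) auto
        then show "(conv (k n) l f x \<bullet> b) * (g x \<bullet> b) = (LINT y|l. ((g x \<bullet> b) * k n (x - y)) *\<^sub>R (f y \<bullet> b))"
          by (simp add: mult.assoc mult.commute[of _ "g x \<bullet> b"])
      qed
    qed
    also have "\<dots> = (LINT y|l. LINT x|lborel. ((g x \<bullet> b) * k n (x - y)) *\<^sub>R (f y \<bullet> b))"
      by (rule kernel_Fubini(3)[OF k l fb gbm gb1[OF b]])
    finally show ?thesis by (simp add: mult.commute)
  qed
  have icb: "integrable lborel (\<lambda>x. (conv (k n) l f x \<bullet> b) * (g x \<bullet> b))" if b: "b \<in> Basis" for n b
    using integrable_bounded_scaleR[OF integrable_inner_left[OF ci[of n], of b] _ gb1[OF b]] gbm by (simp add: mult.commute)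
  have ifb: "integrable l (\<lambda>y. (f y \<bullet> b) * (g y \<bullet> b))" if b: "b \<in> Basis" for b
    using integrable_bounded_scaleR[OF fb _ gb1[OF b]] gbl by (simp add: mult.commute)
  have fg: "f y \<bullet> g y = (\<Sum>b\<in>Basis. (f y \<bullet> b) * (g y \<bullet> b))" for y by (rule euclidean_inner)
  have cg: "conv (k n) l f x \<bullet> g x = (\<Sum>b\<in>Basis. (conv (k n) l f x \<bullet> b) * (g x \<bullet> b))" for n x by (rule euclidean_inner)
  have "(\<lambda>n. \<Sum>b\<in>Basis. LINT y|l. (f y \<bullet> b) * (LINT x|lborel. (g x \<bullet> b) * k n (x - y)))
      \<longlonglongrightarrow> (\<Sum>b\<in>Basis. LINT y|l. (f y \<bullet> b) * (g y \<bullet> b))"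
    by (intro tendsto_sum lb)
  moreover have "(\<Sum>b\<in>Basis. LINT y|l. (f y \<bullet> b) * (g y \<bullet> b)) = (LINT y|l. f y \<bullet> g y)"
    unfolding fg by (rule Bochner_Integration.integral_sum[symmetric]) (rule ifb)
  moreover have "(\<Sum>b\<in>Basis. LINT y|l. (f y \<bullet> b) * (LINT x|lborel. (g x \<bullet> b) * k n (x - y))) = (LINT x|lborel. conv (k n) l f x \<bullet> g x)" for n
  proof -
    have "(\<Sum>b\<in>Basis. LINT y|l. (f y \<bullet> b) * (LINT x|lborel. (g x \<bullet> b) * k n (x - y)))
        = (\<Sum>b\<in>Basis. LINT x|lborel. (conv (k n) l f x \<bullet> b) * (g x \<bullet> b))"
      by (intro sum.cong refl sw)
    also have "\<dots> = (LINT x|lborel. conv (k n) l f x \<bullet> g x)"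
      unfolding cg by (rule Bochner_Integration.integral_sum[symmetric]) (rule icb)
    finally show ?thesis .
  qed
  ultimately have L: "(\<lambda>n. LINT x|lborel. conv (k n) l f x \<bullet> g x) \<longlonglongrightarrow> (LINT y|l. f y \<bullet> g y)" by simp
  from order_tendstoD(1)[OF L g(3)] obtain N where
    N: "\<And>n. N \<le> n \<Longrightarrow> (LINT y|l. norm (f y)) - e / 2 < (LINT x|lborel. conv (k n) l f x \<bullet> g x)"
    by (auto simp: eventually_sequentially)
  have "norm ((LINT x|lborel. norm (conv (k n) l f x)) - (LINT y|l. norm (f y))) < e" if "N \<le> n" for n
  proof -
    have "(LINT x|lborel. conv (k n) l f x \<bullet> g x) \<le> (LINT x|lborel. norm (conv (k n) l f x))"
    proof (rule integral_mono)
      show "integrable lborel (\<lambda>x. conv (k n) l f x \<bullet> g x)"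
        unfolding cg by (rule Bochner_Integration.integrable_sum) (rule icb)
      show "integrable lborel (\<lambda>x. norm (conv (k n) l f x))" using ci by simp
      fix x
      have "conv (k n) l f x \<bullet> g x \<le> norm (conv (k n) l f x) * norm (g x)" by (rule norm_cauchy_schwarz)
      also have "\<dots> \<le> norm (conv (k n) l f x)" using g(2)[of x] by (simp add: mult_left_le)
      finally show "conv (k n) l f x \<bullet> g x \<le> norm (conv (k n) l f x)" .
    qed
    moreover have "(LINT x|lborel. norm (conv (k n) l f x)) \<le> (LINT y|l. norm (f y))"
      by (rule conv_norm_integral_le[OF k l f])
    ultimately show ?thesis using N[OF that] \<open>0 < e\<close> by (simp add: abs_real_def)
  qed
  then show "\<exists>no. \<forall>n\<ge>no. norm ((LINT x|lborel. norm (conv (k n) l f x)) - (LINT y|l. norm (f y))) < e" by blast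
qed

section \<open>The functional \<open>\<eta>\<close>\<close>

text \<open>Dyadic scales are adapted to the semigroup law: two kernels of scale
  \<open>(1/2) ^ Suc n\<close> convolve to the one of scale \<open>(1/2) ^ n\<close>.\<close>

lemma mollifier_semigroupD:
  assumes \<rho>: "mollifier_semigroup \<rho>"
  shows "kernel (\<rho> ((1/2) ^ n))"
    "0 < r \<Longrightarrow> (\<lambda>n. LINT x|lborel. indicator (- ball 0 r) x * \<rho> ((1/2) ^ n) x) \<longlonglongrightarrow> 0"
    "has_bochner_integral lborel (\<lambda>y. \<rho> ((1/2) ^ Suc n) (x - y) * \<rho> ((1/2) ^ Suc n) y) (\<rho> ((1/2) ^ n) x)"
proof -
  have p: "0 < (1/2::real) ^ n" for n by simp
  have "smooth (\<rho> ((1/2) ^ n))" "\<forall>x. 0 \<le> \<rho> ((1/2) ^ n) x" "has_bochner_integral lborel (\<rho> ((1/2) ^ n)) 1"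
    using \<rho> p[of n] unfolding mollifier_semigroup_def by metis+
  then show "kernel (\<rho> ((1/2) ^ n))" by (simp add: kernel_def smooth_continuous)
  show "(\<lambda>n. LINT x|lborel. indicator (- ball 0 r) x * \<rho> ((1/2) ^ n) x) \<longlonglongrightarrow> 0" if "0 < r"
  proof -
    have "((\<lambda>e. LINT x:- ball 0 r|lborel. \<rho> e x) \<longlongrightarrow> 0) (at_right 0)"
      using \<rho> that unfolding mollifier_semigroup_def by blast
    moreover have "filterlim (\<lambda>n. (1/2::real) ^ n) (at_right 0) sequentially"
      unfolding filterlim_at by (auto intro!: LIMSEQ_power_zero)
    ultimately have "(\<lambda>n. LINT x:- ball 0 r|lborel. \<rho> ((1/2) ^ n) x) \<longlonglongrightarrow> 0"
      by (rule filterlim_compose)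
    then show ?thesis by (simp add: set_lebesgue_integral_def)
  qed
  have "has_bochner_integral lborel (\<lambda>y. \<rho> ((1/2) ^ Suc n) (x - y) * \<rho> ((1/2) ^ Suc n) y) (\<rho> ((1/2) ^ Suc n + (1/2) ^ Suc n) x)"
    using \<rho> p[of "Suc n"] unfolding mollifier_semigroup_def by blast
  then show "has_bochner_integral lborel (\<lambda>y. \<rho> ((1/2) ^ Suc n) (x - y) * \<rho> ((1/2) ^ Suc n) y) (\<rho> ((1/2) ^ n) x)"
    by simp
qed

lemma represents_sigma_finite: "represents l f \<mu> \<Longrightarrow> sigma_finite_measure l"
  unfolding represents_def by (auto simp: finite_measure_def)

lemma represents_conv:
  fixes \<mu> :: "'a::euclidean_space set \<Rightarrow> 'b::euclidean_space"
  assumes r: "represents l f \<mu>" and supp: "\<And>x. R < norm x \<Longrightarrow> f x = 0" and k: "kernel k"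
  shows "vm_integral \<mu> (\<lambda>y. k (x - y)) = conv k l f x"
    "(LINT y|variation \<mu>. k (x - y)) = conv k l (\<lambda>y. norm (f y)) x"
proof -
  have s: "sets l = sets borel" and f: "integrable l f" using r by (auto simp: represents_def)
  have c: "continuous_on UNIV (\<lambda>y. k (x - y))" by (rule continuous_kernel_shift[OF k])
  have cm: "(\<lambda>y. k (x - y)) \<in> borel_measurable borel" by (rule borel_measurable_continuous_onI[OF c])
  have i: "integrable l (\<lambda>y. k (x - y) *\<^sub>R f y)"
    by (rule integrable_bounded_support[OF s f supp c])
  show "vm_integral \<mu> (\<lambda>y. k (x - y)) = conv k l f x"
    unfolding conv_def by (rule represents_vm_integral[OF r cm i])
  show "(LINT y|variation \<mu>. k (x - y)) = conv k l (\<lambda>y. norm (f y)) x"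
    unfolding represents_variation[OF r] conv_def
    using f represents_borel_measurable[OF r cm] by (subst integral_real_density) (auto simp: mult.commute)
qed

text \<open>A kernel of integral 1 preserves the total mass of the variation, so the level is the
  mass lost when the vector measure itself is mollified. The bounded support makes the convolutions
  finite at every point.\<close>

lemma eta_level_eq:
  fixes \<mu> :: "'a::euclidean_space set \<Rightarrow> 'b::euclidean_space"
  assumes \<rho>: "mollifier_semigroup \<rho>" and r: "represents l f \<mu>" and supp: "\<And>x. R < norm x \<Longrightarrow> f x = 0"
  shows "eta_level \<rho> n \<mu> = (LINT y|l. norm (f y)) - (LINT x|lborel. norm (conv (\<rho> ((1/2) ^ n)) l f x))"
proof -
  have s: "sets l = sets borel" and f: "integrable l f" using r by (auto simp: represents_def)
  note k = mollifier_semigroupD(1)[OF \<rho>, of n]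
  note sf = represents_sigma_finite[OF r]
  have fn: "integrable l (\<lambda>y. norm (f y))" using f by simp
  have "eta_level \<rho> n \<mu> = (LINT x|lborel. conv (\<rho> ((1/2) ^ n)) l (\<lambda>y. norm (f y)) x - norm (conv (\<rho> ((1/2) ^ n)) l f x))"
    unfolding eta_level_def by (simp only: represents_conv[OF r supp k])
  also have "\<dots> = (LINT x|lborel. conv (\<rho> ((1/2) ^ n)) l (\<lambda>y. norm (f y)) x) - (LINT x|lborel. norm (conv (\<rho> ((1/2) ^ n)) l f x))"
    by (intro Bochner_Integration.integral_diff integrable_norm conv_integrable(1)[OF k sf s] fn f)
  also have "(LINT x|lborel. conv (\<rho> ((1/2) ^ n)) l (\<lambda>y. norm (f y)) x) = (LINT y|l. norm (f y))"
    by (rule conv_integrable(3)[OF k sf s fn])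
  finally show ?thesis .
qed

lemma eta_level_nonneg:
  fixes \<mu> :: "'a::euclidean_space set \<Rightarrow> 'b::euclidean_space"
  assumes \<rho>: "mollifier_semigroup \<rho>" and r: "represents l f \<mu>" and supp: "\<And>x. R < norm x \<Longrightarrow> f x = 0"
  shows "0 \<le> eta_level \<rho> n \<mu>"
  using conv_norm_integral_le[OF mollifier_semigroupD(1)[OF \<rho>, of n] represents_sigma_finite[OF r], of f] r
  by (simp add: eta_level_eq[OF assms] represents_def)

text \<open>A coarser mollification is a further mollification of a finer one, and therefore loses
  at least as much mass.\<close>

lemma eta_level_antimono:
  fixes \<mu> :: "'a::euclidean_space set \<Rightarrow> 'b::euclidean_space"
  assumes \<rho>: "mollifier_semigroup \<rho>" and r: "represents l f \<mu>" and supp: "\<And>x. R < norm x \<Longrightarrow> f x = 0"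
  shows "m \<le> n \<Longrightarrow> eta_level \<rho> n \<mu> \<le> eta_level \<rho> m \<mu>"
proof (induction n rule: dec_induct)
  case (step n)
  have s: "sets l = sets borel" and f: "integrable l f" using r by (auto simp: represents_def)
  have eq: "eta_level \<rho> n \<mu> = (LINT y|l. norm (f y)) - (LINT x|lborel. norm (conv (\<rho> ((1/2) ^ n)) l f x))" for n
    by (rule eta_level_eq[OF \<rho> r supp])
  have "eta_level \<rho> (Suc n) \<mu> \<le> eta_level \<rho> n \<mu>"
    unfolding eq using conv_norm_mono_semigroup[OF mollifier_semigroupD(1)[OF \<rho>, of "Suc n"] mollifier_semigroupD(1)[OF \<rho>, of "Suc n"]
      mollifier_semigroupD(1)[OF \<rho>, of n] represents_sigma_finite[OF r] s f mollifier_semigroupD(3)[OF \<rho>, of n]]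
    by simp
  then show ?case using step.IH by simp
qed simp

lemma eta_nonneg:
  fixes \<mu> :: "'a::euclidean_space set \<Rightarrow> 'b::euclidean_space"
  assumes \<rho>: "mollifier_semigroup \<rho>" and r: "represents l f \<mu>" and supp: "\<And>x. R < norm x \<Longrightarrow> f x = 0"
    and \<eta>: "0 < \<eta>\<^sub>0"
  shows "0 \<le> eta \<rho> \<eta>\<^sub>0 \<mu>"
  unfolding eta_def using eta_level_nonneg[OF assms(1-3)] \<eta>
  by (intro ereal_0_le_mult suminf_0_le) auto

text \<open>The levels decrease in \<open>n\<close>, so a bound on their sum forces the decay \<open>O(1/n)\<close>, uniformly in \<open>\<mu>\<close>.\<close>

lemma eta_level_decay:
  fixes \<mu> :: "'a::euclidean_space set \<Rightarrow> 'b::euclidean_space"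
  assumes \<rho>: "mollifier_semigroup \<rho>" and r: "represents l f \<mu>" and supp: "\<And>x. R < norm x \<Longrightarrow> f x = 0"
    and \<eta>: "0 < \<eta>\<^sub>0" and K: "eta \<rho> \<eta>\<^sub>0 \<mu> \<le> ereal K"
  shows "real n * eta_level \<rho> n \<mu> \<le> K / \<eta>\<^sub>0"
proof -
  have "real n * eta_level \<rho> n \<mu> = (\<Sum>l<n. eta_level \<rho> n \<mu>)" by simp
  also have "\<dots> \<le> (\<Sum>l<n. eta_level \<rho> (Suc l) \<mu>)"
    by (intro sum_mono eta_level_antimono[OF assms(1-3)]) auto
  finally have 1: "real n * eta_level \<rho> n \<mu> \<le> (\<Sum>l<n. eta_level \<rho> (Suc l) \<mu>)" .
  have "ereal \<eta>\<^sub>0 * (\<Sum>l<n. ereal (eta_level \<rho> (Suc l) \<mu>)) \<le> eta \<rho> \<eta>\<^sub>0 \<mu>"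
    unfolding eta_def using \<eta> eta_level_nonneg[OF assms(1-3)]
    by (intro ereal_mult_left_mono suminf_upper) auto
  then have "ereal (\<eta>\<^sub>0 * (\<Sum>l<n. eta_level \<rho> (Suc l) \<mu>)) \<le> ereal K" using K order_trans by fastforce
  then have "(\<Sum>l<n. eta_level \<rho> (Suc l) \<mu>) \<le> K / \<eta>\<^sub>0" using \<eta> by (simp add: pos_le_divide_eq mult.commute)
  then show ?thesis using 1 by simp
qed

section \<open>Convergence of homogeneous functionals under a bound on \<eta>\<close>

lemma homogeneous_key_estimate:
  fixes \<Phi> :: "'b::euclidean_space \<Rightarrow> real"
  assumes \<Phi>: "continuous_on UNIV \<Phi>" "\<And>v. \<bar>\<Phi> v\<bar> \<le> c * norm v" "\<And>t v. 0 \<le> t \<Longrightarrow> \<Phi> (t *\<^sub>R v) = t * \<Phi> v"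
    and \<delta>: "0 < \<delta>"
  obtains C where "0 \<le> C"
    "\<And>v m. norm m = 1 \<Longrightarrow> \<bar>\<Phi> v - \<Phi> m * (v \<bullet> m)\<bar> \<le> \<delta> * norm v + C * (norm v - v \<bullet> m)"
proof -
  have c0: "0 \<le> c"
  proof -
    obtain b :: 'b where "b \<in> Basis" using nonempty_Basis by blast
    then show ?thesis using \<Phi>(2)[of b] abs_ge_zero[of "\<Phi> b"] by simp
  qed
  have "uniformly_continuous_on (sphere 0 1) \<Phi>"
    by (rule compact_uniformly_continuous[OF continuous_on_subset[OF \<Phi>(1)] compact_sphere]) simp
  then obtain r where r: "0 < r" "\<And>x y. norm x = 1 \<Longrightarrow> norm y = 1 \<Longrightarrow> dist x y < r \<Longrightarrow> dist (\<Phi> x) (\<Phi> y) < \<delta>"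
    unfolding uniformly_continuous_on_def using \<delta> by (metis mem_sphere_0)
  \<comment> \<open>For unit vectors \<open>s\<close> and \<open>m\<close> one has
    \<open>(dist s m)\<^sup>2 = 2 * (1 - s \<bullet> m)\<close>. The summand \<open>c\<close> pays
    for replacing \<open>\<Phi> m\<close> by \<open>\<Phi> m * (s \<bullet> m)\<close>. The summand
    \<open>4 * c / r\<^sup>2\<close> absorbs the crude bound \<open>2 * c\<close> for the difference
    of the values when \<open>s\<close> and \<open>m\<close> are at least \<open>r\<close> apart;
    closer pairs are covered by \<delta>.\<close>
  define C where "C = c + 4 * c / r\<^sup>2"
  have C: "c \<le> C" "0 \<le> C" using c0 by (auto simp: C_def)
  have unit: "\<bar>\<Phi> s - \<Phi> m * (s \<bullet> m)\<bar> \<le> \<delta> + C * (1 - s \<bullet> m)" if s: "norm s = 1" and m: "norm m = 1" for s m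
  proof -
    have sm: "s \<bullet> m \<le> 1" using norm_cauchy_schwarz[of s m] s m by simp
    have d2: "(dist s m)\<^sup>2 = 2 * (1 - s \<bullet> m)"
    proof -
      have "s \<bullet> s = 1" "m \<bullet> m = 1" using s m by (simp_all add: dot_square_norm)
      then show ?thesis unfolding dist_norm power2_norm_eq_inner
        by (simp add: inner_diff_left inner_diff_right inner_commute)
    qed
    have "\<Phi> s - \<Phi> m * (s \<bullet> m) = (\<Phi> s - \<Phi> m) + \<Phi> m * (1 - s \<bullet> m)" by (simp add: algebra_simps)
    then have "\<bar>\<Phi> s - \<Phi> m * (s \<bullet> m)\<bar> \<le> \<bar>\<Phi> s - \<Phi> m\<bar> + \<bar>\<Phi> m\<bar> * (1 - s \<bullet> m)"
      using sm abs_triangle_ineq[of "\<Phi> s - \<Phi> m" "\<Phi> m * (1 - s \<bullet> m)"] by (simp add: abs_mult)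
    also have "\<bar>\<Phi> m\<bar> * (1 - s \<bullet> m) \<le> c * (1 - s \<bullet> m)"
      using \<Phi>(2)[of m] m sm by (intro mult_right_mono) auto
    finally have 1: "\<bar>\<Phi> s - \<Phi> m * (s \<bullet> m)\<bar> \<le> \<bar>\<Phi> s - \<Phi> m\<bar> + c * (1 - s \<bullet> m)" by simp
    show ?thesis
    proof (cases "dist s m < r")
      case True
      have "c * (1 - s \<bullet> m) \<le> C * (1 - s \<bullet> m)" using C sm by (intro mult_right_mono) auto
      then show ?thesis using 1 r(2)[OF s m True] by (simp add: dist_real_def)
    next
      case False
      then have "r\<^sup>2 \<le> (dist s m)\<^sup>2" using r(1) by (intro power_mono) auto
      then have "1 \<le> 2 * (1 - s \<bullet> m) / r\<^sup>2" using r(1) d2 by simp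
      then have "2 * c * 1 \<le> 2 * c * (2 * (1 - s \<bullet> m) / r\<^sup>2)" using c0 by (intro mult_left_mono) auto
      moreover have "\<bar>\<Phi> s - \<Phi> m\<bar> \<le> 2 * c"
      proof -
        have "\<bar>\<Phi> s\<bar> \<le> c" "\<bar>\<Phi> m\<bar> \<le> c" using \<Phi>(2)[of s] \<Phi>(2)[of m] s m by simp_all
        then show ?thesis by linarith
      qed
      moreover have "2 * c * (2 * (1 - s \<bullet> m) / r\<^sup>2) + c * (1 - s \<bullet> m) = C * (1 - s \<bullet> m)"
        by (simp add: C_def algebra_simps)
      ultimately show ?thesis using 1 \<delta> by linarith
    qed
  qed
  show ?thesis
  proof (rule that[OF C(2)])
    fix v m :: 'b assume m: "norm m = 1"
    show "\<bar>\<Phi> v - \<Phi> m * (v \<bullet> m)\<bar> \<le> \<delta> * norm v + C * (norm v - v \<bullet> m)"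
    proof (cases "v = 0")
      case True then show ?thesis using \<Phi>(3)[of 0 0] by simp
    next
      case False
      define s where "s = sgn v"
      have s: "norm s = 1" using False by (simp add: s_def norm_sgn)
      have v: "v = norm v *\<^sub>R s" using False by (simp add: s_def sgn_div_norm)
      have "\<Phi> v = norm v * \<Phi> s" using \<Phi>(3)[of "norm v" s] v by simp
      moreover have "v \<bullet> m = norm v * (s \<bullet> m)" using v by (metis inner_scaleR_left)
      ultimately have "\<Phi> v - \<Phi> m * (v \<bullet> m) = norm v * (\<Phi> s - \<Phi> m * (s \<bullet> m))" by (simp add: algebra_simps)
      then have "\<bar>\<Phi> v - \<Phi> m * (v \<bullet> m)\<bar> = norm v * \<bar>\<Phi> s - \<Phi> m * (s \<bullet> m)\<bar>" by (simp add: abs_mult)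
      also have "\<dots> \<le> norm v * (\<delta> + C * (1 - s \<bullet> m))" by (intro mult_left_mono unit s m) simp
      also have "\<dots> = \<delta> * norm v + C * (norm v - v \<bullet> m)"
        using \<open>v \<bullet> m = norm v * (s \<bullet> m)\<close> by (simp add: algebra_simps)
      finally show ?thesis .
    qed
  qed
qed

text \<open>The functional is compared with its value at the mollification, both for the members of
  the sequence and for the limit; at a fixed scale the mollified values converge. The budget is four
  times \<open>e / 4\<close>: the two \<delta>-terms together, the mass lost by the member, the mass
  lost by the limit, and the difference of the mollified values. The order of choices is \<delta>,
  \<open>C\<close>, scale, index.\<close>

theorem eta_bounded_functional_tendsto:
  fixes \<mu> :: "nat \<Rightarrow> 'a::euclidean_space set \<Rightarrow> 'b::euclidean_space" and \<Phi> :: "'b \<Rightarrow> real"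
  assumes \<rho>: "mollifier_semigroup \<rho>" and \<eta>: "0 < \<eta>\<^sub>0"
    and rep: "\<And>i. represents (l i) (f i) (\<mu> i)" and supp: "\<And>i x. R < norm x \<Longrightarrow> f i x = 0"
    and bd: "\<And>i. (LINT y|l i. norm (f i y)) \<le> B" and K: "\<And>i. eta \<rho> \<eta>\<^sub>0 (\<mu> i) \<le> ereal K"
    and repL: "represents L g \<nu>" and suppL: "\<And>x. R < norm x \<Longrightarrow> g x = 0"
    and weak: "\<And>\<psi>. continuous_on UNIV \<psi> \<Longrightarrow> (\<lambda>i. LINT y|l i. \<psi> y *\<^sub>R f i y) \<longlonglongrightarrow> (LINT y|L. \<psi> y *\<^sub>R g y)"
    and \<Phi>: "continuous_on UNIV \<Phi>" "\<And>v. \<bar>\<Phi> v\<bar> \<le> c * norm v" "\<And>t v. 0 \<le> t \<Longrightarrow> \<Phi> (t *\<^sub>R v) = t * \<Phi> v"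
  shows "(\<lambda>i. LINT y|l i. \<Phi> (f i y)) \<longlonglongrightarrow> (LINT y|L. \<Phi> (g y))"
proof (rule LIMSEQ_I)
  fix e :: real assume e: "0 < e"
  define k where "k n = \<rho> ((1/2) ^ n)" for n :: nat
  have k: "kernel (k n)" for n unfolding k_def by (rule mollifier_semigroupD(1)[OF \<rho>])
  have s: "sets (l i) = sets borel" and fi: "integrable (l i) (f i)" for i
    using rep[of i] by (auto simp: represents_def)
  have sL: "sets L = sets borel" and gi: "integrable L g" using repL by (auto simp: represents_def)
  note sf = represents_sigma_finite[OF rep] and sfL = represents_sigma_finite[OF repL]
  have B0: "0 \<le> B" using bd[of 0] by (rule order_trans[rotated]) simp
  define VL where "VL = (LINT y|L. norm (g y))"
  have VL0: "0 \<le> VL" by (simp add: VL_def)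
  define D where "D = B + VL + 1"
  have D: "0 < D" using B0 VL0 by (simp add: D_def)
  define \<delta> where "\<delta> = e / (4 * D)"
  have \<delta>: "0 < \<delta>" using e D by (simp add: \<delta>_def)
  obtain C where C: "0 \<le> C"
    "\<And>v m. norm m = 1 \<Longrightarrow> \<bar>\<Phi> v - \<Phi> m * (v \<bullet> m)\<bar> \<le> \<delta> * norm v + C * (norm v - v \<bullet> m)"
    using homogeneous_key_estimate[OF \<Phi> \<delta>] by metis
  define K' where "K' = max 0 (K / \<eta>\<^sub>0)"
  have lev: "real n * (C * ((LINT y|l i. norm (f i y)) - (LINT x|lborel. norm (conv (k n) (l i) (f i) x)))) \<le> C * K'" for i n
  proof -
    have "real n * eta_level \<rho> n (\<mu> i) \<le> K / \<eta>\<^sub>0" by (rule eta_level_decay[OF \<rho> rep supp \<eta> K])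
    then have "real n * eta_level \<rho> n (\<mu> i) \<le> K'" by (simp add: K'_def)
    moreover have "eta_level \<rho> n (\<mu> i) = (LINT y|l i. norm (f i y)) - (LINT x|lborel. norm (conv (k n) (l i) (f i) x))"
      unfolding k_def by (rule eta_level_eq[OF \<rho> rep supp])
    ultimately show ?thesis
      using C(1) by (simp only: mult.left_commute[of _ C] mult_left_mono)
  qed
  \<comment> \<open>The bound on \<eta> concerns the sequence only, so for the limit measure the
    lost mass is made small by \<open>conv_norm_tendsto\<close> instead of the decay of the
    levels.\<close>
  have tL: "(\<lambda>n. C * (VL - (LINT x|lborel. norm (conv (k n) L g x)))) \<longlonglongrightarrow> C * (VL - VL)"
    unfolding VL_def by (intro tendsto_mult tendsto_diff tendsto_const conv_norm_tendsto[OF k _ sfL sL gi])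
      (simp add: k_def mollifier_semigroupD(2)[OF \<rho>])
  then have "eventually (\<lambda>n. C * (VL - (LINT x|lborel. norm (conv (k n) L g x))) < e / 4) sequentially"
    using e by (intro order_tendstoD(2)) auto
  then obtain N where N: "\<And>n. N \<le> n \<Longrightarrow> C * (VL - (LINT x|lborel. norm (conv (k n) L g x))) < e / 4"
    by (auto simp: eventually_sequentially)
  obtain N' :: nat where N': "4 * (C * K') / e < real N'" using reals_Archimedean2 by blast
  \<comment> \<open>One scale for the whole sequence and its limit: \<open>N'\<close> comes from the
    uniform decay \<open>K' / n\<close>, \<open>N\<close> from the limit measure, and the 1 permits
    cancelling \<open>real n\<close>.\<close>
  define n where "n = max 1 (max N N')"
  have n: "N \<le> n" "0 < real n" "C * K' < real n * (e / 4)"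
  proof -
    show "N \<le> n" "0 < real n" by (auto simp: n_def)
    have "4 * (C * K') / e < real n" using N' by (simp add: n_def)
    then show "C * K' < real n * (e / 4)" using e by (simp add: field_simps)
  qed
  have dn: "C * ((LINT y|l i. norm (f i y)) - (LINT x|lborel. norm (conv (k n) (l i) (f i) x))) < e / 4" for i
  proof -
    have "real n * (C * ((LINT y|l i. norm (f i y)) - (LINT x|lborel. norm (conv (k n) (l i) (f i) x)))) < real n * (e / 4)"
      using lev[of n i] n(3) by linarith
    then show ?thesis by (simp only: mult_less_cancel_left_pos[OF n(2)])
  qed
  have lim: "(\<lambda>i. conv (k n) (l i) (f i) x) \<longlonglongrightarrow> conv (k n) L g x" for x
    unfolding conv_def by (rule weak[OF continuous_kernel_shift[OF k]])
  have "(\<lambda>i. LINT x|lborel. \<Phi> (conv (k n) (l i) (f i) x)) \<longlonglongrightarrow> (LINT x|lborel. \<Phi> (conv (k n) L g x))"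
  proof (rule conv_tendsto(2)[OF k sf s fi supp bd sfL sL gi lim \<Phi>(1), where c=c])
    show "norm (\<Phi> v) \<le> c * norm v" for v using \<Phi>(2)[of v] by simp
  qed
  from LIMSEQ_D[OF this, of "e / 4"] e obtain i0 where
    i0: "\<And>i. i0 \<le> i \<Longrightarrow> \<bar>(LINT x|lborel. \<Phi> (conv (k n) (l i) (f i) x)) - (LINT x|lborel. \<Phi> (conv (k n) L g x))\<bar> < e / 4"
    by auto
  have "norm ((LINT y|l i. \<Phi> (f i y)) - (LINT y|L. \<Phi> (g y))) < e" if i: "i0 \<le> i" for i
  proof -
    have 1: "\<bar>(LINT y|l i. \<Phi> (f i y)) - (LINT x|lborel. \<Phi> (conv (k n) (l i) (f i) x))\<bar> \<le>
        \<delta> * (LINT y|l i. norm (f i y)) + C * ((LINT y|l i. norm (f i y)) - (LINT x|lborel. norm (conv (k n) (l i) (f i) x)))"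
      by (rule mollified_functional_error[OF k sf s fi supp \<Phi> C(2)])
    have 2: "\<bar>(LINT y|L. \<Phi> (g y)) - (LINT x|lborel. \<Phi> (conv (k n) L g x))\<bar> \<le>
        \<delta> * VL + C * (VL - (LINT x|lborel. norm (conv (k n) L g x)))"
      unfolding VL_def by (rule mollified_functional_error[OF k sfL sL gi suppL \<Phi> C(2)])
    have "\<delta> * (LINT y|l i. norm (f i y)) + \<delta> * VL \<le> \<delta> * (B + VL)"
      using bd[of i] \<delta> by (simp add: distrib_left mult_left_mono)
    also have "\<dots> \<le> \<delta> * (B + VL + 1)" using \<delta> by simp
    also have "\<dots> = e / 4"
      using D by (simp add: \<delta>_def flip: D_def)
    finally show ?thesis using 1 2 dn[of i] N[OF n(1)] i0[OF i] unfolding real_norm_def by linarith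
  qed
  then show "\<exists>no. \<forall>i\<ge>no. norm ((LINT y|l i. \<Phi> (f i y)) - (LINT y|L. \<Phi> (g y))) < e" by blast
qed

text \<open>A level is a difference of two masses. The total mass converges by the preceding theorem
  with the norm as integrand, the mollified mass because the scale is fixed.\<close>

theorem eta_bounded_level_tendsto:
  fixes \<mu> :: "nat \<Rightarrow> 'a::euclidean_space set \<Rightarrow> 'b::euclidean_space"
  assumes \<rho>: "mollifier_semigroup \<rho>" and \<eta>: "0 < \<eta>\<^sub>0"
    and rep: "\<And>i. represents (l i) (f i) (\<mu> i)" and supp: "\<And>i x. R < norm x \<Longrightarrow> f i x = 0"
    and bd: "\<And>i. (LINT y|l i. norm (f i y)) \<le> B" and K: "\<And>i. eta \<rho> \<eta>\<^sub>0 (\<mu> i) \<le> ereal K"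
    and repL: "represents L g \<nu>" and suppL: "\<And>x. R < norm x \<Longrightarrow> g x = 0"
    and weak: "\<And>\<psi>. continuous_on UNIV \<psi> \<Longrightarrow> (\<lambda>i. LINT y|l i. \<psi> y *\<^sub>R f i y) \<longlonglongrightarrow> (LINT y|L. \<psi> y *\<^sub>R g y)"
  shows "(\<lambda>i. eta_level \<rho> n (\<mu> i)) \<longlonglongrightarrow> eta_level \<rho> n \<nu>"
proof -
  have s: "sets (l i) = sets borel" and fi: "integrable (l i) (f i)" for i
    using rep[of i] by (auto simp: represents_def)
  have sL: "sets L = sets borel" and gi: "integrable L g" using repL by (auto simp: represents_def)
  note sf = represents_sigma_finite[OF rep] and sfL = represents_sigma_finite[OF repL]
  have k: "kernel (\<rho> ((1/2) ^ n))" by (rule mollifier_semigroupD(1)[OF \<rho>])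
  have cn: "continuous_on UNIV (\<lambda>v::'b. norm v)" by (intro continuous_intros)
  have lim: "(\<lambda>i. conv (\<rho> ((1/2) ^ n)) (l i) (f i) x) \<longlonglongrightarrow> conv (\<rho> ((1/2) ^ n)) L g x" for x
    unfolding conv_def by (rule weak[OF continuous_kernel_shift[OF k]])
  have "(\<lambda>i. LINT y|l i. norm (f i y)) \<longlonglongrightarrow> (LINT y|L. norm (g y))"
    by (rule eta_bounded_functional_tendsto[OF assms(1-9) cn, where c=1]) auto
  moreover have "(\<lambda>i. LINT x|lborel. norm (conv (\<rho> ((1/2) ^ n)) (l i) (f i) x)) \<longlonglongrightarrow> (LINT x|lborel. norm (conv (\<rho> ((1/2) ^ n)) L g x))"
    by (rule conv_tendsto(2)[OF k sf s fi supp bd sfL sL gi lim cn, where c=1]) auto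
  moreover have "eta_level \<rho> n (\<mu> i) = (LINT y|l i. norm (f i y)) - (LINT x|lborel. norm (conv (\<rho> ((1/2) ^ n)) (l i) (f i) x))" for i
    by (rule eta_level_eq[OF \<rho> rep supp])
  moreover have "eta_level \<rho> n \<nu> = (LINT y|L. norm (g y)) - (LINT x|lborel. norm (conv (\<rho> ((1/2) ^ n)) L g x))"
    by (rule eta_level_eq[OF \<rho> repL suppL])
  ultimately show ?thesis by (simp add: tendsto_diff)
qed

section \<open>Functions of bounded variation and the perspective integrand\<close>

lemma lebesgue_on_integral_borel:
  fixes k :: "'a::euclidean_space \<Rightarrow> 'b::euclidean_space"
  assumes \<Omega>: "\<Omega> \<in> sets borel" and k: "k \<in> borel_measurable borel"
  shows "(LINT x|lebesgue_on \<Omega>. k x) = (LINT x|lborel. indicator \<Omega> x *\<^sub>R k x)"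
    "integrable (lebesgue_on \<Omega>) k \<longleftrightarrow> integrable lborel (\<lambda>x. indicator \<Omega> x *\<^sub>R k x)"
proof -
  have O: "\<Omega> \<inter> space lebesgue \<in> sets lebesgue" using \<Omega> by simp
  have m: "(\<lambda>x. indicat_real \<Omega> x *\<^sub>R k x) \<in> borel_measurable lborel" using \<Omega> k by simp
  show "(LINT x|lebesgue_on \<Omega>. k x) = (LINT x|lborel. indicator \<Omega> x *\<^sub>R k x)"
    unfolding integral_restrict_space[OF O] by (rule integral_completion[OF m])
  show "integrable (lebesgue_on \<Omega>) k \<longleftrightarrow> integrable lborel (\<lambda>x. indicator \<Omega> x *\<^sub>R k x)"
    unfolding integrable_restrict_space[OF O] by (rule integrable_completion[OF m])
qed

lemma AE_lebesgue_on_lborel: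
  assumes "\<Omega> \<in> sets borel" "AE x in lborel. x \<in> \<Omega> \<longrightarrow> P x"
  shows "AE x in lebesgue_on \<Omega>. P x"
proof -
  have O: "\<Omega> \<inter> space lebesgue \<in> sets lebesgue" using assms(1) by simp
  show ?thesis unfolding AE_restrict_space_iff[OF O] by (rule AE_completion[OF assms(2)])
qed

text \<open>BV functions and gradients are Lebesgue measurable, while all densities live on Borel
  sets. A Borel representative that vanishes off \<Omega> at every point mediates between the
  two.\<close>

lemma lebesgue_on_borel_representative:
  fixes g :: "'a::euclidean_space \<Rightarrow> 'b::euclidean_space"
  assumes \<Omega>: "\<Omega> \<in> sets borel" and g: "integrable (lebesgue_on \<Omega>) g"
  obtains g' where "g' \<in> borel_measurable borel" "integrable lborel g'" "\<And>x. x \<notin> \<Omega> \<Longrightarrow> g' x = 0"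
    "AE x in lebesgue_on \<Omega>. g x = g' x"
proof -
  have O: "\<Omega> \<inter> space lebesgue \<in> sets lebesgue" using \<Omega> by simp
  have i: "integrable lebesgue (\<lambda>x. indicat_real \<Omega> x *\<^sub>R g x)"
    using g unfolding integrable_restrict_space[OF O] .
  have "\<exists>h. h \<in> borel_measurable lborel \<and> (AE x in lborel. (indicat_real \<Omega> x *\<^sub>R g x) \<bullet> b = h x)" for b
    using completion_ex_borel_measurable_real[of "\<lambda>x. (indicat_real \<Omega> x *\<^sub>R g x) \<bullet> b" lborel]
      borel_measurable_integrable[OF integrable_inner_left[OF i, of b]] by blast
  then obtain h where h: "\<And>b. h b \<in> borel_measurable lborel"
    "\<And>b. AE x in lborel. (indicat_real \<Omega> x *\<^sub>R g x) \<bullet> b = h b x" by metis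
  define g' where "g' x = (\<Sum>b\<in>Basis. (indicator \<Omega> x * h b x) *\<^sub>R b)" for x
  have m: "g' \<in> borel_measurable borel"
    unfolding g'_def using h(1) \<Omega> by (intro borel_measurable_sum borel_measurable_scaleR borel_measurable_times) auto
  have "AE x in lborel. \<forall>b\<in>Basis. (indicat_real \<Omega> x *\<^sub>R g x) \<bullet> b = h b x"
    using h(2) by (intro AE_finite_allI) auto
  then have ae: "AE x in lborel. indicat_real \<Omega> x *\<^sub>R g x = g' x"
  proof (rule AE_mp, intro AE_I2 impI)
    fix x assume b: "\<forall>b\<in>Basis. (indicat_real \<Omega> x *\<^sub>R g x) \<bullet> b = h b x"
    have "g' x = (\<Sum>b\<in>Basis. ((indicat_real \<Omega> x *\<^sub>R g x) \<bullet> b) *\<^sub>R b)"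
      unfolding g'_def
    proof (intro sum.cong refl)
      fix c :: 'b assume "c \<in> Basis"
      then have e: "h c x = (indicat_real \<Omega> x *\<^sub>R g x) \<bullet> c" using b by simp
      show "(indicat_real \<Omega> x * h c x) *\<^sub>R c = ((indicat_real \<Omega> x *\<^sub>R g x) \<bullet> c) *\<^sub>R c"
        unfolding e by (simp split: split_indicator)
    qed
    also have "\<dots> = indicat_real \<Omega> x *\<^sub>R g x" by (rule euclidean_representation)
    finally show "indicat_real \<Omega> x *\<^sub>R g x = g' x" by (rule sym)
  qed
  have "integrable lebesgue g'"
    by (rule integrable_cong_AE_imp[OF i measurable_completion AE_completion[OF ae]]) (use m in simp)
  then have "integrable lborel g'" using m by (subst (asm) integrable_completion) auto
  moreover have "AE x in lebesgue_on \<Omega>. g x = g' x"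
    by (rule AE_lebesgue_on_lborel[OF \<Omega>]) (use ae in \<open>rule AE_mp\<close>, auto)
  ultimately show ?thesis using that[of g'] m by (simp add: g'_def)
qed

lemma Deriv_has_deriv_measure: "u \<in> BV \<Omega> \<Longrightarrow> has_deriv_measure \<Omega> u (Deriv \<Omega> u)"
  unfolding BV_def Deriv_def by (blast intro: someI_ex[of "has_deriv_measure \<Omega> u"])

lemma Deriv_vector_measure_on: "u \<in> BV \<Omega> \<Longrightarrow> vector_measure_on \<Omega> (Deriv \<Omega> u)"
  using Deriv_has_deriv_measure by (auto simp: has_deriv_measure_def)

section \<open>The lifting and its Lebesgue decomposition\<close>

lemma additive_borel_Pair:
  assumes "additive_borel \<mu>" "additive_borel \<nu>"
  shows "additive_borel (\<lambda>A. (\<mu> A, \<nu> A))"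
proof -
  have "bounded_linear (\<lambda>a. (a, 0::'c))" "bounded_linear (\<lambda>b. (0::'b, b))" for a b
    by (auto intro!: bounded_linear_Pair bounded_linear_ident bounded_linear_zero)
  then have "additive_borel (\<lambda>A. (\<mu> A, 0) + (0, \<nu> A))"
    using additive_borel_linear[OF assms(1)] additive_borel_linear[OF assms(2)]
    by (intro additive_borel_add) auto
  then show ?thesis by simp
qed

lemma additive_borel_lborel_Int:
  assumes "\<Omega> \<in> sets borel" "emeasure lborel \<Omega> < \<infinity>"
  shows "additive_borel (\<lambda>A. measure lborel (A \<inter> \<Omega>))"
  unfolding additive_borel_def
proof (intro allI impI)
  fix A :: "nat \<Rightarrow> 'a set" assume A: "range A \<subseteq> sets borel" "disjoint_family A"
  have "(\<lambda>i. measure lborel (A i \<inter> \<Omega>)) sums measure lborel (\<Union>i. A i \<inter> \<Omega>)"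
  proof (rule measure_UNION)
    show "range (\<lambda>i. A i \<inter> \<Omega>) \<subseteq> sets lborel" using A assms by auto
    show "disjoint_family (\<lambda>i. A i \<inter> \<Omega>)" using A(2) by (auto simp: disjoint_family_on_def)
    have "emeasure lborel (\<Union>i. A i \<inter> \<Omega>) \<le> emeasure lborel \<Omega>" using assms by (intro emeasure_mono) auto
    then show "emeasure lborel (\<Union>i. A i \<inter> \<Omega>) \<noteq> \<infinity>" using assms(2) by auto
  qed
  then show "(\<lambda>i. measure lborel (A i \<inter> \<Omega>)) sums measure lborel ((\<Union>i. A i) \<inter> \<Omega>)" by simp
qed

lemma lifting_vector_measure_on:
  assumes \<Omega>: "open \<Omega>" "bounded \<Omega>" and u: "u \<in> BV \<Omega>"
  shows "vector_measure_on \<Omega> (lifting \<Omega> u)"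
proof -
  have "additive_borel (lifting \<Omega> u)"
    unfolding lifting_def[abs_def]
    by (intro additive_borel_Pair additive_borel_lborel_Int vector_measure_on_additive[OF Deriv_vector_measure_on[OF u]])
      (use \<Omega> emeasure_bounded_finite in auto)
  moreover have "\<forall>A\<in>sets borel. lifting \<Omega> u A = lifting \<Omega> u (A \<inter> \<Omega>)"
    using Deriv_vector_measure_on[OF u] unfolding lifting_def vector_measure_on_def by (simp add: Int_assoc)
  ultimately show ?thesis by (simp add: vector_measure_on_def additive_borel_def)
qed

text \<open>The variation depends on the set function alone, so \<open>f\<close> and the zero
  density have the same total variation. This gives uniqueness of densities relative to a common
  \<open>l\<close>.\<close>

lemma represents_AE_zero:
  fixes f :: "'a::euclidean_space \<Rightarrow> 'b::euclidean_space"
  assumes r: "represents l f \<mu>" and z: "\<And>A. A \<in> sets borel \<Longrightarrow> \<mu> A = 0"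
  shows "AE x in l. f x = 0"
proof -
  have f: "integrable l f" using r by (simp add: represents_def)
  have r1: "represents l f (\<lambda>_. 0)" by (rule represents_cong[OF r z])
  have r0: "represents l (\<lambda>_. 0::'b) (\<lambda>_. 0)"
    using r by (simp add: represents_def set_lebesgue_integral_def)
  have "(LINT x|l. norm (f x)) = 0"
    using represents_measure_variation(1)[OF r1, of UNIV] represents_measure_variation(1)[OF r0, of UNIV] by simp
  then show ?thesis using integral_nonneg_eq_0_iff_AE[OF integrable_norm[OF f]] by simp
qed

lemma represents_AE_nonneg:
  fixes p :: "'a::euclidean_space \<Rightarrow> real"
  assumes r: "represents l p \<nu>" and nn: "\<And>A. A \<in> sets borel \<Longrightarrow> 0 \<le> \<nu> A"
  shows "AE x in l. 0 \<le> p x"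
proof -
  have p: "integrable l p" and s: "sets l = sets borel" using r by (auto simp: represents_def)
  have pm: "p \<in> borel_measurable borel"
    using borel_measurable_integrable[OF p] unfolding measurable_cong_sets[OF s refl] .
  define A where "A = {x. p x < 0}"
  have A: "A \<in> sets borel" unfolding A_def using pm by measurable
  have i: "integrable l (\<lambda>x. indicator A x * p x)"
    using integrable_mult_indicator[OF _ p, of A] A s by simp
  have "\<nu> A = (LINT x|l. indicator A x * p x)" using r A by (simp add: represents_def set_lebesgue_integral_def)
  then have le: "(LINT x|l. - (indicator A x * p x)) \<le> 0" using nn[OF A] by simp
  have nn': "0 \<le> - (indicator A x * p x)" for x by (auto simp: A_def split: split_indicator)
  then have "0 \<le> (LINT x|l. - (indicator A x * p x))" by (intro Bochner_Integration.integral_nonneg) auto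
  then have "(LINT x|l. - (indicator A x * p x)) = 0" using le by simp
  then have "AE x in l. - (indicator A x * p x) = 0"
    using integral_nonneg_eq_0_iff_AE[of l "\<lambda>x. - (indicator A x * p x)"] i nn' by simp
  then show ?thesis by (rule AE_mp) (auto simp: A_def split: split_indicator_asm)
qed

lemma represents_lborel_density:
  fixes p :: "'a::euclidean_space \<Rightarrow> real"
  assumes \<Omega>: "\<Omega> \<in> sets borel" "emeasure lborel \<Omega> < \<infinity>"
    and r: "represents l p (\<lambda>A. measure lborel (A \<inter> \<Omega>))"
  shows "density l (\<lambda>x. ennreal (max 0 (p x))) = density lborel (\<lambda>x. ennreal (indicator \<Omega> x))"
proof (rule measure_eqI)
  have p: "integrable l p" and s: "sets l = sets borel" using r by (auto simp: represents_def)
  show "sets (density l (\<lambda>x. ennreal (max 0 (p x)))) = sets (density lborel (\<lambda>x. ennreal (indicator \<Omega> x)))"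
    by (simp add: s)
  fix A assume "A \<in> sets (density l (\<lambda>x. ennreal (max 0 (p x))))"
  then have A: "A \<in> sets borel" "A \<in> sets l" by (simp_all add: s)
  have ae: "AE x in l. 0 \<le> p x" by (rule represents_AE_nonneg[OF r]) simp
  have i: "integrable l (\<lambda>x. indicator A x * p x)" using integrable_mult_indicator[OF A(2) p] by simp
  have "emeasure (density l (\<lambda>x. ennreal (max 0 (p x)))) A = (\<integral>\<^sup>+x. ennreal (max 0 (p x)) * indicator A x \<partial>l)"
    using A p by (intro emeasure_density) auto
  also have "\<dots> = (\<integral>\<^sup>+x. ennreal (indicator A x * p x) \<partial>l)"
    using ae by (intro nn_integral_cong_AE) (auto elim!: AE_mp split: split_indicator)
  also have "\<dots> = ennreal (LINT x|l. indicator A x * p x)"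
    using ae i by (intro nn_integral_eq_integral) (auto elim!: AE_mp)
  also have "(LINT x|l. indicator A x * p x) = measure lborel (A \<inter> \<Omega>)"
    using r A by (simp add: represents_def set_lebesgue_integral_def)
  also have "ennreal \<dots> = emeasure lborel (A \<inter> \<Omega>)"
  proof (rule emeasure_eq_ennreal_measure[symmetric])
    have "emeasure lborel (A \<inter> \<Omega>) \<le> emeasure lborel \<Omega>" using A \<Omega> by (intro emeasure_mono) auto
    then show "emeasure lborel (A \<inter> \<Omega>) \<noteq> top" using \<Omega>(2) by auto
  qed
  also have "\<dots> = (\<integral>\<^sup>+x. indicator (A \<inter> \<Omega>) x \<partial>lborel)" using A \<Omega> by simp
  also have "\<dots> = (\<integral>\<^sup>+x. ennreal (indicator \<Omega> x) * indicator A x \<partial>lborel)"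
    by (intro nn_integral_cong) (auto split: split_indicator)
  also have "\<dots> = emeasure (density lborel (\<lambda>x. ennreal (indicator \<Omega> x))) A"
    using A \<Omega> by (intro emeasure_density[symmetric]) auto
  finally show "emeasure (density l (\<lambda>x. ennreal (max 0 (p x)))) A = emeasure (density lborel (\<lambda>x. ennreal (indicator \<Omega> x))) A" .
qed

text \<open>Lebesgue measure on \<Omega> is the measure \<open>l\<close> weighted by
  \<open>p\<close>, the first component of the density of the lifting; the truncation at 0 alters
  \<open>p\<close> only on an \<open>l\<close>-null set. Integrals of gradients over \<Omega> can
  thus be computed against \<open>l\<close>, together with the singular part.\<close>

lemma lborel_density_integral:
  fixes p :: "'a::euclidean_space \<Rightarrow> real" and k :: "'a \<Rightarrow> 'b::euclidean_space"
  assumes \<Omega>: "\<Omega> \<in> sets borel" "emeasure lborel \<Omega> < \<infinity>"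
    and r: "represents l p (\<lambda>A. measure lborel (A \<inter> \<Omega>))" and k: "k \<in> borel_measurable borel"
  shows "(LINT x|lborel. indicator \<Omega> x *\<^sub>R k x) = (LINT x|l. max 0 (p x) *\<^sub>R k x)"
    "integrable lborel (\<lambda>x. indicator \<Omega> x *\<^sub>R k x) \<longleftrightarrow> integrable l (\<lambda>x. max 0 (p x) *\<^sub>R k x)"
proof -
  have p: "integrable l p" using r by (simp add: represents_def)
  have pm: "(\<lambda>x. max 0 (p x)) \<in> borel_measurable l"
    by (intro borel_measurable_max borel_measurable_const borel_measurable_integrable[OF p])
  have kl: "k \<in> borel_measurable l"
    using k r by (subst measurable_cong_sets[OF _ refl]) (auto simp: represents_def)
  have im: "(\<lambda>x. indicat_real \<Omega> x) \<in> borel_measurable lborel" using \<Omega> by simp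
  have kb: "k \<in> borel_measurable lborel" using k by simp
  note D = represents_lborel_density[OF \<Omega> r]
  show "(LINT x|lborel. indicator \<Omega> x *\<^sub>R k x) = (LINT x|l. max 0 (p x) *\<^sub>R k x)"
    using integral_density[OF kb im] integral_density[OF kl pm] unfolding D by simp
  show "integrable lborel (\<lambda>x. indicator \<Omega> x *\<^sub>R k x) \<longleftrightarrow> integrable l (\<lambda>x. max 0 (p x) *\<^sub>R k x)"
    using integrable_density[OF kb im] integrable_density[OF kl pm] unfolding D by simp
qed

text \<open>The Lebesgue decomposition is read off a representation \<open>(p, q) l\<close> of \<open>(\<L>, Du)\<close>:
  the density is \<open>q / p\<close> and the singular part lives on \<open>{p \<le> 0}\<close>.\<close>

lemma ac_grad_spec:
  fixes \<Omega> :: "'a::euclidean_space set"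
  assumes \<Omega>: "open \<Omega>" "bounded \<Omega>" and u: "u \<in> BV \<Omega>"
  shows "integrable (lebesgue_on \<Omega>) (ac_grad \<Omega> u) \<and>
     lebesgue_singular (\<lambda>A. Deriv \<Omega> u A - (LINT x:A|lebesgue_on \<Omega>. ac_grad \<Omega> u x))"
proof -
  have Ob: "\<Omega> \<in> sets borel" "emeasure lborel \<Omega> < \<infinity>"
    using \<Omega> emeasure_bounded_finite by auto
  obtain l f where r: "represents l f (lifting \<Omega> u)" and supp: "\<And>x. x \<notin> \<Omega> \<Longrightarrow> f x = 0"
    using vector_measure_on_represents[OF lifting_vector_measure_on[OF \<Omega> u] Ob(1)] by blast
  define p where "p x = fst (f x)" for x
  define q where "q x = snd (f x)" for x
  have rp: "represents l p (\<lambda>A. measure lborel (A \<inter> \<Omega>))"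
    using represents_bounded_linear[OF r bounded_linear_fst] by (simp add: p_def[abs_def] lifting_def)
  have rq: "represents l q (Deriv \<Omega> u)"
    using represents_bounded_linear[OF r bounded_linear_snd] by (simp add: q_def[abs_def] lifting_def)
  have s: "sets l = sets borel" and fi: "integrable l f" using r by (auto simp: represents_def)
  have mcong: "borel_measurable l = borel_measurable borel" for n :: nat by (rule measurable_cong_sets[OF s refl])
  have pm: "p \<in> borel_measurable borel" using rp by (metis represents_def borel_measurable_integrable measurable_cong_sets)
  have qm: "q \<in> borel_measurable borel" using rq by (metis represents_def borel_measurable_integrable measurable_cong_sets)
  have qi: "integrable l q" using rq by (simp add: represents_def)
  \<comment> \<open>Where \<open>p\<close> vanishes, division by zero gives the value 0.
    Multiplication by \<open>max 0 (p x)\<close> returns \<open>q\<close> exactly off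
    \<open>N\<close>; outside \<Omega> both \<open>p\<close> and \<open>q\<close> are 0.\<close>
  define g where "g x = (1 / p x) *\<^sub>R q x" for x
  have gm: "g \<in> borel_measurable borel" unfolding g_def using pm qm by measurable
  \<comment> \<open>Its Lebesgue measure is the \<open>l\<close>-integral of \<open>p\<close> over
    \<open>N\<close>, where \<open>p\<close> is both nonpositive and almost everywhere nonnegative;
    hence \<open>N\<close> is null and can carry the singular part.\<close>
  define N where "N = {x\<in>\<Omega>. p x \<le> 0}"
  have Nb: "N \<in> sets borel" unfolding N_def using pm Ob by measurable
  have pg: "max 0 (p x) *\<^sub>R g x = indicator (- N) x *\<^sub>R q x" for x
    using supp[of x] by (auto simp: g_def N_def p_def q_def max_def split: split_indicator)
  have qN: "integrable l (\<lambda>x. indicat_real (- N) x *\<^sub>R q x)"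
    using Nb s qi by (intro integrable_mult_indicator) (auto simp: borel_comp)
  have gi: "integrable (lebesgue_on \<Omega>) g"
    unfolding lebesgue_on_integral_borel(2)[OF Ob(1) gm] lborel_density_integral(2)[OF Ob rp gm] pg by (rule qN)
  have gint: "(LINT x:A|lebesgue_on \<Omega>. g x) = (LINT x|l. indicator A x *\<^sub>R (indicator (- N) x *\<^sub>R q x))" if A: "A \<in> sets borel" for A
  proof -
    have m: "(\<lambda>x. indicat_real A x *\<^sub>R g x) \<in> borel_measurable borel" using gm A by simp
    have e: "max 0 (p x) *\<^sub>R (indicat_real A x *\<^sub>R g x) = indicat_real A x *\<^sub>R (indicator (- N) x *\<^sub>R q x)" for x
      unfolding pg[symmetric] by (rule scaleR_left_commute)
    show ?thesis
      unfolding set_lebesgue_integral_def lebesgue_on_integral_borel(1)[OF Ob(1) m] lborel_density_integral(1)[OF Ob rp m] e ..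
  qed
  have N0: "N \<in> null_sets lborel"
  proof -
    have "measure lborel (N \<inter> \<Omega>) = (LINT x|l. indicator N x * p x)"
      using rp Nb by (simp add: represents_def set_lebesgue_integral_def)
    also have "\<dots> = (LINT x|l. 0)"
    proof (rule integral_cong_AE)
      have "AE x in l. 0 \<le> p x" by (rule represents_AE_nonneg[OF rp]) simp
      then show "AE x in l. indicator N x * p x = 0" by (rule AE_mp) (auto simp: N_def split: split_indicator)
      have pi: "integrable l p" using rp by (simp add: represents_def)
      show "(\<lambda>x. indicator N x * p x) \<in> borel_measurable l"
        by (intro borel_measurable_times borel_measurable_indicator borel_measurable_integrable[OF pi]) (use Nb s in simp)
    qed simp
    also have "N \<inter> \<Omega> = N" by (auto simp: N_def)
    finally have "measure lborel N = 0" by simp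
    moreover have "emeasure lborel N \<noteq> top"
    proof -
      have "emeasure lborel N \<le> emeasure lborel \<Omega>" using Ob by (intro emeasure_mono) (auto simp: N_def)
      then show ?thesis using Ob(2) by auto
    qed
    ultimately show ?thesis using Nb by (auto simp: null_sets_def emeasure_eq_ennreal_measure)
  qed
  have sing: "lebesgue_singular (\<lambda>A. Deriv \<Omega> u A - (LINT x:A|lebesgue_on \<Omega>. g x))"
    unfolding lebesgue_singular_def
  proof (intro bexI[OF _ N0] ballI)
    have eq: "Deriv \<Omega> u A - (LINT x:A|lebesgue_on \<Omega>. g x) = (LINT x|l. indicator (A \<inter> N) x *\<^sub>R q x)" if A: "A \<in> sets borel" for A
    proof -
      have i1: "integrable l (\<lambda>x. indicat_real A x *\<^sub>R q x)" using A s qi by (intro integrable_mult_indicator) auto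
      have i2: "integrable l (\<lambda>x. indicat_real A x *\<^sub>R (indicat_real (- N) x *\<^sub>R q x))"
        by (rule integrable_mult_indicator[OF _ qN]) (use A s in simp)
      have D1: "Deriv \<Omega> u A = (LINT x|l. indicat_real A x *\<^sub>R q x)"
        using rq A by (simp add: represents_def set_lebesgue_integral_def)
      have "Deriv \<Omega> u A - (LINT x:A|lebesgue_on \<Omega>. g x) =
          (LINT x|l. indicat_real A x *\<^sub>R q x - indicat_real A x *\<^sub>R (indicat_real (- N) x *\<^sub>R q x))"
        unfolding gint[OF A] D1 by (rule Bochner_Integration.integral_diff[OF i1 i2, symmetric])
      also have "\<dots> = (LINT x|l. indicator (A \<inter> N) x *\<^sub>R q x)"
        by (intro Bochner_Integration.integral_cong refl) (auto split: split_indicator)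
      finally show ?thesis .
    qed
    fix A :: "'a set" assume A: "A \<in> sets borel"
    show "Deriv \<Omega> u A - (LINT x:A|lebesgue_on \<Omega>. g x) = Deriv \<Omega> u (A \<inter> N) - (LINT x:A \<inter> N|lebesgue_on \<Omega>. g x)"
      unfolding eq[OF A] eq[OF sets.Int[OF A Nb]] by (simp add: Int_assoc)
  qed
  have "\<exists>g. integrable (lebesgue_on \<Omega>) g \<and> lebesgue_singular (\<lambda>A. Deriv \<Omega> u A - (LINT x:A|lebesgue_on \<Omega>. g x))"
    using gi sing by blast
  then show ?thesis unfolding ac_grad_def by (rule someI_ex)
qed

text \<open>On the line where the first entry is 0 the perspective takes its recession value. The
  absolute value extends it evenly to negative first entries, so that it is defined and continuous
  on the whole space; liftings have a nonnegative first component almost everywhere.\<close>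

definition perspective :: "(real \<Rightarrow> real) \<Rightarrow> real \<Rightarrow> real \<times> 'a::euclidean_space \<Rightarrow> real" where
  "perspective \<phi> \<phi>inf v =
     (if fst v = 0 then \<phi>inf * norm (snd v) else \<bar>fst v\<bar> * \<phi> (norm (snd v) / \<bar>fst v\<bar>))"

lemma perspective_scaleR:
  assumes "0 \<le> t"
  shows "perspective \<phi> \<phi>inf (t *\<^sub>R v) = t * perspective \<phi> \<phi>inf v"
  using assms by (cases "t = 0") (auto simp: perspective_def abs_mult)

section \<open>Integrands of linear growth and their perspective\<close>

locale linear_growth =
  fixes \<phi> :: "real \<Rightarrow> real" and \<phi>inf c C' b :: real
  assumes cont: "continuous_on {0..} \<phi>"
    and recession: "((\<lambda>t. \<phi> t / t) \<longlongrightarrow> \<phi>inf) at_top"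
    and c: "0 < c" and C': "0 < C'" and b: "0 \<le> b"
    and growth: "0 \<le> t \<Longrightarrow> c * t - b \<le> \<phi> t \<and> \<phi> t \<le> C' * (1 + t)"
begin

lemma recession_bounds: "c \<le> \<phi>inf" "\<phi>inf \<le> C'"
proof -
  have z: "((\<lambda>t::real. d / t) \<longlongrightarrow> 0) at_top" for d
    by (rule tendsto_divide_0[OF tendsto_const filterlim_at_top_imp_at_infinity[OF filterlim_ident]])
  have "((\<lambda>t::real. c - b / t) \<longlongrightarrow> c - 0) at_top" by (intro tendsto_diff tendsto_const z)
  moreover have "\<forall>\<^sub>F t in at_top. c - b / t \<le> \<phi> t / t"
    using eventually_gt_at_top[of "0::real"]
  proof eventually_elim
    case (elim t)
    have "c - b / t = (c * t - b) / t" using elim by (simp add: diff_divide_distrib)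
    also have "\<dots> \<le> \<phi> t / t" using elim growth[of t] by (intro divide_right_mono) auto
    finally show ?case .
  qed
  ultimately show "c \<le> \<phi>inf" using tendsto_le[OF _ recession] by fastforce
  have "((\<lambda>t::real. C' + C' / t) \<longlongrightarrow> C' + 0) at_top" by (intro tendsto_add tendsto_const z)
  moreover have "\<forall>\<^sub>F t in at_top. \<phi> t / t \<le> C' + C' / t"
    using eventually_gt_at_top[of "0::real"]
  proof eventually_elim
    case (elim t)
    have "\<phi> t / t \<le> (C' * (1 + t)) / t" using elim growth[of t] by (intro divide_right_mono) auto
    also have "\<dots> = C' + C' / t" using elim by (simp add: distrib_left add_divide_distrib)
    finally show ?case .
  qed
  ultimately show "\<phi>inf \<le> C'" using tendsto_le[OF _ _ recession] by fastforce
qed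

lemma abs_growth: "0 \<le> t \<Longrightarrow> \<bar>\<phi> t\<bar> \<le> (C' + b) * (1 + t)"
proof -
  assume t: "0 \<le> t"
  have "0 \<le> c * t" "0 \<le> b * t" "0 \<le> C' * t" using c b C' t by auto
  then show ?thesis using growth[OF t] C' b by (simp add: abs_le_iff algebra_simps)
qed

lemma perspective_bound: "\<bar>perspective \<phi> \<phi>inf v\<bar> \<le> (2 * (C' + b)) * norm v"
proof -
  have n: "\<bar>fst v\<bar> \<le> norm v" "norm (snd v) \<le> norm v"
    using norm_fst_le[of "fst v" "snd v"] norm_snd_le[of "snd v" "fst v"] by simp_all
  show ?thesis
  proof (cases "fst v = 0")
    case True
    have "\<phi>inf * norm (snd v) \<le> (2 * (C' + b)) * norm v"
      using recession_bounds C' b n by (intro mult_mono) auto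
    moreover have "0 \<le> \<phi>inf * norm (snd v)" using recession_bounds c by simp
    ultimately show ?thesis using True by (simp add: perspective_def)
  next
    case False
    have "\<bar>perspective \<phi> \<phi>inf v\<bar> = \<bar>fst v\<bar> * \<bar>\<phi> (norm (snd v) / \<bar>fst v\<bar>)\<bar>"
      using False by (simp add: perspective_def abs_mult)
    also have "\<dots> \<le> \<bar>fst v\<bar> * ((C' + b) * (1 + norm (snd v) / \<bar>fst v\<bar>))"
      by (intro mult_left_mono abs_growth) auto
    also have "\<dots> = (C' + b) * (\<bar>fst v\<bar> + norm (snd v))" using False by (simp add: field_simps)
    also have "\<dots> \<le> (C' + b) * (norm v + norm v)" using n C' b by (intro mult_left_mono) auto
    finally show ?thesis by (simp add: algebra_simps)
  qed
qed

lemma continuous_extension: "continuous_on UNIV (\<lambda>t. \<phi> (max 0 t))"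
  by (rule continuous_on_compose2[OF cont]) (auto intro!: continuous_intros)

text \<open>Off \<open>fst v = 0\<close> this is a composition of continuous functions, and at the
  origin linear growth suffices. At the remaining points the value is \<open>norm (snd w)\<close>
  times the ratio of \<phi> to its argument; that argument tends to infinity, so the ratio tends to
  the recession value.\<close>

lemma perspective_continuous: "continuous_on UNIV (perspective \<phi> \<phi>inf :: real \<times> 'a::euclidean_space \<Rightarrow> real)"
proof (rule continuous_at_imp_continuous_on, rule ballI)
  fix v :: "real \<times> 'a"
  let ?P = "perspective \<phi> \<phi>inf :: real \<times> 'a \<Rightarrow> real"
  show "isCont ?P v"
  proof (cases "fst v = 0")
    case False
    have "continuous_on {w :: real \<times> 'a. fst w \<noteq> 0} (\<lambda>w. \<bar>fst w\<bar> * \<phi> (max 0 (norm (snd w) / \<bar>fst w\<bar>)))"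
      by (intro continuous_intros continuous_on_compose2[OF continuous_extension]) auto
    then have "continuous_on {w :: real \<times> 'a. fst w \<noteq> 0} ?P"
      by (rule continuous_on_eq) (auto simp: perspective_def)
    moreover have "open {w :: real \<times> 'a. fst w \<noteq> 0}" by (intro open_Collect_neq continuous_intros)
    ultimately show ?thesis using False continuous_on_eq_continuous_at[of "{w :: real \<times> 'a. fst w \<noteq> 0}" ?P] by blast
  next
    case t0: True
    show ?thesis
    proof (cases "snd v = 0")
      case True
      then have v: "v = 0" using t0 by (simp add: prod_eq_iff)
      have "?P \<midarrow>0\<rightarrow> 0"
      proof (rule Lim_null_comparison)
        show "\<forall>\<^sub>F w in at 0. norm (?P w) \<le> (2 * (C' + b)) * norm w"
          by (intro always_eventually allI) (unfold real_norm_def, rule perspective_bound)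
        show "((\<lambda>w::real \<times> 'a. (2 * (C' + b)) * norm w) \<longlongrightarrow> 0) (at 0)"
          by (intro tendsto_mult_right_zero tendsto_norm_zero tendsto_ident_at)
      qed
      then show ?thesis by (simp add: v isCont_def perspective_def)
    next
      case False
      define \<kappa> where "\<kappa> w = (if fst w = 0 then \<phi>inf else \<phi> (norm (snd w) / \<bar>fst w\<bar>) / (norm (snd w) / \<bar>fst w\<bar>))" for w :: "real \<times> 'a"
      have k: "(\<kappa> \<longlongrightarrow> \<phi>inf) (at v)"
      proof (rule tendstoI)
        fix e :: real assume e: "0 < e"
        from tendstoD[OF recession e] obtain R where R: "\<And>t. R \<le> t \<Longrightarrow> dist (\<phi> t / t) \<phi>inf < e"
          by (auto simp: eventually_at_top_linorder)
        define S where "S = max 1 R"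
        have S: "0 < S" "R \<le> S" by (auto simp: S_def)
        \<comment> \<open>Positivity of \<open>h\<close> near \<open>v\<close> is an open condition,
          and it pushes the argument of \<phi> beyond \<open>S\<close>, hence beyond
          \<open>R\<close>.\<close>
        define h where "h w = norm (snd w) - S * \<bar>fst w\<bar>" for w :: "real \<times> 'a"
        have "(h \<longlongrightarrow> h v) (at v)" unfolding h_def by (intro tendsto_intros)
        moreover have "0 < h v" using False t0 by (simp add: h_def)
        ultimately have "\<forall>\<^sub>F w in at v. 0 < h w" by (rule order_tendstoD(1))
        then show "\<forall>\<^sub>F w in at v. dist (\<kappa> w) \<phi>inf < e"
        proof eventually_elim
          case (elim w)
          show ?case
          proof (cases "fst w = 0")
            case True then show ?thesis using e by (simp add: \<kappa>_def)
          next
            case F: False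
            have "S \<le> norm (snd w) / \<bar>fst w\<bar>" using elim F by (simp add: h_def pos_le_divide_eq)
            then show ?thesis using R[of "norm (snd w) / \<bar>fst w\<bar>"] S F by (simp add: \<kappa>_def)
          qed
        qed
      qed
      have "((\<lambda>w. norm (snd w) * \<kappa> w) \<longlongrightarrow> norm (snd v) * \<phi>inf) (at v)"
        by (intro tendsto_mult k tendsto_intros)
      moreover have "\<forall>\<^sub>F w in at v. norm (snd w) * \<kappa> w = ?P w"
      proof -
        have "((\<lambda>w. norm (snd w)) \<longlongrightarrow> norm (snd v)) (at v)" by (intro tendsto_intros)
        then have "\<forall>\<^sub>F w in at v. 0 < norm (snd w)" by (rule order_tendstoD(1)) (use False in simp)
        then show ?thesis by eventually_elim (auto simp: \<kappa>_def perspective_def)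
      qed
      ultimately have "(?P \<longlongrightarrow> norm (snd v) * \<phi>inf) (at v)" by (rule Lim_transform_eventually)
      then show ?thesis using t0 by (simp add: isCont_def perspective_def mult.commute)
    qed
  qed
qed

text \<open>Write the density of the lifting as \<open>(p, q)\<close>. Off the singular null set
  \<open>q = p g\<close> with \<open>g\<close> the gradient, so the perspective is \<open>p\<close>
  times \<phi> of the norm of \<open>g\<close>; on the null set \<open>p = 0\<close> and only the
  recession value remains. The second claim is coercivity, from the lower bound
  \<open>c * norm q - b * \<bar>p\<bar>\<close> of the integrand.\<close>

theorem TV_as_eq_integral:
  fixes \<Omega> :: "'a::euclidean_space set"
  assumes \<Omega>: "open \<Omega>" "bounded \<Omega>" and u: "u \<in> BV \<Omega>"
    and r: "represents l f (lifting \<Omega> u)" and supp: "\<And>x. x \<notin> \<Omega> \<Longrightarrow> f x = 0"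
  shows "TV_as \<phi> \<phi>inf \<Omega> u = (LINT y|l. perspective \<phi> \<phi>inf (f y))"
    and "(LINT y|l. norm (f y)) \<le> measure lborel \<Omega> + (TV_as \<phi> \<phi>inf \<Omega> u + b * measure lborel \<Omega>) / c"
proof -
  have Ob: "\<Omega> \<in> sets borel" "emeasure lborel \<Omega> < \<infinity>"
    using \<Omega> emeasure_bounded_finite by auto
  define p where "p x = fst (f x)" for x
  define q where "q x = snd (f x)" for x
  have rp: "represents l p (\<lambda>A. measure lborel (A \<inter> \<Omega>))"
    using represents_bounded_linear[OF r bounded_linear_fst] by (simp add: p_def[abs_def] lifting_def)
  have rq: "represents l q (Deriv \<Omega> u)"
    using represents_bounded_linear[OF r bounded_linear_snd] by (simp add: q_def[abs_def] lifting_def)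
  have s: "sets l = sets borel" and fi: "integrable l f" using r by (auto simp: represents_def)
  have pi: "integrable l p" using rp by (simp add: represents_def)
  have qi: "integrable l q" using rq by (simp add: represents_def)
  have p0: "AE x in l. 0 \<le> p x" by (rule represents_AE_nonneg[OF rp]) simp
  note spec = ac_grad_spec[OF \<Omega> u]
  obtain N where N: "N \<in> null_sets lborel" and sing: "\<And>A. A \<in> sets borel \<Longrightarrow>
     Deriv \<Omega> u A - (LINT x:A|lebesgue_on \<Omega>. ac_grad \<Omega> u x) =
     Deriv \<Omega> u (A \<inter> N) - (LINT x:A \<inter> N|lebesgue_on \<Omega>. ac_grad \<Omega> u x)"
    using spec unfolding lebesgue_singular_def by metis
  have Nb: "N \<in> sets borel" "-N \<in> sets borel" using N by (auto simp: null_sets_def borel_comp)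
  obtain g where g: "g \<in> borel_measurable borel" "integrable lborel g" "\<And>x. x \<notin> \<Omega> \<Longrightarrow> g x = 0"
    "AE x in lebesgue_on \<Omega>. ac_grad \<Omega> u x = g x"
    using lebesgue_on_borel_representative[OF Ob(1) conjunct1[OF spec]] by metis
  have acm: "ac_grad \<Omega> u \<in> borel_measurable (lebesgue_on \<Omega>)" using spec by auto
  have bmr: "k \<in> borel_measurable (lebesgue_on \<Omega>)" if "k \<in> borel_measurable borel" for k :: "'a \<Rightarrow> real"
    using that by (intro measurable_restrict_space1 measurable_completion) simp
  have bma: "k \<in> borel_measurable (lebesgue_on \<Omega>)" if "k \<in> borel_measurable borel" for k :: "'a \<Rightarrow> 'a"
    using that by (intro measurable_restrict_space1 measurable_completion) simp
  have gint: "(LINT x:A|lebesgue_on \<Omega>. ac_grad \<Omega> u x) = (LINT x|l. max 0 (p x) *\<^sub>R (indicator A x *\<^sub>R g x))"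
    if A: "A \<in> sets borel" for A
  proof -
    have m: "(\<lambda>x. indicat_real A x *\<^sub>R g x) \<in> borel_measurable borel" using g A by simp
    have Am: "indicat_real A \<in> borel_measurable borel" using A by simp
    have "(LINT x:A|lebesgue_on \<Omega>. ac_grad \<Omega> u x) = (LINT x|lebesgue_on \<Omega>. indicator A x *\<^sub>R g x)"
      unfolding set_lebesgue_integral_def
    proof (rule integral_cong_AE)
      show "(\<lambda>x. indicat_real A x *\<^sub>R ac_grad \<Omega> u x) \<in> borel_measurable (lebesgue_on \<Omega>)"
        by (rule borel_measurable_scaleR[OF bmr[OF Am] acm])
      show "(\<lambda>x. indicat_real A x *\<^sub>R g x) \<in> borel_measurable (lebesgue_on \<Omega>)" by (rule bma[OF m])
      show "AE x in lebesgue_on \<Omega>. indicat_real A x *\<^sub>R ac_grad \<Omega> u x = indicat_real A x *\<^sub>R g x"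
        using g(4) by (rule AE_mp) simp
    qed
    also have "\<dots> = (LINT x|l. max 0 (p x) *\<^sub>R (indicator A x *\<^sub>R g x))"
      unfolding lebesgue_on_integral_borel(1)[OF Ob(1) m] by (rule lborel_density_integral(1)[OF Ob rp m])
    finally show ?thesis .
  qed
  have L0: "measure lborel (N \<inter> \<Omega>) = 0"
  proof -
    have "emeasure lborel (N \<inter> \<Omega>) \<le> emeasure lborel N" using Nb by (intro emeasure_mono) auto
    then show ?thesis using N by (simp add: measure_def null_sets_def)
  qed
  \<comment> \<open>Integrating \<open>p\<close> over \<open>N\<close> gives the Lebesgue measure of
    a null set, so the nonnegative \<open>p\<close> vanishes almost everywhere there.\<close>
  have pN: "AE x in l. x \<in> N \<longrightarrow> p x = 0"
  proof -
    have i: "integrable l (\<lambda>x. indicator N x * p x)"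
      using integrable_mult_indicator[OF _ pi, of N] Nb s by simp
    have "(LINT x|l. indicator N x * p x) = 0"
      using rp Nb L0 by (simp add: represents_def set_lebesgue_integral_def)
    moreover have "AE x in l. 0 \<le> indicator N x * p x" using p0 by (rule AE_mp) simp
    ultimately have "AE x in l. indicator N x * p x = 0" using integral_nonneg_eq_0_iff_AE[OF i] by simp
    then show ?thesis by (rule AE_mp) (auto split: split_indicator_asm)
  qed
  have ig: "integrable lborel (\<lambda>x. indicator \<Omega> x *\<^sub>R g x)"
    using g(2) integrable_mult_indicator[OF _ g(2), of \<Omega>] Ob by simp
  have pgi: "integrable l (\<lambda>x. max 0 (p x) *\<^sub>R g x)"
    using ig unfolding lborel_density_integral(2)[OF Ob rp g(1)] .
  have empty: "Deriv \<Omega> u {} = 0"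
    by (rule additive_borel_empty[OF vector_measure_on_additive[OF Deriv_vector_measure_on[OF u]]])
  have ac_eq: "Deriv \<Omega> u A = (LINT x|l. indicator A x *\<^sub>R (max 0 (p x) *\<^sub>R g x))" if A: "A \<in> sets borel" "A \<inter> N = {}" for A
  proof -
    have "Deriv \<Omega> u A - (LINT x:A|lebesgue_on \<Omega>. ac_grad \<Omega> u x) = 0"
      unfolding sing[OF A(1)] A(2) using empty by (simp add: set_lebesgue_integral_def)
    then have "Deriv \<Omega> u A = (LINT x|l. max 0 (p x) *\<^sub>R (indicator A x *\<^sub>R g x))" using gint[OF A(1)] by simp
    then show ?thesis by (simp only: scaleR_left_commute)
  qed
  \<comment> \<open>Off \<open>N\<close> the singular part is absent, so both sides are densities of
    the same set function relative to \<open>l\<close>, and their difference vanishes by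
    \<open>represents_AE_zero\<close>.\<close>
  have qN: "AE x in l. x \<notin> N \<longrightarrow> q x = max 0 (p x) *\<^sub>R g x"
  proof -
    have r1: "represents l (\<lambda>x. indicator (- N) x *\<^sub>R q x) (\<lambda>A. Deriv \<Omega> u (A \<inter> - N))"
      by (rule represents_restrict[OF rq Nb(2)])
    have r2: "represents l (\<lambda>x. indicator (- N) x *\<^sub>R (max 0 (p x) *\<^sub>R g x)) (\<lambda>A. Deriv \<Omega> u (A \<inter> - N))"
      unfolding represents_def
    proof (intro conjI ballI)
      show "finite_measure l" "sets l = sets borel" using r by (auto simp: represents_def)
      show "integrable l (\<lambda>x. indicat_real (- N) x *\<^sub>R (max 0 (p x) *\<^sub>R g x))"
        using Nb s by (intro integrable_mult_indicator pgi) simp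
      fix A :: "'a set" assume A: "A \<in> sets borel"
      have A': "A \<inter> - N \<in> sets borel" "A \<inter> - N \<inter> N = {}" using A Nb by auto
      show "Deriv \<Omega> u (A \<inter> - N) = (LINT x:A|l. indicat_real (- N) x *\<^sub>R (max 0 (p x) *\<^sub>R g x))"
        unfolding ac_eq[OF A'] set_lebesgue_integral_def
        by (intro Bochner_Integration.integral_cong refl) (auto split: split_indicator)
    qed
    have i1: "integrable l (\<lambda>x. indicat_real (- N) x *\<^sub>R q x)" and i2: "integrable l (\<lambda>x. indicat_real (- N) x *\<^sub>R (max 0 (p x) *\<^sub>R g x))"
      using r1 r2 by (simp_all add: represents_def)
    have "represents l (\<lambda>x. indicator (- N) x *\<^sub>R q x - indicator (- N) x *\<^sub>R (max 0 (p x) *\<^sub>R g x)) (\<lambda>_. 0)"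
      unfolding represents_def
    proof (intro conjI ballI)
      show "finite_measure l" "sets l = sets borel" using r by (auto simp: represents_def)
      show "integrable l (\<lambda>x. indicat_real (- N) x *\<^sub>R q x - indicat_real (- N) x *\<^sub>R (max 0 (p x) *\<^sub>R g x))"
        by (rule Bochner_Integration.integrable_diff[OF i1 i2])
      fix A :: "'a set" assume A: "A \<in> sets borel"
      have A': "A \<in> sets l" using A s by simp
      have "(LINT x:A|l. indicat_real (- N) x *\<^sub>R q x - indicat_real (- N) x *\<^sub>R (max 0 (p x) *\<^sub>R g x)) =
        (LINT x:A|l. indicat_real (- N) x *\<^sub>R q x) - (LINT x:A|l. indicat_real (- N) x *\<^sub>R (max 0 (p x) *\<^sub>R g x))"
        by (rule set_integral_diff(2)) (use integrable_mult_indicator[OF A' i1] integrable_mult_indicator[OF A' i2] in \<open>simp_all only: set_integrable_def\<close>)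
      also have "\<dots> = 0" using r1 r2 A by (simp add: represents_def)
      finally show "0 = (LINT x:A|l. indicat_real (- N) x *\<^sub>R q x - indicat_real (- N) x *\<^sub>R (max 0 (p x) *\<^sub>R g x))" by (rule sym)
    qed
    from represents_AE_zero[OF this] have "AE x in l. indicat_real (- N) x *\<^sub>R q x - indicat_real (- N) x *\<^sub>R (max 0 (p x) *\<^sub>R g x) = 0" by simp
    then show ?thesis by (rule AE_mp) (auto split: split_indicator_asm)
  qed
  \<comment> \<open>On norms the truncation at 0 changes nothing; it replaces \<phi>, known to be
    continuous only on \<open>{0..}\<close>, by a function continuous on the line, which settles
    measurability.\<close>
  define F where "F x = \<phi> (max 0 (norm (g x)))" for x
  have Fm: "F \<in> borel_measurable borel"
    unfolding F_def using g(1)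
    by (intro measurable_compose[OF _ borel_measurable_continuous_onI[OF continuous_extension]]) simp
  have Fi: "integrable lborel (\<lambda>x. indicator \<Omega> x *\<^sub>R F x)"
  proof (rule Bochner_Integration.integrable_bound)
    show "integrable lborel (\<lambda>x. (C' + b) * (indicat_real \<Omega> x + norm (indicator \<Omega> x *\<^sub>R g x)))"
      using ig Ob by (intro integrable_mult_right Bochner_Integration.integrable_add integrable_norm integrable_real_indicator) auto
    show "(\<lambda>x. indicat_real \<Omega> x *\<^sub>R F x) \<in> borel_measurable lborel" using Fm Ob by simp
    show "AE x in lborel. norm (indicat_real \<Omega> x *\<^sub>R F x) \<le> norm ((C' + b) * (indicat_real \<Omega> x + norm (indicator \<Omega> x *\<^sub>R g x)))"
    proof (intro AE_I2)
      fix x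
      have "\<bar>F x\<bar> \<le> (C' + b) * (1 + norm (g x))" using abs_growth[of "norm (g x)"] by (simp add: F_def)
      then show "norm (indicat_real \<Omega> x *\<^sub>R F x) \<le> norm ((C' + b) * (indicat_real \<Omega> x + norm (indicator \<Omega> x *\<^sub>R g x)))"
        using abs_ge_self[of "(C' + b) * (1 + norm (g x))"] by (cases "x \<in> \<Omega>") auto
    qed
  qed
  have pFi: "integrable l (\<lambda>x. max 0 (p x) *\<^sub>R F x)" using Fi unfolding lborel_density_integral(2)[OF Ob rp Fm] .
  have iNq: "integrable l (\<lambda>x. indicator N x * norm (q x))"
    using integrable_mult_indicator[OF _ integrable_norm[OF qi], of N] Nb s by simp
  have \<Phi>m: "perspective \<phi> \<phi>inf \<in> borel_measurable (borel :: (real \<times> 'a) measure)"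
    by (rule borel_measurable_continuous_onI[OF perspective_continuous])
  have f\<Phi>m: "(\<lambda>y. perspective \<phi> \<phi>inf (f y)) \<in> borel_measurable l"
    by (rule measurable_compose[OF borel_measurable_integrable[OF fi] \<Phi>m])
  have "(LINT y|l. perspective \<phi> \<phi>inf (f y)) = (LINT x|l. max 0 (p x) *\<^sub>R F x + \<phi>inf * (indicator N x * norm (q x)))"
  proof (rule integral_cong_AE[OF f\<Phi>m])
    show "(\<lambda>x. max 0 (p x) *\<^sub>R F x + \<phi>inf * (indicator N x * norm (q x))) \<in> borel_measurable l"
      by (intro borel_measurable_add borel_measurable_integrable[OF pFi] borel_measurable_times borel_measurable_const
          borel_measurable_integrable[OF iNq])
    show "AE x in l. perspective \<phi> \<phi>inf (f x) = max 0 (p x) *\<^sub>R F x + \<phi>inf * (indicator N x * norm (q x))"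
      using p0 pN qN
    proof eventually_elim
      case (elim x)
      have P: "perspective \<phi> \<phi>inf (f x) = (if p x = 0 then \<phi>inf * norm (q x) else p x * \<phi> (norm (q x) / p x))"
        using elim(1) by (simp add: perspective_def p_def q_def)
      show ?case
      proof (cases "x \<in> N")
        case True then show ?thesis using elim(2) P by simp
      next
        case False
        then have q: "q x = max 0 (p x) *\<^sub>R g x" using elim(3) by simp
        show ?thesis
        proof (cases "p x = 0")
          case True then show ?thesis using P q False by simp
        next
          case pos: False
          then have "norm (q x) / p x = norm (g x)" using q elim(1) by simp
          then show ?thesis using P pos False elim(1) by (simp add: F_def)
        qed
      qed
    qed
  qed
  also have "\<dots> = (LINT x|l. max 0 (p x) *\<^sub>R F x) + \<phi>inf * (LINT x|l. indicator N x * norm (q x))"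
    by (subst Bochner_Integration.integral_add[OF pFi integrable_mult_right[OF iNq]]) simp
  also have "(LINT x|l. max 0 (p x) *\<^sub>R F x) = (LINT x|lebesgue_on \<Omega>. \<phi> (norm (ac_grad \<Omega> u x)))"
  proof -
    have "(LINT x|l. max 0 (p x) *\<^sub>R F x) = (LINT x|lebesgue_on \<Omega>. F x)"
      unfolding lebesgue_on_integral_borel(1)[OF Ob(1) Fm] by (rule lborel_density_integral(1)[OF Ob rp Fm, symmetric])
    also have "\<dots> = (LINT x|lebesgue_on \<Omega>. \<phi> (max 0 (norm (ac_grad \<Omega> u x))))"
    proof (rule integral_cong_AE)
      show "F \<in> borel_measurable (lebesgue_on \<Omega>)" by (rule bmr[OF Fm])
      show "(\<lambda>x. \<phi> (max 0 (norm (ac_grad \<Omega> u x)))) \<in> borel_measurable (lebesgue_on \<Omega>)"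
        by (rule measurable_compose[OF measurable_compose[OF acm borel_measurable_norm] borel_measurable_continuous_onI[OF continuous_extension]])
      show "AE x in lebesgue_on \<Omega>. F x = \<phi> (max 0 (norm (ac_grad \<Omega> u x)))"
        using g(4) by (rule AE_mp) (simp add: F_def)
    qed
    finally show ?thesis by simp
  qed
  also have "(LINT x|l. indicator N x * norm (q x)) = measure (variation (sing_deriv \<Omega> u)) \<Omega>"
  proof -
    have "represents l (\<lambda>x. indicator N x *\<^sub>R q x) (sing_deriv \<Omega> u)"
    proof (rule represents_cong[OF represents_restrict[OF rq Nb(1)]])
      fix A :: "'a set" assume A: "A \<in> sets borel"
      have AN: "A \<inter> N \<in> sets borel" using A Nb by simp
      have "(LINT x:A \<inter> N|lebesgue_on \<Omega>. ac_grad \<Omega> u x) = 0"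
        unfolding gint[OF AN]
        by (rule integral_eq_zero_AE) (use pN in \<open>rule AE_mp\<close>, auto split: split_indicator)
      then show "Deriv \<Omega> u (A \<inter> N) = sing_deriv \<Omega> u A"
        using sing[OF A] by (simp add: sing_deriv_def)
    qed
    from represents_measure_variation(1)[OF this Ob(1)]
    have "measure (variation (sing_deriv \<Omega> u)) \<Omega> = (LINT x|l. indicator \<Omega> x * norm (indicat_real N x *\<^sub>R q x))" .
    also have "\<dots> = (LINT x|l. indicator N x * norm (q x))"
      by (intro Bochner_Integration.integral_cong refl) (use supp in \<open>auto simp: q_def split: split_indicator\<close>)
    finally show ?thesis by (rule sym)
  qed
  finally show TV: "TV_as \<phi> \<phi>inf \<Omega> u = (LINT y|l. perspective \<phi> \<phi>inf (f y))" by (simp add: TV_as_def)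
  have "(LINT x|l. \<bar>p x\<bar>) = (LINT x|l. p x)"
    by (rule integral_cong_AE) (use pi p0 in \<open>auto elim!: AE_mp\<close>)
  also have "\<dots> = measure lborel \<Omega>"
  proof -
    have "\<forall>A\<in>sets borel. measure lborel (A \<inter> \<Omega>) = (LINT x:A|l. p x)" using rp by (simp add: represents_def)
    from bspec[OF this, of UNIV] show ?thesis by (simp add: set_lebesgue_integral_def)
  qed
  finally have p1: "(LINT x|l. \<bar>p x\<bar>) = measure lborel \<Omega>" .
  have f\<Phi>: "integrable l (\<lambda>y. perspective \<phi> \<phi>inf (f y))"
  proof (rule Bochner_Integration.integrable_bound[OF _ f\<Phi>m])
    show "integrable l (\<lambda>y. (2 * (C' + b)) * norm (f y))" using fi by simp
    show "AE y in l. norm (perspective \<phi> \<phi>inf (f y)) \<le> norm ((2 * (C' + b)) * norm (f y))"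
    proof (intro AE_I2)
      fix y
      show "norm (perspective \<phi> \<phi>inf (f y)) \<le> norm ((2 * (C' + b)) * norm (f y))"
        using perspective_bound[of "f y"] abs_ge_self[of "(2 * (C' + b)) * norm (f y)"]
        unfolding real_norm_def by (rule order_trans)
    qed
  qed
  have low: "c * norm (snd v) - b * \<bar>fst v\<bar> \<le> perspective \<phi> \<phi>inf v" for v :: "real \<times> 'a"
  proof (cases "fst v = 0")
    case True then show ?thesis using recession_bounds by (simp add: perspective_def mult_right_mono)
  next
    case False
    have "\<bar>fst v\<bar> * (c * (norm (snd v) / \<bar>fst v\<bar>) - b) \<le> \<bar>fst v\<bar> * \<phi> (norm (snd v) / \<bar>fst v\<bar>)"
      using growth[of "norm (snd v) / \<bar>fst v\<bar>"] by (intro mult_left_mono) auto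
    then show ?thesis using False by (simp add: perspective_def right_diff_distrib mult.commute)
  qed
  have "c * (LINT x|l. norm (q x)) - b * measure lborel \<Omega> = (LINT x|l. c * norm (q x) - b * \<bar>p x\<bar>)"
    using qi pi p1 by simp
  also have "\<dots> \<le> TV_as \<phi> \<phi>inf \<Omega> u"
    unfolding TV
  proof (rule integral_mono[OF _ f\<Phi>])
    show "integrable l (\<lambda>x. c * norm (q x) - b * \<bar>p x\<bar>)" using qi pi by simp
    show "c * norm (q x) - b * \<bar>p x\<bar> \<le> perspective \<phi> \<phi>inf (f x)" for x
      using low[of "f x"] by (simp add: p_def q_def)
  qed
  finally have q1: "(LINT x|l. norm (q x)) \<le> (TV_as \<phi> \<phi>inf \<Omega> u + b * measure lborel \<Omega>) / c"
    using c by (simp add: pos_le_divide_eq mult.commute)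
  have "(LINT y|l. norm (f y)) \<le> (LINT y|l. \<bar>p y\<bar> + norm (q y))"
  proof (rule integral_mono)
    show "norm (f y) \<le> \<bar>p y\<bar> + norm (q y)" for y
      using norm_Pair_le[of "fst (f y)" "snd (f y)"] by (simp add: p_def q_def)
  qed (use fi pi qi in auto)
  also have "\<dots> = measure lborel \<Omega> + (LINT y|l. norm (q y))" using pi qi p1 by simp
  finally show "(LINT y|l. norm (f y)) \<le> measure lborel \<Omega> + (TV_as \<phi> \<phi>inf \<Omega> u + b * measure lborel \<Omega>) / c"
    using q1 by simp
qed

end

section \<open>Boundary layers of Lipschitz domains\<close>

text \<open>A function extended by zero with the density of its derivative inside \<Omega>. Since
  only test functions of \<Omega> occur, the jump created at the boundary by the extension need not
  appear in \<open>f\<close>; controlling it is the purpose of the strip estimates.\<close>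

definition bv_pair :: "'a::euclidean_space set \<Rightarrow> ('a \<Rightarrow> real) \<Rightarrow> 'a measure \<Rightarrow> ('a \<Rightarrow> 'a) \<Rightarrow> bool" where
  "bv_pair \<Omega> u l f \<longleftrightarrow> integrable lborel u \<and> (\<forall>x. x \<notin> \<Omega> \<longrightarrow> u x = 0) \<and> sets l = sets borel \<and> integrable l f \<and>
     (\<forall>\<psi>\<in>test_functions \<Omega>. (LINT x|lborel. u x *\<^sub>R gradient \<psi> x) = - (LINT x|l. \<psi> x *\<^sub>R f x))"

lemma bv_pair_translation:
  assumes p: "bv_pair \<Omega> u l f" and U: "open U"
    and seg: "\<And>y t. y \<in> U \<Longrightarrow> 0 \<le> t \<Longrightarrow> t \<le> 1 \<Longrightarrow> y + t *\<^sub>R z \<in> \<Omega>"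
  shows "(LINT x|lborel. indicator U x * \<bar>u (x + z) - u x\<bar>) \<le> norm z * (LINT x|l. norm (f x))"
proof (rule translation_estimate[OF _ _ _ _ U seg])
  show "integrable lborel u" "integrable l f" using p by (auto simp: bv_pair_def)
  show "\<psi> \<in> borel_measurable l" if "\<psi> \<in> test_functions \<Omega>" for \<psi>
    using test_functionsD(3)[OF that] p by (subst measurable_cong_sets[OF _ refl]) (auto simp: bv_pair_def)
  show "(LINT x|lborel. u x *\<^sub>R gradient \<psi> x) = - (LINT x|l. \<psi> x *\<^sub>R f x)" if "\<psi> \<in> test_functions \<Omega>" for \<psi>
    using p that by (simp add: bv_pair_def)
qed

lemma integrable_indicator_abs:
  fixes u :: "'a::euclidean_space \<Rightarrow> real"
  assumes u: "integrable lborel u" and S: "S \<in> sets borel"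
  shows "integrable lborel (\<lambda>y. indicator S y * \<bar>u y\<bar>)"
proof -
  have "indicat_real S \<in> borel_measurable lborel" using S by simp
  moreover have "\<bar>indicat_real S y\<bar> \<le> 1" for y by (auto split: split_indicator)
  ultimately have "integrable lborel (\<lambda>y. indicat_real S y *\<^sub>R \<bar>u y\<bar>)"
    using integrable_bounded_scaleR[OF integrable_abs[OF u], of "indicat_real S" 1] by blast
  then show ?thesis by simp
qed

definition inner_strip :: "'a::euclidean_space set \<Rightarrow> real \<Rightarrow> 'a set" where
  "inner_strip \<Omega> h = {y\<in>\<Omega>. infdist y (- \<Omega>) \<le> h}"

lemma inner_strip_borel: "open \<Omega> \<Longrightarrow> inner_strip \<Omega> h \<in> sets borel"
proof -
  assume o: "open \<Omega>"
  have "closed {y. infdist y (- \<Omega>) \<le> h}" by (intro closed_Collect_le continuous_intros)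
  moreover have "inner_strip \<Omega> h = \<Omega> \<inter> {y. infdist y (- \<Omega>) \<le> h}" by (auto simp: inner_strip_def)
  ultimately show ?thesis using o by simp
qed

lemma inner_strip_witness:
  assumes "open \<Omega>" "bounded \<Omega>" "y \<in> inner_strip \<Omega> h"
  obtains p where "p \<notin> \<Omega>" "dist y p \<le> h"
proof -
  have ne: "- \<Omega> \<noteq> {}" using assms(2) not_bounded_UNIV by (metis Compl_empty_eq double_complement)
  have "closed (- \<Omega>)" by (rule closed_Compl[OF assms(1)])
  from infdist_attains_inf[OF this ne] obtain p where "p \<in> - \<Omega>" "infdist y (- \<Omega>) = dist y p" by blast
  then show ?thesis using that assms(3) by (auto simp: inner_strip_def)
qed

text \<open>Shifting a boundary layer of thickness \<open>H\<close> inwards by \<open>H, 2H, \<dots>, KH\<close> gives disjoint copies, so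
  one of them carries at most a fraction \<open>1/K\<close> of the mass; the translation estimate compares it
  with the original layer.\<close>

lemma lipschitz_chart_strip_bound:
  fixes \<Omega> :: "'a::euclidean_space set"
  assumes \<Omega>: "open \<Omega>" "bounded \<Omega>" and r: "0 < r" and \<nu>: "norm \<nu> = 1"
    and g: "L-lipschitz_on {z. z \<bullet> \<nu> = 0} g"
    and chart: "\<Omega> \<inter> ball x r = {y \<in> ball x r. g (y - (y \<bullet> \<nu>) *\<^sub>R \<nu>) < y \<bullet> \<nu>}"
    and p: "bv_pair \<Omega> u l f" and h: "0 < h" "h < r / 2" and K: "real K * ((1 + L) * h) < r / 2"
  shows "real K * (LINT y|lborel. indicator (inner_strip \<Omega> h \<inter> ball x (r/2)) y * \<bar>u y\<bar>) \<le>
     (LINT y|lborel. \<bar>u y\<bar>) + real K * (real K * ((1 + L) * h) * (LINT y|l. norm (f y)))"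
proof -
  have L0: "0 \<le> L" using g by (rule lipschitz_on_nonneg)
  \<comment> \<open>A point within \<open>h\<close> of the complement lies at most
    \<open>h + L * h\<close> above the graph: its own height changes by at most \<open>h\<close> on
    the way, and the graph by at most \<open>L * h\<close>.\<close>
  define H where "H = (1 + L) * h"
  have H: "0 < H" using h L0 by (simp add: H_def)
  define P where "P y = y - (y \<bullet> \<nu>) *\<^sub>R \<nu>" for y
  have \<nu>\<nu>: "\<nu> \<bullet> \<nu> = 1" using \<nu> by (simp add: dot_square_norm)
  have P0: "P y \<in> {z. z \<bullet> \<nu> = 0}" for y by (simp add: P_def inner_diff_left \<nu>\<nu>)
  have Pshift: "P (y + s *\<^sub>R \<nu>) = P y" for y s
    by (simp add: P_def inner_add_left \<nu>\<nu> scaleR_add_left)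
  have Pdist: "dist (P y) (P y') \<le> dist y y'" for y y'
  proof -
    have e: "P y - P y' = (y - y') - ((y - y') \<bullet> \<nu>) *\<^sub>R \<nu>"
      by (simp add: P_def inner_diff_left scaleR_diff_left)
    have "(norm (P y - P y'))\<^sup>2 = (norm (y - y'))\<^sup>2 - ((y - y') \<bullet> \<nu>)\<^sup>2"
      unfolding e power2_norm_eq_inner
      by (simp add: inner_diff_left inner_diff_right \<nu>\<nu> inner_commute power2_eq_square)
    then have "(norm (P y - P y'))\<^sup>2 \<le> (norm (y - y'))\<^sup>2" by simp
    then show ?thesis unfolding dist_norm by (rule power2_le_imp_le) simp
  qed
  \<comment> \<open>The height above the graph. In the chart \<Omega> is exactly where it is
    positive, and a shift by \<open>s\<close> in the direction \<nu> raises it by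
    \<open>s\<close>.\<close>
  define t where "t y = y \<bullet> \<nu> - g (P y)" for y
  have tshift: "t (y + s *\<^sub>R \<nu>) = t y + s" for y s
    by (simp add: t_def Pshift inner_add_left \<nu>\<nu>)
  have inO: "y \<in> \<Omega> \<longleftrightarrow> 0 < t y" if "y \<in> ball x r" for y
    using chart that unfolding t_def P_def by (auto simp: set_eq_iff)
  define A where "A = inner_strip \<Omega> h \<inter> ball x (r/2)"
  define U where "U = \<Omega> \<inter> ball x (r/2)"
  have U: "open U" using \<Omega> by (auto simp: U_def)
  have Ab: "A \<in> sets borel" unfolding A_def using inner_strip_borel[OF \<Omega>(1)] by simp
  have AU: "A \<subseteq> U" by (auto simp: A_def U_def inner_strip_def)
  have Ub: "U \<subseteq> ball x r"
  proof -
    have "ball x (r/2) \<subseteq> ball x r" using r by (intro subset_ball) simp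
    then show ?thesis by (auto simp: U_def)
  qed
  have layer: "0 < t y" "t y \<le> H" if y: "y \<in> A" for y
  proof -
    have yb: "y \<in> ball x r" "y \<in> \<Omega>" using y AU Ub by (auto simp: U_def)
    then show "0 < t y" using inO by simp
    obtain q where q: "q \<notin> \<Omega>" "dist y q \<le> h"
      using inner_strip_witness[OF \<Omega>, of y h] y by (auto simp: A_def)
    have "dist x q \<le> dist x y + dist y q" by (rule dist_triangle)
    also have "\<dots> < r" using y q(2) h by (auto simp: A_def)
    finally have "t q \<le> 0" using inO[of q] q(1) by force
    then have "q \<bullet> \<nu> \<le> g (P q)" by (simp add: t_def)
    moreover have "g (P q) - g (P y) \<le> L * h"
    proof -
      have "dist (g (P q)) (g (P y)) \<le> L * dist (P q) (P y)" by (rule lipschitz_onD[OF g P0 P0])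
      also have "\<dots> \<le> L * h" using Pdist[of q y] q(2) L0 by (intro mult_left_mono) (auto simp: dist_commute)
      finally show ?thesis by (simp add: dist_real_def)
    qed
    moreover have "(y - q) \<bullet> \<nu> \<le> h"
      using norm_cauchy_schwarz[of "y - q" \<nu>] q(2) \<nu> by (simp add: dist_norm)
    ultimately show "t y \<le> H" by (simp add: t_def H_def inner_diff_left algebra_simps)
  qed
  have ui: "integrable lborel u" using p by (simp add: bv_pair_def)
  have au: "integrable lborel (\<lambda>y. \<bar>u y\<bar>)" using ui by simp
  have Im: "indicat_real A \<in> borel_measurable borel" "indicat_real U \<in> borel_measurable borel" using Ab U by auto
  have ib: "\<bar>indicat_real S y\<bar> \<le> 1" for S and y :: 'a by (auto split: split_indicator)
  define V where "V = (LINT y|l. norm (f y))"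
  have V0: "0 \<le> V" by (simp add: V_def)
  have step: "(LINT y|lborel. indicator A y * \<bar>u y\<bar>) \<le>
      (LINT y|lborel. indicator A (y + (- real k * H) *\<^sub>R \<nu>) * \<bar>u y\<bar>) + real K * H * V" if k: "k \<in> {1..K}" for k
  proof -
    define z where "z = (real k * H) *\<^sub>R \<nu>"
    have kH: "0 \<le> real k * H" "real k * H \<le> real K * H" using k H by auto
    have nz: "norm z = real k * H" using \<nu> kH by (simp add: z_def)
    have uz: "integrable lborel (\<lambda>y. u (y + z))" by (rule integrable_lborel_translate[OF ui])
    \<comment> \<open>Upward shifts only increase the height, so the segment stays in \<Omega> as
      long as it stays in the chart; the hypothesis \<open>K\<close> bounds every shift by half the
      radius.\<close>
    have seg: "y + s *\<^sub>R z \<in> \<Omega>" if y: "y \<in> U" and s: "0 \<le> s" "s \<le> 1" for y s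
    proof -
      have "s * (real k * H) \<le> 1 * (real K * H)" by (rule mult_mono[OF s(2) kH(2)]) (use s kH in auto)
      then have ns: "norm (s *\<^sub>R z) < r / 2" using K s kH by (simp add: nz H_def[symmetric])
      have "dist x (y + s *\<^sub>R z) \<le> dist x y + dist y (y + s *\<^sub>R z)" by (rule dist_triangle)
      also have "\<dots> < r" using y ns by (simp add: U_def dist_norm)
      finally have b: "y + s *\<^sub>R z \<in> ball x r" by simp
      have "0 < t y" using inO[of y] y Ub by (auto simp: U_def)
      then have "0 < t (y + s *\<^sub>R z)" using tshift[of y "s * (real k * H)"] s kH by (simp add: z_def add_pos_nonneg)
      then show ?thesis using inO[OF b] by simp
    qed
    have T: "(LINT y|lborel. indicator U y * \<bar>u (y + z) - u y\<bar>) \<le> norm z * V"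
      unfolding V_def by (rule bv_pair_translation[OF p U seg])
    have i1: "integrable lborel (\<lambda>y. indicator A y * \<bar>u (y + z)\<bar>)"
      by (rule integrable_indicator_abs[OF uz Ab])
    have i2: "integrable lborel (\<lambda>y. indicator U y * \<bar>u (y + z) - u y\<bar>)"
      using integrable_indicator_abs[OF Bochner_Integration.integrable_diff[OF uz ui] borel_open[OF U]] .
    have i3: "integrable lborel (\<lambda>y. indicator A y * \<bar>u y\<bar>)"
      by (rule integrable_indicator_abs[OF ui Ab])
    have "(LINT y|lborel. indicator A y * \<bar>u y\<bar>) \<le> (LINT y|lborel. indicator A y * \<bar>u (y + z)\<bar> + indicator U y * \<bar>u (y + z) - u y\<bar>)"
    proof (rule integral_mono[OF i3 Bochner_Integration.integrable_add[OF i1 i2]])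
      fix y show "indicator A y * \<bar>u y\<bar> \<le> indicator A y * \<bar>u (y + z)\<bar> + indicator U y * \<bar>u (y + z) - u y\<bar>"
        using AU by (cases "y \<in> A") (auto split: split_indicator)
    qed
    also have "\<dots> = (LINT y|lborel. indicator A y * \<bar>u (y + z)\<bar>) + (LINT y|lborel. indicator U y * \<bar>u (y + z) - u y\<bar>)"
      by (rule Bochner_Integration.integral_add[OF i1 i2])
    also have "(LINT y|lborel. indicator A y * \<bar>u (y + z)\<bar>) = (LINT y|lborel. indicator A (y - z) * \<bar>u y\<bar>)"
    proof -
      have um: "u \<in> borel_measurable borel" using ui by auto
      have "(\<lambda>y. indicat_real A (y - z)) \<in> borel_measurable borel"
        by (rule measurable_compose[OF _ Im(1)]) measurable
      then have m: "(\<lambda>y. indicat_real A (y - z) * \<bar>u y\<bar>) \<in> borel_measurable borel" using um by measurable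
      from integral_lborel_translate[OF this, of z] show ?thesis by simp
    qed
    also have "(LINT y|lborel. indicator U y * \<bar>u (y + z) - u y\<bar>) \<le> real K * H * V"
      using T nz mult_right_mono[OF kH(2) V0] by simp
    finally show ?thesis by (simp add: z_def)
  qed
  \<comment> \<open>The layer has heights in \<open>{0<..H}\<close>, half open, so its shifts by
    different multiples of \<open>H\<close> cannot overlap.\<close>
  have disj: "(\<Sum>k\<in>{1..K}. indicat_real A (y + (- real k * H) *\<^sub>R \<nu>)) \<le> 1" for y
  proof (cases "\<exists>k\<in>{1..K}. y + (- real k * H) *\<^sub>R \<nu> \<in> A")
    case True
    then obtain k where k: "k \<in> {1..K}" "y + (- real k * H) *\<^sub>R \<nu> \<in> A" by blast
    have "indicat_real A (y + (- real j * H) *\<^sub>R \<nu>) = 0" if j: "j \<in> {1..K} - {k}" for j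
    proof (rule ccontr)
      assume "indicat_real A (y + (- real j * H) *\<^sub>R \<nu>) \<noteq> 0"
      then have jA: "y + (- real j * H) *\<^sub>R \<nu> \<in> A" by (auto split: split_indicator_asm)
      have b: "0 < t y - real i * H" "t y - real i * H \<le> H" if "y + (- real i * H) *\<^sub>R \<nu> \<in> A" for i
        using layer[OF that] tshift[of y "- real i * H"] by simp_all
      have "\<bar>real j - real k\<bar> * H < 1 * H"
      proof -
        have "\<bar>real j * H - real k * H\<bar> < H" using b[OF k(2)] b[OF jA] by linarith
        then show ?thesis using H by (simp add: left_diff_distrib[symmetric] abs_mult)
      qed
      then have "\<bar>real j - real k\<bar> < 1" using H mult_less_cancel_right_pos by blast
      then show False using j by auto
    qed
    then have "(\<Sum>k\<in>{1..K}. indicat_real A (y + (- real k * H) *\<^sub>R \<nu>)) = indicat_real A (y + (- real k * H) *\<^sub>R \<nu>)"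
      using k(1) by (subst sum.remove[OF _ k(1)]) auto
    then show ?thesis by (simp split: split_indicator)
  next
    case False
    then have "(\<Sum>k\<in>{1..K}. indicat_real A (y + (- real k * H) *\<^sub>R \<nu>)) = 0"
      by (intro sum.neutral ballI) (auto split: split_indicator)
    then show ?thesis by simp
  qed
  have ik: "integrable lborel (\<lambda>y. indicator A (y + (- real k * H) *\<^sub>R \<nu>) * \<bar>u y\<bar>)" for k
  proof -
    have "(\<lambda>y. indicat_real A (y + (- real k * H) *\<^sub>R \<nu>)) \<in> borel_measurable borel"
      by (rule measurable_compose[OF _ Im(1)]) measurable
    from integrable_bounded_scaleR[OF au, of "\<lambda>y. indicat_real A (y + (- real k * H) *\<^sub>R \<nu>)" 1] this ib
    show ?thesis by simp
  qed
  have "real K * (LINT y|lborel. indicator A y * \<bar>u y\<bar>) = (\<Sum>k\<in>{1..K}. LINT y|lborel. indicator A y * \<bar>u y\<bar>)" by simp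
  also have "\<dots> \<le> (\<Sum>k\<in>{1..K}. (LINT y|lborel. indicator A (y + (- real k * H) *\<^sub>R \<nu>) * \<bar>u y\<bar>) + real K * H * V)"
    by (rule sum_mono[OF step])
  also have "\<dots> = (\<Sum>k\<in>{1..K}. LINT y|lborel. indicator A (y + (- real k * H) *\<^sub>R \<nu>) * \<bar>u y\<bar>) + real K * (real K * H * V)"
    by (simp add: sum.distrib)
  also have "(\<Sum>k\<in>{1..K}. LINT y|lborel. indicator A (y + (- real k * H) *\<^sub>R \<nu>) * \<bar>u y\<bar>) =
      (LINT y|lborel. (\<Sum>k\<in>{1..K}. indicator A (y + (- real k * H) *\<^sub>R \<nu>) * \<bar>u y\<bar>))"
    by (rule Bochner_Integration.integral_sum[symmetric]) (rule ik)
  also have "\<dots> \<le> (LINT y|lborel. \<bar>u y\<bar>)"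
  proof (rule integral_mono[OF Bochner_Integration.integrable_sum[OF ik] au])
    show "(\<Sum>k\<in>{1..K}. indicator A (y + (- real k * H) *\<^sub>R \<nu>) * \<bar>u y\<bar>) \<le> \<bar>u y\<bar>" for y
      using mult_right_mono[OF disj, of "\<bar>u y\<bar>" y] by (simp add: sum_distrib_right)
  qed
  finally show ?thesis by (simp add: A_def H_def V_def)
qed

text \<open>The compact frontier is covered by finitely many charts, and each gets the budget
  \<open>e'\<close>. In a chart the number \<open>K\<close> of shifts is chosen first, so that the
  averaged mass \<open>M / K\<close> is at most \<open>e' / 2\<close>; the thickness
  \<open>h\<close> comes afterwards and makes the translation cost at most \<open>e' / 2\<close>. No
  choice depends on the function.\<close>

theorem uniform_strip_bound:
  fixes \<Omega> :: "'a::euclidean_space set"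
  assumes \<Omega>: "open \<Omega>" "bounded \<Omega>" "lipschitz_boundary \<Omega>" and M: "0 \<le> M" and e: "0 < e"
  obtains h where "0 < h" "\<And>u l f. bv_pair \<Omega> u l f \<Longrightarrow> (LINT x|lborel. \<bar>u x\<bar>) \<le> M \<Longrightarrow> (LINT x|l. norm (f x)) \<le> M \<Longrightarrow>
    (LINT x|lborel. indicator (inner_strip \<Omega> h) x * \<bar>u x\<bar>) \<le> e"
proof -
  define Q where "Q x r \<nu> g L \<longleftrightarrow> 0 < r \<and> norm \<nu> = 1 \<and> L-lipschitz_on {z. z \<bullet> \<nu> = 0} g \<and>
     \<Omega> \<inter> ball x r = {y \<in> ball x r. g (y - (y \<bullet> \<nu>) *\<^sub>R \<nu>) < y \<bullet> \<nu>}" for x r \<nu> g L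
  have "\<forall>x\<in>frontier \<Omega>. \<exists>r \<nu> g L. Q x r \<nu> g L"
    using \<Omega>(3) unfolding lipschitz_boundary_def Q_def by meson
  then obtain r \<nu> g L where "\<And>x. x \<in> frontier \<Omega> \<Longrightarrow> Q x (r x) (\<nu> x) (g x) (L x)" by metis
  note ch = this[unfolded Q_def]
  have "compact (frontier \<Omega>)" using \<Omega>(2) by (rule compact_frontier_bounded)
  then obtain J where J: "J \<subseteq> frontier \<Omega>" "finite J" "frontier \<Omega> \<subseteq> (\<Union>x\<in>J. ball x (r x / 4))"
  proof (rule compactE_image)
    show "frontier \<Omega> \<subseteq> (\<Union>x\<in>frontier \<Omega>. ball x (r x / 4))" using ch by force
  qed auto
  define e' where "e' = e / (real (card J) + 1)"
  have e': "0 < e'" using e by (simp add: e'_def)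
  obtain K :: nat where K: "2 * M / e' < real K" using reals_Archimedean2 by blast
  have K0: "0 < real K" using K M e' by (smt (verit) divide_nonneg_pos)
  \<comment> \<open>The three bounds keep the strip within the half ball of the chart, fit all
    \<open>K\<close> shifts into the chart, and make the translation cost at most
    \<open>e' / 2\<close>.\<close>
  define hh where "hh x = min (r x / 8) (min (r x / (4 * (real K * (1 + L x)))) (e' / (2 * (real K * (1 + L x) * (M + 1)))))" for x
  have L0: "0 \<le> L x" if "x \<in> frontier \<Omega>" for x using ch[OF that] lipschitz_on_nonneg by blast
  have hh: "0 < hh x" if x: "x \<in> frontier \<Omega>" for x
    using ch[OF x] L0[OF x] K0 e' M by (simp add: hh_def)
  define h where "h = Min (insert 1 (hh ` J))"
  have h: "0 < h" unfolding h_def using J hh by (subst Min_gr_iff) auto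
  have hJ: "h \<le> hh x" if "x \<in> J" for x unfolding h_def using J(2) that by (intro Min_le) auto
  show ?thesis
  proof (rule that[OF h])
    fix u l f assume p: "bv_pair \<Omega> u l f" and uM: "(LINT x|lborel. \<bar>u x\<bar>) \<le> M" and fM: "(LINT x|l. norm (f x)) \<le> M"
    let ?A = "\<lambda>x. inner_strip \<Omega> h \<inter> ball x (r x / 2)"
    have sb: "inner_strip \<Omega> h \<in> sets borel" by (rule inner_strip_borel[OF \<Omega>(1)])
    have i: "integrable lborel (\<lambda>y. indicator S y * \<bar>u y\<bar>)" if "S \<in> sets borel" for S
      using p that by (intro integrable_indicator_abs) (auto simp: bv_pair_def)
    have each: "(LINT y|lborel. indicator (?A x) y * \<bar>u y\<bar>) \<le> e'" if x: "x \<in> J" for x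
    proof -
      have xf: "x \<in> frontier \<Omega>" using J x by blast
      note c = ch[OF xf]
      have q: "0 < real K * (1 + L x)" using K0 L0[OF xf] by simp
      have h1: "h \<le> r x / 8" "h \<le> r x / (4 * (real K * (1 + L x)))" "h \<le> e' / (2 * (real K * (1 + L x) * (M + 1)))"
        using hJ[OF x] by (auto simp: hh_def)
      have "h * (4 * (real K * (1 + L x))) \<le> r x" using h1(2) q by (subst pos_le_divide_eq[symmetric]) auto
      then have "real K * (1 + L x) * h \<le> r x / 4" by (simp add: mult.commute mult.left_commute)
      then have hK: "real K * ((1 + L x) * h) < r x / 2" using c by (simp add: mult.assoc)
      have "h * (2 * (real K * (1 + L x) * (M + 1))) \<le> e'" using h1(3) q M by (subst pos_le_divide_eq[symmetric]) auto
      then have "real K * (1 + L x) * h * (M + 1) \<le> e' / 2" by (simp add: mult.commute mult.left_commute)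
      then have hM: "real K * ((1 + L x) * h) * (M + 1) \<le> e' / 2" by (simp add: mult.assoc)
      have "0 \<le> real K * ((1 + L x) * h)" using K0 L0[OF xf] h by simp
      then have hM': "real K * ((1 + L x) * h) * (LINT y|l. norm (f y)) \<le> e' / 2"
        using hM mult_left_mono[of "LINT y|l. norm (f y)" "M + 1" "real K * ((1 + L x) * h)"] fM by linarith
      have hr: "h < r x / 2" using h1(1) c by linarith
      have "real K * (LINT y|lborel. indicator (?A x) y * \<bar>u y\<bar>) \<le>
        (LINT y|lborel. \<bar>u y\<bar>) + real K * (real K * ((1 + L x) * h) * (LINT y|l. norm (f y)))"
        using c by (intro lipschitz_chart_strip_bound[OF \<Omega>(1,2) _ _ _ _ p h hr hK]) auto
      also have "\<dots> \<le> M + real K * (e' / 2)" using uM hM' K0 by (intro add_mono mult_left_mono) auto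
      also have "M \<le> real K * (e' / 2)" using K e' by (simp add: pos_divide_less_eq mult.commute)
      finally have "real K * (LINT y|lborel. indicator (?A x) y * \<bar>u y\<bar>) \<le> real K * e'" by (simp add: field_simps)
      then show ?thesis using K0 by simp
    qed
    have cover: "inner_strip \<Omega> h \<subseteq> (\<Union>x\<in>J. ?A x)"
    proof
      fix y assume y: "y \<in> inner_strip \<Omega> h"
      obtain q where q: "q \<notin> \<Omega>" "dist y q \<le> h" using inner_strip_witness[OF \<Omega>(1,2) y] by blast
      \<comment> \<open>A segment from the strip to the complement crosses the frontier, so
        \<open>y\<close> is within \<open>r x / 8\<close> of a point of some quarter ball, hence
        inside the corresponding half ball.\<close>
      have "closed_segment y q \<inter> frontier \<Omega> \<noteq> {}"
        using y q(1) by (intro connected_Int_frontier connected_segment) (auto simp: inner_strip_def)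
      then obtain w where w: "w \<in> closed_segment y q" "w \<in> frontier \<Omega>" by blast
      then obtain x where x: "x \<in> J" "dist x w < r x / 4" using J(3) by auto
      have "dist y w \<le> dist y q" using segment_bound(1)[OF w(1)] by (simp add: dist_norm norm_minus_commute)
      then have "dist y w \<le> r x / 8" using q(2) hJ[OF x(1)] by (simp add: hh_def)
      moreover have "dist x y \<le> dist x w + dist w y" by (rule dist_triangle)
      moreover have "0 < r x" using ch J(1) x(1) by blast
      ultimately have "dist x y < r x / 2" using x(2) by (simp add: dist_commute)
      then show "y \<in> (\<Union>x\<in>J. ?A x)" using x(1) y by auto
    qed
    have "(LINT y|lborel. indicator (inner_strip \<Omega> h) y * \<bar>u y\<bar>) \<le> (LINT y|lborel. (\<Sum>x\<in>J. indicator (?A x) y * \<bar>u y\<bar>))"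
    proof (rule integral_mono[OF i[OF sb] Bochner_Integration.integrable_sum[OF i]])
      show "?A x \<in> sets borel" for x using sb by simp
      fix y
      show "indicator (inner_strip \<Omega> h) y * \<bar>u y\<bar> \<le> (\<Sum>x\<in>J. indicator (?A x) y * \<bar>u y\<bar>)"
      proof (cases "y \<in> inner_strip \<Omega> h")
        case True
        then obtain x where x: "x \<in> J" "y \<in> ?A x" using cover by blast
        have "indicator (?A x) y * \<bar>u y\<bar> \<le> (\<Sum>x\<in>J. indicator (?A x) y * \<bar>u y\<bar>)"
          by (rule member_le_sum[OF x(1) _ J(2)]) simp
        then show ?thesis using True x by simp
      next
        case False then show ?thesis by (simp add: sum_nonneg)
      qed
    qed
    also have "\<dots> = (\<Sum>x\<in>J. LINT y|lborel. indicator (?A x) y * \<bar>u y\<bar>)"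
      by (rule Bochner_Integration.integral_sum) (use sb in \<open>intro i, simp\<close>)
    also have "\<dots> \<le> (\<Sum>x\<in>J. e')" by (rule sum_mono[OF each])
    also have "\<dots> = real (card J) * e'" by simp
    also have "\<dots> \<le> (real (card J) + 1) * e'" using e' by simp
    also have "\<dots> = e" by (simp add: e'_def)
    finally show "(LINT x|lborel. indicator (inner_strip \<Omega> h) x * \<bar>u x\<bar>) \<le> e" .
  qed
qed

section \<open>Compactness in \<open>L\<^sup>1\<close> and in \<open>BV\<close>\<close>

text \<open>For \<open>norm z < h / 2\<close>, a point deeper than \<open>h / 2\<close> moves within
  \<Omega> along the whole shift, and the translation estimate applies. For any other point
  \<open>x\<close>, both \<open>x\<close> and \<open>x + z\<close> lie off \<Omega>, where the
  function is 0, or in the strip of thickness \<open>h\<close>, whose mass is small. This replaces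
  an extension operator for BV.\<close>

lemma bv_translation_modulus:
  fixes \<Omega> :: "'a::euclidean_space set"
  assumes \<Omega>: "open \<Omega>" "bounded \<Omega>" "lipschitz_boundary \<Omega>" and M: "0 \<le> M" and e: "0 < e"
  obtains d where "0 < d" "\<And>u l f z. bv_pair \<Omega> u l f \<Longrightarrow> (LINT x|lborel. \<bar>u x\<bar>) \<le> M \<Longrightarrow> (LINT x|l. norm (f x)) \<le> M \<Longrightarrow>
    norm z < d \<Longrightarrow> (LINT x|lborel. \<bar>u (x + z) - u x\<bar>) \<le> e"
proof -
  have e4: "0 < e / 4" using e by simp
  obtain h where h: "0 < h" and strip: "\<And>u l f. bv_pair \<Omega> u l f \<Longrightarrow> (LINT x|lborel. \<bar>u x\<bar>) \<le> M \<Longrightarrow> (LINT x|l. norm (f x)) \<le> M \<Longrightarrow>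
    (LINT x|lborel. indicator (inner_strip \<Omega> h) x * \<bar>u x\<bar>) \<le> e / 4"
    using uniform_strip_bound[OF \<Omega> M e4] by metis
  define d where "d = min (h / 2) (e / (2 * (M + 1)))"
  define S where "S = inner_strip \<Omega> h"
  define U where "U = {x. h / 2 < infdist x (- \<Omega>)}"
  have Sb: "S \<in> sets borel" unfolding S_def by (rule inner_strip_borel[OF \<Omega>(1)])
  have U: "open U" unfolding U_def by (intro open_Collect_less continuous_intros)
  have Ub: "U \<in> sets borel" by (rule borel_open[OF U])
  have inf_shift: "infdist (x + z) A \<le> infdist x A + norm z" "infdist x A \<le> infdist (x + z) A + norm z" for x z :: 'a and A
    using infdist_triangle[of "x + z" A x] infdist_triangle[of x A "x + z"] by (simp_all add: dist_norm)
  show ?thesis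
  proof (rule that)
    show "0 < d" using h e M by (simp add: d_def)
    fix u l f and z :: 'a
    assume p: "bv_pair \<Omega> u l f" and uM: "(LINT x|lborel. \<bar>u x\<bar>) \<le> M" and fM: "(LINT x|l. norm (f x)) \<le> M" and z: "norm z < d"
    have ui: "integrable lborel u" and u0: "\<And>x. x \<notin> \<Omega> \<Longrightarrow> u x = 0" using p by (auto simp: bv_pair_def)
    have uz: "integrable lborel (\<lambda>x. u (x + z))" by (rule integrable_lborel_translate[OF ui])
    have zh: "norm z < h / 2" and zM: "norm z < e / (2 * (M + 1))" using z by (auto simp: d_def)
    have seg: "y + t *\<^sub>R z \<in> \<Omega>" if "y \<in> U" "0 \<le> t" "t \<le> 1" for y t
    proof (rule ccontr)
      assume "y + t *\<^sub>R z \<notin> \<Omega>"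
      then have "infdist (y + t *\<^sub>R z) (- \<Omega>) = 0" by simp
      moreover have "norm (t *\<^sub>R z) \<le> norm z" using that by (simp add: mult_left_le_one_le)
      ultimately show False using inf_shift(2)[of y "- \<Omega>" "t *\<^sub>R z"] that(1) zh by (simp add: U_def)
    qed
    have T: "(LINT y|lborel. indicator U y * \<bar>u (y + z) - u y\<bar>) \<le> norm z * (LINT x|l. norm (f x))"
      by (rule bv_pair_translation[OF p U seg])
    have iU: "integrable lborel (\<lambda>y. indicator U y * \<bar>u (y + z) - u y\<bar>)"
      by (rule integrable_indicator_abs[OF Bochner_Integration.integrable_diff[OF uz ui] Ub])
    have iS: "integrable lborel (\<lambda>y. indicator S y * \<bar>u y\<bar>)" by (rule integrable_indicator_abs[OF ui Sb])
    have iSz: "integrable lborel (\<lambda>y. indicator S (y + z) * \<bar>u (y + z)\<bar>)" by (rule integrable_lborel_translate[OF iS])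
    have str: "(LINT y|lborel. indicator S y * \<bar>u y\<bar>) \<le> e / 4" unfolding S_def by (rule strip[OF p uM fM])
    have strz: "(LINT y|lborel. indicator S (y + z) * \<bar>u (y + z)\<bar>) \<le> e / 4"
      using integral_lborel_translate[OF borel_measurable_integrable[OF iS, simplified], of z] str by simp
    have "(LINT x|lborel. \<bar>u (x + z) - u x\<bar>) \<le>
      (LINT x|lborel. indicator U x * \<bar>u (x + z) - u x\<bar> + (indicator S x * \<bar>u x\<bar> + indicator S (x + z) * \<bar>u (x + z)\<bar>))"
    proof (rule integral_mono)
      show "integrable lborel (\<lambda>x. \<bar>u (x + z) - u x\<bar>)" using ui uz by simp
      show "integrable lborel (\<lambda>x. indicator U x * \<bar>u (x + z) - u x\<bar> + (indicator S x * \<bar>u x\<bar> + indicator S (x + z) * \<bar>u (x + z)\<bar>))"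
        by (rule Bochner_Integration.integrable_add[OF iU Bochner_Integration.integrable_add[OF iS iSz]])
      fix x
      have nn: "0 \<le> indicator S x * \<bar>u x\<bar>" "0 \<le> indicator S (x + z) * \<bar>u (x + z)\<bar>" by simp_all
      show "\<bar>u (x + z) - u x\<bar> \<le> indicator U x * \<bar>u (x + z) - u x\<bar> + (indicator S x * \<bar>u x\<bar> + indicator S (x + z) * \<bar>u (x + z)\<bar>)"
      proof (cases "x \<in> U")
        case True then show ?thesis using nn by simp
      next
        case False
        then have i: "infdist x (- \<Omega>) \<le> h / 2" by (simp add: U_def)
        have "\<bar>u x\<bar> = indicator S x * \<bar>u x\<bar>"
          using u0[of x] i h by (cases "x \<in> \<Omega>") (auto simp: S_def inner_strip_def)
        moreover have "\<bar>u (x + z)\<bar> = indicator S (x + z) * \<bar>u (x + z)\<bar>"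
          using u0[of "x + z"] i zh inf_shift(1)[of x z "- \<Omega>"] by (cases "x + z \<in> \<Omega>") (auto simp: S_def inner_strip_def)
        moreover have "\<bar>u (x + z) - u x\<bar> \<le> \<bar>u x\<bar> + \<bar>u (x + z)\<bar>" by simp
        ultimately have "\<bar>u (x + z) - u x\<bar> \<le> indicator S x * \<bar>u x\<bar> + indicator S (x + z) * \<bar>u (x + z)\<bar>" by linarith
        then show ?thesis using False by simp
      qed
    qed
    also have "\<dots> = (LINT x|lborel. indicator U x * \<bar>u (x + z) - u x\<bar>) +
        ((LINT x|lborel. indicator S x * \<bar>u x\<bar>) + (LINT x|lborel. indicator S (x + z) * \<bar>u (x + z)\<bar>))"
      by (simp only: Bochner_Integration.integral_add[OF iU Bochner_Integration.integrable_add[OF iS iSz]]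
          Bochner_Integration.integral_add[OF iS iSz])
    also have "\<dots> \<le> norm z * (LINT x|l. norm (f x)) + (e / 4 + e / 4)" by (intro add_mono T str strz)
    also have "norm z * (LINT x|l. norm (f x)) \<le> norm z * (M + 1)" using fM by (intro mult_left_mono) auto
    also have "norm z * (M + 1) \<le> e / 2"
    proof -
      have "norm z * (2 * (M + 1)) < e" using zM M by (subst pos_less_divide_eq[symmetric]) auto
      then show ?thesis by (simp add: algebra_simps)
    qed
    finally show "(LINT x|lborel. \<bar>u (x + z) - u x\<bar>) \<le> e" by simp
  qed
qed

section \<open>Mollification error, completeness and compactness in L1\<close>

lemma nn_integral_lborel_reflect:
  fixes h :: "'a::euclidean_space \<Rightarrow> ennreal"
  assumes [measurable]: "h \<in> borel_measurable borel"
  shows "(\<integral>\<^sup>+ y. h (a - y) \<partial>lborel) = (\<integral>\<^sup>+ y. h y \<partial>lborel)"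
proof -
  have "(\<integral>\<^sup>+ y. h y \<partial>lborel) = (\<integral>\<^sup>+ y. h y \<partial>density (distr lborel borel (\<lambda>y. a + (-1) *\<^sub>R y)) (\<lambda>_. \<bar>-1 :: real\<bar> ^ DIM('a)))"
    using lborel_affine[of "-1" a] by simp
  also have "\<dots> = (\<integral>\<^sup>+ y. h (a - y) \<partial>lborel)"
    by (subst nn_integral_density) (auto simp: nn_integral_distr)
  finally show ?thesis ..
qed

text \<open>The error is an average, weighted by \<open>k z\<close>, of the differences between
  \<open>u\<close> and its translate by \<open>z\<close>. Translations shorter than \<open>d\<close>
  contribute at most \<open>e\<close>, the others at most \<open>2 * M\<close>. Nonnegative
  integrals allow the exchange of the integrations without checking joint integrability.\<close>

lemma conv_L1_error:
  fixes u :: "'a::euclidean_space \<Rightarrow> real"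
  assumes k: "kernel k" and u: "integrable lborel u" and M: "(LINT x|lborel. \<bar>u x\<bar>) \<le> M" and e: "0 \<le> e"
    and modulus: "\<And>z. norm z < d \<Longrightarrow> (LINT x|lborel. \<bar>u (x + z) - u x\<bar>) \<le> e"
  shows "(LINT x|lborel. \<bar>conv k lborel u x - u x\<bar>) \<le> e + 2 * M * (LINT z|lborel. indicator (- ball 0 d) z * k z)"
proof -
  note kD = kernelD[OF k]
  have M0: "0 \<le> M" using order_trans[OF _ M, of 0] by simp
  have um[measurable]: "u \<in> borel_measurable borel" using u by auto
  have km[measurable]: "k \<in> borel_measurable borel" by (rule kD(2))
  let ?B = "- ball 0 d :: 'a set"
  have uz: "integrable lborel (\<lambda>x. u (x + z))" for z by (rule integrable_lborel_translate[OF u])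
  have iz: "integrable lborel (\<lambda>x. \<bar>u (x + z) - u x\<bar>)" for z using uz u by simp
  have i1: "integrable lborel (\<lambda>z. indicator ?B z * k z)"
    using integrable_indicator_abs[OF kD(4), of ?B] kD(3) by (simp add: borel_closed)
  have ci: "integrable lborel (conv k lborel u)" by (rule conv_integrable(1)[OF k sigma_finite_lborel _ u]) simp
  have \<omega>: "(LINT x|lborel. \<bar>u (x - z) - u x\<bar>) \<le> e + 2 * M * indicator ?B z" for z
  proof (cases "norm z < d")
    case True then show ?thesis using modulus[of "- z"] by simp
  next
    case False
    have "(LINT x|lborel. \<bar>u (x + - z) - u x\<bar>) \<le> (LINT x|lborel. \<bar>u (x + - z)\<bar> + \<bar>u x\<bar>)"
      using uz[of "- z"] u by (intro integral_mono[OF iz]) auto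
    also have "\<dots> = (LINT x|lborel. \<bar>u (x + - z)\<bar>) + (LINT x|lborel. \<bar>u x\<bar>)"
      using uz[of "- z"] u by (intro Bochner_Integration.integral_add) auto
    also have "\<dots> \<le> 2 * M" using integral_lborel_translate[of "\<lambda>x. \<bar>u x\<bar>" "- z"] M by simp
    finally show ?thesis using False e by simp
  qed
  have ae: "AE x in lborel. integrable lborel (\<lambda>y. k (x - y) *\<^sub>R u y)"
    by (rule conv_integrable(2)[OF k sigma_finite_lborel _ u]) simp
  have pt: "AE x in lborel. ennreal \<bar>conv k lborel u x - u x\<bar> \<le> (\<integral>\<^sup>+ z. ennreal (k z * \<bar>u (x - z) - u x\<bar>) \<partial>lborel)"
    using ae
  proof eventually_elim
    fix x assume "integrable lborel (\<lambda>y. k (x - y) *\<^sub>R u y)"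
    then have ky: "integrable lborel (\<lambda>y. k (x - y) * u y)" by simp
    have "(\<integral>\<^sup>+ y. ennreal (k (x - y)) \<partial>lborel) = ennreal 1"
      using nn_integral_lborel_reflect[of "\<lambda>y. ennreal (k y)" x] kD(3,4,5) by (simp add: nn_integral_eq_integral)
    then have "has_bochner_integral lborel (\<lambda>y. k (x - y)) 1"
      using kD(3) by (intro has_bochner_integral_nn_integral) auto
    then have k1: "integrable lborel (\<lambda>y. k (x - y))" "(LINT y|lborel. k (x - y)) = 1"
      by (auto simp: has_bochner_integral_iff)
    have d: "integrable lborel (\<lambda>y. k (x - y) * (u y - u x))"
      using Bochner_Integration.integrable_diff[OF ky integrable_mult_left[OF k1(1), of "u x"]] by (simp add: right_diff_distrib)
    have "conv k lborel u x - u x = (LINT y|lborel. k (x - y) * u y) - (LINT y|lborel. k (x - y) * u x)"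
      using k1(2) by (simp add: conv_def)
    also have "\<dots> = (LINT y|lborel. k (x - y) * (u y - u x))"
      using Bochner_Integration.integral_diff[OF ky integrable_mult_left[OF k1(1), of "u x"]] by (simp add: right_diff_distrib)
    finally have "\<bar>conv k lborel u x - u x\<bar> \<le> (LINT y|lborel. norm (k (x - y) * (u y - u x)))"
      using integral_norm_bound[of lborel "\<lambda>y. k (x - y) * (u y - u x)"] by simp
    then have "ennreal \<bar>conv k lborel u x - u x\<bar> \<le> ennreal (LINT y|lborel. norm (k (x - y) * (u y - u x)))"
      by (rule ennreal_leI)
    also have "\<dots> = (\<integral>\<^sup>+ y. ennreal (norm (k (x - y) * (u y - u x))) \<partial>lborel)"
      using d by (intro nn_integral_eq_integral[symmetric]) auto
    also have "\<dots> = (\<integral>\<^sup>+ y. ennreal (k (x - y) * \<bar>u (x - (x - y)) - u x\<bar>) \<partial>lborel)"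
      using kD(3) by (simp add: abs_mult)
    also have "\<dots> = (\<integral>\<^sup>+ z. ennreal (k z * \<bar>u (x - z) - u x\<bar>) \<partial>lborel)"
      by (rule nn_integral_lborel_reflect[of "\<lambda>z. ennreal (k z * \<bar>u (x - z) - u x\<bar>)" x]) measurable
    finally show "ennreal \<bar>conv k lborel u x - u x\<bar> \<le> (\<integral>\<^sup>+ z. ennreal (k z * \<bar>u (x - z) - u x\<bar>) \<partial>lborel)" .
  qed
  have "ennreal (LINT x|lborel. \<bar>conv k lborel u x - u x\<bar>) = (\<integral>\<^sup>+ x. ennreal \<bar>conv k lborel u x - u x\<bar> \<partial>lborel)"
    using ci u by (intro nn_integral_eq_integral[symmetric]) auto
  also have "\<dots> \<le> (\<integral>\<^sup>+ x. (\<integral>\<^sup>+ z. ennreal (k z * \<bar>u (x - z) - u x\<bar>) \<partial>lborel) \<partial>lborel)"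
    by (rule nn_integral_mono_AE[OF pt])
  also have "\<dots> = (\<integral>\<^sup>+ z. (\<integral>\<^sup>+ x. ennreal (k z * \<bar>u (x - z) - u x\<bar>) \<partial>lborel) \<partial>lborel)"
    by (rule lborel_pair.Fubini') measurable
  also have "\<dots> \<le> (\<integral>\<^sup>+ z. ennreal (k z * (e + 2 * M * indicator ?B z)) \<partial>lborel)"
  proof (rule nn_integral_mono)
    fix z :: 'a
    have "(\<integral>\<^sup>+ x. ennreal (k z * \<bar>u (x - z) - u x\<bar>) \<partial>lborel) = ennreal (LINT x|lborel. k z * \<bar>u (x - z) - u x\<bar>)"
      using iz[of "- z"] kD(3) by (intro nn_integral_eq_integral) auto
    also have "\<dots> = ennreal (k z * (LINT x|lborel. \<bar>u (x - z) - u x\<bar>))" by simp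
    also have "\<dots> \<le> ennreal (k z * (e + 2 * M * indicator ?B z))"
      by (intro ennreal_leI mult_left_mono \<omega> kD(3))
    finally show "(\<integral>\<^sup>+ x. ennreal (k z * \<bar>u (x - z) - u x\<bar>) \<partial>lborel) \<le> ennreal (k z * (e + 2 * M * indicator ?B z))" .
  qed
  also have "\<dots> = ennreal (LINT z|lborel. k z * e + 2 * M * (indicator ?B z * k z))"
  proof -
    have ii: "integrable lborel (\<lambda>z. k z * e + 2 * M * (indicator ?B z * k z))" using i1 kD(4) by auto
    have "(\<integral>\<^sup>+ z. ennreal (k z * (e + 2 * M * indicator ?B z)) \<partial>lborel) =
      (\<integral>\<^sup>+ z. ennreal (k z * e + 2 * M * (indicator ?B z * k z)) \<partial>lborel)"
      by (simp add: distrib_left mult_ac)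
    also have "\<dots> = ennreal (LINT z|lborel. k z * e + 2 * M * (indicator ?B z * k z))"
      using e M0 kD(3) by (intro nn_integral_eq_integral[OF ii]) auto
    finally show ?thesis .
  qed
  also have "(LINT z|lborel. k z * e + 2 * M * (indicator ?B z * k z)) = e + 2 * M * (LINT z|lborel. indicator ?B z * k z)"
    using i1 kD(4,5) by (subst Bochner_Integration.integral_add) auto
  finally show ?thesis
    using e M0 kD(3) by (subst (asm) ennreal_le_iff) (auto intro!: add_nonneg_nonneg mult_nonneg_nonneg Bochner_Integration.integral_nonneg)
qed

text \<open>A subsequence converges almost everywhere and provides the candidate. Fatou then carries
  the Cauchy bound over to the distance from the candidate, for the whole sequence.\<close>

lemma L1_complete:
  fixes s :: "nat \<Rightarrow> 'a \<Rightarrow> 'b::{banach,second_countable_topology}"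
  assumes i: "\<And>n. integrable M (s n)"
    and C: "\<And>e. e > 0 \<Longrightarrow> \<exists>N. \<forall>i\<ge>N. \<forall>j\<ge>N. (LINT x|M. norm (s i x - s j x)) < e"
  obtains v where "integrable M v" "(\<lambda>n. LINT x|M. norm (s n x - v x)) \<longlonglongrightarrow> 0"
proof -
  obtain r where r: "strict_mono (r :: nat \<Rightarrow> nat)" and ae: "AE x in M. Cauchy (\<lambda>i. s (r i) x)"
    using cauchy_L1_AE_cauchy_subseq[OF i C] by blast
  define v where "v x = lim (\<lambda>i. s (r i) x)" for x
  have sm[measurable]: "s n \<in> borel_measurable M" for n using i by auto
  have vm[measurable]: "v \<in> borel_measurable M" unfolding v_def by (rule borel_measurable_lim_metric) simp
  have conv: "AE x in M. (\<lambda>i. s (r i) x) \<longlonglongrightarrow> v x"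
    using ae by eventually_elim (simp add: v_def Cauchy_convergent_iff convergent_LIMSEQ_iff)
  have key: "\<exists>N. \<forall>n\<ge>N. (\<integral>\<^sup>+ x. ennreal (norm (s n x - v x)) \<partial>M) \<le> ennreal e" if e: "0 < e" for e
  proof -
    obtain N where N: "\<And>i j. N \<le> i \<Longrightarrow> N \<le> j \<Longrightarrow> (LINT x|M. norm (s i x - s j x)) < e" using C[OF e] by blast
    have "(\<integral>\<^sup>+ x. ennreal (norm (s n x - v x)) \<partial>M) \<le> ennreal e" if n: "N \<le> n" for n
    proof -
      have "(\<integral>\<^sup>+ x. ennreal (norm (s n x - v x)) \<partial>M) = (\<integral>\<^sup>+ x. liminf (\<lambda>j. ennreal (norm (s n x - s (r j) x))) \<partial>M)"
      proof (rule nn_integral_cong_AE, use conv in eventually_elim)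
        fix x assume "(\<lambda>i. s (r i) x) \<longlonglongrightarrow> v x"
        then have "(\<lambda>j. ennreal (norm (s n x - s (r j) x))) \<longlonglongrightarrow> ennreal (norm (s n x - v x))"
          by (intro tendsto_ennrealI tendsto_intros)
        then show "ennreal (norm (s n x - v x)) = liminf (\<lambda>j. ennreal (norm (s n x - s (r j) x)))"
          by (rule lim_imp_Liminf[OF sequentially_bot, symmetric])
      qed
      also have "\<dots> \<le> liminf (\<lambda>j. \<integral>\<^sup>+ x. ennreal (norm (s n x - s (r j) x)) \<partial>M)"
        by (rule nn_integral_liminf) measurable
      also have "\<dots> \<le> ennreal e"
      proof (rule Liminf_le)
        have "eventually (\<lambda>j. N \<le> r j) sequentially"
          using filterlim_subseq[OF r] by (simp add: filterlim_at_top)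
        then show "eventually (\<lambda>j. (\<integral>\<^sup>+ x. ennreal (norm (s n x - s (r j) x)) \<partial>M) \<le> ennreal e) sequentially"
        proof eventually_elim
          case (elim j)
          have "(\<integral>\<^sup>+ x. ennreal (norm (s n x - s (r j) x)) \<partial>M) = ennreal (LINT x|M. norm (s n x - s (r j) x))"
            using i by (intro nn_integral_eq_integral) auto
          then show ?case using N[OF n elim] by (simp add: ennreal_leI)
        qed
      qed simp
      finally show ?thesis .
    qed
    then show ?thesis by blast
  qed
  obtain N where "(\<integral>\<^sup>+ x. ennreal (norm (s N x - v x)) \<partial>M) \<le> ennreal 1" using key[of 1] by auto
  then have "integrable M (\<lambda>x. s N x - v x)"
    by (intro integrableI_bounded) (auto intro: le_less_trans)
  from Bochner_Integration.integrable_diff[OF i[of N] this] have vi: "integrable M v" by simp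
  have "(\<lambda>n. LINT x|M. norm (s n x - v x)) \<longlonglongrightarrow> 0"
  proof (rule LIMSEQ_I)
    fix e :: real assume e: "0 < e"
    obtain N where N: "\<And>n. N \<le> n \<Longrightarrow> (\<integral>\<^sup>+ x. ennreal (norm (s n x - v x)) \<partial>M) \<le> ennreal (e / 2)"
      using key[of "e / 2"] e by auto
    have "norm ((LINT x|M. norm (s n x - v x)) - 0) < e" if "N \<le> n" for n
    proof -
      have "ennreal (LINT x|M. norm (s n x - v x)) \<le> ennreal (e / 2)"
        using N[OF that] i vi by (subst nn_integral_eq_integral[symmetric]) auto
      then have "(LINT x|M. norm (s n x - v x)) \<le> e / 2" using e by (subst (asm) ennreal_le_iff) auto
      then show ?thesis using e by simp
    qed
    then show "\<exists>no. \<forall>n\<ge>no. norm ((LINT x|M. norm (s n x - v x)) - 0) < e" by blast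
  qed
  then show ?thesis using that vi by blast
qed

text \<open>A Kolmogorov-Riesz argument by way of measures. Regarded as measures on
  \<open>S\<close>, the functions converge narrowly along a subsequence, so at each fixed scale
  their mollifications converge in L1. The common modulus makes the mollification error uniformly
  small, and therefore the subsequence is Cauchy.\<close>

theorem L1_compactness:
  fixes u :: "nat \<Rightarrow> 'a::euclidean_space \<Rightarrow> real" and k :: "nat \<Rightarrow> 'a \<Rightarrow> real"
  assumes S: "compact S" and u: "\<And>i. integrable lborel (u i)" and supp: "\<And>i x. x \<notin> S \<Longrightarrow> u i x = 0"
    and M: "\<And>i. (LINT x|lborel. \<bar>u i x\<bar>) \<le> M"
    and modulus: "\<And>e. 0 < e \<Longrightarrow> \<exists>d>0. \<forall>i z. norm z < d \<longrightarrow> (LINT x|lborel. \<bar>u i (x + z) - u i x\<bar>) \<le> e"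
    and k: "\<And>n. kernel (k n)"
    and conc: "\<And>r. 0 < r \<Longrightarrow> (\<lambda>n. LINT x|lborel. indicator (- ball 0 r) x * k n x) \<longlonglongrightarrow> 0"
  obtains r v where "strict_mono (r :: nat \<Rightarrow> nat)" "integrable lborel v"
    "(\<lambda>i. LINT x|lborel. \<bar>u (r i) x - v x\<bar>) \<longlonglongrightarrow> 0"
proof -
  \<comment> \<open>Lebesgue measure restricted to \<open>S\<close> is finite, as
    \<open>represents\<close> demands; for functions vanishing off \<open>S\<close> the integrals do
    not change.\<close>
  define l where "l = density lborel (\<lambda>x. ennreal (indicator S x))"
  have Sb: "S \<in> sets borel" using S by (simp add: borel_compact)
  have Sm: "indicat_real S \<in> borel_measurable lborel" using Sb by simp
  have s: "sets l = sets borel" by (simp add: l_def)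
  have fin: "finite_measure l"
  proof
    have "emeasure l (space l) = emeasure lborel S"
      unfolding l_def by (subst emeasure_density) (auto simp: Sb ennreal_indicator intro!: borel_measurable_indicator)
    also have "\<dots> < \<infinity>" by (rule emeasure_compact_finite[OF S])
    finally show "emeasure l (space l) \<noteq> \<infinity>" by simp
  qed
  have LI: "(LINT x|l. h x) = (LINT x|lborel. indicator S x *\<^sub>R h x)" if "h \<in> borel_measurable borel" for h :: "'a \<Rightarrow> real"
    unfolding l_def using that Sb by (intro integral_density) auto
  have um: "u i \<in> borel_measurable borel" for i using borel_measurable_integrable[OF u] by simp
  have Su: "indicator S x * (a * u i x) = a * u i x" for a i x using supp[of x i] by (cases "x \<in> S") auto
  have ul: "integrable l (u i)" for i
  proof -
    have "(\<lambda>x. indicat_real S x *\<^sub>R u i x) = u i" using Su[of _ 1] by auto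
    then show ?thesis unfolding l_def using um u Sm by (subst integrable_density) auto
  qed
  have rep: "represents l (u i) (\<lambda>A. LINT x:A|l. u i x)" for i
    using fin s ul by (simp add: represents_def)
  have bd: "(LINT x|l. norm (u i x)) \<le> M" for i
  proof -
    have "(\<lambda>x. indicat_real S x *\<^sub>R norm (u i x)) = (\<lambda>x. \<bar>u i x\<bar>)" using supp[of _ i] by (auto simp: fun_eq_iff split: split_indicator)
    then show ?thesis using LI[of "\<lambda>x. norm (u i x)"] um[of i] M[of i] by simp
  qed
  obtain r L g \<nu> where r: "strict_mono (r :: nat \<Rightarrow> nat)" and repL: "represents L g \<nu>"
    and weak: "\<And>\<psi>::'a \<Rightarrow> real. continuous_on UNIV \<psi> \<Longrightarrow> (\<lambda>i. LINT x|l. \<psi> x *\<^sub>R u (r i) x) \<longlonglongrightarrow> (LINT x|L. \<psi> x *\<^sub>R g x)"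
    by (rule represents_compactness[OF S rep supp bd]) (assumption | rule that)+
  have km: "(\<lambda>y. k n (x - y)) \<in> borel_measurable borel" for n x
    by (intro borel_measurable_continuous_onI continuous_kernel_shift[OF k])
  have cv: "conv (k n) l (u i) = conv (k n) lborel (u i)" for n i
  proof
    fix x
    have "(LINT y|l. k n (x - y) *\<^sub>R u i y) = (LINT y|lborel. indicator S y *\<^sub>R (k n (x - y) *\<^sub>R u i y))"
      using km um by (intro LI) measurable
    then show "conv (k n) l (u i) x = conv (k n) lborel (u i) x" by (simp add: conv_def Su)
  qed
  obtain R0 where R0: "\<And>x. x \<in> S \<Longrightarrow> norm x \<le> R0" using compact_imp_bounded[OF S] by (auto simp: bounded_iff)
  have sf: "sigma_finite_measure l" by (rule represents_sigma_finite[OF rep])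
  have sL: "sets L = sets borel" and gi: "integrable L g" using repL by (auto simp: represents_def)
  note sfL = represents_sigma_finite[OF repL]
  define \<gamma> where "\<gamma> n = conv (k n) L g" for n
  have ci: "integrable lborel (conv (k n) lborel (u i))" for n i
    by (rule conv_integrable(1)[OF k sigma_finite_lborel _ u]) simp
  have gci: "integrable lborel (\<gamma> n)" for n unfolding \<gamma>_def by (rule conv_integrable(1)[OF k sfL sL gi])
  have narrow: "(\<lambda>i. LINT x|lborel. norm (conv (k n) l (u (r i)) x - \<gamma> n x)) \<longlonglongrightarrow> 0" for n
    unfolding \<gamma>_def
  proof (rule conv_tendsto(1)[OF k sf s ul _ bd sfL sL gi, where h = "\<lambda>v. v" and c = 1])
    show "u (r i) x = 0" if "R0 < norm x" for i x using that R0[of x] supp[of x] by force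
    show "(\<lambda>i. conv (k n) l (u (r i)) x) \<longlonglongrightarrow> conv (k n) L g x" for x
      unfolding conv_def by (rule weak[OF continuous_kernel_shift[OF k]])
  qed auto
  have "\<exists>N. \<forall>i\<ge>N. \<forall>j\<ge>N. (LINT x|lborel. norm (u (r i) x - u (r j) x)) < e" if e: "0 < e" for e
  proof -
    obtain d where d: "0 < d" "\<And>i z. norm z < d \<Longrightarrow> (LINT x|lborel. \<bar>u i (x + z) - u i x\<bar>) \<le> e / 8"
      using modulus[of "e / 8"] e by auto
    have "(\<lambda>n. 2 * M * (LINT x|lborel. indicator (- ball 0 d) x * k n x)) \<longlonglongrightarrow> 2 * M * 0"
      by (intro tendsto_mult tendsto_const conc d)
    then have "eventually (\<lambda>n. 2 * M * (LINT x|lborel. indicator (- ball 0 d) x * k n x) < e / 8) sequentially"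
      using e by (intro order_tendstoD(2)) auto
    then obtain n where n: "2 * M * (LINT x|lborel. indicator (- ball 0 d) x * k n x) < e / 8"
      by (auto simp: eventually_sequentially)
    define c where "c i = conv (k n) lborel (u i)" for i
    have c1: "integrable lborel (c i)" for i unfolding c_def by (rule ci)
    have err: "(LINT x|lborel. \<bar>c i x - u i x\<bar>) < e / 4" for i
      using conv_L1_error[OF k[of n] u M, of "e / 8" d i] d(2) e n unfolding c_def by force
    obtain N where N: "\<And>i. N \<le> i \<Longrightarrow> (LINT x|lborel. \<bar>c (r i) x - \<gamma> n x\<bar>) < e / 4"
      using order_tendstoD(2)[OF narrow[of n], of "e / 4"] e unfolding cv c_def
      by (auto simp: eventually_sequentially)
    have "(LINT x|lborel. norm (u (r i) x - u (r j) x)) < e" if ij: "N \<le> i" "N \<le> j" for i j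
    proof -
      have a: "integrable lborel (\<lambda>x. \<bar>c i x - u i x\<bar>)" "integrable lborel (\<lambda>x. \<bar>c i x - \<gamma> n x\<bar>)" for i
        using c1 u gci by auto
      have "(LINT x|lborel. norm (u (r i) x - u (r j) x)) \<le>
        (LINT x|lborel. (\<bar>c (r i) x - u (r i) x\<bar> + \<bar>c (r i) x - \<gamma> n x\<bar>) + (\<bar>c (r j) x - u (r j) x\<bar> + \<bar>c (r j) x - \<gamma> n x\<bar>))"
        using a u by (intro integral_mono) auto
      also have "\<dots> = (LINT x|lborel. \<bar>c (r i) x - u (r i) x\<bar>) + (LINT x|lborel. \<bar>c (r i) x - \<gamma> n x\<bar>) +
         ((LINT x|lborel. \<bar>c (r j) x - u (r j) x\<bar>) + (LINT x|lborel. \<bar>c (r j) x - \<gamma> n x\<bar>))"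
        using a by (simp add: Bochner_Integration.integral_add)
      finally show ?thesis using err[of "r i"] err[of "r j"] N[OF ij(1)] N[OF ij(2)] by linarith
    qed
    then show ?thesis by blast
  qed
  then obtain v where v: "integrable lborel v" "(\<lambda>i. LINT x|lborel. norm (u (r i) x - v x)) \<longlonglongrightarrow> 0"
    by (rule L1_complete[OF u])
  show ?thesis
    by (rule that[OF r v(1)]) (use v(2) in simp)
qed

section \<open>From BV classes to Borel functions, and compactness in BV\<close>

lemma lebesgue_on_representative_integrals:
  fixes u u' v :: "'a::euclidean_space \<Rightarrow> real" and h :: "'a \<Rightarrow> 'b::euclidean_space"
  assumes \<Omega>: "\<Omega> \<in> sets borel" and u: "u \<in> borel_measurable (lebesgue_on \<Omega>)" and u': "u' \<in> borel_measurable borel"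
    and z: "\<And>x. x \<notin> \<Omega> \<Longrightarrow> u' x = 0" and ae: "AE x in lebesgue_on \<Omega>. u x = u' x"
  shows "h \<in> borel_measurable borel \<Longrightarrow> (LINT x|lebesgue_on \<Omega>. u x *\<^sub>R h x) = (LINT x|lborel. u' x *\<^sub>R h x)"
    and "v \<in> borel_measurable borel \<Longrightarrow> (\<And>x. x \<notin> \<Omega> \<Longrightarrow> v x = 0) \<Longrightarrow>
      (LINT x|lebesgue_on \<Omega>. \<bar>u x - v x\<bar>) = (LINT x|lborel. \<bar>u' x - v x\<bar>)"
proof -
  have m1: "k \<in> borel_measurable (lebesgue_on \<Omega>)" if "k \<in> borel_measurable borel" for k :: "'a \<Rightarrow> real"
    using that by (intro measurable_restrict_space1 measurable_completion) simp
  have m2: "k \<in> borel_measurable (lebesgue_on \<Omega>)" if "k \<in> borel_measurable borel" for k :: "'a \<Rightarrow> 'b"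
    using that by (intro measurable_restrict_space1 measurable_completion) simp
  {
    assume h: "h \<in> borel_measurable borel"
    have "(LINT x|lebesgue_on \<Omega>. u x *\<^sub>R h x) = (LINT x|lebesgue_on \<Omega>. u' x *\<^sub>R h x)"
      using ae u m1[OF u'] m2[OF h] by (intro integral_cong_AE borel_measurable_scaleR) auto
    also have "\<dots> = (LINT x|lborel. indicator \<Omega> x *\<^sub>R (u' x *\<^sub>R h x))"
      using u' h by (intro lebesgue_on_integral_borel(1)[OF \<Omega>]) auto
    also have "\<dots> = (LINT x|lborel. u' x *\<^sub>R h x)"
      using z by (intro Bochner_Integration.integral_cong) (auto split: split_indicator)
    finally show "(LINT x|lebesgue_on \<Omega>. u x *\<^sub>R h x) = (LINT x|lborel. u' x *\<^sub>R h x)" .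
  }
  {
    assume v: "v \<in> borel_measurable borel" and v0: "\<And>x. x \<notin> \<Omega> \<Longrightarrow> v x = 0"
    have "(LINT x|lebesgue_on \<Omega>. \<bar>u x - v x\<bar>) = (LINT x|lebesgue_on \<Omega>. \<bar>u' x - v x\<bar>)"
      using ae u m1[OF u'] m1[OF v] by (intro integral_cong_AE) auto
    also have "\<dots> = (LINT x|lborel. indicator \<Omega> x *\<^sub>R \<bar>u' x - v x\<bar>)"
      using u' v by (intro lebesgue_on_integral_borel(1)[OF \<Omega>]) auto
    also have "\<dots> = (LINT x|lborel. \<bar>u' x - v x\<bar>)"
      using z v0 by (intro Bochner_Integration.integral_cong) (auto split: split_indicator)
    finally show "(LINT x|lebesgue_on \<Omega>. \<bar>u x - v x\<bar>) = (LINT x|lborel. \<bar>u' x - v x\<bar>)" .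
  }
qed

lemma test_functions_gradient_measurable:
  assumes "\<psi> \<in> test_functions W"
  shows "gradient \<psi> \<in> borel_measurable borel"
  by (rule borel_measurable_continuous_onI[OF smooth_gradient_continuous[OF test_functionsD(1)[OF assms]]])

lemma bv_pair_BV:
  fixes \<Omega> :: "'a::euclidean_space set"
  assumes \<Omega>: "open \<Omega>" and u: "u \<in> BV \<Omega>" and r: "represents l f (Deriv \<Omega> u)"
    and u': "u' \<in> borel_measurable borel" "integrable lborel u'" "\<And>x. x \<notin> \<Omega> \<Longrightarrow> u' x = 0"
    "AE x in lebesgue_on \<Omega>. u x = u' x"
  shows "bv_pair \<Omega> u' l f"
proof -
  have Ob: "\<Omega> \<in> sets borel" using \<Omega> by simp
  have um: "u \<in> borel_measurable (lebesgue_on \<Omega>)" using u by (auto simp: BV_def)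
  have "(LINT x|lborel. u' x *\<^sub>R gradient \<psi> x) = - (LINT x|l. \<psi> x *\<^sub>R f x)" if \<psi>: "\<psi> \<in> test_functions \<Omega>" for \<psi>
  proof -
    obtain B where B: "\<And>x. \<bar>\<psi> x\<bar> \<le> B" using test_functions_bounded[OF \<psi>] by metis
    have "(LINT x|lborel. u' x *\<^sub>R gradient \<psi> x) = (LINT x|lebesgue_on \<Omega>. u x *\<^sub>R gradient \<psi> x)"
      by (rule lebesgue_on_representative_integrals(1)[OF Ob um u'(1,3,4) test_functions_gradient_measurable[OF \<psi>], symmetric])
    also have "\<dots> = - vm_integral (Deriv \<Omega> u) \<psi>"
      using Deriv_has_deriv_measure[OF u] \<psi> by (simp add: has_deriv_measure_def)
    also have "vm_integral (Deriv \<Omega> u) \<psi> = (LINT x|l. \<psi> x *\<^sub>R f x)"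
      by (rule represents_vm_integral_bounded(1)[OF r test_functionsD(3)[OF \<psi>] B])
    finally show ?thesis .
  qed
  then show ?thesis using u' r by (auto simp: bv_pair_def represents_def)
qed

text \<open>The liftings have a narrow limit \<nu> on the closure, and the functions have an L1
  limit; the two are obtained separately. Testing inside \<Omega> links them: the derivative of the
  limit function is the restriction to \<Omega> of the second component of \<nu>. Mass of \<nu> on
  the boundary is invisible to the limit function, so \<nu> is returned as well.\<close>

theorem BV_compactness:
  fixes \<Omega> :: "'a::euclidean_space set" and u :: "nat \<Rightarrow> 'a \<Rightarrow> real" and k :: "nat \<Rightarrow> 'a \<Rightarrow> real"
  assumes \<Omega>: "open \<Omega>" "bounded \<Omega>" "lipschitz_boundary \<Omega>"
    and u: "\<And>i. u i \<in> BV \<Omega>" and M: "\<And>i. (LINT x|lebesgue_on \<Omega>. \<bar>u i x\<bar>) \<le> M"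
    and rep: "\<And>i. represents (l i) (f i) (lifting \<Omega> (u i))" and supp: "\<And>i x. x \<notin> \<Omega> \<Longrightarrow> f i x = 0"
    and fM: "\<And>i. (LINT y|l i. norm (f i y)) \<le> M"
    and k: "\<And>n. kernel (k n)"
    and conc: "\<And>r. 0 < r \<Longrightarrow> (\<lambda>n. LINT x|lborel. indicator (- ball 0 r) x * k n x) \<longlonglongrightarrow> 0"
  obtains r v L g \<nu> where "strict_mono (r :: nat \<Rightarrow> nat)" "v \<in> BV \<Omega>" "weak_star_BV \<Omega> (\<lambda>i. u (r i)) v"
    "represents L g \<nu>" "\<And>x. x \<notin> closure \<Omega> \<Longrightarrow> g x = 0"
    "represents L (\<lambda>x. indicator \<Omega> x *\<^sub>R g x) (lifting \<Omega> v)"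
    "\<And>A. A \<in> sets borel \<Longrightarrow> fst (\<nu> A) = measure lborel (A \<inter> \<Omega>)"
    "\<And>\<psi>::'a \<Rightarrow> real. continuous_on UNIV \<psi> \<Longrightarrow>
      (\<lambda>i. LINT x|l (r i). \<psi> x *\<^sub>R f (r i) x) \<longlonglongrightarrow> (LINT x|L. \<psi> x *\<^sub>R g x)"
proof -
  have Ob: "\<Omega> \<in> sets borel" and Ofin: "emeasure lborel \<Omega> < \<infinity>" using \<Omega> emeasure_bounded_finite by auto
  have K: "compact (closure \<Omega>)" using \<Omega>(2) by simp
  have um: "u i \<in> borel_measurable (lebesgue_on \<Omega>)" and ui: "integrable (lebesgue_on \<Omega>) (u i)" for i
    using u[of i] by (auto simp: BV_def)
  have "\<exists>u'. u' \<in> borel_measurable borel \<and> integrable lborel u' \<and> (\<forall>x. x \<notin> \<Omega> \<longrightarrow> u' x = 0) \<and> (AE x in lebesgue_on \<Omega>. u i x = u' x)" for i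
    by (rule lebesgue_on_borel_representative[OF Ob ui[of i]]) blast
  then obtain w where "\<And>i. w i \<in> borel_measurable borel \<and> integrable lborel (w i) \<and> (\<forall>x. x \<notin> \<Omega> \<longrightarrow> w i x = 0) \<and> (AE x in lebesgue_on \<Omega>. u i x = w i x)"
    by metis
  then have wm: "w i \<in> borel_measurable borel" and wi: "integrable lborel (w i)" and w0: "\<And>x. x \<notin> \<Omega> \<Longrightarrow> w i x = 0"
    and wae: "AE x in lebesgue_on \<Omega>. u i x = w i x" for i by blast+
  have rq: "represents (l i) (\<lambda>x. snd (f i x)) (Deriv \<Omega> (u i))" for i
    using represents_bounded_linear[OF rep[of i] bounded_linear_snd] by (simp add: lifting_def)
  have rp: "represents (l i) (\<lambda>x. fst (f i x)) (\<lambda>A. measure lborel (A \<inter> \<Omega>))" for i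
    using represents_bounded_linear[OF rep[of i] bounded_linear_fst] by (simp add: lifting_def)
  have fi: "integrable (l i) (f i)" for i using rep[of i] by (simp add: represents_def)
  have pair: "bv_pair \<Omega> (w i) (l i) (\<lambda>x. snd (f i x))" for i
    by (rule bv_pair_BV[OF \<Omega>(1) u rq wm wi w0 wae])
  have wM: "(LINT x|lborel. \<bar>w i x\<bar>) \<le> M" for i
    using lebesgue_on_representative_integrals(2)[OF Ob um wm w0 wae, of "\<lambda>_. 0"] M[of i] by simp
  have qM: "(LINT y|l i. norm (snd (f i y))) \<le> M" for i
  proof -
    have "norm (snd z) \<le> norm z" for z :: "real \<times> 'a" by (cases z) (simp add: norm_snd_le)
    then have "(LINT y|l i. norm (snd (f i y))) \<le> (LINT y|l i. norm (f i y))"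
      using fi[of i] rq[of i] by (intro integral_mono) (auto simp: represents_def)
    then show ?thesis using fM[of i] by linarith
  qed
  have M0: "0 \<le> M" using order_trans[OF _ wM[of 0], of 0] by simp
  have suppK: "f i x = 0" if "x \<notin> closure \<Omega>" for i x using supp that closure_subset by blast
  obtain r1 L g \<nu> where r1: "strict_mono (r1 :: nat \<Rightarrow> nat)" and repL: "represents L g \<nu>" and g0: "\<And>x. x \<notin> closure \<Omega> \<Longrightarrow> g x = 0"
    and weak1: "\<And>\<psi>::'a \<Rightarrow> real. continuous_on UNIV \<psi> \<Longrightarrow> (\<lambda>i. LINT x|l (r1 i). \<psi> x *\<^sub>R f (r1 i) x) \<longlonglongrightarrow> (LINT x|L. \<psi> x *\<^sub>R g x)"
    by (rule represents_compactness[OF K rep suppK fM]) (assumption | rule that)+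
  have mod: "\<exists>d>0. \<forall>i z. norm z < d \<longrightarrow> (LINT x|lborel. \<bar>w (r1 i) (x + z) - w (r1 i) x\<bar>) \<le> e" if e: "0 < e" for e
  proof (rule bv_translation_modulus[OF \<Omega> M0 e])
    fix d :: real assume d: "0 < d" and m: "\<And>u l f z. bv_pair \<Omega> u l f \<Longrightarrow> (LINT x|lborel. \<bar>u x\<bar>) \<le> M \<Longrightarrow>
      (LINT x|l. norm (f x)) \<le> M \<Longrightarrow> norm z < d \<Longrightarrow> (LINT x|lborel. \<bar>u (x + z) - u x\<bar>) \<le> e"
    show ?thesis
      by (rule exI[of _ d], intro conjI allI impI d m[OF pair wM qM])
  qed
  have w0K: "w (r1 i) x = 0" if "x \<notin> closure \<Omega>" for i x using w0 that closure_subset by blast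
  obtain r2 v0 where r2: "strict_mono (r2 :: nat \<Rightarrow> nat)" and v0: "integrable lborel v0"
    and lim0: "(\<lambda>i. LINT x|lborel. \<bar>w (r1 (r2 i)) x - v0 x\<bar>) \<longlonglongrightarrow> 0"
    by (rule L1_compactness[OF K wi w0K wM mod k conc]) (assumption | rule that)+
  define r where "r = r1 \<circ> r2"
  \<comment> \<open>Cutting off outside \<Omega> makes the limit vanish there at every point; the L1
    distances do not increase, because the functions \<open>w i\<close> vanish there too.\<close>
  define v where "v x = indicator \<Omega> x * v0 x" for x
  have sm: "strict_mono r" using r1 r2 by (simp add: r_def strict_mono_o)
  have weak: "(\<lambda>i. LINT x|l (r i). \<psi> x *\<^sub>R f (r i) x) \<longlonglongrightarrow> (LINT x|L. \<psi> x *\<^sub>R g x)" if "continuous_on UNIV \<psi>" for \<psi> :: "'a \<Rightarrow> real"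
    using LIMSEQ_subseq_LIMSEQ[OF weak1[OF that] r2] by (simp add: r_def o_def)
  have v00: "v x = 0" if "x \<notin> \<Omega>" for x using that by (simp add: v_def)
  have vm: "v \<in> borel_measurable borel" using borel_measurable_integrable[OF v0] Ob by (auto simp: v_def[abs_def])
  have vi: "integrable lborel v"
  proof (rule Bochner_Integration.integrable_bound[OF v0])
    show "v \<in> borel_measurable lborel" using vm by simp
    show "AE x in lborel. norm (v x) \<le> norm (v0 x)" by (auto simp: v_def split: split_indicator)
  qed
  have vL: "integrable (lebesgue_on \<Omega>) v"
  proof -
    have "(\<lambda>x. indicator \<Omega> x *\<^sub>R v x) = v" by (auto simp: v_def split: split_indicator)
    then show ?thesis using vi by (simp add: lebesgue_on_integral_borel(2)[OF Ob vm])
  qed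
  have L1: "(\<lambda>i. LINT x|lborel. \<bar>w (r i) x - v x\<bar>) \<longlonglongrightarrow> 0"
  proof (rule tendsto_sandwich[OF _ _ tendsto_const lim0])
    show "\<forall>\<^sub>F i in sequentially. (LINT x|lborel. \<bar>w (r i) x - v x\<bar>) \<le> (LINT x|lborel. \<bar>w (r1 (r2 i)) x - v0 x\<bar>)"
    proof (intro always_eventually allI integral_mono)
      fix i x show "\<bar>w (r i) x - v x\<bar> \<le> \<bar>w (r1 (r2 i)) x - v0 x\<bar>"
        using w0[of x] by (simp add: r_def v_def split: split_indicator)
    qed (use wi v0 vi in auto)
  qed simp
  have sL: "sets L = sets borel" and gi: "integrable L g" using repL by (auto simp: represents_def)
  have rqL: "represents L (\<lambda>x. snd (g x)) (\<lambda>A. snd (\<nu> A))" by (rule represents_bounded_linear[OF repL bounded_linear_snd])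
  have rpL: "represents L (\<lambda>x. fst (g x)) (\<lambda>A. fst (\<nu> A))" by (rule represents_bounded_linear[OF repL bounded_linear_fst])
  have weak_snd: "(\<lambda>i. LINT x|l (r i). \<psi> x *\<^sub>R snd (f (r i) x)) \<longlonglongrightarrow> (LINT x|L. \<psi> x *\<^sub>R snd (g x))"
    and weak_fst: "(\<lambda>i. LINT x|l (r i). \<psi> x *\<^sub>R fst (f (r i) x)) \<longlonglongrightarrow> (LINT x|L. \<psi> x *\<^sub>R fst (g x))"
    if \<psi>: "continuous_on UNIV \<psi>" "\<And>x. \<bar>\<psi> x\<bar> \<le> B" for \<psi> :: "'a \<Rightarrow> real" and B
  proof -
    have \<psi>m: "\<psi> \<in> borel_measurable borel" by (rule borel_measurable_continuous_onI[OF \<psi>(1)])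
    have i: "integrable (l i) (\<lambda>x. \<psi> x *\<^sub>R f i x)" for i by (rule represents_vm_integral_bounded(2)[OF rep \<psi>m \<psi>(2)])
    have iL: "integrable L (\<lambda>x. \<psi> x *\<^sub>R g x)" by (rule represents_vm_integral_bounded(2)[OF repL \<psi>m \<psi>(2)])
    show "(\<lambda>i. LINT x|l (r i). \<psi> x *\<^sub>R snd (f (r i) x)) \<longlonglongrightarrow> (LINT x|L. \<psi> x *\<^sub>R snd (g x))"
      using tendsto_snd[OF weak[OF \<psi>(1)]] integral_bounded_linear[OF bounded_linear_snd i] integral_bounded_linear[OF bounded_linear_snd iL]
      by (simp add: snd_scaleR)
    show "(\<lambda>i. LINT x|l (r i). \<psi> x *\<^sub>R fst (f (r i) x)) \<longlonglongrightarrow> (LINT x|L. \<psi> x *\<^sub>R fst (g x))"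
      using tendsto_fst[OF weak[OF \<psi>(1)]] integral_bounded_linear[OF bounded_linear_fst i] integral_bounded_linear[OF bounded_linear_fst iL]
      by (simp add: fst_scaleR)
  qed
  \<comment> \<open>The first component of the lifting is the same for every index, so the sequences
    tested here are constant: the limit has no Lebesgue part on the boundary.\<close>
  have first: "fst (\<nu> A) = measure lborel (A \<inter> \<Omega>)" if A: "A \<in> sets borel" for A
  proof -
    have "measure lborel ((A \<inter> UNIV) \<inter> \<Omega>) = fst (\<nu> (A \<inter> UNIV))"
    proof (rule test_functions_determine_measure[OF rp[of 0] rpL open_UNIV _ A])
      fix \<psi> :: "'a \<Rightarrow> real" assume \<psi>: "\<psi> \<in> test_functions UNIV"
      obtain B where B: "\<And>x. \<bar>\<psi> x\<bar> \<le> B" using test_functions_bounded[OF \<psi>] by metis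
      have e: "(LINT x|l i. \<psi> x *\<^sub>R fst (f i x)) = (LINT x|l 0. \<psi> x *\<^sub>R fst (f 0 x))" for i
        using represents_vm_integral_bounded(1)[OF rp test_functionsD(3)[OF \<psi>] B] by metis
      have "(\<lambda>i. LINT x|l (r i). \<psi> x *\<^sub>R fst (f (r i) x)) \<longlonglongrightarrow> (LINT x|L. \<psi> x *\<^sub>R fst (g x))"
        by (rule weak_fst[OF test_functionsD(2)[OF \<psi>] B])
      then have "(\<lambda>i::nat. LINT x|l 0. \<psi> x *\<^sub>R fst (f 0 x)) \<longlonglongrightarrow> (LINT x|L. \<psi> x *\<^sub>R fst (g x))"
        by (subst (asm) e)
      then show "(LINT x|l 0. \<psi> x *\<^sub>R fst (f 0 x)) = (LINT x|L. \<psi> x *\<^sub>R fst (g x))"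
        by (simp add: LIMSEQ_const_iff)
    qed
    then show ?thesis by simp
  qed
  define D where "D A = snd (\<nu> (A \<inter> \<Omega>))" for A
  have rD: "represents L (\<lambda>x. indicator \<Omega> x *\<^sub>R snd (g x)) D"
    using represents_restrict[OF rqL Ob] by (simp add: D_def[abs_def])
  have Dint: "vm_integral D \<psi> = (LINT x|L. \<psi> x *\<^sub>R snd (g x))"
    if \<psi>: "\<psi> \<in> borel_measurable borel" "\<And>x. \<bar>\<psi> x\<bar> \<le> B" "\<And>x. x \<notin> \<Omega> \<Longrightarrow> \<psi> x = 0" for \<psi> :: "'a \<Rightarrow> real" and B
  proof -
    have "vm_integral D \<psi> = (LINT x|L. \<psi> x *\<^sub>R (indicator \<Omega> x *\<^sub>R snd (g x)))"
      by (rule represents_vm_integral_bounded(1)[OF rD \<psi>(1,2)])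
    also have "\<dots> = (LINT x|L. \<psi> x *\<^sub>R snd (g x))"
      using \<psi>(3) by (intro Bochner_Integration.integral_cong) (auto split: split_indicator)
    finally show ?thesis .
  qed
  have vmD: "vector_measure_on \<Omega> D"
    using represents_additive[OF rD] by (simp add: vector_measure_on_def additive_borel_def D_def)
  have deriv: "has_deriv_measure \<Omega> v D"
    unfolding has_deriv_measure_def
  proof (intro conjI ballI vmD)
    fix \<psi> assume \<psi>: "\<psi> \<in> test_functions \<Omega>"
    obtain B where B: "\<And>x. \<bar>\<psi> x\<bar> \<le> B" using test_functions_bounded[OF \<psi>] by metis
    obtain B' where B'0: "0 < B'" and B': "\<And>x. norm (gradient \<psi> x) \<le> B'" using test_functions_gradient_bounded[OF \<psi>] by metis
    note gm = test_functions_gradient_measurable[OF \<psi>]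
    have gint: "integrable lborel (\<lambda>x. h x *\<^sub>R gradient \<psi> x)" if "integrable lborel h" for h :: "'a \<Rightarrow> real"
    proof (rule Bochner_Integration.integrable_bound)
      show "integrable lborel (\<lambda>x. B' * \<bar>h x\<bar>)" using that by simp
      show "(\<lambda>x. h x *\<^sub>R gradient \<psi> x) \<in> borel_measurable lborel" using borel_measurable_integrable[OF that] gm by simp
      show "AE x in lborel. norm (h x *\<^sub>R gradient \<psi> x) \<le> norm (B' * \<bar>h x\<bar>)"
      proof (intro AE_I2)
        fix x
        have "norm (h x *\<^sub>R gradient \<psi> x) \<le> \<bar>h x\<bar> * B'" using B'[of x] by (simp add: mult_left_mono)
        then show "norm (h x *\<^sub>R gradient \<psi> x) \<le> norm (B' * \<bar>h x\<bar>)" using B'0 by (simp add: abs_mult mult.commute)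
      qed
    qed
    have "(\<lambda>i. LINT x|lborel. w (r i) x *\<^sub>R gradient \<psi> x) \<longlonglongrightarrow> (LINT x|lborel. v x *\<^sub>R gradient \<psi> x)"
    proof (rule LIM_zero_cancel, rule Lim_null_comparison)
      show "\<forall>\<^sub>F i in sequentially. norm ((LINT x|lborel. w (r i) x *\<^sub>R gradient \<psi> x) - (LINT x|lborel. v x *\<^sub>R gradient \<psi> x)) \<le>
        B' * (LINT x|lborel. \<bar>w (r i) x - v x\<bar>)"
      proof (intro always_eventually allI)
        fix i
        have d: "integrable lborel (\<lambda>x. w (r i) x - v x)" using wi vi by simp
        have "norm ((LINT x|lborel. w (r i) x *\<^sub>R gradient \<psi> x) - (LINT x|lborel. v x *\<^sub>R gradient \<psi> x)) =
          norm (LINT x|lborel. (w (r i) x - v x) *\<^sub>R gradient \<psi> x)"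
          by (simp add: scaleR_diff_left Bochner_Integration.integral_diff[OF gint[OF wi] gint[OF vi]])
        also have "\<dots> \<le> (LINT x|lborel. norm ((w (r i) x - v x) *\<^sub>R gradient \<psi> x))" by (rule integral_norm_bound)
        also have "\<dots> \<le> (LINT x|lborel. B' * \<bar>w (r i) x - v x\<bar>)"
        proof (rule integral_mono[OF integrable_norm[OF gint[OF d]]])
          show "integrable lborel (\<lambda>x. B' * \<bar>w (r i) x - v x\<bar>)" using d by simp
          show "norm ((w (r i) x - v x) *\<^sub>R gradient \<psi> x) \<le> B' * \<bar>w (r i) x - v x\<bar>" for x
            using mult_left_mono[OF B'[of x], of "\<bar>w (r i) x - v x\<bar>"] by (simp add: mult.commute)
        qed
        finally show "norm ((LINT x|lborel. w (r i) x *\<^sub>R gradient \<psi> x) - (LINT x|lborel. v x *\<^sub>R gradient \<psi> x)) \<le>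
          B' * (LINT x|lborel. \<bar>w (r i) x - v x\<bar>)" by simp
      qed
      show "(\<lambda>i. B' * (LINT x|lborel. \<bar>w (r i) x - v x\<bar>)) \<longlonglongrightarrow> 0" by (rule tendsto_mult_right_zero[OF L1])
    qed
    moreover have "(LINT x|lborel. w (r i) x *\<^sub>R gradient \<psi> x) = - (LINT x|l (r i). \<psi> x *\<^sub>R snd (f (r i) x))" for i
      using pair[of "r i"] \<psi> by (simp add: bv_pair_def)
    moreover have "(\<lambda>i. - (LINT x|l (r i). \<psi> x *\<^sub>R snd (f (r i) x))) \<longlonglongrightarrow> - (LINT x|L. \<psi> x *\<^sub>R snd (g x))"
      by (intro tendsto_minus weak_snd[OF test_functionsD(2)[OF \<psi>] B])
    ultimately have "(LINT x|lborel. v x *\<^sub>R gradient \<psi> x) = - (LINT x|L. \<psi> x *\<^sub>R snd (g x))"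
      by (intro LIMSEQ_unique[of "\<lambda>i. LINT x|lborel. w (r i) x *\<^sub>R gradient \<psi> x"]) simp_all
    moreover have "(LINT x|lebesgue_on \<Omega>. v x *\<^sub>R gradient \<psi> x) = (LINT x|lborel. v x *\<^sub>R gradient \<psi> x)"
      by (rule lebesgue_on_representative_integrals(1)[OF Ob borel_measurable_integrable[OF vL] vm v00 _ gm]) auto
    moreover have "vm_integral D \<psi> = (LINT x|L. \<psi> x *\<^sub>R snd (g x))"
      by (rule Dint[OF test_functionsD(3)[OF \<psi>] B test_functions_zero[OF \<psi>]])
    ultimately show "(LINT x|lebesgue_on \<Omega>. v x *\<^sub>R gradient \<psi> x) = - vm_integral D \<psi>" by simp
  qed
  have vBV: "v \<in> BV \<Omega>" using vL deriv by (auto simp: BV_def)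
  \<comment> \<open>\<open>Deriv\<close> is an arbitrary choice among the derivative measures; test
    functions of \<Omega> force it to agree with \<open>D\<close> on Borel sets.\<close>
  have DD: "Deriv \<Omega> v A = D A" if A: "A \<in> sets borel" for A
  proof -
    note dv = Deriv_has_deriv_measure[OF vBV]
    obtain l' f' where r': "represents l' f' (Deriv \<Omega> v)"
      by (rule vector_measure_on_represents[OF Deriv_vector_measure_on[OF vBV] Ob])
    have "Deriv \<Omega> v (A \<inter> \<Omega>) = D (A \<inter> \<Omega>)"
    proof (rule test_functions_determine_measure[OF r' rD \<Omega>(1) _ A])
      fix \<psi> assume \<psi>: "\<psi> \<in> test_functions \<Omega>"
      obtain B where B: "\<And>x. \<bar>\<psi> x\<bar> \<le> B" using test_functions_bounded[OF \<psi>] by metis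
      have "vm_integral (Deriv \<Omega> v) \<psi> = vm_integral D \<psi>"
        using dv deriv \<psi> unfolding has_deriv_measure_def by (metis neg_equal_iff_equal)
      then show "(LINT x|l'. \<psi> x *\<^sub>R f' x) = (LINT x|L. \<psi> x *\<^sub>R (indicator \<Omega> x *\<^sub>R snd (g x)))"
        using represents_vm_integral_bounded(1)[OF r' test_functionsD(3)[OF \<psi>] B]
          represents_vm_integral_bounded(1)[OF rD test_functionsD(3)[OF \<psi>] B] by metis
    qed
    then show ?thesis using vmD Deriv_vector_measure_on[OF vBV] A unfolding vector_measure_on_def by metis
  qed
  have rlift: "represents L (\<lambda>x. indicator \<Omega> x *\<^sub>R g x) (lifting \<Omega> v)"
  proof (rule represents_cong[OF represents_restrict[OF repL Ob]])
    fix A :: "'a set" assume A: "A \<in> sets borel"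
    then show "\<nu> (A \<inter> \<Omega>) = lifting \<Omega> v A"
      using first[of "A \<inter> \<Omega>"] Ob by (simp add: lifting_def DD D_def prod_eq_iff Int_assoc)
  qed
  have ws: "weak_star_BV \<Omega> (\<lambda>i. u (r i)) v"
    unfolding weak_star_BV_def
  proof (intro conjI ballI)
    show "(\<lambda>i. LINT x|lebesgue_on \<Omega>. \<bar>u (r i) x - v x\<bar>) \<longlonglongrightarrow> 0"
      using L1 lebesgue_on_representative_integrals(2)[OF Ob um wm w0 wae vm v00] by simp
    fix \<psi> assume \<psi>: "\<psi> \<in> C0 \<Omega>"
    \<comment> \<open>Functions of \<open>C0\<close> vanish on the boundary, so they do not see the
      mass of the narrow limit there, and narrow convergence yields the weak* limit inside
      \<Omega>.\<close>
    then have \<psi>c: "continuous_on UNIV \<psi>" and \<psi>0: "\<And>x. x \<notin> \<Omega> \<Longrightarrow> \<psi> x = 0" by (auto simp: C0_def)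
    have \<psi>K: "\<psi> x = 0" if "x \<notin> closure \<Omega>" for x using \<psi>0 that closure_subset by blast
    obtain B where B: "\<And>x. \<bar>\<psi> x\<bar> \<le> B"
      using continuous_compact_support_bounded[OF \<psi>c K \<psi>K] by auto
    have \<psi>m: "\<psi> \<in> borel_measurable borel" by (rule borel_measurable_continuous_onI[OF \<psi>c])
    have "vm_integral (Deriv \<Omega> (u (r i))) \<psi> = (LINT x|l (r i). \<psi> x *\<^sub>R snd (f (r i) x))" for i
      by (rule represents_vm_integral_bounded(1)[OF rq \<psi>m B])
    moreover have "vm_integral (Deriv \<Omega> v) \<psi> = (LINT x|L. \<psi> x *\<^sub>R (indicator \<Omega> x *\<^sub>R snd (g x)))"
      by (rule represents_vm_integral_bounded(1)[OF represents_cong[OF rD] \<psi>m B]) (simp add: DD)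
    moreover have "vm_integral D \<psi> = (LINT x|L. \<psi> x *\<^sub>R (indicator \<Omega> x *\<^sub>R snd (g x)))"
      by (rule represents_vm_integral_bounded(1)[OF rD \<psi>m B])
    moreover have "vm_integral D \<psi> = (LINT x|L. \<psi> x *\<^sub>R snd (g x))" by (rule Dint[OF \<psi>m B \<psi>0])
    ultimately show "(\<lambda>i. vm_integral (Deriv \<Omega> (u (r i))) \<psi>) \<longlonglongrightarrow> vm_integral (Deriv \<Omega> v) \<psi>"
      using weak_snd[OF \<psi>c B] by simp
  qed
  show ?thesis by (rule that[OF sm vBV ws repL g0 rlift first weak])
qed

section \<open>Lower semicontinuity and existence of minimisers\<close>

text \<open>The lost mass is superadditive over a partition: the variation is additive, while the L1
  norms of the mollifications are subadditive. The part off \<open>S\<close> loses a nonnegative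
  amount itself, so discarding it can only lower the level.\<close>

lemma eta_level_restrict_le:
  fixes \<mu> :: "'a::euclidean_space set \<Rightarrow> 'b::euclidean_space"
  assumes \<rho>: "mollifier_semigroup \<rho>" and r: "represents l f \<mu>" and supp: "\<And>x. R < norm x \<Longrightarrow> f x = 0"
    and S: "S \<in> sets borel" and r': "represents l (\<lambda>x. indicator S x *\<^sub>R f x) \<nu>"
  shows "eta_level \<rho> n \<nu> \<le> eta_level \<rho> n \<mu>"
proof -
  let ?k = "\<rho> ((1/2) ^ n)"
  let ?f1 = "\<lambda>x. indicator S x *\<^sub>R f x" and ?f2 = "\<lambda>x. indicator (- S) x *\<^sub>R f x"
  have k: "kernel ?k" by (rule mollifier_semigroupD(1)[OF \<rho>])
  have s: "sets l = sets borel" and fi: "integrable l f" using r by (auto simp: represents_def)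
  note sf = represents_sigma_finite[OF r]
  have f1: "integrable l ?f1" using r' by (simp add: represents_def)
  have f2: "integrable l ?f2"
    using represents_restrict[OF r borel_comp[OF S]] by (simp add: represents_def)
  have split: "f x = ?f1 x + ?f2 x" for x by (simp split: split_indicator)
  have ci: "integrable lborel (\<lambda>x. norm (conv ?k l h x))" if "integrable l h" for h :: "'a \<Rightarrow> 'b"
    by (rule integrable_norm[OF conv_integrable(1)[OF k sf s that]])
  have "AE x in lborel. conv ?k l f x = conv ?k l ?f1 x + conv ?k l ?f2 x"
    using conv_integrable(2)[OF k sf s f1] conv_integrable(2)[OF k sf s f2]
  proof eventually_elim
    case (elim x)
    have "conv ?k l f x = (LINT y|l. ?k (x - y) *\<^sub>R ?f1 y + ?k (x - y) *\<^sub>R ?f2 y)"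
      unfolding conv_def by (subst split) (simp only: scaleR_add_right)
    also have "\<dots> = conv ?k l ?f1 x + conv ?k l ?f2 x"
      unfolding conv_def by (rule Bochner_Integration.integral_add[OF elim])
    finally show ?case .
  qed
  then have ae: "AE x in lborel. norm (conv ?k l f x) \<le> norm (conv ?k l ?f1 x) + norm (conv ?k l ?f2 x)"
    by eventually_elim (simp add: norm_triangle_ineq)
  have "(LINT x|lborel. norm (conv ?k l f x)) \<le> (LINT x|lborel. norm (conv ?k l ?f1 x) + norm (conv ?k l ?f2 x))"
    by (rule integral_mono_AE[OF ci[OF fi] Bochner_Integration.integrable_add[OF ci[OF f1] ci[OF f2]] ae])
  also have "\<dots> = (LINT x|lborel. norm (conv ?k l ?f1 x)) + (LINT x|lborel. norm (conv ?k l ?f2 x))"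
    by (rule Bochner_Integration.integral_add[OF ci[OF f1] ci[OF f2]])
  also have "(LINT x|lborel. norm (conv ?k l ?f2 x)) \<le> (LINT y|l. norm (?f2 y))"
    by (rule conv_norm_integral_le[OF k sf s f2])
  finally have 1: "(LINT x|lborel. norm (conv ?k l f x)) \<le> (LINT x|lborel. norm (conv ?k l ?f1 x)) + (LINT y|l. norm (?f2 y))"
    by simp
  have "(LINT y|l. norm (f y)) = (LINT y|l. norm (?f1 y) + norm (?f2 y))"
    by (intro Bochner_Integration.integral_cong) (auto split: split_indicator)
  also have "\<dots> = (LINT y|l. norm (?f1 y)) + (LINT y|l. norm (?f2 y))"
    by (rule Bochner_Integration.integral_add[OF integrable_norm[OF f1] integrable_norm[OF f2]])
  finally have 2: "(LINT y|l. norm (f y)) = (LINT y|l. norm (?f1 y)) + (LINT y|l. norm (?f2 y))" .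
  have "eta_level \<rho> n \<nu> = (LINT y|l. norm (?f1 y)) - (LINT x|lborel. norm (conv ?k l ?f1 x))"
    by (rule eta_level_eq[OF \<rho> r', where R = R]) (simp add: supp)
  moreover have "eta_level \<rho> n \<mu> = (LINT y|l. norm (f y)) - (LINT x|lborel. norm (conv ?k l f x))"
    by (rule eta_level_eq[OF \<rho> r supp])
  ultimately show ?thesis using 1 2 by linarith
qed

text \<open>Fatou for series of nonnegative terms: partial sums pass to the limit, and each is
  bounded by the full series. The limits \<open>a n\<close> are kept apart from the levels of \<nu>,
  since the limit measure may charge the boundary while the lifting of the limit function does
  not.\<close>

lemma eta_liminf:
  assumes \<eta>: "0 < \<eta>\<^sub>0" and nn: "\<And>n i. 0 \<le> eta_level \<rho> n (\<mu> i)" "\<And>n. 0 \<le> eta_level \<rho> n \<nu>"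
    and lim: "\<And>n. (\<lambda>i::nat. eta_level \<rho> n (\<mu> i)) \<longlonglongrightarrow> a n" and le: "\<And>n. eta_level \<rho> n \<nu> \<le> a n"
  shows "eta \<rho> \<eta>\<^sub>0 \<nu> \<le> liminf (\<lambda>i. eta \<rho> \<eta>\<^sub>0 (\<mu> i))"
proof -
  have cm: "eta \<rho> \<eta>\<^sub>0 \<xi> = (\<Sum>l. ereal (\<eta>\<^sub>0 * eta_level \<rho> (Suc l) \<xi>))" if "\<And>n. 0 \<le> eta_level \<rho> n \<xi>" for \<xi>
    using suminf_cmult_ereal[of "\<lambda>l. ereal (eta_level \<rho> (Suc l) \<xi>)" "ereal \<eta>\<^sub>0"] that \<eta> by (simp add: eta_def)
  have "(\<Sum>l<N. ereal (\<eta>\<^sub>0 * eta_level \<rho> (Suc l) \<nu>)) \<le> liminf (\<lambda>i. eta \<rho> \<eta>\<^sub>0 (\<mu> i))" for N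
  proof -
    have "(\<Sum>l<N. ereal (\<eta>\<^sub>0 * eta_level \<rho> (Suc l) \<nu>)) \<le> ereal (\<Sum>l<N. \<eta>\<^sub>0 * a (Suc l))"
      using le \<eta> by (simp add: sum_mono)
    also have "\<dots> = liminf (\<lambda>i. ereal (\<Sum>l<N. \<eta>\<^sub>0 * eta_level \<rho> (Suc l) (\<mu> i)))"
    proof (rule lim_imp_Liminf[OF sequentially_bot, symmetric])
      show "(\<lambda>i. ereal (\<Sum>l<N. \<eta>\<^sub>0 * eta_level \<rho> (Suc l) (\<mu> i))) \<longlonglongrightarrow> ereal (\<Sum>l<N. \<eta>\<^sub>0 * a (Suc l))"
        by (intro tendsto_ereal tendsto_sum tendsto_mult tendsto_const lim)
    qed
    also have "\<dots> \<le> liminf (\<lambda>i. eta \<rho> \<eta>\<^sub>0 (\<mu> i))"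
    proof (rule Liminf_mono, rule always_eventually, rule allI)
      fix i
      have "(\<Sum>l<N. ereal (\<eta>\<^sub>0 * eta_level \<rho> (Suc l) (\<mu> i))) \<le> (\<Sum>l. ereal (\<eta>\<^sub>0 * eta_level \<rho> (Suc l) (\<mu> i)))"
        using nn(1) \<eta> by (intro suminf_upper) simp
      then show "ereal (\<Sum>l<N. \<eta>\<^sub>0 * eta_level \<rho> (Suc l) (\<mu> i)) \<le> eta \<rho> \<eta>\<^sub>0 (\<mu> i)"
        using cm[of "\<mu> i"] nn(1) by simp
    qed
    finally show ?thesis .
  qed
  then show ?thesis unfolding cm[OF nn(2)] using nn(2) \<eta> by (intro suminf_bound) auto
qed

context linear_growth
begin

lemma perspective_integrable:
  fixes g :: "'c \<Rightarrow> real \<times> 'a::euclidean_space"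
  assumes "integrable l g"
  shows "integrable l (\<lambda>y. perspective \<phi> \<phi>inf (g y))"
proof (rule Bochner_Integration.integrable_bound)
  show "integrable l (\<lambda>y. (2 * (C' + b)) * norm (g y))" using assms by simp
  show "(\<lambda>y. perspective \<phi> \<phi>inf (g y)) \<in> borel_measurable l"
    by (rule measurable_compose[OF borel_measurable_integrable[OF assms] borel_measurable_continuous_onI[OF perspective_continuous]])
  have "0 \<le> (2 * (C' + b)) * norm v" for v :: "real \<times> 'a" using C' b by simp
  then show "AE y in l. norm (perspective \<phi> \<phi>inf (g y)) \<le> norm ((2 * (C' + b)) * norm (g y))"
    using perspective_bound by (intro AE_I2) (simp only: real_norm_def abs_of_nonneg)
qed

text \<open>Mass of a limit measure on the boundary of \<open>\<Omega>\<close> is carried by the gradient components alone, where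
  the integrand is nonnegative.\<close>

lemma TV_as_le_perspective:
  fixes \<Omega> :: "'a::euclidean_space set"
  assumes \<Omega>: "open \<Omega>" "bounded \<Omega>" and v: "v \<in> BV \<Omega>" and r: "represents L g \<nu>"
    and r': "represents L (\<lambda>x. indicator \<Omega> x *\<^sub>R g x) (lifting \<Omega> v)"
    and first: "\<And>A. A \<in> sets borel \<Longrightarrow> fst (\<nu> A) = measure lborel (A \<inter> \<Omega>)"
  shows "TV_as \<phi> \<phi>inf \<Omega> v \<le> (LINT x|L. perspective \<phi> \<phi>inf (g x))"
proof -
  have Ob: "\<Omega> \<in> sets borel" using \<Omega> by simp
  have gi: "integrable L g" using r by (simp add: represents_def)
  have gi': "integrable L (\<lambda>x. indicator \<Omega> x *\<^sub>R g x)" using r' by (simp add: represents_def)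
  have rz: "represents L (\<lambda>x. indicator (- \<Omega>) x *\<^sub>R fst (g x)) (\<lambda>A. fst (\<nu> (A \<inter> - \<Omega>)))"
    by (rule represents_restrict[OF represents_bounded_linear[OF r bounded_linear_fst] borel_comp[OF Ob]])
  have "AE x in L. indicator (- \<Omega>) x *\<^sub>R fst (g x) = 0"
  proof (rule represents_AE_zero[OF rz])
    fix A :: "'a set" assume A: "A \<in> sets borel"
    have "(A \<inter> - \<Omega>) \<inter> \<Omega> = {}" by blast
    then show "fst (\<nu> (A \<inter> - \<Omega>)) = 0" using first[of "A \<inter> - \<Omega>"] A Ob by simp
  qed
  then have ae: "AE x in L. perspective \<phi> \<phi>inf (indicator \<Omega> x *\<^sub>R g x) \<le> perspective \<phi> \<phi>inf (g x)"
  proof eventually_elim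
    case (elim x)
    show ?case
    proof (cases "x \<in> \<Omega>")
      case False
      then have "fst (g x) = 0" using elim by simp
      then have "0 \<le> perspective \<phi> \<phi>inf (g x)" using recession_bounds c by (simp add: perspective_def)
      then show ?thesis using False by (simp add: perspective_def)
    qed simp
  qed
  have "TV_as \<phi> \<phi>inf \<Omega> v = (LINT x|L. perspective \<phi> \<phi>inf (indicator \<Omega> x *\<^sub>R g x))"
    by (rule TV_as_eq_integral(1)[OF \<Omega> v r']) simp
  also have "\<dots> \<le> (LINT x|L. perspective \<phi> \<phi>inf (g x))"
    by (rule integral_mono_AE[OF perspective_integrable[OF gi'] perspective_integrable[OF gi] ae])
  finally show ?thesis .
qed

end

section \<open>The direct method in the extended reals\<close>

lemma ereal_add_bounds:
  fixes x z :: ereal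
  assumes "x + ereal y + z \<le> ereal B" "ereal a \<le> x" "0 \<le> z"
  shows "a + y \<le> B" "z \<le> ereal (B - a - y)"
  using assms by (cases x; cases z; auto)+

text \<open>The lower bounds on \<open>x\<close> and \<open>z\<close> and the finiteness of
  \<open>t\<close> exclude sums of opposite infinities, so superadditivity of the lower limit
  applies twice.\<close>

lemma ereal_liminf_add3:
  fixes x z :: "nat \<Rightarrow> ereal"
  assumes y: "y \<longlonglongrightarrow> t" and x: "\<And>i. ereal a \<le> x i" and z: "\<And>i. 0 \<le> z i"
  shows "liminf x + ereal t + liminf z \<le> liminf (\<lambda>i. x i + ereal (y i) + z i)"
proof -
  have xl: "ereal a \<le> liminf x" using x by (intro Liminf_bounded always_eventually allI)
  have zl: "0 \<le> liminf z" using z by (intro Liminf_bounded always_eventually allI)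
  have yl: "liminf (\<lambda>i. ereal (y i)) = ereal t"
    by (rule lim_imp_Liminf[OF sequentially_bot tendsto_ereal[OF y]])
  have 1: "liminf x + ereal t \<le> liminf (\<lambda>i. x i + ereal (y i))"
    using ereal_liminf_add_mono[of x "\<lambda>i. ereal (y i)"] by (simp add: yl)
  have s: "- \<infinity> < liminf x + ereal t" using xl by (cases "liminf x") auto
  have "liminf x + ereal t + liminf z \<le> liminf (\<lambda>i. x i + ereal (y i)) + liminf z"
    using 1 by (rule add_right_mono)
  also have "\<dots> \<le> liminf (\<lambda>i. x i + ereal (y i) + z i)"
    using s 1 zl by (intro ereal_liminf_add_mono) auto
  finally show ?thesis .
qed

theorem corollary6p2:
  fixes \<Omega> :: "(real ^ 'n) set"
    and J :: "(real ^ 'n \<Rightarrow> real) \<Rightarrow> ereal"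
    and \<rho> :: "real \<Rightarrow> real ^ 'n \<Rightarrow> real"
    and \<phi> :: "real \<Rightarrow> real"
    and \<alpha> \<eta>\<^sub>0 \<phi>inf c C C' b :: real
  assumes "bounded_lipschitz_domain \<Omega>"
    and "\<alpha> > 0"
    and "\<eta>\<^sub>0 > 0" and "mollifier_semigroup \<rho>"
    and "continuous_on {0..} \<phi>"
    and "((\<lambda>t. \<phi> t / t) \<longlongrightarrow> \<phi>inf) at_top"
    and "c > 0" and "C' > 0" and "b \<ge> 0"
    and "\<And>t. t \<ge> 0 \<Longrightarrow> c * t - b \<le> \<phi> t \<and> \<phi> t \<le> C' * (1 + t)"
    and "respects_ae \<Omega> J"
    and "convex_on_BV \<Omega> J" and "proper_on_BV \<Omega> J" and "weak_star_lsc \<Omega> J"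
    and "C > 0"
    and "\<And>u. u \<in> BV \<Omega> \<Longrightarrow> J u \<ge> ereal (C * ((LINT x|lebesgue_on \<Omega>. \<bar>u x\<bar>) - 1))"
  defines "G \<equiv> \<lambda>u. J u + ereal (\<alpha> * TV_as \<phi> \<phi>inf \<Omega> u) + eta \<rho> \<eta>\<^sub>0 (lifting \<Omega> u)"
  shows "\<exists>u\<in>BV \<Omega>. \<forall>v\<in>BV \<Omega>. G u \<le> G v"
proof -
  interpret linear_growth \<phi> \<phi>inf c C' b
    by unfold_locales (use assms in auto)
  note \<alpha> = assms(2) and \<eta> = assms(3) and \<rho> = assms(4) and C = assms(15) and Jge = assms(16)
  have \<Omega>: "open \<Omega>" "bounded \<Omega>" "lipschitz_boundary \<Omega>" using assms(1) by (auto simp: bounded_lipschitz_domain_def)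
  have Ob: "\<Omega> \<in> sets borel" using \<Omega> by simp
  obtain R where R: "\<And>x. x \<in> closure \<Omega> \<Longrightarrow> norm x \<le> R"
    using bounded_closure[OF \<Omega>(2)] by (auto simp: bounded_iff)
  have out: "x \<notin> closure \<Omega>" "x \<notin> \<Omega>" if "R < norm x" for x
    using R[of x] that closure_subset[of \<Omega>] by auto
  define m where "m = measure lborel \<Omega>"
  have m0: "0 \<le> m" by (simp add: m_def)
  define TV where "TV u = TV_as \<phi> \<phi>inf \<Omega> u" for u :: "real ^ 'n \<Rightarrow> real"
  define E where "E u = eta \<rho> \<eta>\<^sub>0 (lifting \<Omega> u)" for u :: "real ^ 'n \<Rightarrow> real"
  have G: "G u = J u + ereal (\<alpha> * TV u) + E u" for u by (simp add: G_def TV_def E_def)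
  have rep_ex: "\<exists>l f. represents l f (lifting \<Omega> u) \<and> (\<forall>x. x \<notin> \<Omega> \<longrightarrow> f x = 0)" if "u \<in> BV \<Omega>" for u
    by (rule vector_measure_on_represents[OF lifting_vector_measure_on[OF \<Omega>(1,2) that] Ob]) blast
  have E0: "0 \<le> E u" and TVb: "- (c * m + b * m) \<le> TV u" if u: "u \<in> BV \<Omega>" for u
  proof -
    obtain l f where r: "represents l f (lifting \<Omega> u)" and z: "\<And>x. x \<notin> \<Omega> \<Longrightarrow> f x = 0" using rep_ex[OF u] by metis
    show "0 \<le> E u" unfolding E_def by (rule eta_nonneg[OF \<rho> r _ \<eta>]) (use z out in blast)
    have "0 \<le> m + (TV u + b * m) / c"
      unfolding TV_def m_def by (rule order_trans[OF _ TV_as_eq_integral(2)[OF \<Omega>(1,2) u r z]]) simp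
    then have "- m \<le> (TV u + b * m) / c" by simp
    then have "- m * c \<le> TV u + b * m" using c by (simp only: pos_le_divide_eq)
    then show "- (c * m + b * m) \<le> TV u" by (simp add: mult.commute)
  qed
  have JC: "ereal (- C) \<le> J u" if "u \<in> BV \<Omega>" for u
  proof -
    have "- C \<le> C * ((LINT x|lebesgue_on \<Omega>. \<bar>u x\<bar>) - 1)" using C by (simp add: right_diff_distrib)
    then show ?thesis using Jge[OF that] by (meson ereal_less_eq(3) order_trans)
  qed
  obtain u1 where u1: "u1 \<in> BV \<Omega>" using assms(13) by (auto simp: proper_on_BV_def)
  show ?thesis
  proof (cases "\<exists>u\<in>BV \<Omega>. G u < \<infinity>")
    case False
    \<comment> \<open>Properness concerns \<open>J\<close> only, and \<eta> may be infinite wherever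
      \<open>J\<close> is finite. If \<open>G\<close> is infinite throughout, every element is a
      minimiser.\<close>
    then show ?thesis using u1 by (metis ereal_infty_less(1) order_refl)
  next
    case True
    then obtain u0 where u0: "u0 \<in> BV \<Omega>" "G u0 < \<infinity>" by blast
    then obtain B where B: "G u0 \<le> ereal B" by (cases "G u0") auto
    \<comment> \<open>Restriction to a sublevel set gives the minimising sequence a uniform finite
      bound on \<open>G\<close>, without first showing that the infimum is finite.\<close>
    define A where "A = {u \<in> BV \<Omega>. G u \<le> G u0}"
    have "G ` A \<noteq> {}" using u0 by (auto simp: A_def)
    from Inf_countable_INF[OF this] obtain h :: "nat \<Rightarrow> ereal" where
      h: "decseq h" "range h \<subseteq> G ` A" "Inf (G ` A) = (INF i. h i)" by blast
    have "\<exists>u. \<forall>i. u i \<in> A \<and> h i = G (u i)" using h(2) by (intro choice) blast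
    then obtain U where U: "\<And>i. U i \<in> A" "\<And>i. h i = G (U i)" by blast
    have UB: "U i \<in> BV \<Omega>" and UG: "G (U i) \<le> ereal B" for i using U(1)[of i] B by (auto simp: A_def)
    have Glim: "(\<lambda>i. G (U i)) \<longlonglongrightarrow> Inf (G ` A)"
      using LIMSEQ_INF[OF h(1)] unfolding h(3) U(2) .
    have "\<exists>l f. represents l f (lifting \<Omega> (U i)) \<and> (\<forall>x. x \<notin> \<Omega> \<longrightarrow> f x = 0)" for i by (rule rep_ex[OF UB])
    then obtain l f where rep: "\<And>i. represents (l i) (f i) (lifting \<Omega> (U i))" and z: "\<And>i x. x \<notin> \<Omega> \<Longrightarrow> f i x = 0"
      by metis
    \<comment> \<open>The coercivity of \<open>TV_as\<close> bounds its contribution from below by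
      \<open>- T\<close>; together with the lower bounds \<open>- C\<close> for \<open>J\<close> and
      0 for \<eta>, this turns the bound on the sum into bounds on each summand.\<close>
    define T where "T = \<alpha> * (c * m + b * m)"
    have TVl: "- T \<le> \<alpha> * TV (U i)" for i using mult_left_mono[OF TVb[OF UB[of i]], of \<alpha>] \<alpha> by (simp add: T_def algebra_simps)
    have UG': "J (U i) + ereal (\<alpha> * TV (U i)) + E (U i) \<le> ereal B" for i using UG by (simp add: G)
    have EK: "E (U i) \<le> ereal (B + C + T)" for i
      using ereal_add_bounds(2)[OF UG' JC[OF UB] E0[OF UB], of i] TVl[of i] by (cases "E (U i)") auto
    have TVu: "\<alpha> * TV (U i) \<le> B + C" for i using ereal_add_bounds(1)[OF UG' JC[OF UB] E0[OF UB], of i] by simp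
    \<comment> \<open>Here the growth of \<open>J\<close> is used in full, no longer only as the
      constant lower bound \<open>- C\<close>; it controls the L1 norms, as coercivity of
      \<open>TV_as\<close> does for the derivatives below.\<close>
    have L1: "(LINT x|lebesgue_on \<Omega>. \<bar>U i x\<bar>) \<le> 1 + (B + T) / C" for i
    proof -
      have "C * ((LINT x|lebesgue_on \<Omega>. \<bar>U i x\<bar>) - 1) \<le> B + T"
        using ereal_add_bounds(1)[OF UG' Jge[OF UB] E0[OF UB], of i] TVl[of i] by simp
      then show ?thesis using C by (simp add: field_simps)
    qed
    have f1: "(LINT y|l i. norm (f i y)) \<le> m + ((B + C) / \<alpha> + b * m) / c" for i
    proof -
      have "TV (U i) \<le> (B + C) / \<alpha>" using TVu[of i] \<alpha> by (simp add: field_simps)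
      then have "(TV (U i) + b * m) / c \<le> ((B + C) / \<alpha> + b * m) / c" using c by (intro divide_right_mono) auto
      then show ?thesis using TV_as_eq_integral(2)[OF \<Omega>(1,2) UB rep z, of i] by (simp add: TV_def m_def)
    qed
    define M where "M = max (1 + (B + T) / C) (m + ((B + C) / \<alpha> + b * m) / c)"
    have LM: "(LINT x|lebesgue_on \<Omega>. \<bar>U i x\<bar>) \<le> M" and fM: "(LINT y|l i. norm (f i y)) \<le> M" for i
      using L1[of i] f1[of i] by (auto simp: M_def)
    obtain r v L g \<nu> where sm: "strict_mono (r :: nat \<Rightarrow> nat)" and vBV: "v \<in> BV \<Omega>"
      and ws: "weak_star_BV \<Omega> (\<lambda>i. U (r i)) v" and repL: "represents L g \<nu>"
      and g0: "\<And>x. x \<notin> closure \<Omega> \<Longrightarrow> g x = 0"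
      and repv: "represents L (\<lambda>x. indicator \<Omega> x *\<^sub>R g x) (lifting \<Omega> v)"
      and first: "\<And>A. A \<in> sets borel \<Longrightarrow> fst (\<nu> A) = measure lborel (A \<inter> \<Omega>)"
      and weak: "\<And>\<psi>::real^'n \<Rightarrow> real. continuous_on UNIV \<psi> \<Longrightarrow>
        (\<lambda>i. LINT x|l (r i). \<psi> x *\<^sub>R f (r i) x) \<longlonglongrightarrow> (LINT x|L. \<psi> x *\<^sub>R g x)"
      by (rule BV_compactness[OF \<Omega> UB LM rep z fM mollifier_semigroupD(1,2)[OF \<rho>]]) (assumption | rule that)+
    have suppf: "f (r i) x = 0" if "R < norm x" for i x using z out(2)[OF that] by blast
    have suppg: "g x = 0" if "R < norm x" for x by (rule g0[OF out(1)[OF that]])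
    have EK': "eta \<rho> \<eta>\<^sub>0 (lifting \<Omega> (U (r i))) \<le> ereal (B + C + T)" for i using EK[of "r i"] by (simp add: E_def)
    have "(\<lambda>i. LINT y|l (r i). perspective \<phi> \<phi>inf (f (r i) y)) \<longlonglongrightarrow> (LINT y|L. perspective \<phi> \<phi>inf (g y))"
      by (rule eta_bounded_functional_tendsto[OF \<rho> \<eta> rep suppf fM EK' repL suppg weak
            perspective_continuous perspective_bound perspective_scaleR])
    then have TVlim: "(\<lambda>i. \<alpha> * TV (U (r i))) \<longlonglongrightarrow> \<alpha> * (LINT y|L. perspective \<phi> \<phi>inf (g y))"
      using TV_as_eq_integral(1)[OF \<Omega>(1,2) UB rep z] by (intro tendsto_mult tendsto_const) (simp add: TV_def)
    have TVle: "\<alpha> * TV v \<le> \<alpha> * (LINT y|L. perspective \<phi> \<phi>inf (g y))"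
      using TV_as_le_perspective[OF \<Omega>(1,2) vBV repL repv first] \<alpha> by (simp add: TV_def)
    have Ele: "E v \<le> liminf (\<lambda>i. E (U (r i)))"
      unfolding E_def
    proof (rule eta_liminf[OF \<eta>])
      show "0 \<le> eta_level \<rho> n (lifting \<Omega> (U (r i)))" for n i by (rule eta_level_nonneg[OF \<rho> rep suppf])
      show "0 \<le> eta_level \<rho> n (lifting \<Omega> v)" for n
        by (rule eta_level_nonneg[OF \<rho> repv, where R = R]) (simp add: suppg)
      show "(\<lambda>i. eta_level \<rho> n (lifting \<Omega> (U (r i)))) \<longlonglongrightarrow> eta_level \<rho> n \<nu>" for n
        by (rule eta_bounded_level_tendsto[OF \<rho> \<eta> rep suppf fM EK' repL suppg weak])
      show "eta_level \<rho> n (lifting \<Omega> v) \<le> eta_level \<rho> n \<nu>" for n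
        by (rule eta_level_restrict_le[OF \<rho> repL suppg Ob repv])
    qed
    have Jle: "J v \<le> liminf (\<lambda>i. J (U (r i)))"
      by (rule assms(14)[unfolded weak_star_lsc_def, rule_format, OF _ vBV ws]) (rule UB)
    have "G v \<le> liminf (\<lambda>i. J (U (r i))) + ereal (\<alpha> * (LINT y|L. perspective \<phi> \<phi>inf (g y))) + liminf (\<lambda>i. E (U (r i)))"
      unfolding G by (intro add_mono Jle Ele) (simp add: TVle)
    also have "\<dots> \<le> liminf (\<lambda>i. J (U (r i)) + ereal (\<alpha> * TV (U (r i))) + E (U (r i)))"
      by (rule ereal_liminf_add3[OF TVlim JC[OF UB] E0[OF UB]])
    also have "\<dots> = Inf (G ` A)"
      using lim_imp_Liminf[OF sequentially_bot LIMSEQ_subseq_LIMSEQ[OF Glim sm]] by (simp add: o_def G)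
    finally have Gv: "G v \<le> Inf (G ` A)" .
    \<comment> \<open>The infimum was taken over the sublevel set \<open>A\<close>; an element
      outside \<open>A\<close> has a value above \<open>G u0\<close>, hence above
      \<open>G v\<close>.\<close>
    have "G v \<le> G w" if w: "w \<in> BV \<Omega>" for w
    proof (cases "G w \<le> G u0")
      case True
      then show ?thesis using w by (intro order_trans[OF Gv] Inf_lower) (auto simp: A_def)
    next
      case False
      have "G v \<le> G u0" using u0 by (intro order_trans[OF Gv] Inf_lower) (auto simp: A_def)
      then show ?thesis using False by simp
    qed
    then show ?thesis using vBV by blast
  qed
qed

end
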